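(* For every bound quiver algebra $\Lambda=kQ/I$ with arrow reduced version $\Lambda_{\mathrm{arv}}$, $$\mathrm{fin.dim}\,\Lambda<\infty\iff\mathrm{fin.dim}\,\Lambda_{\mathrm{arv}}<\infty,$$ and the equivalence remains valid if $\mathrm{fin.dim}$ is replaced by $\mathrm{Fin.dim}$ or by $\mathrm{gl.dim}$.
   Context: A bound quiver algebra $\Lambda=kQ/I$ consists of a field $k$, a finite quiver $Q$ and an admissible ideal $I$ of the path algebra $kQ$ (every path occurring in an element of $I$ has length at least $2$, and $I$ contains all paths of length $N$ for some $N>1$). For a set $A$ of arrows (possibly empty), $\langle A+I\rangle$ is the ideal of $\Lambda$ generated by the cosets of the arrows in $A$. Every $z\in kQ$ is uniquely $z=z_A+z_{\mathrm{not}A}$, where $z_A$ is a linear combination of paths passing through at least one arrow of $A$ and $z_{\mathrm{not}A}$ one of paths avoiding $A$. $A$ is pre-removable in $\Lambda$ if $z_A,z_{\mathrm{not}A}\in I$ for every $z\in I$. A pre-removable set $A$ is two-sided removable if $\langle A+I\rangle$ has finite projective dimension both as a left and as a right $\Lambda$-module; only left removable if $\langle A+I\rangle^2=0$ and $\langle A+I\rangle$ has finite projective dimension as a right but not as a left $\Lambda$-module; removable if two-sided or only left removable. If $A$ is pre-removable, the canonical representation of $\Lambda/\langle A+I\rangle$ is the bound quiver algebra $kQ'/I'$, where $Q'$ is $Q$ with the arrows of $A$ deleted and $I'$ is the set of elements of $I$ that are linear combinations of paths avoiding $A$ (canonically $kQ'/I'\cong\Lambda/\langle A+I\rangle$); $B\subseteq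 Q_1\setminus A$ is called removable in $\Lambda/\langle A+I\rangle$ if it is removable in $kQ'/I'$. A set $A$ is eventually removable in $\Lambda$ if there is an ordered partition $A=A_1\dot\cup\cdots\dot\cup A_m$ such that $A_l$ is removable in $\Lambda/\langle(A_1\dot\cup\cdots\dot\cup A_{l-1})+I\rangle$ for every $l$ (the sets $A_1\dot\cup\cdots\dot\cup A_{l-1}$ are then automatically pre-removable). There is a unique maximal eventually removable set of arrows, denoted $A^{\mathrm{er}}_\Lambda$, and the arrow reduced version $\Lambda_{\mathrm{arv}}$ of $\Lambda$ is the canonical representation of $\Lambda/\langle A^{\mathrm{er}}_\Lambda+I\rangle$. $\mathrm{fin.dim}\,R$ (resp. $\mathrm{Fin.dim}\,R$) is the supremum of the projective dimensions of finitely generated (resp. all) left $R$-modules of finite projective dimension; $\mathrm{gl.dim}$ is the global dimension. *)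

theory Defs
  imports
    "Graph_Theory.Digraph"
    "Graph_Theory.Arc_Walk"
    "HOL-Algebra.QuotRing"
    "HOL-Algebra.Ideal_Product"
    "HOL-Algebra.Module"
    "HOL-Library.Poly_Mapping"
    "HOL-Library.Disjoint_Sets"
    "HOL-Library.Extended_Nat"
begin

section \<open>Modules over a not necessarily commutative ring\<close>

text \<open>The locale \<open>module\<close> of HOL-Algebra demands a commutative ring of scalars. The record type
  of the same name and the locale \<open>submodule\<close> do not, and are reused.\<close>

locale left_module = R?: ring R + M?: abelian_group M
  for R (structure) and M (structure) +
  assumes smult_closed:
      "\<lbrakk>a \<in> carrier R; x \<in> carrier M\<rbrakk> \<Longrightarrow> a \<odot>\<^bsub>M\<^esub> x \<in> carrier M"
    and smult_l_distr:
      "\<lbrakk>a \<in> carrier R; b \<in> carrier R; x \<in> carrier M\<rbrakk> \<Longrightarrow>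
        (a \<oplus> b) \<odot>\<^bsub>M\<^esub> x = a \<odot>\<^bsub>M\<^esub> x \<oplus>\<^bsub>M\<^esub> b \<odot>\<^bsub>M\<^esub> x"
    and smult_r_distr:
      "\<lbrakk>a \<in> carrier R; x \<in> carrier M; y \<in> carrier M\<rbrakk> \<Longrightarrow>
        a \<odot>\<^bsub>M\<^esub> (x \<oplus>\<^bsub>M\<^esub> y) = a \<odot>\<^bsub>M\<^esub> x \<oplus>\<^bsub>M\<^esub> a \<odot>\<^bsub>M\<^esub> y"
    and smult_assoc:
      "\<lbrakk>a \<in> carrier R; b \<in> carrier R; x \<in> carrier M\<rbrakk> \<Longrightarrow>
        (a \<otimes> b) \<odot>\<^bsub>M\<^esub> x = a \<odot>\<^bsub>M\<^esub> (b \<odot>\<^bsub>M\<^esub> x)"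
    and smult_one:
      "x \<in> carrier M \<Longrightarrow> \<one> \<odot>\<^bsub>M\<^esub> x = x"

definition module_hom ::
  "('r, 'x) ring_scheme \<Rightarrow> ('r, 'm) module \<Rightarrow> ('r, 'n) module \<Rightarrow> ('m \<Rightarrow> 'n) set" where
  "module_hom R M N =
    {f \<in> carrier M \<rightarrow> carrier N.
      (\<forall>x\<in>carrier M. \<forall>y\<in>carrier M. f (x \<oplus>\<^bsub>M\<^esub> y) = f x \<oplus>\<^bsub>N\<^esub> f y) \<and>
      (\<forall>a\<in>carrier R. \<forall>x\<in>carrier M. f (a \<odot>\<^bsub>M\<^esub> x) = a \<odot>\<^bsub>N\<^esub> f x)}"

text \<open>The test modules below, and the terms of the projective resolutions further down, live on
  the same type \<open>'m\<close> as the module under consideration. This is no restriction as soon as \<open>'m\<close> is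
  infinite and at least as large as the ring: then a free module on the elements of any module
  with elements in \<open>'m\<close> has an isomorphic copy with elements in \<open>'m\<close>.\<close>

definition projective_module :: "('r, 'x) ring_scheme \<Rightarrow> ('r, 'm) module \<Rightarrow> bool" where
  "projective_module R P \<longleftrightarrow> left_module R P \<and>
    (\<forall>(M :: ('r, 'm) module) (N :: ('r, 'm) module).
       left_module R M \<longrightarrow> left_module R N \<longrightarrow>
       (\<forall>g \<in> module_hom R M N. \<forall>f \<in> module_hom R P N.
          g ` carrier M = carrier N \<longrightarrow>
          (\<exists>h \<in> module_hom R P M. \<forall>x\<in>carrier P. g (h x) = f x)))"

text \<open>An exact sequence \<open>0 \<rightarrow> P n \<rightarrow> \<dots> \<rightarrow> P 0 \<rightarrow> M \<rightarrow> 0\<close> with projective terms, where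
  \<open>d 0\<close> is the augmentation \<open>P 0 \<rightarrow> M\<close> and \<open>d (Suc i)\<close> the differential \<open>P (Suc i) \<rightarrow> P i\<close>;
  the sequence is continued by zero modules beyond \<open>n\<close>.\<close>

definition projective_resolution ::
  "('r, 'x) ring_scheme \<Rightarrow> ('r, 'm) module \<Rightarrow> nat \<Rightarrow> (nat \<Rightarrow> ('r, 'm) module) \<Rightarrow>
    (nat \<Rightarrow> 'm \<Rightarrow> 'm) \<Rightarrow> bool" where
  "projective_resolution R M n P d \<longleftrightarrow>
    (\<forall>i. projective_module R (P i)) \<and>
    (\<forall>i>n. carrier (P i) = {\<zero>\<^bsub>P i\<^esub>}) \<and>
    d 0 \<in> module_hom R (P 0) M \<and>
    (\<forall>i. d (Suc i) \<in> module_hom R (P (Suc i)) (P i)) \<and>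
    d 0 ` carrier (P 0) = carrier M \<and>
    d (Suc 0) ` carrier (P (Suc 0)) = a_kernel (P 0) M (d 0) \<and>
    (\<forall>i. d (Suc (Suc i)) ` carrier (P (Suc (Suc i))) = a_kernel (P (Suc i)) (P i) (d (Suc i)))"

text \<open>The infimum of the empty set is \<open>\<infinity>\<close>; the zero module gets dimension \<open>0\<close>.\<close>

definition projdim :: "('r, 'x) ring_scheme \<Rightarrow> ('r, 'm) module \<Rightarrow> enat" where
  "projdim R M = Inf {enat n |n. \<exists>P d. projective_resolution R M n P d}"

definition finitely_generated :: "('r, 'x) ring_scheme \<Rightarrow> ('r, 'm) module \<Rightarrow> bool" where
  "finitely_generated R M \<longleftrightarrow>
    (\<exists>S. finite S \<and> S \<subseteq> carrier M \<and> (\<forall>H. submodule H R M \<and> S \<subseteq> H \<longrightarrow> H = carrier M))"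

text \<open>HOL has no type of all modules. The type \<open>'m\<close> serves as a universe: the suprema
  range over all modules with elements in \<open>'m\<close>. Statements about these dimensions should be
  made for every sufficiently large type \<open>'m\<close>.\<close>

definition fin_dim :: "'m itself \<Rightarrow> ('r, 'x) ring_scheme \<Rightarrow> enat" where
  "fin_dim (_ :: 'm itself) R =
    Sup {projdim R M |M :: ('r, 'm) module.
      left_module R M \<and> finitely_generated R M \<and> projdim R M < \<infinity>}"

definition Fin_dim :: "'m itself \<Rightarrow> ('r, 'x) ring_scheme \<Rightarrow> enat" where
  "Fin_dim (_ :: 'm itself) R =
    Sup {projdim R M |M :: ('r, 'm) module. left_module R M \<and> projdim R M < \<infinity>}"

definition gl_dim :: "'m itself \<Rightarrow> ('r, 'x) ring_scheme \<Rightarrow> enat" where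
  "gl_dim (_ :: 'm itself) R = Sup {projdim R M |M :: ('r, 'm) module. left_module R M}"

text \<open>Right modules over \<open>R\<close> are left modules over the opposite ring.\<close>

definition op_ring :: "'r ring \<Rightarrow> 'r ring" where
  "op_ring R = R\<lparr>mult := \<lambda>x y. y \<otimes>\<^bsub>R\<^esub> x\<rparr>"

text \<open>A left ideal \<open>J\<close> of \<open>R\<close> as a left module. Only the fields \<open>carrier\<close>, \<open>zero\<close>,
  \<open>add\<close> and \<open>smult\<close> of a module record matter. Below, its projective dimension is only used
  when the element type of \<open>R\<close> is that of a bound quiver algebra, which is infinite.\<close>

definition ideal_module :: "'r ring \<Rightarrow> 'r set \<Rightarrow> ('r, 'r) module" where
  "ideal_module R J =
    \<lparr>carrier = J, mult = mult R, one = one R, zero = zero R, add = add R, smult = mult R\<rparr>"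

definition left_projdim_ideal :: "'r ring \<Rightarrow> 'r set \<Rightarrow> enat" where
  "left_projdim_ideal R J = projdim R (ideal_module R J)"

definition right_projdim_ideal :: "'r ring \<Rightarrow> 'r set \<Rightarrow> enat" where
  "right_projdim_ideal R J = projdim (op_ring R) (ideal_module (op_ring R) J)"


section \<open>Path algebras\<close>

text \<open>A path is a triple of its start vertex, its list of arrows and its end vertex; the
  trivial path at \<open>v\<close> is \<open>(v, [], v)\<close>.\<close>

type_synonym ('v, 'a) qpath = "'v \<times> 'a list \<times> 'v"

definition paths :: "('v, 'a) pre_digraph \<Rightarrow> ('v, 'a) qpath set" where
  "paths Q = {(u, p, v). pre_digraph.awalk Q u p v}"

definition path_arrows :: "('v, 'a) qpath \<Rightarrow> 'a set" where
  "path_arrows p = set (fst (snd p))"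

definition path_length :: "('v, 'a) qpath \<Rightarrow> nat" where
  "path_length p = length (fst (snd p))"

definition arrow_path :: "('v, 'a) pre_digraph \<Rightarrow> 'a \<Rightarrow> ('v, 'a) qpath" where
  "arrow_path Q a = (tail Q a, [a], head Q a)"

text \<open>Paths are multiplied by concatenation, read from left to right. The opposite
  convention amounts to replacing the quiver by the one with all arrows reversed.\<close>

definition basis_mult ::
  "('v, 'a) qpath \<Rightarrow> ('v, 'a) qpath \<Rightarrow> 'k::field \<Rightarrow> ('v, 'a) qpath \<Rightarrow>\<^sub>0 'k" where
  "basis_mult p q c =
    (if snd (snd p) = fst q
     then Poly_Mapping.single (fst p, fst (snd p) @ fst (snd q), snd (snd q)) c else 0)"

definition path_mult ::
  "(('v, 'a) qpath \<Rightarrow>\<^sub>0 'k::field) \<Rightarrow> (('v, 'a) qpath \<Rightarrow>\<^sub>0 'k) \<Rightarrow> ('v, 'a) qpath \<Rightarrow>\<^sub>0 'k" where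
  "path_mult x y =
    (\<Sum>p\<in>Poly_Mapping.keys x. \<Sum>q\<in>Poly_Mapping.keys y.
       basis_mult p q (Poly_Mapping.lookup x p * Poly_Mapping.lookup y q))"

definition path_algebra ::
  "('v, 'a) pre_digraph \<Rightarrow> (('v, 'a) qpath \<Rightarrow>\<^sub>0 'k::field) ring" where
  "path_algebra Q =
    \<lparr>carrier = {z. Poly_Mapping.keys z \<subseteq> paths Q},
     mult = path_mult,
     one = (\<Sum>v\<in>verts Q. Poly_Mapping.single (v, [], v) 1),
     zero = 0,
     add = (+)\<rparr>"


section \<open>Bound quiver algebras\<close>

text \<open>Ideals of the path algebra are automatically closed under scalar multiplication,
  as the path algebra of a finite quiver is unital.\<close>

definition admissible_ideal ::
  "('v, 'a) pre_digraph \<Rightarrow> (('v, 'a) qpath \<Rightarrow>\<^sub>0 'k::field) set \<Rightarrow> bool" where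
  "admissible_ideal Q I \<longleftrightarrow>
    ideal I (path_algebra Q) \<and>
    (\<forall>z\<in>I. \<forall>p\<in>Poly_Mapping.keys z. 2 \<le> path_length p) \<and>
    (\<exists>N>1. \<forall>p\<in>paths Q. path_length p = N \<longrightarrow> Poly_Mapping.single p 1 \<in> I)"

definition bound_quiver ::
  "('v, 'a) pre_digraph \<Rightarrow> (('v, 'a) qpath \<Rightarrow>\<^sub>0 'k::field) set \<Rightarrow> bool" where
  "bound_quiver Q I \<longleftrightarrow> fin_digraph Q \<and> admissible_ideal Q I"

definition bound_quiver_algebra ::
  "('v, 'a) pre_digraph \<Rightarrow> (('v, 'a) qpath \<Rightarrow>\<^sub>0 'k::field) set \<Rightarrow>
    (('v, 'a) qpath \<Rightarrow>\<^sub>0 'k) set ring" where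
  "bound_quiver_algebra Q I = path_algebra Q Quot I"

definition arrow_ideal ::
  "('v, 'a) pre_digraph \<Rightarrow> (('v, 'a) qpath \<Rightarrow>\<^sub>0 'k::field) set \<Rightarrow> 'a set \<Rightarrow>
    (('v, 'a) qpath \<Rightarrow>\<^sub>0 'k) set set" where
  "arrow_ideal Q I A =
    Idl\<^bsub>bound_quiver_algebra Q I\<^esub>
      ((\<lambda>a. I +>\<^bsub>path_algebra Q\<^esub> Poly_Mapping.single (arrow_path Q a) 1) ` A)"


section \<open>Removable sets of arrows\<close>

definition part_through ::
  "'a set \<Rightarrow> (('v, 'a) qpath \<Rightarrow>\<^sub>0 'k::field) \<Rightarrow> ('v, 'a) qpath \<Rightarrow>\<^sub>0 'k" where
  "part_through A z =
    (\<Sum>p\<in>{p \<in> Poly_Mapping.keys z. path_arrows p \<inter> A \<noteq> {}}.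
       Poly_Mapping.single p (Poly_Mapping.lookup z p))"

definition part_avoiding ::
  "'a set \<Rightarrow> (('v, 'a) qpath \<Rightarrow>\<^sub>0 'k::field) \<Rightarrow> ('v, 'a) qpath \<Rightarrow>\<^sub>0 'k" where
  "part_avoiding A z =
    (\<Sum>p\<in>{p \<in> Poly_Mapping.keys z. path_arrows p \<inter> A = {}}.
       Poly_Mapping.single p (Poly_Mapping.lookup z p))"

definition pre_removable ::
  "('v, 'a) pre_digraph \<Rightarrow> (('v, 'a) qpath \<Rightarrow>\<^sub>0 'k::field) set \<Rightarrow> 'a set \<Rightarrow> bool" where
  "pre_removable Q I A \<longleftrightarrow>
    A \<subseteq> arcs Q \<and> (\<forall>z\<in>I. part_through A z \<in> I \<and> part_avoiding A z \<in> I)"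

definition two_sided_removable ::
  "('v, 'a) pre_digraph \<Rightarrow> (('v, 'a) qpath \<Rightarrow>\<^sub>0 'k::field) set \<Rightarrow> 'a set \<Rightarrow> bool" where
  "two_sided_removable Q I A \<longleftrightarrow>
    pre_removable Q I A \<and>
    left_projdim_ideal (bound_quiver_algebra Q I) (arrow_ideal Q I A) < \<infinity> \<and>
    right_projdim_ideal (bound_quiver_algebra Q I) (arrow_ideal Q I A) < \<infinity>"

definition only_left_removable ::
  "('v, 'a) pre_digraph \<Rightarrow> (('v, 'a) qpath \<Rightarrow>\<^sub>0 'k::field) set \<Rightarrow> 'a set \<Rightarrow> bool" where
  "only_left_removable Q I A \<longleftrightarrow>
    pre_removable Q I A \<and>
    ideal_prod (bound_quiver_algebra Q I) (arrow_ideal Q I A) (arrow_ideal Q I A) =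
      {\<zero>\<^bsub>bound_quiver_algebra Q I\<^esub>} \<and>
    right_projdim_ideal (bound_quiver_algebra Q I) (arrow_ideal Q I A) < \<infinity> \<and>
    left_projdim_ideal (bound_quiver_algebra Q I) (arrow_ideal Q I A) = \<infinity>"

definition removable ::
  "('v, 'a) pre_digraph \<Rightarrow> (('v, 'a) qpath \<Rightarrow>\<^sub>0 'k::field) set \<Rightarrow> 'a set \<Rightarrow> bool" where
  "removable Q I A \<longleftrightarrow> two_sided_removable Q I A \<or> only_left_removable Q I A"

text \<open>The canonical representation \<open>(quiver_minus Q A, ideal_avoiding I A)\<close> of
  the quotient by the ideal generated by \<open>A\<close>.\<close>

definition quiver_minus :: "('v, 'a) pre_digraph \<Rightarrow> 'a set \<Rightarrow> ('v, 'a) pre_digraph" where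
  "quiver_minus Q A = Q\<lparr>arcs := arcs Q - A\<rparr>"

definition ideal_avoiding ::
  "(('v, 'a) qpath \<Rightarrow>\<^sub>0 'k::field) set \<Rightarrow> 'a set \<Rightarrow> (('v, 'a) qpath \<Rightarrow>\<^sub>0 'k) set" where
  "ideal_avoiding I A = {z \<in> I. \<forall>p\<in>Poly_Mapping.keys z. path_arrows p \<inter> A = {}}"

definition eventually_removable ::
  "('v, 'a) pre_digraph \<Rightarrow> (('v, 'a) qpath \<Rightarrow>\<^sub>0 'k::field) set \<Rightarrow> 'a set \<Rightarrow> bool" where
  "eventually_removable Q I A \<longleftrightarrow>
    (\<exists>As. partition_on A (set As) \<and> distinct As \<and>
      (\<forall>l<length As. let U = \<Union>(set (take l As)) in
         removable (quiver_minus Q U) (ideal_avoiding I U) (As ! l)))"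

definition maximal_eventually_removable ::
  "('v, 'a) pre_digraph \<Rightarrow> (('v, 'a) qpath \<Rightarrow>\<^sub>0 'k::field) set \<Rightarrow> 'a set \<Rightarrow> bool" where
  "maximal_eventually_removable Q I A \<longleftrightarrow>
    eventually_removable Q I A \<and> (\<forall>B. eventually_removable Q I B \<longrightarrow> A \<subseteq> B \<longrightarrow> B = A)"

text \<open>The relation that \<open>(Q', I')\<close> presents the arrow reduced version of \<open>(Q, I)\<close>. Phrasing it
  as a relation avoids choosing a value by description for the maximal set, and hence does not
  rely on its uniqueness.\<close>

definition arrow_reduced_version ::
  "('v, 'a) pre_digraph \<Rightarrow> (('v, 'a) qpath \<Rightarrow>\<^sub>0 'k::field) set \<Rightarrow>
    ('v, 'a) pre_digraph \<Rightarrow> (('v, 'a) qpath \<Rightarrow>\<^sub>0 'k) set \<Rightarrow> bool" where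
  "arrow_reduced_version Q I Q' I' \<longleftrightarrow>
    (\<exists>A. maximal_eventually_removable Q I A \<and> Q' = quiver_minus Q A \<and> I' = ideal_avoiding I A)"


section \<open>Well-definedness\<close>

lemma eventually_removable_empty: "eventually_removable Q I {}"
  unfolding eventually_removable_def by (rule exI[of _ "[]"]) (simp add: partition_on_def)

lemma removable_subset: "removable Q I A \<Longrightarrow> A \<subseteq> arcs Q"
  unfolding removable_def two_sided_removable_def only_left_removable_def pre_removable_def
  by blast

lemma arcs_quiver_minus: "arcs (quiver_minus Q A) = arcs Q - A"
  by (simp add: quiver_minus_def)

lemma eventually_removable_subset:
  assumes "eventually_removable Q I A" shows "A \<subseteq> arcs Q"
proof -
  obtain As where p: "partition_on A (set As)" and
    r: "\<forall>l<length As. removable (quiver_minus Q (\<Union>(set (take l As))))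
          (ideal_avoiding I (\<Union>(set (take l As)))) (As ! l)"
    using assms unfolding eventually_removable_def Let_def by (elim exE conjE)
  have "B \<subseteq> arcs Q" if "B \<in> set As" for B
  proof -
    have "\<exists>l<length As. As ! l = B" using that by (simp only: in_set_conv_nth)
    then obtain l where l: "l < length As" "As ! l = B" by (elim exE conjE)
    have "As ! l \<subseteq> arcs (quiver_minus Q (\<Union>(set (take l As))))"
      by (rule removable_subset[OF r[rule_format, OF l(1)]])
    then show ?thesis using l(2) by (simp only: arcs_quiver_minus) blast
  qed
  then show ?thesis using partition_onD1[OF p] by (simp only: Union_least)
qed

lemma arrow_reduced_version_exists:
  assumes "bound_quiver Q I" shows "\<exists>Q' I'. arrow_reduced_version Q I Q' I'"
proof -
  have "fin_digraph Q" using assms by (simp only: bound_quiver_def)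
  then have "finite (Pow (arcs Q))" by (simp add: fin_digraph.finite_arcs)
  moreover have "{A. eventually_removable Q I A} \<subseteq> Pow (arcs Q)"
    by (rule subsetI) (simp only: mem_Collect_eq Pow_iff eventually_removable_subset)
  ultimately have "finite {A. eventually_removable Q I A}" by (rule finite_subset[rotated])
  moreover have "{A. eventually_removable Q I A} \<noteq> {}"
    using eventually_removable_empty[of Q I] by blast
  ultimately obtain A where A: "A \<in> {A. eventually_removable Q I A}"
    "\<forall>B\<in>{A. eventually_removable Q I A}. A \<subseteq> B \<longrightarrow> A = B"
    by (rule finite_has_maximal[THEN bexE]) (rule that)
  have "eventually_removable Q I A" using A(1) by (simp only: mem_Collect_eq)
  moreover have "\<forall>B. eventually_removable Q I B \<longrightarrow> A \<subseteq> B \<longrightarrow> B = A"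
    using A(2) by (simp only: Ball_def mem_Collect_eq) (metis (no_types))
  ultimately have "maximal_eventually_removable Q I A"
    unfolding maximal_eventually_removable_def by (rule conjI)
  then show ?thesis unfolding arrow_reduced_version_def by (intro exI conjI) (assumption, rule refl, rule refl)
qed

lemma path_mult_finite:
  assumes "finite S" "finite T" "Poly_Mapping.keys x \<subseteq> S" "Poly_Mapping.keys y \<subseteq> T"
  shows "path_mult x y = (\<Sum>p\<in>S. \<Sum>q\<in>T.
    basis_mult p q (Poly_Mapping.lookup x p * Poly_Mapping.lookup y q))"
proof -
  have inner: "(\<Sum>q\<in>Poly_Mapping.keys y.
        basis_mult p q (Poly_Mapping.lookup x p * Poly_Mapping.lookup y q)) =
      (\<Sum>q\<in>T. basis_mult p q (Poly_Mapping.lookup x p * Poly_Mapping.lookup y q))" for p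
    using assms by (intro sum.mono_neutral_left) (auto simp: basis_mult_def in_keys_iff)
  show ?thesis unfolding path_mult_def inner
    using assms
    by (intro sum.mono_neutral_left) (auto simp: basis_mult_def in_keys_iff intro!: sum.neutral)
qed

lemma basis_mult_add: "basis_mult p q (c + d) = basis_mult p q c + basis_mult p q d"
  by (simp add: basis_mult_def single_add)

lemma path_mult_add_left: "path_mult (x + x') y = path_mult x y + path_mult x' y"
proof -
  let ?S = "Poly_Mapping.keys x \<union> Poly_Mapping.keys x'"
  let ?T = "Poly_Mapping.keys y"
  have "Poly_Mapping.keys (x + x') \<subseteq> ?S" by (rule Poly_Mapping.keys_add)
  then show ?thesis
    by (simp add: path_mult_finite[of ?S ?T] lookup_add distrib_right basis_mult_add sum.distrib)
qed

lemma path_mult_add_right: "path_mult x (y + y') = path_mult x y + path_mult x y'"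
proof -
  let ?S = "Poly_Mapping.keys y \<union> Poly_Mapping.keys y'"
  let ?T = "Poly_Mapping.keys x"
  have "Poly_Mapping.keys (y + y') \<subseteq> ?S" by (rule Poly_Mapping.keys_add)
  then show ?thesis
    by (simp add: path_mult_finite[of ?T ?S] lookup_add distrib_left basis_mult_add sum.distrib)
qed

lemma path_mult_zero: "path_mult 0 y = 0" "path_mult x 0 = 0"
  by (simp_all add: path_mult_def)

lemma path_mult_sum:
  "path_mult (sum f S) y = (\<Sum>s\<in>S. path_mult (f s) y)"
  "path_mult x (sum f S) = (\<Sum>s\<in>S. path_mult x (f s))"
  by (induction S rule: infinite_finite_induct)
    (simp_all add: path_mult_zero path_mult_add_left path_mult_add_right)

lemma path_mult_single:
  "path_mult (Poly_Mapping.single p c) (Poly_Mapping.single q d) = basis_mult p q (c * d)"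
  by (subst path_mult_finite[of "{p}" "{q}"]) simp_all

lemma path_single_induct [case_names zero add single]:
  fixes z :: "'p \<Rightarrow>\<^sub>0 'k::comm_monoid_add"
  assumes "P 0" "\<And>x y. P x \<Longrightarrow> P y \<Longrightarrow> P (x + y)"
    "\<And>p c. p \<in> Poly_Mapping.keys z \<Longrightarrow> P (Poly_Mapping.single p c)"
  shows "P z"
proof -
  have "P (\<Sum>p\<in>S. Poly_Mapping.single p (Poly_Mapping.lookup z p))"
    if "finite S" "S \<subseteq> Poly_Mapping.keys z" for S
    using that by (induction S rule: finite_induct) (auto intro: assms)
  moreover have "(\<Sum>p\<in>Poly_Mapping.keys z. Poly_Mapping.single p (Poly_Mapping.lookup z p)) = z"
    by (rule poly_mapping_eqI) (simp add: lookup_sum lookup_single when_def in_keys_iff sum.delta)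
  ultimately show ?thesis by (metis finite_keys order_refl)
qed

lemma path_mult_assoc: "path_mult (path_mult x y) z = path_mult x (path_mult y z)"
proof (induction x rule: path_single_induct)
  case (single p c)
  show ?case
  proof (induction y rule: path_single_induct)
    case (single q d)
    show ?case
    proof (induction z rule: path_single_induct)
      case (single r e)
      show ?case
        by (simp add: path_mult_single basis_mult_def path_mult_zero mult.assoc)
    qed (simp_all add: path_mult_zero path_mult_add_right)
  qed (simp_all add: path_mult_zero path_mult_add_left path_mult_add_right)
qed (simp_all add: path_mult_zero path_mult_add_left)

lemma keys_path_mult:
  fixes x y :: "('v, 'a) qpath \<Rightarrow>\<^sub>0 'k::field"
  assumes "Poly_Mapping.keys x \<subseteq> paths Q" "Poly_Mapping.keys y \<subseteq> paths Q"
  shows "Poly_Mapping.keys (path_mult x y) \<subseteq> paths Q"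
proof -
  have basis: "Poly_Mapping.keys (basis_mult p q c) \<subseteq> paths Q"
    if "p \<in> paths Q" "q \<in> paths Q" for p q and c :: 'k
  proof -
    have cas: "pre_digraph.cas Q u (as @ bs) w"
      if "pre_digraph.cas Q u as v" "pre_digraph.cas Q v bs w" for u v w as bs
      using that by (induction as arbitrary: u) (auto simp: pre_digraph.cas.simps)
    show ?thesis
      using that by (auto simp: basis_mult_def paths_def pre_digraph.awalk_def intro: cas)
  qed
  have sub: "Poly_Mapping.keys (sum f S) \<subseteq> paths Q"
    if "\<And>s. s \<in> S \<Longrightarrow> Poly_Mapping.keys (f s) \<subseteq> paths Q"
    for S and f :: "('v, 'a) qpath \<Rightarrow> ('v, 'a) qpath \<Rightarrow>\<^sub>0 'k"
    using Poly_Mapping.keys_sum[of f S] that by blast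
  show ?thesis unfolding path_mult_def
    using assms by (intro sub basis) blast+
qed

lemma path_mult_one:
  fixes z :: "('v, 'a) qpath \<Rightarrow>\<^sub>0 'k::field"
  assumes "fin_digraph Q" "Poly_Mapping.keys z \<subseteq> paths Q"
  shows "path_mult (\<Sum>v\<in>verts Q. Poly_Mapping.single (v, [], v) 1) z = z"
    and "path_mult z (\<Sum>v\<in>verts Q. Poly_Mapping.single (v, [], v) 1) = z"
proof -
  interpret fin_digraph Q by fact
  have ends: "fst p \<in> verts Q" "snd (snd p) \<in> verts Q" if "p \<in> Poly_Mapping.keys z" for p
    using that assms(2)
    by (cases p; auto simp: paths_def dest: awalk_hd_in_verts awalk_last_in_verts)+
  have "z = (\<Sum>p\<in>Poly_Mapping.keys z. Poly_Mapping.single p (Poly_Mapping.lookup z p))"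
    by (rule poly_mapping_eqI) (simp add: lookup_sum lookup_single when_def in_keys_iff sum.delta)
  note z = this
  have l: "path_mult (\<Sum>v\<in>verts Q. Poly_Mapping.single (v, [], v) 1) (Poly_Mapping.single p c) =
      Poly_Mapping.single p c" if "p \<in> Poly_Mapping.keys z" for p and c :: 'k
    using ends[OF that]
    by (simp add: path_mult_sum path_mult_single basis_mult_def sum.delta)
  have r: "path_mult (Poly_Mapping.single p c) (\<Sum>v\<in>verts Q. Poly_Mapping.single (v, [], v) 1) =
      Poly_Mapping.single p c" if "p \<in> Poly_Mapping.keys z" for p and c :: 'k
    using ends[OF that]
    by (simp add: path_mult_sum path_mult_single basis_mult_def sum.delta')
  show "path_mult (\<Sum>v\<in>verts Q. Poly_Mapping.single (v, [], v) 1) z = z"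
    by (subst (1 2) z, subst path_mult_sum(2)) (rule sum.cong[OF refl], rule l)
  show "path_mult z (\<Sum>v\<in>verts Q. Poly_Mapping.single (v, [], v) 1) = z"
    by (subst (1 2) z, subst path_mult_sum(1)) (rule sum.cong[OF refl], rule r)
qed

lemma ring_path_algebra:
  assumes "fin_digraph Q"
  shows "ring (path_algebra Q :: (('v, 'a) qpath \<Rightarrow>\<^sub>0 'k::field) ring)"
proof -
  interpret fin_digraph Q by fact
  let ?K = "path_algebra Q :: (('v, 'a) qpath \<Rightarrow>\<^sub>0 'k) ring"
  have one: "\<one>\<^bsub>?K\<^esub> \<in> carrier ?K"
    using Poly_Mapping.keys_sum[of "\<lambda>v. Poly_Mapping.single (v, [], v) (1::'k)" "verts Q"]
    by (fastforce simp: path_algebra_def paths_def awalk_Nil_iff)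
  have keys_add: "Poly_Mapping.keys (x + y) \<subseteq> paths Q"
    if "Poly_Mapping.keys x \<subseteq> paths Q" "Poly_Mapping.keys y \<subseteq> paths Q"
    for x y :: "('v, 'a) qpath \<Rightarrow>\<^sub>0 'k"
    using that Poly_Mapping.keys_add[of x y] by blast
  show ?thesis
  proof (rule ringI)
    show "abelian_group ?K"
    proof (rule abelian_groupI)
      fix x assume "x \<in> carrier ?K"
      then show "\<exists>y\<in>carrier ?K. y \<oplus>\<^bsub>?K\<^esub> x = \<zero>\<^bsub>?K\<^esub>"
        by (intro bexI[of _ "- x"]) (auto simp: path_algebra_def)
    qed (auto simp: path_algebra_def keys_add[THEN subsetD] add.assoc add.commute)
    show "Group.monoid ?K"
    proof (rule monoidI)
      show "\<one>\<^bsub>?K\<^esub> \<in> carrier ?K" by (rule one)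
    qed (use keys_path_mult path_mult_assoc path_mult_one[OF assms] in \<open>simp_all add: path_algebra_def\<close>)
  qed (simp_all add: path_algebra_def path_mult_add_left path_mult_add_right)
qed

end

theory Submission
  imports Defs
begin

text \<open>Let \<open>J = \<langle>A + I\<rangle>\<close> and \<open>\<Gamma> = \<Lambda> / J\<close>. As \<open>A\<close> is pre-removable, the paths avoiding \<open>A\<close> embed
  \<open>\<Gamma>\<close> into \<open>\<Lambda>\<close> as a complement of the nilpotent ideal \<open>J\<close>. It suffices to remove one set \<open>A\<close>.

  From \<open>\<Gamma>\<close> to \<open>\<Lambda>\<close>: if \<open>J\<close> has projective dimension at most \<open>d\<close> as a right module, then
  \<open>Tor(\<Lambda> / J, X)\<close> vanishes in positive degrees on every high syzygy \<open>X\<close>. Hence projective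
  resolutions of \<open>X\<close> stay exact modulo \<open>J\<close>, and since \<open>J\<close> is nilpotent, \<open>X\<close> is projective as soon
  as \<open>X / J X\<close> is. So \<open>X\<close> over \<open>\<Lambda>\<close> and \<open>X / J X\<close> over \<open>\<Gamma>\<close> have the same projective dimension.

  From \<open>\<Lambda>\<close> to \<open>\<Gamma>\<close>: if the identity of a \<open>\<Gamma>\<close>-module \<open>M\<close> factors as a \<open>\<Gamma>\<close>-map from \<open>M\<close> to a
  \<open>\<Lambda>\<close>-module \<open>N\<close> followed by a \<open>\<Lambda>\<close>-map to the inflation of \<open>M\<close>, then the dimension of \<open>M\<close> over
  \<open>\<Gamma>\<close> is at most that of \<open>N\<close> over \<open>\<Lambda>\<close>. When \<open>J\<close> has finite projective dimension on the left, take
  the inflation of \<open>M\<close> for \<open>N\<close>; inflated projectives then have bounded dimension. When \<open>J\<close> squares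
  to zero, it is a right \<open>\<Gamma>\<close>-module of finite projective dimension; replace \<open>M\<close> by a high syzygy and
  take \<open>\<Lambda> \<otimes> M\<close> over \<open>\<Gamma>\<close>, which has the projective dimension of \<open>M\<close> because
  \<open>Tor(J, M)\<close> vanishes.

  The functor \<open>Tor\<close> is avoided by stating the exactness of free right resolutions by matrices.\<close>

section \<open>Modules and their homomorphisms\<close>

text \<open>The modules of the statement live on one fixed type \<open>'m\<close>, and this shapes
  the homological part. A free module on the elements of a module lives on a function type; it is
  moved back to \<open>'m\<close> along an injection, which exists because \<open>'m\<close> is
  infinite and at least as large as the ring. The direct sum of two modules, as in Schanuel's lemma,
  is replaced by a retract up to a projective correction. The shifts are those of Tor. If
  \<open>J\<close> has right dimension at most d, then \<Lambda>/J has at most d + 1, and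
  Tor_i(\<Lambda>/J, X) = Tor_(i+d+1)(\<Lambda>/J, M) = 0 for i > 0 when X is a (d+1)-st syzygy of
  M; the cost is dim M \<le> dim X + d + 1. The vanishing is used in one form: if a matrix maps a
  column over P to a column over the kernel K of P -> X, then some column over K has the same image.
  On the way from \<Lambda> to \<Gamma> the obstacle is that a \<Gamma>-module of finite dimension
  may have infinite dimension over \<Lambda>. The left hypothesis on \<open>J\<close>, or its square
  being zero, provides a substitute of finite dimension; for gl.dim all dimensions over \<Lambda>
  are bounded anyway.\<close>

lemma (in abelian_group) minus_zero_right [simp]: "x \<in> carrier G \<Longrightarrow> x \<ominus> \<zero> = x"
  by (simp add: a_minus_def)

lemma (in abelian_group) minus_eq_zero_iff:
  "x \<in> carrier G \<Longrightarrow> y \<in> carrier G \<Longrightarrow> x \<ominus> y = \<zero> \<longleftrightarrow> x = y"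
  by (metis a_minus_def add.inv_closed add.inv_inv minus_equality r_neg)

context left_module
begin

declare smult_closed [simp, intro] smult_one [simp]

lemma smult_l_null [simp]: "x \<in> carrier M \<Longrightarrow> \<zero> \<odot>\<^bsub>M\<^esub> x = \<zero>\<^bsub>M\<^esub>"
  using smult_l_distr[of \<zero> \<zero> x] by (metis R.l_zero R.zero_closed M.add.l_cancel_one smult_closed)

lemma smult_r_null [simp]: "a \<in> carrier R \<Longrightarrow> a \<odot>\<^bsub>M\<^esub> \<zero>\<^bsub>M\<^esub> = \<zero>\<^bsub>M\<^esub>"
  using smult_r_distr[of a "\<zero>\<^bsub>M\<^esub>" "\<zero>\<^bsub>M\<^esub>"]
  by (metis M.l_zero M.zero_closed M.add.l_cancel_one smult_closed)

lemma smult_l_minus: "\<lbrakk>a \<in> carrier R; x \<in> carrier M\<rbrakk> \<Longrightarrow> (\<ominus> a) \<odot>\<^bsub>M\<^esub> x = \<ominus>\<^bsub>M\<^esub> (a \<odot>\<^bsub>M\<^esub> x)"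
  using smult_l_distr[of "\<ominus> a" a x] by (simp add: R.l_neg M.minus_equality)

lemma smult_r_minus: "\<lbrakk>a \<in> carrier R; x \<in> carrier M\<rbrakk> \<Longrightarrow> a \<odot>\<^bsub>M\<^esub> (\<ominus>\<^bsub>M\<^esub> x) = \<ominus>\<^bsub>M\<^esub> (a \<odot>\<^bsub>M\<^esub> x)"
  using smult_r_distr[of a "\<ominus>\<^bsub>M\<^esub> x" x] by (simp add: M.l_neg M.minus_equality)

text \<open>Closure under negation is automatic, since -x is (-1) x.\<close>

lemma submoduleI':
  assumes "H \<subseteq> carrier M" "\<zero>\<^bsub>M\<^esub> \<in> H" "\<And>x y. x \<in> H \<Longrightarrow> y \<in> H \<Longrightarrow> x \<oplus>\<^bsub>M\<^esub> y \<in> H"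
    "\<And>a x. a \<in> carrier R \<Longrightarrow> x \<in> H \<Longrightarrow> a \<odot>\<^bsub>M\<^esub> x \<in> H"
  shows "submodule H R M"
proof -
  have "\<ominus>\<^bsub>M\<^esub> x \<in> H" if "x \<in> H" for x
    using assms(4)[of "\<ominus> \<one>" x] that assms(1) smult_l_minus[of \<one> x] by auto
  then show ?thesis
    using assms by (auto intro!: submodule.intro subgroup.intro simp: submodule_axioms_def a_inv_def)
qed

lemma submoduleD:
  assumes "submodule H R M"
  shows "H \<subseteq> carrier M" "\<zero>\<^bsub>M\<^esub> \<in> H" "\<And>x. x \<in> H \<Longrightarrow> x \<in> carrier M"
    "\<And>x y. x \<in> H \<Longrightarrow> y \<in> H \<Longrightarrow> x \<oplus>\<^bsub>M\<^esub> y \<in> H"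
    "\<And>x. x \<in> H \<Longrightarrow> \<ominus>\<^bsub>M\<^esub> x \<in> H"
    "\<And>x y. x \<in> H \<Longrightarrow> y \<in> H \<Longrightarrow> x \<ominus>\<^bsub>M\<^esub> y \<in> H"
    "\<And>a x. a \<in> carrier R \<Longrightarrow> x \<in> H \<Longrightarrow> a \<odot>\<^bsub>M\<^esub> x \<in> H"
proof -
  interpret H: submodule H R M by fact
  show "H \<subseteq> carrier M" "\<zero>\<^bsub>M\<^esub> \<in> H" "\<And>x. x \<in> H \<Longrightarrow> x \<in> carrier M"
    "\<And>x y. x \<in> H \<Longrightarrow> y \<in> H \<Longrightarrow> x \<oplus>\<^bsub>M\<^esub> y \<in> H"
    "\<And>x. x \<in> H \<Longrightarrow> \<ominus>\<^bsub>M\<^esub> x \<in> H"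
    "\<And>x y. x \<in> H \<Longrightarrow> y \<in> H \<Longrightarrow> x \<ominus>\<^bsub>M\<^esub> y \<in> H"
    "\<And>a x. a \<in> carrier R \<Longrightarrow> x \<in> H \<Longrightarrow> a \<odot>\<^bsub>M\<^esub> x \<in> H"
    using H.subset H.one_closed H.m_closed H.m_inv_closed by (auto simp: a_inv_def a_minus_def)
qed

lemma submodule_carrier: "submodule (carrier M) R M"
  by (rule submoduleI') auto

lemma left_module_submodule:
  assumes "submodule H R M"
  shows "left_module R (M\<lparr>carrier := H\<rparr>)"
proof -
  note H = submoduleD[OF assms]
  have "abelian_group (M\<lparr>carrier := H\<rparr>)"
  proof (rule abelian_groupI)
    fix x assume "x \<in> carrier (M\<lparr>carrier := H\<rparr>)"
    then show "\<exists>y\<in>carrier (M\<lparr>carrier := H\<rparr>). y \<oplus>\<^bsub>M\<lparr>carrier := H\<rparr>\<^esub> x = \<zero>\<^bsub>M\<lparr>carrier := H\<rparr>\<^esub>"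
      using H by (intro bexI[of _ "\<ominus>\<^bsub>M\<^esub> x"]) (auto simp: M.l_neg)
  qed (use H in \<open>auto simp: M.a_ac\<close>)
  then show ?thesis
    using H by (auto intro!: left_module.intro left_module_axioms.intro
        simp: smult_l_distr smult_r_distr smult_assoc R.ring_axioms)
qed

end

lemma a_kernel_iff: "x \<in> a_kernel M N f \<longleftrightarrow> x \<in> carrier M \<and> f x = \<zero>\<^bsub>N\<^esub>"
  by (simp add: a_kernel_def')

lemma module_homI:
  assumes "\<And>x. x \<in> carrier M \<Longrightarrow> f x \<in> carrier N"
    "\<And>x y. x \<in> carrier M \<Longrightarrow> y \<in> carrier M \<Longrightarrow> f (x \<oplus>\<^bsub>M\<^esub> y) = f x \<oplus>\<^bsub>N\<^esub> f y"
    "\<And>a x. a \<in> carrier R \<Longrightarrow> x \<in> carrier M \<Longrightarrow> f (a \<odot>\<^bsub>M\<^esub> x) = a \<odot>\<^bsub>N\<^esub> f x"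
  shows "f \<in> module_hom R M N"
  using assms by (simp add: module_hom_def)

lemma inclusion_hom: "H \<subseteq> carrier M \<Longrightarrow> (\<lambda>x. x) \<in> module_hom R (M\<lparr>carrier := H\<rparr>) M"
  by (auto simp: module_hom_def)

lemma module_hom_ident: "(\<lambda>x. x) \<in> module_hom R M M"
  by (simp add: module_hom_def)

lemma module_hom_comp:
  "f \<in> module_hom R M N \<Longrightarrow> g \<in> module_hom R N L \<Longrightarrow> (\<lambda>x. g (f x)) \<in> module_hom R M L"
  by (auto simp: module_hom_def Pi_iff)

lemma module_hom_into_submodule:
  "f \<in> module_hom R M N \<Longrightarrow> (\<And>x. x \<in> carrier M \<Longrightarrow> f x \<in> H) \<Longrightarrow>
    f \<in> module_hom R M (N\<lparr>carrier := H\<rparr>)"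
  by (auto simp: module_hom_def)

lemma module_hom_restrict:
  "f \<in> module_hom R M N \<Longrightarrow> H \<subseteq> carrier M \<Longrightarrow> f \<in> module_hom R (M\<lparr>carrier := H\<rparr>) N"
  by (auto simp: module_hom_def subset_iff)

locale module_morphism = M: left_module R M + N: left_module R N
  for R (structure) and M and N and f +
  assumes hom: "f \<in> module_hom R M N"
begin

lemma closed [simp, intro]: "x \<in> carrier M \<Longrightarrow> f x \<in> carrier N"
  and add [simp]: "x \<in> carrier M \<Longrightarrow> y \<in> carrier M \<Longrightarrow> f (x \<oplus>\<^bsub>M\<^esub> y) = f x \<oplus>\<^bsub>N\<^esub> f y"
  and smult [simp]: "a \<in> carrier R \<Longrightarrow> x \<in> carrier M \<Longrightarrow> f (a \<odot>\<^bsub>M\<^esub> x) = a \<odot>\<^bsub>N\<^esub> f x"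
  using hom by (auto simp: module_hom_def)

lemma zero [simp]: "f \<zero>\<^bsub>M\<^esub> = \<zero>\<^bsub>N\<^esub>"
  using add[of "\<zero>\<^bsub>M\<^esub>" "\<zero>\<^bsub>M\<^esub>"]
  by (metis M.M.l_zero M.M.zero_closed N.M.add.l_cancel_one closed)

lemma neg [simp]: "x \<in> carrier M \<Longrightarrow> f (\<ominus>\<^bsub>M\<^esub> x) = \<ominus>\<^bsub>N\<^esub> f x"
  using add[of "\<ominus>\<^bsub>M\<^esub> x" x] by (simp add: M.M.l_neg N.M.minus_equality)

lemma minus [simp]: "x \<in> carrier M \<Longrightarrow> y \<in> carrier M \<Longrightarrow> f (x \<ominus>\<^bsub>M\<^esub> y) = f x \<ominus>\<^bsub>N\<^esub> f y"
  by (simp add: a_minus_def)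

lemma finsum:
  assumes "h \<in> A \<rightarrow> carrier M"
  shows "f (finsum M h A) = finsum N (\<lambda>x. f (h x)) A"
  using assms
proof (induction A rule: infinite_finite_induct)
  case (insert x F)
  then have "h \<in> F \<rightarrow> carrier M" "h x \<in> carrier M" by auto
  then show ?case using insert by (auto simp: Pi_iff)
qed auto

lemma submodule_kernel: "submodule (a_kernel M N f) R M"
  by (rule M.submoduleI') (auto simp: a_kernel_iff)

lemma submodule_image: "submodule H R M \<Longrightarrow> submodule (f ` H) R N"
proof (rule N.submoduleI')
  assume H: "submodule H R M"
  note H = M.submoduleD[OF H]
  show "f ` H \<subseteq> carrier N" using H by auto
  show "\<zero>\<^bsub>N\<^esub> \<in> f ` H" using zero H(2) by (metis imageI)
  show "x \<oplus>\<^bsub>N\<^esub> y \<in> f ` H" if "x \<in> f ` H" "y \<in> f ` H" for x y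
    using that H by (auto simp flip: add)
  show "a \<odot>\<^bsub>N\<^esub> x \<in> f ` H" if "a \<in> carrier R" "x \<in> f ` H" for a x
    using that H by (auto simp flip: smult)
qed

lemma submodule_vimage: "submodule H R N \<Longrightarrow> submodule {x \<in> carrier M. f x \<in> H} R M"
  by (rule M.submoduleI') (auto dest: N.submoduleD)

lemma injective:
  assumes "\<And>x. x \<in> carrier M \<Longrightarrow> f x = \<zero>\<^bsub>N\<^esub> \<Longrightarrow> x = \<zero>\<^bsub>M\<^esub>"
  shows "inj_on f (carrier M)"
proof (rule inj_onI)
  fix x y assume "x \<in> carrier M" "y \<in> carrier M" "f x = f y"
  then show "x = y" using assms[of "x \<ominus>\<^bsub>M\<^esub> y"]
    by (simp add: N.M.minus_eq_zero_iff M.M.minus_eq_zero_iff)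
qed

end

lemma module_hom_add:
  assumes "left_module R M" "left_module R N" "f \<in> module_hom R M N" "g \<in> module_hom R M N"
  shows "(\<lambda>x. f x \<oplus>\<^bsub>N\<^esub> g x) \<in> module_hom R M N"
proof -
  interpret f: module_morphism R M N f using assms by (simp add: module_morphism_def module_morphism_axioms_def)
  interpret g: module_morphism R M N g using assms by (simp add: module_morphism_def module_morphism_axioms_def)
  show ?thesis by (rule module_homI) (auto simp: f.N.smult_r_distr f.N.M.a_ac)
qed

lemma module_hom_minus:
  assumes "left_module R M" "left_module R N" "f \<in> module_hom R M N" "g \<in> module_hom R M N"
  shows "(\<lambda>x. f x \<ominus>\<^bsub>N\<^esub> g x) \<in> module_hom R M N"
proof -
  interpret f: module_morphism R M N f using assms by (simp add: module_morphism_def module_morphism_axioms_def)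
  interpret g: module_morphism R M N g using assms by (simp add: module_morphism_def module_morphism_axioms_def)
  show ?thesis
    by (rule module_homI) (auto simp: a_minus_def f.N.smult_r_distr f.N.smult_r_minus
        f.N.M.a_ac f.N.M.minus_add)
qed

lemma module_morphismI:
  "left_module R M \<Longrightarrow> left_module R N \<Longrightarrow> f \<in> module_hom R M N \<Longrightarrow> module_morphism R M N f"
  by (simp add: module_morphism_def module_morphism_axioms_def)


section \<open>Quotients of modules and copies on other types\<close>

definition image_module :: "('m \<Rightarrow> 'n) \<Rightarrow> ('r, 'm) module \<Rightarrow> ('r, 'n) module" where
  "image_module q M =
    \<lparr>carrier = q ` carrier M, mult = undefined, one = undefined, zero = q \<zero>\<^bsub>M\<^esub>,
     add = \<lambda>x y. q (inv_into (carrier M) q x \<oplus>\<^bsub>M\<^esub> inv_into (carrier M) q y),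
     smult = \<lambda>a x. q (a \<odot>\<^bsub>M\<^esub> inv_into (carrier M) q x)\<rparr>"

text \<open>If \<open>q\<close> chooses one element per coset of \<open>H\<close>, this is the
  quotient; if \<open>q\<close> is injective and \<open>H\<close> zero, it is a copy on another
  type. In both cases the representatives found by \<open>inv_into\<close> differ from the given
  ones by elements of \<open>H\<close>, which addition and scalars respect.\<close>

lemma image_module:
  assumes M: "left_module R M" and H: "submodule H R M"
    and q: "\<And>x y. x \<in> carrier M \<Longrightarrow> y \<in> carrier M \<Longrightarrow> q x = q y \<longleftrightarrow> x \<ominus>\<^bsub>M\<^esub> y \<in> H"
  shows "left_module R (image_module q M)" "q \<in> module_hom R M (image_module q M)"
    "q ` carrier M = carrier (image_module q M)" "a_kernel M (image_module q M) q = H"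
proof -
  interpret left_module R M by fact
  note H = submoduleD[OF H]
  let ?N = "image_module q M" and ?i = "inv_into (carrier M) q"
  have i: "?i (q x) \<in> carrier M" "q (?i (q x)) = q x" if "x \<in> carrier M" for x
    using that by (auto intro: inv_into_into f_inv_into_f)
  have i': "?i (q x) \<ominus>\<^bsub>M\<^esub> x \<in> H" if "x \<in> carrier M" for x
    using i[OF that] q that by blast
  have add: "q x \<oplus>\<^bsub>?N\<^esub> q y = q (x \<oplus>\<^bsub>M\<^esub> y)" if xy: "x \<in> carrier M" "y \<in> carrier M" for x y
  proof -
    have "(?i (q x) \<oplus>\<^bsub>M\<^esub> ?i (q y)) \<ominus>\<^bsub>M\<^esub> (x \<oplus>\<^bsub>M\<^esub> y)
      = (?i (q x) \<ominus>\<^bsub>M\<^esub> x) \<oplus>\<^bsub>M\<^esub> (?i (q y) \<ominus>\<^bsub>M\<^esub> y)"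
      using xy i by (simp add: a_minus_def M.minus_add M.a_ac)
    also have "\<dots> \<in> H" using xy i' H by auto
    finally show ?thesis using xy i by (simp add: image_module_def q)
  qed
  have smult: "a \<odot>\<^bsub>?N\<^esub> q x = q (a \<odot>\<^bsub>M\<^esub> x)" if xy: "a \<in> carrier R" "x \<in> carrier M" for a x
  proof -
    have "(a \<odot>\<^bsub>M\<^esub> ?i (q x)) \<ominus>\<^bsub>M\<^esub> (a \<odot>\<^bsub>M\<^esub> x) = a \<odot>\<^bsub>M\<^esub> (?i (q x) \<ominus>\<^bsub>M\<^esub> x)"
      using xy i by (simp add: a_minus_def smult_r_distr smult_r_minus)
    also have "\<dots> \<in> H" using xy i' H by auto
    finally show ?thesis using xy i by (simp add: image_module_def q)
  qed
  have car: "carrier ?N = q ` carrier M" and zero: "\<zero>\<^bsub>?N\<^esub> = q \<zero>\<^bsub>M\<^esub>"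
    by (simp_all add: image_module_def)
  have "abelian_group ?N"
  proof (rule abelian_groupI)
    fix x assume "x \<in> carrier ?N"
    then obtain y where "y \<in> carrier M" "x = q y" by (auto simp: car)
    then show "\<exists>y\<in>carrier ?N. y \<oplus>\<^bsub>?N\<^esub> x = \<zero>\<^bsub>?N\<^esub>"
      by (intro bexI[of _ "q (\<ominus>\<^bsub>M\<^esub> y)"]) (auto simp: car zero add M.l_neg)
  qed (auto simp: car zero add M.a_ac)
  then show "left_module R ?N"
    by (auto intro!: left_module.intro left_module_axioms.intro R.ring_axioms
        simp: car add smult smult_l_distr smult_r_distr smult_assoc)
  show "q \<in> module_hom R M ?N" by (rule module_homI) (auto simp: car add smult)
  show "q ` carrier M = carrier ?N" by (simp add: car)
  show "a_kernel M ?N q = H" using H by (auto simp: a_kernel_iff zero q)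
qed

text \<open>The quotient stays on the type of \<open>M\<close>: its elements are chosen
  representatives instead of cosets. Congruent arguments satisfy the same predicate, so
  \<open>SOME\<close> returns the same representative for them.\<close>

lemma quotient_module_exists:
  fixes M :: "('r, 'm) module"
  assumes "left_module R M" "submodule H R M"
  obtains N :: "('r, 'm) module" and q where "left_module R N" "q \<in> module_hom R M N"
    "q ` carrier M = carrier N" "a_kernel M N q = H"
proof -
  interpret left_module R M by fact
  note H = submoduleD[OF assms(2)]
  define q where "q x = (SOME y. y \<in> carrier M \<and> x \<ominus>\<^bsub>M\<^esub> y \<in> H)" for x
  have sym: "y \<ominus>\<^bsub>M\<^esub> x \<in> H" if "x \<ominus>\<^bsub>M\<^esub> y \<in> H" "x \<in> carrier M" "y \<in> carrier M" for x y
    using H(5)[OF that(1)] that by (simp add: a_minus_def M.minus_add M.a_ac)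
  have trans: "x \<ominus>\<^bsub>M\<^esub> z \<in> H" if "x \<ominus>\<^bsub>M\<^esub> y \<in> H" "y \<ominus>\<^bsub>M\<^esub> z \<in> H"
    "x \<in> carrier M" "y \<in> carrier M" "z \<in> carrier M" for x y z
  proof -
    have "x \<ominus>\<^bsub>M\<^esub> z = (x \<ominus>\<^bsub>M\<^esub> y) \<oplus>\<^bsub>M\<^esub> (y \<ominus>\<^bsub>M\<^esub> z)"
      using that(3-) by (simp add: a_minus_def M.a_assoc M.r_neg1)
    then show ?thesis using that H by simp
  qed
  have "x \<ominus>\<^bsub>M\<^esub> x \<in> H" if "x \<in> carrier M" for x using that H by (simp add: a_minus_def M.r_neg)
  then have qx: "q x \<in> carrier M \<and> x \<ominus>\<^bsub>M\<^esub> q x \<in> H" if "x \<in> carrier M" for x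
    unfolding q_def using that by (metis (mono_tags, lifting) someI_ex)
  have qq: "q x = q y \<longleftrightarrow> x \<ominus>\<^bsub>M\<^esub> y \<in> H" if xy: "x \<in> carrier M" "y \<in> carrier M" for x y
  proof
    assume "q x = q y"
    then show "x \<ominus>\<^bsub>M\<^esub> y \<in> H" using qx[OF xy(1)] qx[OF xy(2)] xy trans[of x "q x" y] sym by auto
  next
    assume "x \<ominus>\<^bsub>M\<^esub> y \<in> H"
    then have "z \<in> carrier M \<and> x \<ominus>\<^bsub>M\<^esub> z \<in> H \<longleftrightarrow> z \<in> carrier M \<and> y \<ominus>\<^bsub>M\<^esub> z \<in> H" for z
      using xy trans sym by blast
    then show "q x = q y" unfolding q_def by simp
  qed
  show ?thesis using image_module[OF assms qq] that by blast
qed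

lemma transport_module:
  assumes M: "left_module R M" and c: "inj_on c (carrier M)"
  shows "left_module R (image_module c M)" "c \<in> module_hom R M (image_module c M)"
    "c ` carrier M = carrier (image_module c M)"
    "inv_into (carrier M) c \<in> module_hom R (image_module c M) M"
proof -
  interpret left_module R M by fact
  have H: "submodule {\<zero>\<^bsub>M\<^esub>} R M" by (rule submoduleI') auto
  have q: "c x = c y \<longleftrightarrow> x \<ominus>\<^bsub>M\<^esub> y \<in> {\<zero>\<^bsub>M\<^esub>}" if "x \<in> carrier M" "y \<in> carrier M" for x y
    using that c by (simp add: M.minus_eq_zero_iff inj_on_eq_iff)
  note * = image_module[OF M H, of c, OF q]
  show "left_module R (image_module c M)" "c \<in> module_hom R M (image_module c M)"
    "c ` carrier M = carrier (image_module c M)" using * by blast+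
  then interpret c: module_morphism R M "image_module c M" c by (auto intro!: module_morphismI M)
  show "inv_into (carrier M) c \<in> module_hom R (image_module c M) M"
    using c by (intro module_homI) (auto simp flip: *(3) c.add c.smult)
qed

section \<open>Free and projective modules\<close>

text \<open>The direct sum of copies of \<open>M\<close> indexed by \<open>S\<close>, not the
  product: supports are finite. Requiring zero outside \<open>S\<close> makes equality of elements
  equality of functions.\<close>

definition power_module :: "'s set \<Rightarrow> ('r, 'm) module \<Rightarrow> ('r, 's \<Rightarrow> 'm) module" where
  "power_module S M =
    \<lparr>carrier = {f. (\<forall>s\<in>S. f s \<in> carrier M) \<and> (\<forall>s. s \<notin> S \<longrightarrow> f s = \<zero>\<^bsub>M\<^esub>) \<and> finite {s. f s \<noteq> \<zero>\<^bsub>M\<^esub>}},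
     mult = undefined, one = undefined, zero = \<lambda>s. \<zero>\<^bsub>M\<^esub>,
     add = \<lambda>f g s. f s \<oplus>\<^bsub>M\<^esub> g s, smult = \<lambda>a f s. a \<odot>\<^bsub>M\<^esub> f s\<rparr>"

lemma power_module_carrier:
  "f \<in> carrier (power_module S M) \<longleftrightarrow>
    (\<forall>s\<in>S. f s \<in> carrier M) \<and> (\<forall>s. s \<notin> S \<longrightarrow> f s = \<zero>\<^bsub>M\<^esub>) \<and> finite {s. f s \<noteq> \<zero>\<^bsub>M\<^esub>}"
  by (simp add: power_module_def)

lemma power_module_simps [simp]:
  "\<zero>\<^bsub>power_module S M\<^esub> = (\<lambda>s. \<zero>\<^bsub>M\<^esub>)"
  "f \<oplus>\<^bsub>power_module S M\<^esub> g = (\<lambda>s. f s \<oplus>\<^bsub>M\<^esub> g s)"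
  "a \<odot>\<^bsub>power_module S M\<^esub> f = (\<lambda>s. a \<odot>\<^bsub>M\<^esub> f s)"
  by (simp_all add: power_module_def)

lemma left_module_power:
  fixes M :: "('r, 'm) module" and S :: "'s set"
  assumes "left_module R M"
  shows "left_module R (power_module S M)"
proof -
  interpret left_module R M by fact
  have mem: "f s \<in> carrier M" if "f \<in> carrier (power_module S M)" for f s
    using that by (cases "s \<in> S") (auto simp: power_module_carrier)
  have fin: "finite {s. f s \<oplus>\<^bsub>M\<^esub> g s \<noteq> \<zero>\<^bsub>M\<^esub>}"
    if "finite {s. f s \<noteq> \<zero>\<^bsub>M\<^esub>}" "finite {s. g s \<noteq> \<zero>\<^bsub>M\<^esub>}" for f g :: "'s \<Rightarrow> 'm"
    by (rule finite_subset[OF _ finite_UnI[OF that]]) auto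
  have fins: "finite {s. a \<odot>\<^bsub>M\<^esub> f s \<noteq> \<zero>\<^bsub>M\<^esub>}"
    if "finite {s. f s \<noteq> \<zero>\<^bsub>M\<^esub>}" "a \<in> carrier R" for f :: "'s \<Rightarrow> 'm" and a
    by (rule finite_subset[OF _ that(1)]) (use that in auto)
  have finm: "finite {s. \<ominus>\<^bsub>M\<^esub> f s \<noteq> \<zero>\<^bsub>M\<^esub>}"
    if "finite {s. f s \<noteq> \<zero>\<^bsub>M\<^esub>}" for f :: "'s \<Rightarrow> 'm"
    by (rule finite_subset[OF _ that(1)]) auto
  have "abelian_group (power_module S M)"
  proof (rule abelian_groupI)
    fix f assume "f \<in> carrier (power_module S M)"
    then show "\<exists>g\<in>carrier (power_module S M). g \<oplus>\<^bsub>power_module S M\<^esub> f = \<zero>\<^bsub>power_module S M\<^esub>"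
      by (intro bexI[of _ "\<lambda>s. \<ominus>\<^bsub>M\<^esub> f s"]) (auto simp: mem M.l_neg power_module_carrier finm)
  qed (auto simp: M.a_ac mem, auto simp: power_module_carrier fin)
  then show ?thesis
    by (auto intro!: left_module.intro left_module_axioms.intro R.ring_axioms
        simp: mem smult_l_distr smult_r_distr smult_assoc, auto simp: power_module_carrier fins)
qed

lemma power_module_mem:
  assumes "left_module R M" "f \<in> carrier (power_module S M)"
  shows "f s \<in> carrier M"
proof -
  interpret left_module R M by fact
  show ?thesis using assms(2) by (cases "s \<in> S") (auto simp: power_module_carrier)
qed

lemma power_module_eval_hom:
  "left_module R M \<Longrightarrow> (\<lambda>f. f s) \<in> module_hom R (power_module S M) M"
  by (rule module_homI) (auto simp: power_module_mem)

lemma power_module_finsum: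
  assumes "left_module R M" "F \<in> A \<rightarrow> carrier (power_module S M)"
  shows "finsum (power_module S M) F A = (\<lambda>s. finsum M (\<lambda>a. F a s) A)"
proof
  fix s
  interpret module_morphism R "power_module S M" M "\<lambda>f. f s"
    using assms by (intro module_morphismI left_module_power power_module_eval_hom)
  show "finsum (power_module S M) F A s = finsum M (\<lambda>a. F a s) A"
    using finsum[OF assms(2)] by simp
qed

definition regular_module :: "'r ring \<Rightarrow> ('r, 'r) module" where
  "regular_module R = ideal_module R (carrier R)"

lemma regular_module_simps [simp]:
  "carrier (regular_module R) = carrier R" "\<zero>\<^bsub>regular_module R\<^esub> = \<zero>\<^bsub>R\<^esub>"
  "x \<oplus>\<^bsub>regular_module R\<^esub> y = x \<oplus>\<^bsub>R\<^esub> y" "a \<odot>\<^bsub>regular_module R\<^esub> x = a \<otimes>\<^bsub>R\<^esub> x"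
  by (simp_all add: regular_module_def ideal_module_def)

lemma left_module_regular:
  assumes "ring R" shows "left_module R (regular_module R)"
proof -
  interpret ring R by fact
  have "abelian_group (regular_module R)"
  proof (rule abelian_groupI)
    fix x assume "x \<in> carrier (regular_module R)"
    then show "\<exists>y\<in>carrier (regular_module R). y \<oplus>\<^bsub>regular_module R\<^esub> x = \<zero>\<^bsub>regular_module R\<^esub>"
      by (intro bexI[of _ "\<ominus>\<^bsub>R\<^esub> x"]) (auto simp: l_neg)
  qed (auto simp: a_ac)
  then show ?thesis
    by (auto intro!: left_module.intro left_module_axioms.intro assms simp: m_assoc l_distr r_distr)
qed

abbreviation free_module :: "'r ring \<Rightarrow> 's set \<Rightarrow> ('r, 's \<Rightarrow> 'r) module" where
  "free_module R S \<equiv> power_module S (regular_module R)"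

lemma left_module_free: "ring R \<Longrightarrow> left_module R (free_module R S)"
  by (intro left_module_power left_module_regular)

definition unit_vector :: "'r ring \<Rightarrow> 's \<Rightarrow> 's \<Rightarrow> 'r" where
  "unit_vector R s = (\<lambda>t. if t = s then \<one>\<^bsub>R\<^esub> else \<zero>\<^bsub>R\<^esub>)"

lemma unit_vector_carrier [simp, intro]:
  assumes "ring R" "s \<in> S" shows "unit_vector R s \<in> carrier (free_module R S)"
proof -
  interpret ring R by fact
  have "finite {t. unit_vector R s t \<noteq> \<zero>\<^bsub>R\<^esub>}"
    by (rule finite_subset[of _ "{s}"]) (auto simp: unit_vector_def)
  then show ?thesis using assms by (auto simp: power_module_carrier) (auto simp: unit_vector_def)
qed

text \<open>The linear map out of the free module with prescribed images \<open>m\<close> of the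
  basis. Summing over the support keeps \<open>S\<close> out of the definition.\<close>

definition lin :: "'r ring \<Rightarrow> ('r, 'm) module \<Rightarrow> ('s \<Rightarrow> 'm) \<Rightarrow> ('s \<Rightarrow> 'r) \<Rightarrow> 'm" where
  "lin R M m f = finsum M (\<lambda>s. f s \<odot>\<^bsub>M\<^esub> m s) {s. f s \<noteq> \<zero>\<^bsub>R\<^esub>}"

lemma lin_eq_finsum:
  assumes "left_module R M" "m \<in> S \<rightarrow> carrier M" "f \<in> carrier (free_module R S)"
    "finite T" "{s. f s \<noteq> \<zero>\<^bsub>R\<^esub>} \<subseteq> T" "T \<subseteq> S"
  shows "lin R M m f = finsum M (\<lambda>s. f s \<odot>\<^bsub>M\<^esub> m s) T"
proof -
  interpret left_module R M by fact
  have [simp]: "m s \<in> carrier M" if "s \<in> T" for s using assms that by auto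
  have [simp]: "f s \<in> carrier R" if "s \<in> T" for s using assms that by (auto simp: power_module_carrier)
  show ?thesis unfolding lin_def
    using assms by (intro M.add.finprod_mono_neutral_cong_left) auto
qed

lemma lin_cong:
  assumes "left_module R M" "m \<in> S \<rightarrow> carrier M" "f \<in> carrier (free_module R S)"
    "\<And>s. s \<in> S \<Longrightarrow> m s = m' s"
  shows "lin R M m f = lin R M m' f"
proof -
  interpret left_module R M by fact
  have "{s. f s \<noteq> \<zero>\<^bsub>R\<^esub>} \<subseteq> S" using assms(3) by (auto simp: power_module_carrier)
  then show ?thesis unfolding lin_def
    using assms by (intro M.finsum_cong') (auto simp: power_module_carrier Pi_iff)
qed

lemma lin_hom:
  fixes m :: "'s \<Rightarrow> 'm"
  assumes "left_module R M" "m \<in> S \<rightarrow> carrier M"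
  shows "lin R M m \<in> module_hom R (free_module R S) M"
proof -
  interpret left_module R M by fact
  interpret F: left_module R "free_module R S" using R.ring_axioms by (rule left_module_free)
  have sub: "{s. f s \<noteq> \<zero>\<^bsub>R\<^esub>} \<subseteq> S" "finite {s. f s \<noteq> \<zero>\<^bsub>R\<^esub>}"
    "\<And>s. s \<in> S \<Longrightarrow> f s \<in> carrier R"
    if "f \<in> carrier (free_module R S)" for f
    using that by (auto simp: power_module_carrier)
  have m: "m s \<in> carrier M" if "s \<in> S" for s using assms that by auto
  show ?thesis
  proof (rule module_homI)
    fix f assume f: "f \<in> carrier (free_module R S)"
    show "lin R M m f \<in> carrier M"
      unfolding lin_def using sub[OF f] m by (intro M.finsum_closed) (auto simp: Pi_iff)
  next
    fix f g assume f: "f \<in> carrier (free_module R S)" and g: "g \<in> carrier (free_module R S)"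
    \<comment> \<open>A finite index set containing the supports of \<open>f\<close>,
      \<open>g\<close> and their sum allows termwise addition.\<close>
    let ?T = "{s. f s \<noteq> \<zero>\<^bsub>R\<^esub>} \<union> {s. g s \<noteq> \<zero>\<^bsub>R\<^esub>}"
    have T: "?T \<subseteq> S" "finite ?T" using sub[OF f] sub[OF g] by auto
    have "{s. (f \<oplus>\<^bsub>free_module R S\<^esub> g) s \<noteq> \<zero>\<^bsub>R\<^esub>} \<subseteq> ?T" by auto
    note eq = lin_eq_finsum[OF assms F.M.a_closed[OF f g] T(2) this T(1)]
      lin_eq_finsum[OF assms f T(2) _ T(1)] lin_eq_finsum[OF assms g T(2) _ T(1)]
    have c: "f s \<in> carrier R" "g s \<in> carrier R" "m s \<in> carrier M" if "s \<in> ?T" for s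
      using sub[OF f] sub[OF g] m T(1) that by blast+
    have "finsum M (\<lambda>s. (f s \<oplus>\<^bsub>R\<^esub> g s) \<odot>\<^bsub>M\<^esub> m s) ?T =
      finsum M (\<lambda>s. f s \<odot>\<^bsub>M\<^esub> m s \<oplus>\<^bsub>M\<^esub> g s \<odot>\<^bsub>M\<^esub> m s) ?T"
      using c by (intro M.finsum_cong') (auto simp: smult_l_distr Pi_iff simp del: Un_iff)
    also have "\<dots> = finsum M (\<lambda>s. f s \<odot>\<^bsub>M\<^esub> m s) ?T \<oplus>\<^bsub>M\<^esub> finsum M (\<lambda>s. g s \<odot>\<^bsub>M\<^esub> m s) ?T"
      using c by (intro M.finsum_addf) (auto simp: Pi_iff simp del: Un_iff)
    finally show "lin R M m (f \<oplus>\<^bsub>free_module R S\<^esub> g) = lin R M m f \<oplus>\<^bsub>M\<^esub> lin R M m g"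
      by (simp only: eq(1) eq(2)[OF Un_upper1] eq(3)[OF Un_upper2])
        (simp only: power_module_simps regular_module_simps)
  next
    fix a f assume a: "a \<in> carrier R" and f: "f \<in> carrier (free_module R S)"
    let ?T = "{s. f s \<noteq> \<zero>\<^bsub>R\<^esub>}"
    have "{s. (a \<odot>\<^bsub>free_module R S\<^esub> f) s \<noteq> \<zero>\<^bsub>R\<^esub>} \<subseteq> ?T" using a by auto
    note eq = lin_eq_finsum[OF assms F.smult_closed[OF a f] sub(2)[OF f] this sub(1)[OF f]]
    have smult_finsum: "a \<odot>\<^bsub>M\<^esub> finsum M h T = finsum M (\<lambda>s. a \<odot>\<^bsub>M\<^esub> h s) T" if "h \<in> T \<rightarrow> carrier M"
      for h and T :: "'s set"
      using that
    proof (induction T rule: infinite_finite_induct)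
      case (insert x F)
      then have "h x \<in> carrier M" "h \<in> F \<rightarrow> carrier M" "(\<lambda>s. a \<odot>\<^bsub>M\<^esub> h s) \<in> F \<rightarrow> carrier M" using a by auto
      then show ?case using insert a by (simp add: smult_r_distr)
    qed (simp_all add: a)
    have "finsum M (\<lambda>s. (a \<otimes>\<^bsub>R\<^esub> f s) \<odot>\<^bsub>M\<^esub> m s) ?T = finsum M (\<lambda>s. a \<odot>\<^bsub>M\<^esub> (f s \<odot>\<^bsub>M\<^esub> m s)) ?T"
      using sub[OF f] m a by (intro M.finsum_cong') (auto simp: smult_assoc Pi_iff)
    also have "\<dots> = a \<odot>\<^bsub>M\<^esub> finsum M (\<lambda>s. f s \<odot>\<^bsub>M\<^esub> m s) ?T"
      using sub[OF f] m by (intro smult_finsum[symmetric]) auto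
    finally show "lin R M m (a \<odot>\<^bsub>free_module R S\<^esub> f) = a \<odot>\<^bsub>M\<^esub> lin R M m f"
      by (simp only: eq) (simp only: power_module_simps regular_module_simps lin_def)
  qed
qed

lemma lin_unit_vector:
  assumes "left_module R M" "m \<in> S \<rightarrow> carrier M" "s \<in> S"
  shows "lin R M m (unit_vector R s) = m s"
proof -
  interpret left_module R M by fact
  have "m s \<in> carrier M" using assms by auto
  moreover have "lin R M m (unit_vector R s) = finsum M (\<lambda>t. unit_vector R s t \<odot>\<^bsub>M\<^esub> m t) {s}"
    by (rule lin_eq_finsum[OF assms(1,2) unit_vector_carrier[OF R.ring_axioms assms(3)]])
      (auto simp: unit_vector_def assms(3))
  ultimately show ?thesis by (simp add: unit_vector_def)
qed

lemma hom_lin: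
  assumes "left_module R M" "left_module R N" "h \<in> module_hom R M N"
    "m \<in> S \<rightarrow> carrier M" "f \<in> carrier (free_module R S)"
  shows "h (lin R M m f) = lin R N (\<lambda>s. h (m s)) f"
proof -
  interpret module_morphism R M N h using assms by (intro module_morphismI)
  have *: "f s \<in> carrier R" "m s \<in> carrier M" if "f s \<noteq> \<zero>\<^bsub>R\<^esub>" for s
    using assms that by (auto simp: power_module_carrier)
  show ?thesis unfolding lin_def
    by (subst finsum) (auto simp: * intro!: N.M.finsum_cong')
qed

lemma lin_unit_vectors:
  assumes "ring R" "f \<in> carrier (free_module R S)"
  shows "lin R (free_module R S) (unit_vector R) f = f"
proof
  fix t
  interpret ring R by fact
  interpret reg: left_module R "regular_module R" by (rule left_module_regular) fact
  have T: "{s. f s \<noteq> \<zero>\<^bsub>R\<^esub>} \<subseteq> S" "finite {s. f s \<noteq> \<zero>\<^bsub>R\<^esub>}"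
    and f: "\<And>s. f s \<in> carrier R"
    using assms(2) power_module_mem[OF left_module_regular assms(2)] assms(1)
    by (auto simp: power_module_carrier)
  have "lin R (free_module R S) (unit_vector R) f t =
      lin R (regular_module R) (\<lambda>s. unit_vector R s t) f"
    using assms(1) by (intro hom_lin[OF _ _ _ _ assms(2), of "free_module R S" "regular_module R" "\<lambda>f. f t"])
      (auto simp: left_module_free left_module_regular power_module_eval_hom)
  also have "\<dots> = finsum (regular_module R) (\<lambda>s. f s \<otimes>\<^bsub>R\<^esub> unit_vector R s t) {s. f s \<noteq> \<zero>\<^bsub>R\<^esub>}"
    by (simp add: lin_def)
  also have "\<dots> = finsum (regular_module R) (\<lambda>s. if t = s then f s else \<zero>\<^bsub>regular_module R\<^esub>) {s. f s \<noteq> \<zero>\<^bsub>R\<^esub>}"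
    using f by (intro reg.M.finsum_cong') (auto simp: unit_vector_def)
  also have "\<dots> = f t"
  proof (cases "f t = \<zero>\<^bsub>R\<^esub>")
    case True
    then have "finsum (regular_module R) (\<lambda>s. if t = s then f s else \<zero>\<^bsub>regular_module R\<^esub>) {s. f s \<noteq> \<zero>\<^bsub>R\<^esub>}
      = finsum (regular_module R) (\<lambda>s. \<zero>\<^bsub>regular_module R\<^esub>) {s. f s \<noteq> \<zero>\<^bsub>R\<^esub>}"
      by (intro reg.M.finsum_cong') auto
    also have "\<dots> = f t" using True reg.M.finsum_zero[of "{s. f s \<noteq> \<zero>\<^bsub>R\<^esub>}"] by simp
    finally show ?thesis .
  next
    case False
    then show ?thesis using f T by (intro reg.M.finsum_singleton) auto
  qed
  finally show "lin R (free_module R S) (unit_vector R) f t = f t" .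
qed

lemma free_module_hom_ext:
  assumes "ring R" "left_module R N" "g \<in> module_hom R (free_module R S) N"
    "h \<in> module_hom R (free_module R S) N"
    "\<And>s. s \<in> S \<Longrightarrow> g (unit_vector R s) = h (unit_vector R s)"
    "f \<in> carrier (free_module R S)"
  shows "g f = h f"
proof -
  have F: "left_module R (free_module R S)" by (rule left_module_free) fact
  have u: "unit_vector R \<in> S \<rightarrow> carrier (free_module R S)" using assms(1) by auto
  interpret g: module_morphism R "free_module R S" N g by (intro module_morphismI F assms)
  have "g f = lin R N (\<lambda>s. g (unit_vector R s)) f"
    using hom_lin[OF F assms(2,3) u assms(6)] by (simp add: lin_unit_vectors assms)
  also have "\<dots> = lin R N (\<lambda>s. h (unit_vector R s)) f"
    by (rule lin_cong[OF assms(2) _ assms(6)]) (use assms in auto)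
  also have "\<dots> = h f"
    using hom_lin[OF F assms(2,4) u assms(6)] by (simp add: lin_unit_vectors assms)
  finally show ?thesis .
qed


text \<open>Projectivity as a splitting of the canonical cover by the free module on all elements of
  \<open>P\<close>. Unlike \<open>projective_module\<close> it does not quantify over test modules,
  so lifts are available against modules on any type.\<close>

definition proj :: "'r ring \<Rightarrow> ('r, 'm) module \<Rightarrow> bool" where
  "proj R P \<longleftrightarrow> left_module R P \<and>
    (\<exists>\<sigma>\<in>module_hom R P (free_module R (carrier P)). \<forall>x\<in>carrier P. lin R P (\<lambda>x. x) (\<sigma> x) = x)"

lemma proj_left_module: "proj R P \<Longrightarrow> left_module R P"
  by (simp add: proj_def)

lemma module_hom_mem: "f \<in> module_hom R M N \<Longrightarrow> x \<in> carrier M \<Longrightarrow> f x \<in> carrier N"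
  by (auto simp: module_hom_def)

text \<open>The elements of \<open>P\<close> are sent to chosen preimages \<open>m\<close> of their
  images under \<open>f\<close>. The linear extension of \<open>m\<close> to the free module on
  \<open>carrier P\<close>, composed with the splitting, is the lift.\<close>

lemma proj_lift:
  assumes P: "proj R P" and M: "left_module R M" "left_module R N"
    and g: "g \<in> module_hom R M N" "g ` carrier M = carrier N" and f: "f \<in> module_hom R P N"
  obtains h where "h \<in> module_hom R P M" "\<And>x. x \<in> carrier P \<Longrightarrow> g (h x) = f x"
proof -
  obtain \<sigma> where s: "\<sigma> \<in> module_hom R P (free_module R (carrier P))"
    "\<And>x. x \<in> carrier P \<Longrightarrow> lin R P (\<lambda>x. x) (\<sigma> x) = x" and P': "left_module R P"
    using P by (auto simp: proj_def)
  have "\<forall>p\<in>carrier P. \<exists>m\<in>carrier M. g m = f p"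
    using g(2) module_hom_mem[OF f] by (metis imageE)
  then obtain m where m: "\<And>p. p \<in> carrier P \<Longrightarrow> m p \<in> carrier M" "\<And>p. p \<in> carrier P \<Longrightarrow> g (m p) = f p"
    by metis
  have mP: "m \<in> carrier P \<rightarrow> carrier M" using m by auto
  show ?thesis
  proof
    show "(\<lambda>x. lin R M m (\<sigma> x)) \<in> module_hom R P M"
      by (rule module_hom_comp[OF s(1) lin_hom[OF M(1) mP]])
    fix x assume x: "x \<in> carrier P"
    note sx = module_hom_mem[OF s(1) x]
    have "g (lin R M m (\<sigma> x)) = lin R N (\<lambda>p. g (m p)) (\<sigma> x)"
      by (rule hom_lin[OF M g(1) mP sx])
    also have "\<dots> = lin R N f (\<sigma> x)"
      by (rule lin_cong[OF M(2) _ sx]) (use m module_hom_mem[OF f] in auto)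
    also have "\<dots> = f (lin R P (\<lambda>x. x) (\<sigma> x))"
      by (rule hom_lin[OF P' M(2) f _ sx, symmetric]) auto
    also have "\<dots> = f x" using s(2) x by simp
    finally show "g (lin R M m (\<sigma> x)) = f x" .
  qed
qed

lemma canonical_cover:
  assumes "left_module R M" "S \<subseteq> carrier M"
  shows "lin R M (\<lambda>x. x) \<in> module_hom R (free_module R S) M"
    "S \<subseteq> lin R M (\<lambda>x. x) ` carrier (free_module R S)"
proof -
  interpret left_module R M by fact
  show "lin R M (\<lambda>x. x) \<in> module_hom R (free_module R S) M"
    by (rule lin_hom) (use assms in auto)
  show "S \<subseteq> lin R M (\<lambda>x. x) ` carrier (free_module R S)"
  proof
    fix s assume "s \<in> S"
    then show "s \<in> lin R M (\<lambda>x. x) ` carrier (free_module R S)"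
      using lin_unit_vector[of R M "\<lambda>x. x" S s] assms R.ring_axioms
      by (intro image_eqI[of _ _ "unit_vector R s"]) (auto simp: subset_iff)
  qed
qed

text \<open>Lifting \<open>b\<close> through the canonical cover of \<open>P\<close> and composing
  with \<open>a\<close> splits that cover.\<close>

lemma proj_retract:
  assumes F: "proj R F" and P: "left_module R P" and a: "a \<in> module_hom R P F"
    and b: "b \<in> module_hom R F P" and ba: "\<And>x. x \<in> carrier P \<Longrightarrow> b (a x) = x"
  shows "proj R P"
proof -
  interpret left_module R P by fact
  let ?G = "free_module R (carrier P)"
  have G: "left_module R ?G" by (rule left_module_free) (rule R.ring_axioms)
  note cc = canonical_cover[OF P order_refl]
  have "lin R P (\<lambda>x. x) ` carrier ?G = carrier P"
    using cc(2) module_hom_mem[OF cc(1)] by auto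
  then obtain h where h: "h \<in> module_hom R F ?G"
    "\<And>x. x \<in> carrier F \<Longrightarrow> lin R P (\<lambda>x. x) (h x) = b x"
    by (rule proj_lift[OF F G P cc(1) _ b]) blast
  show ?thesis unfolding proj_def
    by (intro conjI P bexI[of _ "\<lambda>x. h (a x)"] ballI module_hom_comp[OF a h(1)])
      (simp add: h(2) ba module_hom_mem[OF a])
qed

lemma proj_free:
  assumes "ring R" shows "proj R (free_module R S)"
proof -
  let ?F = "free_module R S" let ?G = "free_module R (carrier ?F)"
  have F: "left_module R ?F" and G: "left_module R ?G" by (intro left_module_free assms)+
  \<comment> \<open>The basis vector of \<open>s\<close> is itself an element of the module, so it
    indexes a basis vector of the larger free module.\<close>
  define \<sigma> where "\<sigma> = lin R ?G (\<lambda>s. unit_vector R (unit_vector R s))"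
  have u: "(\<lambda>s. unit_vector R (unit_vector R s)) \<in> S \<rightarrow> carrier ?G" using assms by auto
  have s: "\<sigma> \<in> module_hom R ?F ?G" unfolding \<sigma>_def by (rule lin_hom[OF G u])
  note cc = canonical_cover[OF F order_refl]
  have "lin R ?F (\<lambda>x. x) (\<sigma> f) = f" if "f \<in> carrier ?F" for f
  proof (rule free_module_hom_ext[OF assms F module_hom_comp[OF s cc(1)] module_hom_ident _ that])
    fix t assume t: "t \<in> S"
    have "\<sigma> (unit_vector R t) = unit_vector R (unit_vector R t)"
      unfolding \<sigma>_def by (rule lin_unit_vector[OF G u t])
    then show "lin R ?F (\<lambda>x. x) (\<sigma> (unit_vector R t)) = unit_vector R t"
      using lin_unit_vector[OF F, of "\<lambda>x. x" "carrier ?F" "unit_vector R t"] t assms by auto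
  qed
  then show ?thesis using s F by (auto simp: proj_def)
qed

section \<open>Projective dimension by syzygies\<close>

text \<open>What a universe type needs: finitely supported functions from \<open>'m\<close> to
  \<open>A\<close> can then be coded in \<open>'m\<close>, so free modules over a ring with carrier
  \<open>A\<close>, on subsets of \<open>'m\<close>, have copies on \<open>'m\<close>.\<close>

definition large :: "'r set \<Rightarrow> 'm itself \<Rightarrow> bool" where
  "large A (_ :: 'm itself) \<longleftrightarrow> infinite (UNIV :: 'm set) \<and> (\<exists>f :: 'r \<Rightarrow> 'm. inj_on f A)"

lemma infinite_pair_injection:
  assumes "infinite (UNIV :: 'm set)"
  obtains p :: "'m \<times> 'm \<Rightarrow> 'm" where "inj p"
proof -
  have "(card_of (UNIV \<times> UNIV :: ('m \<times> 'm) set), card_of (UNIV :: 'm set)) \<in> ordLeq"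
    using card_of_Times_same_infinite[OF assms] by (rule ordIso_imp_ordLeq)
  then have "\<exists>f. inj_on f (UNIV \<times> UNIV :: ('m \<times> 'm) set) \<and> f ` (UNIV \<times> UNIV) \<subseteq> (UNIV :: 'm set)"
    by (simp only: card_of_ordLeq)
  then show ?thesis using that by auto
qed

lemma infinite_list_injection:
  assumes "infinite (UNIV :: 'm set)"
  obtains c :: "'m list \<Rightarrow> 'm" where "inj c"
proof -
  obtain p :: "'m \<times> 'm \<Rightarrow> 'm" where p: "inj p" by (rule infinite_pair_injection[OF assms])
  obtain num :: "nat \<Rightarrow> 'm" where num: "inj num"
    using infinite_countable_subset[OF assms] by blast
  \<comment> \<open>Iterated pairing is injective only among lists of one length, hence the length
    is coded as a separate component below.\<close>
  define body where "body = rec_list undefined (\<lambda>x _ r. p (x, r))"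
  have body: "body (x # xs) = p (x, body xs)" for x xs by (simp add: body_def)
  have inj_body: "xs = ys" if "length xs = length ys" "body xs = body ys" for xs ys
    using that by (induction xs ys rule: list_induct2) (auto simp: body dest: injD[OF p])
  have "inj (\<lambda>xs. p (num (length xs), body xs))"
    by (rule injI) (auto intro!: inj_body dest!: injD[OF p] dest: injD[OF num])
  then show ?thesis by (rule that)
qed

text \<open>A function is coded by its graph over the support, listed in some order. The order is
  lost on passing to the set of the list, and this set determines the function.\<close>

lemma large_finite_support:
  assumes "large A TYPE('m)"
  obtains c :: "('m \<Rightarrow> 'r) \<Rightarrow> 'm"
  where "inj_on c {f. finite {s. f s \<noteq> z} \<and> (\<forall>s. f s \<in> A)}"
proof -
  obtain e :: "'r \<Rightarrow> 'm" where e: "inj_on e A" and inf: "infinite (UNIV :: 'm set)"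
    using assms by (auto simp: large_def)
  obtain p :: "'m \<times> 'm \<Rightarrow> 'm" where p: "inj p" by (rule infinite_pair_injection[OF inf])
  obtain c :: "'m list \<Rightarrow> 'm" where c: "inj c" by (rule infinite_list_injection[OF inf])
  define enum where "enum f = (SOME xs. set xs = {s. f s \<noteq> z})" for f :: "'m \<Rightarrow> 'r"
  have enum: "set (enum f) = {s. f s \<noteq> z}" if "finite {s. f s \<noteq> z}" for f
    unfolding enum_def using finite_list[OF that] by (rule someI_ex)
  define code where "code f = c (map (\<lambda>s. p (s, e (f s))) (enum f))" for f
  have "inj_on code {f. finite {s. f s \<noteq> z} \<and> (\<forall>s. f s \<in> A)}"
  proof (rule inj_onI, clarify)
    fix f g assume f: "finite {s. f s \<noteq> z}" "\<forall>s. f s \<in> A" and g: "finite {s. g s \<noteq> z}" "\<forall>s. g s \<in> A"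
      and "code f = code g"
    then have "map (\<lambda>s. p (s, e (f s))) (enum f) = map (\<lambda>s. p (s, e (g s))) (enum g)"
      unfolding code_def by (intro injD[OF c])
    from arg_cong[OF this, of set]
    have "(\<lambda>s. p (s, e (f s))) ` set (enum f) = (\<lambda>s. p (s, e (g s))) ` set (enum g)"
      by (simp only: list.set_map)
    then have eq: "(\<lambda>s. p (s, e (f s))) ` {s. f s \<noteq> z} = (\<lambda>s. p (s, e (g s))) ` {s. g s \<noteq> z}"
      by (simp only: enum[OF f(1)] enum[OF g(1)])
    have *: "f s = g s" if "f s \<noteq> z" "(\<lambda>s. p (s, e (f s))) ` {s. f s \<noteq> z} = (\<lambda>s. p (s, e (g s))) ` {s. g s \<noteq> z}"
      "\<forall>s. f s \<in> A" "\<forall>s. g s \<in> A" for f g s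
    proof -
      have "p (s, e (f s)) \<in> (\<lambda>s. p (s, e (f s))) ` {s. f s \<noteq> z}" using that(1) by simp
      then have "p (s, e (f s)) \<in> (\<lambda>s. p (s, e (g s))) ` {s. g s \<noteq> z}" unfolding that(2) .
      then obtain t where "p (s, e (f s)) = p (t, e (g t))" by blast
      then have eq: "(s, e (f s)) = (t, e (g t))" by (rule injD[OF p])
      have "t = s" using arg_cong[OF eq, of fst] by simp
      moreover have "e (f s) = e (g t)" using arg_cong[OF eq, of snd] by simp
      ultimately have "e (f s) = e (g s)" by (simp only:)
      then show ?thesis by (rule inj_onD[OF e]) (use that(3,4) in simp_all)
    qed
    show "f = g"
    proof
      fix s
      show "f s = g s"
      proof (cases "f s = z")
        case True
        then show ?thesis using *[of g s f, OF _ eq[symmetric] g(2) f(2)] by (cases "g s = z") auto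
      next
        case False
        then show ?thesis by (rule *[OF _ eq f(2) g(2)])
      qed
    qed
  qed
  then show ?thesis by (rule that)
qed

lemma free_module_copy:
  fixes S :: "'m set"
  assumes "ring R" "large (carrier R) TYPE('m)"
  obtains F :: "('r, 'm) module" and c c' where "proj R F"
    "c \<in> module_hom R (free_module R S) F" "c' \<in> module_hom R F (free_module R S)"
    "\<And>f. f \<in> carrier (free_module R S) \<Longrightarrow> c' (c f) = f" "\<And>x. x \<in> carrier F \<Longrightarrow> c (c' x) = x"
proof -
  have L: "left_module R (free_module R S)" by (rule left_module_free) fact
  obtain c :: "('m \<Rightarrow> 'r) \<Rightarrow> 'm"
    where c: "inj_on c {f. finite {s. f s \<noteq> \<zero>\<^bsub>R\<^esub>} \<and> (\<forall>s. f s \<in> carrier R)}"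
    by (rule large_finite_support[OF assms(2)])
  have inj: "inj_on c (carrier (free_module R S))"
  proof (rule inj_on_subset[OF c], rule subsetI)
    fix f assume f: "f \<in> carrier (free_module R S)"
    have "f s \<in> carrier R" for s
      using power_module_mem[OF left_module_regular[OF assms(1)] f, of s] by simp
    moreover have "finite {s. f s \<noteq> \<zero>\<^bsub>R\<^esub>}" using f by (simp add: power_module_def)
    ultimately show "f \<in> {f. finite {s. f s \<noteq> \<zero>\<^bsub>R\<^esub>} \<and> (\<forall>s. f s \<in> carrier R)}" by simp
  qed
  let ?F = "image_module c (free_module R S)" and ?c = "inv_into (carrier (free_module R S)) c"
  note t = transport_module[OF L inj]
  have 1: "?c (c f) = f" if "f \<in> carrier (free_module R S)" for f using inj that by simp
  have 2: "c (?c x) = x" if "x \<in> carrier ?F" for x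
    using that t(3) by (metis f_inv_into_f)
  have "proj R ?F" by (rule proj_retract[OF proj_free[OF assms(1)] t(1) t(4) t(2)]) (rule 2)
  then show ?thesis by (rule that[OF _ t(2) t(4)]) (rule 1, assumption, rule 2, assumption)
qed

lemma submodule_finsum:
  assumes "left_module R M" "submodule H R M" "f \<in> A \<rightarrow> H"
  shows "finsum M f A \<in> H"
proof -
  interpret left_module R M by fact
  note H = submoduleD[OF assms(2)]
  show ?thesis using assms(3)
  proof (induction A rule: infinite_finite_induct)
    case (insert x F)
    then have 1: "f x \<in> H" "finsum M f F \<in> H" by auto
    have "f \<in> F \<rightarrow> carrier M" "f x \<in> carrier M" using insert.prems H(3) by blast+
    then have "finsum M f (insert x F) = f x \<oplus>\<^bsub>M\<^esub> finsum M f F"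
      using insert.hyps by (intro M.finsum_insert)
    then show ?case using H(4)[OF 1] by simp
  qed (simp_all add: H(2))
qed

lemma lin_in_submodule:
  assumes "left_module R M" "submodule H R M" "m \<in> S \<rightarrow> H" "f \<in> carrier (free_module R S)"
  shows "lin R M m f \<in> H"
proof -
  interpret left_module R M by fact
  show ?thesis unfolding lin_def
  proof (rule submodule_finsum[OF assms(1,2)], rule Pi_I)
    fix s assume "s \<in> {s. f s \<noteq> \<zero>\<^bsub>R\<^esub>}"
    then have "s \<in> S" "f s \<in> carrier R" using assms(4) by (auto simp: power_module_carrier)
    then show "f s \<odot>\<^bsub>M\<^esub> m s \<in> H" using assms(3) submoduleD(7)[OF assms(2)] by blast
  qed
qed

lemma finitely_generatedE:
  assumes "finitely_generated R M"
  obtains S where "finite S" "S \<subseteq> carrier M" "\<And>H. submodule H R M \<Longrightarrow> S \<subseteq> H \<Longrightarrow> H = carrier M"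
proof -
  obtain S where S: "finite S" "S \<subseteq> carrier M"
    and gen: "\<forall>H. submodule H R M \<and> S \<subseteq> H \<longrightarrow> H = carrier M"
    using assms unfolding finitely_generated_def by (elim exE conjE)
  show ?thesis by (rule that[OF S gen[rule_format, OF conjI]])
qed

lemma finitely_generatedI:
  assumes "finite S" "S \<subseteq> carrier M" "\<And>H. submodule H R M \<Longrightarrow> S \<subseteq> H \<Longrightarrow> H = carrier M"
  shows "finitely_generated R M"
  unfolding finitely_generated_def using assms by (intro exI[of _ S]) simp

lemma finitely_generated_iff:
  assumes "left_module R M"
  shows "finitely_generated R M \<longleftrightarrow>
    (\<exists>S. finite S \<and> S \<subseteq> carrier M \<and> lin R M (\<lambda>x. x) ` carrier (free_module R S) = carrier M)"
    (is "_ = ?r")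
proof
  interpret left_module R M by fact
  assume "finitely_generated R M"
  then obtain S where S: "finite S" "S \<subseteq> carrier M" "\<And>H. submodule H R M \<Longrightarrow> S \<subseteq> H \<Longrightarrow> H = carrier M"
    by (elim finitely_generatedE) (rule that)
  note cc = canonical_cover[OF assms S(2)]
  interpret c: module_morphism R "free_module R S" M "lin R M (\<lambda>x. x)"
    by (rule module_morphismI[OF left_module_free[OF R.ring_axioms] assms cc(1)])
  have "lin R M (\<lambda>x. x) ` carrier (free_module R S) = carrier M"
    by (rule S(3)[OF c.submodule_image[OF c.M.submodule_carrier] cc(2)])
  then show ?r using S by blast
next
  interpret left_module R M by fact
  assume ?r
  then obtain S where S: "finite S" "S \<subseteq> carrier M" "lin R M (\<lambda>x. x) ` carrier (free_module R S) = carrier M"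
    by blast
  have "H = carrier M" if H: "submodule H R M" "S \<subseteq> H" for H
  proof -
    have "(\<lambda>x. x) \<in> S \<rightarrow> H" using H(2) by blast
    then have "lin R M (\<lambda>x. x) f \<in> H" if "f \<in> carrier (free_module R S)" for f
      using that by (rule lin_in_submodule[OF assms H(1)])
    then have "carrier M \<subseteq> H" unfolding S(3)[symmetric] by blast
    then show ?thesis using submoduleD(1)[OF H(1)] by blast
  qed
  then show "finitely_generated R M" by (rule finitely_generatedI[OF S(1,2)])
qed

lemma finitely_generated_image:
  assumes "left_module R M" "left_module R N" "g \<in> module_hom R M N" "g ` carrier M = carrier N"
    "finitely_generated R M"
  shows "finitely_generated R N"
proof -
  interpret module_morphism R M N g by (rule module_morphismI) fact+
  obtain S where S: "finite S" "S \<subseteq> carrier M" "\<And>H. submodule H R M \<Longrightarrow> S \<subseteq> H \<Longrightarrow> H = carrier M"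
    using assms(5) by (elim finitely_generatedE) (rule that)
  have "H = carrier N" if H: "submodule H R N" "g ` S \<subseteq> H" for H
  proof -
    have "{x \<in> carrier M. g x \<in> H} = carrier M"
      using H(2) S(2) by (intro S(3)[OF submodule_vimage[OF H(1)]]) blast
    then have "carrier N \<subseteq> H" unfolding assms(4)[symmetric] by blast
    then show ?thesis using N.submoduleD(1)[OF H(1)] by blast
  qed
  then show ?thesis using S(1,2) by (intro finitely_generatedI[of "g ` S"]) auto
qed

lemma finitely_generated_free:
  assumes "ring R" "finite S" shows "finitely_generated R (free_module R S)"
proof -
  have L: "left_module R (free_module R S)" by (rule left_module_free) fact
  interpret left_module R "free_module R S" by fact
  have "H = carrier (free_module R S)" if H: "submodule H R (free_module R S)" "unit_vector R ` S \<subseteq> H" for H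
  proof -
    have "f \<in> H" if "f \<in> carrier (free_module R S)" for f
    proof -
      have "unit_vector R \<in> S \<rightarrow> H" using H(2) by blast
      then have "lin R (free_module R S) (unit_vector R) f \<in> H"
        using that by (rule lin_in_submodule[OF L H(1)])
      then show ?thesis by (simp only: lin_unit_vectors[OF assms(1) that])
    qed
    then show ?thesis using submoduleD(1)[OF H(1)] by blast
  qed
  then show ?thesis using assms by (intro finitely_generatedI[of "unit_vector R ` S"]) auto
qed

text \<open>The free module on a generating set has a copy on \<open>'m\<close>, so covers do not
  leave the universe. The basis \<open>S\<close> and the isomorphisms \<open>c\<close> and
  \<open>c'\<close> are kept so that a free module over another ring on the same basis can be formed
  later.\<close>

lemma free_cover_exists:
  fixes M :: "('r, 'm) module"
  assumes "left_module R M" "large (carrier R) TYPE('m)"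
  obtains F :: "('r, 'm) module" and g S c c' where
    "S \<subseteq> carrier M" "finitely_generated R M \<Longrightarrow> finite S"
    "proj R F" "g \<in> module_hom R F M" "g ` carrier F = carrier M"
    "finitely_generated R M \<Longrightarrow> finitely_generated R F"
    "c \<in> module_hom R (free_module R S) F" "c' \<in> module_hom R F (free_module R S)"
    "\<And>f. f \<in> carrier (free_module R S) \<Longrightarrow> c' (c f) = f" "\<And>x. x \<in> carrier F \<Longrightarrow> c (c' x) = x"
proof -
  interpret left_module R M by fact
  have "\<exists>S. S \<subseteq> carrier M \<and> lin R M (\<lambda>x. x) ` carrier (free_module R S) = carrier M \<and>
      (finitely_generated R M \<longrightarrow> finite S)"
  proof (cases "finitely_generated R M")
    case True
    then obtain S where "finite S" "S \<subseteq> carrier M"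
      "lin R M (\<lambda>x. x) ` carrier (free_module R S) = carrier M"
      unfolding finitely_generated_iff[OF assms(1)] by (elim exE conjE)
    then show ?thesis by (intro exI[of _ S] conjI impI)
  next
    case False
    have "lin R M (\<lambda>x. x) ` carrier (free_module R (carrier M)) \<subseteq> carrier M"
      using module_hom_mem[OF canonical_cover(1)[OF assms(1) order_refl]] by (intro image_subsetI)
    then have "lin R M (\<lambda>x. x) ` carrier (free_module R (carrier M)) = carrier M"
      using canonical_cover(2)[OF assms(1) order_refl] by (rule equalityI)
    then show ?thesis using False by (intro exI[of _ "carrier M"] conjI impI) simp_all
  qed
  then obtain S where S: "S \<subseteq> carrier M" "lin R M (\<lambda>x. x) ` carrier (free_module R S) = carrier M"
    and fin: "finitely_generated R M \<Longrightarrow> finite S"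
    by (elim exE conjE) (rule that; simp)
  obtain F :: "('r, 'm) module" and c c' where F: "proj R F"
    "c \<in> module_hom R (free_module R S) F" "c' \<in> module_hom R F (free_module R S)"
    "\<And>f. f \<in> carrier (free_module R S) \<Longrightarrow> c' (c f) = f" "\<And>x. x \<in> carrier F \<Longrightarrow> c (c' x) = x"
    by (rule free_module_copy[OF R.ring_axioms assms(2), of S]) (rule that)
  have c'c: "c' ` carrier F = carrier (free_module R S)" "c ` carrier (free_module R S) = carrier F"
  proof -
    show "c' ` carrier F = carrier (free_module R S)"
      using F(4) module_hom_mem[OF F(2)] module_hom_mem[OF F(3)] by (intro equalityI subsetI) (blast, metis imageI)
    show "c ` carrier (free_module R S) = carrier F"
      using F(5) module_hom_mem[OF F(2)] module_hom_mem[OF F(3)] by (intro equalityI subsetI) (blast, metis imageI)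
  qed
  show ?thesis
  proof (rule that)
    show "S \<subseteq> carrier M" by (rule S(1))
    show "finite S" if "finitely_generated R M" using that by (rule fin)
    show "proj R F" "c \<in> module_hom R (free_module R S) F" "c' \<in> module_hom R F (free_module R S)"
      by (rule F(1-3))+
    show "finitely_generated R F" if "finitely_generated R M"
      by (rule finitely_generated_image[OF left_module_free[OF R.ring_axioms] proj_left_module[OF F(1)]
        F(2) c'c(2) finitely_generated_free[OF R.ring_axioms fin[OF that]]])
    show "(\<lambda>x. lin R M (\<lambda>x. x) (c' x)) ` carrier F = carrier M"
      using S(2) c'c(1) by (metis image_image)
    show "(\<lambda>x. lin R M (\<lambda>x. x) (c' x)) \<in> module_hom R F M"
      by (rule module_hom_comp[OF F(3) canonical_cover(1)[OF assms(1) S(1)]])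
    show "c' (c f) = f" if "f \<in> carrier (free_module R S)" for f using that by (rule F(4))
    show "c (c' x) = x" if "x \<in> carrier F" for x using that by (rule F(5))
  qed
qed

text \<open>Testing on modules over \<open>'m\<close> is enough because the free cover of
  \<open>P\<close> is one of them: the identity of \<open>P\<close> lifts to it.\<close>

lemma projective_module_imp_proj:
  fixes P :: "('r, 'm) module"
  assumes "large (carrier R) TYPE('m)" "projective_module R P"
  shows "proj R P"
proof -
  have P: "left_module R P"
    "\<And>(M :: ('r, 'm) module) (N :: ('r, 'm) module) g f. left_module R M \<Longrightarrow> left_module R N \<Longrightarrow>
       g \<in> module_hom R M N \<Longrightarrow> f \<in> module_hom R P N \<Longrightarrow> g ` carrier M = carrier N \<Longrightarrow>
       \<exists>h\<in>module_hom R P M. \<forall>x\<in>carrier P. g (h x) = f x"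
    using assms(2) unfolding projective_module_def by blast+
  obtain F :: "('r, 'm) module" and g where F: "proj R F" "g \<in> module_hom R F P" "g ` carrier F = carrier P"
    by (rule free_cover_exists[OF P(1) assms(1)]) (rule that)
  have "\<exists>h\<in>module_hom R P F. \<forall>x\<in>carrier P. g (h x) = x"
    by (rule P(2)[OF proj_left_module[OF F(1)] P(1) F(2) module_hom_ident F(3)])
  then obtain h where h: "h \<in> module_hom R P F" "\<forall>x\<in>carrier P. g (h x) = x" by (rule bexE)
  show ?thesis by (rule proj_retract[OF F(1) P(1) h(1) F(2)]) (rule h(2)[rule_format])
qed

lemma proj_imp_projective_module:
  assumes "proj R P"
  shows "projective_module R P"
  unfolding projective_module_def
proof (intro conjI allI impI ballI)
  show "left_module R P" by (rule proj_left_module) fact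
  fix M N g f
  assume *: "left_module R M" "left_module R N" "g \<in> module_hom R M N" "f \<in> module_hom R P N"
    "g ` carrier M = carrier N"
  obtain h where "h \<in> module_hom R P M" "\<And>x. x \<in> carrier P \<Longrightarrow> g (h x) = f x"
    by (rule proj_lift[OF assms *(1-3) *(5) *(4)]) (rule that)
  then show "\<exists>h\<in>module_hom R P M. \<forall>x\<in>carrier P. g (h x) = f x" by (intro bexI[of _ h] ballI)
qed

text \<open>Projective dimension at most n, asking for one suitable cover at each stage. That every
  cover will do is \<open>schanuel\<close>.\<close>

primrec pdle :: "nat \<Rightarrow> 'r ring \<Rightarrow> ('r, 'm) module \<Rightarrow> bool" where
  "pdle 0 R M \<longleftrightarrow> proj R M"
| "pdle (Suc n) R M \<longleftrightarrow> left_module R M \<and>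
    (\<exists>P g. proj R P \<and> g \<in> module_hom R P M \<and> g ` carrier P = carrier M \<and>
      pdle n R (P\<lparr>carrier := a_kernel P M g\<rparr>))"

lemma pdle_left_module: "pdle n R M \<Longrightarrow> left_module R M"
  by (cases n) (auto simp: proj_left_module)

lemma proj_zero:
  assumes "left_module R M" "carrier M = {\<zero>\<^bsub>M\<^esub>}" shows "proj R M"
proof -
  interpret left_module R M by fact
  have F: "proj R (free_module R {})" by (rule proj_free) (rule R.ring_axioms)
  interpret F: left_module R "free_module R {}" using F by (rule proj_left_module)
  show ?thesis
    by (rule proj_retract[OF F assms(1), of "\<lambda>_. \<zero>\<^bsub>free_module R {}\<^esub>" "\<lambda>_. \<zero>\<^bsub>M\<^esub>"])
      (auto simp: assms(2) intro!: module_homI simp del: power_module_simps)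
qed

lemma left_module_kernel:
  assumes "left_module R M" "left_module R N" "f \<in> module_hom R M N"
  shows "left_module R (M\<lparr>carrier := a_kernel M N f\<rparr>)" "submodule (a_kernel M N f) R M"
proof -
  interpret module_morphism R M N f by (intro module_morphismI assms)
  show "submodule (a_kernel M N f) R M" by (rule submodule_kernel)
  then show "left_module R (M\<lparr>carrier := a_kernel M N f\<rparr>)" by (rule M.left_module_submodule)
qed

lemma pdle_Suc:
  fixes M :: "('r, 'm) module"
  shows "pdle n R M \<Longrightarrow> pdle (Suc n) R M"
proof (induction n arbitrary: M)
  case 0
  then have P: "proj R M" by simp
  interpret left_module R M by (rule proj_left_module[OF P])
  have "proj R (M\<lparr>carrier := a_kernel M M (\<lambda>x. x)\<rparr>)"
    by (rule proj_zero[OF left_module_kernel(1)])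
      (use proj_left_module[OF P] in \<open>auto simp: module_hom_ident a_kernel_iff\<close>)
  then show ?case using P proj_left_module[OF P] module_hom_ident[of R M]
    by (auto intro!: exI[of _ M] exI[of _ "\<lambda>x. x"])
next
  case (Suc n)
  obtain P :: "('r, 'm) module" and g where P: "proj R P" "g \<in> module_hom R P M" "g ` carrier P = carrier M"
    "pdle n R (P\<lparr>carrier := a_kernel P M g\<rparr>)" and M: "left_module R M"
    using Suc.prems unfolding pdle.simps(2) by (elim conjE exE) (rule that)
  show ?case unfolding pdle.simps(2)[of "Suc n"]
    by (intro conjI exI[of _ P] exI[of _ g] M P(1-3) Suc.IH[OF P(4)])
qed

lemma pdle_mono: "m \<le> n \<Longrightarrow> pdle m R M \<Longrightarrow> pdle n R M"
  by (induction n rule: dec_induct) (auto simp del: pdle.simps intro: pdle_Suc)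

section \<open>Retracts along a ring retraction\<close>

definition restrict_scalars :: "('r \<Rightarrow> 'r) \<Rightarrow> ('r, 'm) module \<Rightarrow> ('r, 'm) module" where
  "restrict_scalars h M = M\<lparr>smult := \<lambda>a x. h a \<odot>\<^bsub>M\<^esub> x\<rparr>"

lemma restrict_scalars_simps [simp]:
  "carrier (restrict_scalars h M) = carrier M" "\<zero>\<^bsub>restrict_scalars h M\<^esub> = \<zero>\<^bsub>M\<^esub>"
  "x \<oplus>\<^bsub>restrict_scalars h M\<^esub> y = x \<oplus>\<^bsub>M\<^esub> y" "a \<odot>\<^bsub>restrict_scalars h M\<^esub> x = h a \<odot>\<^bsub>M\<^esub> x"
  "(restrict_scalars h M)\<lparr>carrier := H\<rparr> = restrict_scalars h (M\<lparr>carrier := H\<rparr>)"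
  by (simp_all add: restrict_scalars_def)

lemma a_kernel_restrict_scalars [simp]:
  "a_kernel (restrict_scalars h M) N f = a_kernel M N f"
  "a_kernel M (restrict_scalars h N) f = a_kernel M N f"
  by (simp_all add: a_kernel_def')

lemma restrict_scalars_id: "restrict_scalars (\<lambda>x. x) M = M"
  by (simp add: restrict_scalars_def)

lemma left_module_restrict_scalars:
  assumes "ring R" "h \<in> ring_hom R S" "left_module S M"
  shows "left_module R (restrict_scalars h M)"
proof -
  interpret R: ring R by fact
  interpret M: left_module S M by fact
  have "abelian_group (restrict_scalars h M)"
  proof (rule abelian_groupI)
    fix x assume "x \<in> carrier (restrict_scalars h M)"
    then show "\<exists>y\<in>carrier (restrict_scalars h M). y \<oplus>\<^bsub>restrict_scalars h M\<^esub> x = \<zero>\<^bsub>restrict_scalars h M\<^esub>"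
      by (intro bexI[of _ "\<ominus>\<^bsub>M\<^esub> x"]) (auto simp: M.M.l_neg)
  qed (auto simp: M.M.a_ac)
  then show ?thesis
    using ring_hom_closed[OF assms(2)] ring_hom_add[OF assms(2)] ring_hom_mult[OF assms(2)]
      ring_hom_one[OF assms(2)]
    by (intro left_module.intro left_module_axioms.intro assms(1))
      (simp_all add: M.smult_l_distr M.smult_r_distr M.smult_assoc)
qed

lemma module_hom_restrict_scalars:
  assumes "f \<in> module_hom S M N" "h \<in> ring_hom R S"
  shows "f \<in> module_hom R (restrict_scalars h M) (restrict_scalars h N)"
  using assms(1) ring_hom_closed[OF assms(2)] by (simp add: module_hom_def)

text \<open>\<Gamma> is at the same time a subring and a quotient of \<Lambda>, so modules can be
  restricted along \<open>i\<close> and inflated along \<pi>. With both maps the identity the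
  results below become statements on modules over one ring.\<close>

locale ring_retraction =
  fixes \<Gamma> \<Lambda> :: "'r ring" and i \<pi>
  assumes ring_\<Gamma>: "ring \<Gamma>" and ring_\<Lambda>: "ring \<Lambda>"
    and i_hom: "i \<in> ring_hom \<Gamma> \<Lambda>" and \<pi>_hom: "\<pi> \<in> ring_hom \<Lambda> \<Gamma>"
    and \<pi>_i: "\<And>x. x \<in> carrier \<Gamma> \<Longrightarrow> \<pi> (i x) = x"
begin

lemma module_hom_descend:
  assumes "f \<in> module_hom \<Lambda> N (restrict_scalars \<pi> M)"
  shows "f \<in> module_hom \<Gamma> (restrict_scalars i N) M"
  using assms ring_hom_closed[OF i_hom] by (simp add: module_hom_def \<pi>_i)

text \<open>The identity of \<open>M\<close> is \<open>b \<circ> a\<close> up to a map factoring through a projective module, as in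
  the stable module category. Only this weak form passes from \<open>M\<close> and \<open>N\<close> to their syzygies.\<close>

definition stable_retract ::
  "('r, 'm) module \<Rightarrow> ('r, 'n) module \<Rightarrow> ('m \<Rightarrow> 'n) \<Rightarrow> ('n \<Rightarrow> 'm) \<Rightarrow>
    ('r, 'm) module \<Rightarrow> ('m \<Rightarrow> 'm) \<Rightarrow> ('m \<Rightarrow> 'm) \<Rightarrow> bool" where
  "stable_retract M N a b V u v \<longleftrightarrow>
    left_module \<Gamma> M \<and> left_module \<Lambda> N \<and> a \<in> module_hom \<Gamma> M (restrict_scalars i N) \<and>
    b \<in> module_hom \<Lambda> N (restrict_scalars \<pi> M) \<and> proj \<Gamma> V \<and> u \<in> module_hom \<Gamma> M V \<and>
    v \<in> module_hom \<Gamma> V M \<and> (\<forall>x\<in>carrier M. b (a x) \<oplus>\<^bsub>M\<^esub> v (u x) = x)"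

text \<open>Projectivity of \<open>N\<close> lifts \<open>b\<close>, and projectivity of
  \<open>V\<close> lifts \<open>v\<close>, both through the cover \<open>p\<close>. The sum of the
  composites b' a and v' u is then a section of \<open>p\<close>.\<close>

lemma stable_retract_proj:
  assumes S: "stable_retract M N a b V u v" and N: "proj \<Lambda> N"
    and Q: "proj \<Gamma> Q" "p \<in> module_hom \<Gamma> Q M" "p ` carrier Q = carrier M"
  shows "proj \<Gamma> M"
proof -
  have M: "left_module \<Gamma> M" and a: "a \<in> module_hom \<Gamma> M (restrict_scalars i N)"
    and b: "b \<in> module_hom \<Lambda> N (restrict_scalars \<pi> M)" and V: "proj \<Gamma> V"
    and u: "u \<in> module_hom \<Gamma> M V" and v: "v \<in> module_hom \<Gamma> V M"
    and eq: "\<And>x. x \<in> carrier M \<Longrightarrow> b (a x) \<oplus>\<^bsub>M\<^esub> v (u x) = x"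
    using S unfolding stable_retract_def by blast+
  note QL = proj_left_module[OF Q(1)]
  obtain b' where b': "b' \<in> module_hom \<Lambda> N (restrict_scalars \<pi> Q)"
    "\<And>x. x \<in> carrier N \<Longrightarrow> p (b' x) = b x"
    by (rule proj_lift[OF N left_module_restrict_scalars[OF ring_\<Lambda> \<pi>_hom QL]
      left_module_restrict_scalars[OF ring_\<Lambda> \<pi>_hom M]
      module_hom_restrict_scalars[OF Q(2) \<pi>_hom] _ b]) (simp add: Q(3), rule that)
  obtain v' where v': "v' \<in> module_hom \<Gamma> V Q" "\<And>x. x \<in> carrier V \<Longrightarrow> p (v' x) = v x"
    by (rule proj_lift[OF V QL M Q(2,3) v]) (rule that)
  define s where "s x = b' (a x) \<oplus>\<^bsub>Q\<^esub> v' (u x)" for x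
  have ba: "(\<lambda>x. b' (a x)) \<in> module_hom \<Gamma> M Q"
    by (rule module_hom_comp[OF a module_hom_descend[OF b'(1)]])
  have vu: "(\<lambda>x. v' (u x)) \<in> module_hom \<Gamma> M Q"
    by (rule module_hom_comp[OF u v'(1)])
  have s: "s \<in> module_hom \<Gamma> M Q"
    unfolding s_def by (rule module_hom_add[OF M QL ba vu])
  interpret p: module_morphism \<Gamma> Q M p by (rule module_morphismI[OF QL M Q(2)])
  have "p (s x) = x" if x: "x \<in> carrier M" for x
  proof -
    have "p (s x) = p (b' (a x)) \<oplus>\<^bsub>M\<^esub> p (v' (u x))"
      unfolding s_def by (rule p.add[OF module_hom_mem[OF ba x] module_hom_mem[OF vu x]])
    also have "\<dots> = b (a x) \<oplus>\<^bsub>M\<^esub> v (u x)"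
      using b'(2) v'(2) module_hom_mem[OF a x] module_hom_mem[OF u x] by simp
    finally show ?thesis using eq[OF x] by simp
  qed
  then show ?thesis by (rule proj_retract[OF Q(1) M s Q(2)])
qed

text \<open>The maps \<open>a\<close> and \<open>b\<close> lift to the covers and restrict to the
  kernels. On \<open>Q\<close> the map s = 1 - b'a' - v'up lands in the kernel of \<open>p\<close>,
  because 1 = ba + vu on \<open>M\<close>. On that kernel the term v'up vanishes, so b'a' + s is the
  identity there, and the new correction factors through \<open>Q\<close>.\<close>

lemma stable_retract_kernel:
  assumes S: "stable_retract M N a b V u v"
    and Q: "proj \<Gamma> Q" "p \<in> module_hom \<Gamma> Q M" "p ` carrier Q = carrier M"
    and P: "proj \<Lambda> P" "q \<in> module_hom \<Lambda> P N" "q ` carrier P = carrier N"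
  obtains a' b' s where
    "stable_retract (Q\<lparr>carrier := a_kernel Q M p\<rparr>) (P\<lparr>carrier := a_kernel P N q\<rparr>) a' b' Q (\<lambda>x. x) s"
proof -
  have M: "left_module \<Gamma> M" and N: "left_module \<Lambda> N" and a: "a \<in> module_hom \<Gamma> M (restrict_scalars i N)"
    and b: "b \<in> module_hom \<Lambda> N (restrict_scalars \<pi> M)" and V: "proj \<Gamma> V"
    and u: "u \<in> module_hom \<Gamma> M V" and v: "v \<in> module_hom \<Gamma> V M"
    and eq: "\<And>x. x \<in> carrier M \<Longrightarrow> b (a x) \<oplus>\<^bsub>M\<^esub> v (u x) = x"
    using S unfolding stable_retract_def by blast+
  note QL = proj_left_module[OF Q(1)] and PL = proj_left_module[OF P(1)]
  note Ni = left_module_restrict_scalars[OF ring_\<Gamma> i_hom N]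
  obtain a' where a': "a' \<in> module_hom \<Gamma> Q (restrict_scalars i P)"
    "\<And>x. x \<in> carrier Q \<Longrightarrow> q (a' x) = a (p x)"
    by (rule proj_lift[OF Q(1) left_module_restrict_scalars[OF ring_\<Gamma> i_hom PL] Ni
      module_hom_restrict_scalars[OF P(2) i_hom] _ module_hom_comp[OF Q(2) a]]) (simp add: P(3), rule that)
  obtain b' where b': "b' \<in> module_hom \<Lambda> P (restrict_scalars \<pi> Q)"
    "\<And>x. x \<in> carrier P \<Longrightarrow> p (b' x) = b (q x)"
    by (rule proj_lift[OF P(1) left_module_restrict_scalars[OF ring_\<Lambda> \<pi>_hom QL]
      left_module_restrict_scalars[OF ring_\<Lambda> \<pi>_hom M]
      module_hom_restrict_scalars[OF Q(2) \<pi>_hom] _ module_hom_comp[OF P(2) b]]) (simp add: Q(3), rule that)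
  obtain v' where v': "v' \<in> module_hom \<Gamma> V Q" "\<And>x. x \<in> carrier V \<Longrightarrow> p (v' x) = v x"
    by (rule proj_lift[OF V QL M Q(2,3) v]) (rule that)
  let ?K = "a_kernel Q M p" and ?L = "a_kernel P N q"
  interpret p: module_morphism \<Gamma> Q M p by (rule module_morphismI[OF QL M Q(2)])
  interpret q: module_morphism \<Lambda> P N q by (rule module_morphismI[OF PL N P(2)])
  interpret a: module_morphism \<Gamma> M "restrict_scalars i N" a by (rule module_morphismI[OF M Ni a])
  interpret b: module_morphism \<Gamma> "restrict_scalars i N" M b
    by (rule module_morphismI[OF Ni M module_hom_descend[OF b]])
  have ba: "(\<lambda>x. b' (a' x)) \<in> module_hom \<Gamma> Q Q"
    by (rule module_hom_comp[OF a'(1) module_hom_descend[OF b'(1)]])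
  have up: "(\<lambda>x. u (p x)) \<in> module_hom \<Gamma> Q V"
    by (rule module_hom_comp[OF Q(2) u])
  have vup: "(\<lambda>x. v' (u (p x))) \<in> module_hom \<Gamma> Q Q"
    by (rule module_hom_comp[OF up v'(1)])
  define s where "s x = x \<ominus>\<^bsub>Q\<^esub> (b' (a' x) \<oplus>\<^bsub>Q\<^esub> v' (u (p x)))" for x
  have s: "s \<in> module_hom \<Gamma> Q Q"
    unfolding s_def by (intro module_hom_minus module_hom_add module_hom_ident QL ba vup)
  have s_K: "s x \<in> ?K" if x: "x \<in> carrier Q" for x
  proof -
    have "p (s x) = p x \<ominus>\<^bsub>M\<^esub> (p (b' (a' x)) \<oplus>\<^bsub>M\<^esub> p (v' (u (p x))))"
      unfolding s_def using x module_hom_mem[OF ba x] module_hom_mem[OF vup x] by simp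
    also have "\<dots> = p x \<ominus>\<^bsub>M\<^esub> (b (a (p x)) \<oplus>\<^bsub>M\<^esub> v (u (p x)))"
      using a'(2)[OF x] b'(2) v'(2) module_hom_mem[OF a'(1) x] module_hom_mem[OF up x] by simp
    also have "\<dots> = \<zero>\<^bsub>M\<^esub>" using eq[OF p.closed[OF x]] p.closed[OF x]
      by (simp add: p.N.M.minus_eq_zero_iff)
    finally show ?thesis using module_hom_mem[OF s x] by (simp add: a_kernel_iff)
  qed
  have a'_L: "a' x \<in> ?L" if "x \<in> ?K" for x
    using that a'(2)[of x] module_hom_mem[OF a'(1), of x] a.zero by (simp add: a_kernel_iff)
  have b'_K: "b' x \<in> ?K" if "x \<in> ?L" for x
    using that b'(2)[of x] module_hom_mem[OF b'(1), of x] b.zero by (simp add: a_kernel_iff)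
  have K: "?K \<subseteq> carrier Q" and L: "?L \<subseteq> carrier P" by (auto simp: a_kernel_iff)
  have "stable_retract (Q\<lparr>carrier := ?K\<rparr>) (P\<lparr>carrier := ?L\<rparr>) a' b' Q (\<lambda>x. x) s"
    unfolding stable_retract_def
  proof (intro conjI ballI)
    show "left_module \<Gamma> (Q\<lparr>carrier := ?K\<rparr>)" by (rule p.M.left_module_submodule[OF p.submodule_kernel])
    show "left_module \<Lambda> (P\<lparr>carrier := ?L\<rparr>)" by (rule q.M.left_module_submodule[OF q.submodule_kernel])
    show "a' \<in> module_hom \<Gamma> (Q\<lparr>carrier := ?K\<rparr>) (restrict_scalars i (P\<lparr>carrier := ?L\<rparr>))"
      using module_hom_into_submodule[OF module_hom_restrict[OF a'(1) K], of ?L] a'_L by simp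
    show "b' \<in> module_hom \<Lambda> (P\<lparr>carrier := ?L\<rparr>) (restrict_scalars \<pi> (Q\<lparr>carrier := ?K\<rparr>))"
      using module_hom_into_submodule[OF module_hom_restrict[OF b'(1) L], of ?K] b'_K by simp
    show "proj \<Gamma> Q" by fact
    show "(\<lambda>x. x) \<in> module_hom \<Gamma> (Q\<lparr>carrier := ?K\<rparr>) Q" by (rule inclusion_hom[OF K])
    show "s \<in> module_hom \<Gamma> Q (Q\<lparr>carrier := ?K\<rparr>)" by (rule module_hom_into_submodule[OF s s_K])
    fix x assume "x \<in> carrier (Q\<lparr>carrier := ?K\<rparr>)"
    then have x: "x \<in> carrier Q" "p x = \<zero>\<^bsub>M\<^esub>" by (auto simp: a_kernel_iff)
    have vu0: "v' (u (p x)) = \<zero>\<^bsub>Q\<^esub>"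
    proof -
      interpret vu: module_morphism \<Gamma> Q Q "\<lambda>x. v' (u (p x))" by (rule module_morphismI[OF QL QL vup])
      show ?thesis using vu.zero x(2) by simp
    qed
    have c: "b' (a' x) \<in> carrier Q" by (rule module_hom_mem[OF ba x(1)])
    show "b' (a' x) \<oplus>\<^bsub>Q\<lparr>carrier := ?K\<rparr>\<^esub> s x = x"
      unfolding s_def vu0 using x(1) c
      by (simp add: a_minus_def p.M.M.a_lcomm[of _ x] p.M.M.r_neg)
  qed
  then show ?thesis by (rule that)
qed

theorem pdle_stable_retract:
  fixes M V :: "('r, 'm) module" and N :: "('r, 'n) module"
  assumes "large (carrier \<Gamma>) TYPE('m)" "stable_retract M N a b V u v" "pdle n \<Lambda> N"
  shows "pdle n \<Gamma> M"
  using assms(2,3)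
proof (induction n arbitrary: M N a b V u v)
  case 0
  have "left_module \<Gamma> M" using "0.prems"(1) unfolding stable_retract_def by blast
  then obtain Q :: "('r, 'm) module" and p where Q: "proj \<Gamma> Q" "p \<in> module_hom \<Gamma> Q M" "p ` carrier Q = carrier M"
    by (rule free_cover_exists[OF _ assms(1)]) (rule that)
  show ?case using stable_retract_proj[OF "0.prems"(1) _ Q] "0.prems"(2) by simp
next
  case (Suc n)
  have M: "left_module \<Gamma> M" using Suc.prems(1) unfolding stable_retract_def by blast
  then obtain Q :: "('r, 'm) module" and p where Q: "proj \<Gamma> Q" "p \<in> module_hom \<Gamma> Q M" "p ` carrier Q = carrier M"
    by (rule free_cover_exists[OF _ assms(1)]) (rule that)
  obtain P :: "('r, 'n) module" and q where P: "proj \<Lambda> P" "q \<in> module_hom \<Lambda> P N" "q ` carrier P = carrier N"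
    "pdle n \<Lambda> (P\<lparr>carrier := a_kernel P N q\<rparr>)"
    using Suc.prems(2) unfolding pdle.simps(2) by (elim conjE exE) (rule that)
  obtain a' b' s where *:
    "stable_retract (Q\<lparr>carrier := a_kernel Q M p\<rparr>) (P\<lparr>carrier := a_kernel P N q\<rparr>) a' b' Q (\<lambda>x. x) s"
    by (rule stable_retract_kernel[OF Suc.prems(1) Q P(1-3)]) (rule that)
  show ?case unfolding pdle.simps(2)
    by (intro conjI exI[of _ Q] exI[of _ p] M Q Suc.IH[OF * P(4)])
qed

text \<open>An honest retract is a stable one with zero correction; the free module on the empty set
  supplies a projective module for it to pass through.\<close>

theorem pdle_retract:
  fixes M :: "('r, 'm) module" and N :: "('r, 'n) module"
  assumes large: "large (carrier \<Gamma>) TYPE('m)" and M: "left_module \<Gamma> M"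
    and a: "a \<in> module_hom \<Gamma> M (restrict_scalars i N)"
    and b: "b \<in> module_hom \<Lambda> N (restrict_scalars \<pi> M)"
    and ba: "\<And>x. x \<in> carrier M \<Longrightarrow> b (a x) = x" and N: "pdle n \<Lambda> N"
  shows "pdle n \<Gamma> M"
proof -
  obtain V :: "('r, 'm) module" and c c' where V: "proj \<Gamma> V"
    by (rule free_module_copy[OF ring_\<Gamma> large, of "{}"]) (rule that)
  interpret M: left_module \<Gamma> M by fact
  interpret V: left_module \<Gamma> V by (rule proj_left_module[OF V])
  have "stable_retract M N a b V (\<lambda>_. \<zero>\<^bsub>V\<^esub>) (\<lambda>_. \<zero>\<^bsub>M\<^esub>)"
    unfolding stable_retract_def
    by (intro conjI M pdle_left_module[OF N] a b V ballI module_homI) (auto simp: ba)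
  then show ?thesis by (rule pdle_stable_retract[OF large _ N])
qed

end

lemma ring_retraction_id: "ring R \<Longrightarrow> ring_retraction R R (\<lambda>x. x) (\<lambda>x. x)"
  by (simp add: ring_retraction_def ring_hom_def)

lemma pdle_module_retract:
  fixes M :: "('r, 'm) module" and N :: "('r, 'n) module"
  assumes "large (carrier R) TYPE('m)" "left_module R M"
    "a \<in> module_hom R M N" "b \<in> module_hom R N M"
    "\<And>x. x \<in> carrier M \<Longrightarrow> b (a x) = x" "pdle n R N"
  shows "pdle n R M"
proof -
  interpret left_module R M by fact
  interpret ring_retraction R R "\<lambda>x. x" "\<lambda>x. x" by (rule ring_retraction_id) (rule R.ring_axioms)
  show ?thesis using pdle_retract[of M a N b n] assms by (simp add: restrict_scalars_id)
qed

text \<open>\<open>M\<close> is a stable retract of itself, so the kernel of one cover of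
  \<open>M\<close> is a stable retract of the kernel of any other. This takes the place of the
  isomorphism between the two kernels, each enlarged by the other projective module.\<close>

theorem schanuel:
  fixes M Q :: "('r, 'm) module"
  assumes "large (carrier R) TYPE('m)" "pdle (Suc n) R M"
    "proj R Q" "p \<in> module_hom R Q M" "p ` carrier Q = carrier M"
  shows "pdle n R (Q\<lparr>carrier := a_kernel Q M p\<rparr>)"
proof -
  obtain P :: "('r, 'm) module" and q where P: "proj R P" "q \<in> module_hom R P M" "q ` carrier P = carrier M"
    "pdle n R (P\<lparr>carrier := a_kernel P M q\<rparr>)" and M: "left_module R M"
    using assms(2) unfolding pdle.simps(2) by (elim conjE exE) (rule that)
  interpret left_module R M by fact
  interpret Q: left_module R Q by (rule proj_left_module) fact
  interpret ring_retraction R R "\<lambda>x. x" "\<lambda>x. x" by (rule ring_retraction_id) (rule R.ring_axioms)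
  have "stable_retract M M (\<lambda>x. x) (\<lambda>x. x) Q (\<lambda>_. \<zero>\<^bsub>Q\<^esub>) (\<lambda>_. \<zero>\<^bsub>M\<^esub>)"
    unfolding stable_retract_def restrict_scalars_id
    by (intro conjI M assms(3) ballI module_homI) auto
  then obtain a' b' s where
    "stable_retract (Q\<lparr>carrier := a_kernel Q M p\<rparr>) (P\<lparr>carrier := a_kernel P M q\<rparr>) a' b' Q (\<lambda>x. x) s"
    by (rule stable_retract_kernel[OF _ assms(3-5) P(1-3)]) (rule that)
  then show ?thesis by (rule pdle_stable_retract[OF assms(1) _ P(4)])
qed

lemma pdle_SucI:
  fixes M Q :: "('r, 'm) module"
  assumes "left_module R M" "proj R Q" "p \<in> module_hom R Q M" "p ` carrier Q = carrier M"
    "pdle n R (Q\<lparr>carrier := a_kernel Q M p\<rparr>)"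
  shows "pdle (Suc n) R M"
  unfolding pdle.simps(2) by (intro conjI exI[of _ Q] exI[of _ p] assms)

section \<open>Projective resolutions and finiteness of the three dimensions\<close>

lemma projective_resolutionD:
  assumes "projective_resolution R M n P d"
  shows "projective_module R (P j)" "n < j \<Longrightarrow> carrier (P j) = {\<zero>\<^bsub>P j\<^esub>}"
    "d 0 \<in> module_hom R (P 0) M" "d 0 ` carrier (P 0) = carrier M"
    "d (Suc j) \<in> module_hom R (P (Suc j)) (P j)"
    "d (Suc 0) ` carrier (P (Suc 0)) = a_kernel (P 0) M (d 0)"
    "d (Suc (Suc j)) ` carrier (P (Suc (Suc j))) = a_kernel (P (Suc j)) (P j) (d (Suc j))"
  using assms by (simp_all add: projective_resolution_def)

lemma projective_resolution_imp_pdle: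
  fixes M :: "('r, 'm) module"
  assumes "large (carrier R) TYPE('m)" "left_module R M" "projective_resolution R M n P d"
  shows "pdle n R M"
  using assms(2,3)
proof (induction n arbitrary: M P d)
  case (Suc n)
  have proj: "\<And>j. projective_module R (P j)" and zero: "\<And>j. j > Suc n \<Longrightarrow> carrier (P j) = {\<zero>\<^bsub>P j\<^esub>}"
    and d0: "d 0 \<in> module_hom R (P 0) M" "d 0 ` carrier (P 0) = carrier M"
    and d: "\<And>j. d (Suc j) \<in> module_hom R (P (Suc j)) (P j)"
    and ker0: "d (Suc 0) ` carrier (P (Suc 0)) = a_kernel (P 0) M (d 0)"
    and ker: "\<And>j. d (Suc (Suc j)) ` carrier (P (Suc (Suc j))) = a_kernel (P (Suc j)) (P j) (d (Suc j))"
    using projective_resolutionD[OF Suc.prems(2)] by simp_all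
  let ?K = "(P 0)\<lparr>carrier := a_kernel (P 0) M (d 0)\<rparr>"
  have P0: "proj R (P 0)" by (rule projective_module_imp_proj[OF assms(1) proj])
  have K: "left_module R ?K" by (rule left_module_kernel(1)[OF proj_left_module[OF P0] Suc.prems(1) d0(1)])
  have d1: "d (Suc 0) \<in> module_hom R (P (Suc 0)) ?K"
    by (rule module_hom_into_submodule[OF d]) (simp flip: ker0)
  have "projective_resolution R ?K n (\<lambda>j. P (Suc j)) (\<lambda>j. d (Suc j))"
    unfolding projective_resolution_def
  proof (intro conjI allI impI)
    show "d (Suc (Suc 0)) ` carrier (P (Suc (Suc 0))) = a_kernel (P (Suc 0)) ?K (d (Suc 0))"
      unfolding ker by (simp add: a_kernel_def')
  qed (use d d1 in \<open>simp_all add: proj zero ker ker0\<close>)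
  then show ?case by (intro pdle_SucI[OF Suc.prems(1) P0 d0] Suc.IH[OF K])
next
  case 0
  have proj: "\<And>j. projective_module R (P j)" and zero: "\<And>j. j > 0 \<Longrightarrow> carrier (P j) = {\<zero>\<^bsub>P j\<^esub>}"
    and d0: "d 0 \<in> module_hom R (P 0) M" "d 0 ` carrier (P 0) = carrier M"
    and d: "\<And>j. d (Suc j) \<in> module_hom R (P (Suc j)) (P j)"
    and ker0: "d (Suc 0) ` carrier (P (Suc 0)) = a_kernel (P 0) M (d 0)"
    using projective_resolutionD[OF "0.prems"(2)] by simp_all
  have P0: "proj R (P 0)" and P1: "proj R (P (Suc 0))"
    by (rule projective_module_imp_proj[OF assms(1) proj])+
  interpret d0: module_morphism R "P 0" M "d 0"
    by (rule module_morphismI[OF proj_left_module[OF P0] "0.prems"(1) d0(1)])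
  interpret d1: module_morphism R "P (Suc 0)" "P 0" "d (Suc 0)"
    by (rule module_morphismI[OF proj_left_module[OF P1] proj_left_module[OF P0] d])
  \<comment> \<open>The next term is zero, so \<open>d 0\<close> is bijective onto \<open>M\<close>,
    and \<open>M\<close> is a retract of \<open>P 0\<close>.\<close>
  have "a_kernel (P 0) M (d 0) = {\<zero>\<^bsub>P 0\<^esub>}" unfolding ker0[symmetric] by (simp add: zero)
  then have inj: "inj_on (d 0) (carrier (P 0))"
    by (intro d0.injective) (metis a_kernel_iff singletonD)
  let ?i = "inv_into (carrier (P 0)) (d 0)"
  have i: "?i (d 0 x) = x" if "x \<in> carrier (P 0)" for x using inj that by simp
  have "?i \<in> module_hom R M (P 0)"
  proof (rule module_homI)
    fix x y assume "x \<in> carrier M" "y \<in> carrier M"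
    then obtain x' y' where "x' \<in> carrier (P 0)" "y' \<in> carrier (P 0)" "x = d 0 x'" "y = d 0 y'"
      unfolding d0(2)[symmetric] by blast
    then show "?i (x \<oplus>\<^bsub>M\<^esub> y) = ?i x \<oplus>\<^bsub>P 0\<^esub> ?i y" by (simp add: i flip: d0.add)
  next
    fix a x assume "a \<in> carrier R" "x \<in> carrier M"
    then obtain x' where "x' \<in> carrier (P 0)" "x = d 0 x'"
      unfolding d0(2)[symmetric] by blast
    then show "?i (a \<odot>\<^bsub>M\<^esub> x) = a \<odot>\<^bsub>P 0\<^esub> ?i x" using \<open>a \<in> carrier R\<close> by (simp add: i flip: d0.smult)
  next
    show "?i x \<in> carrier (P 0)" if "x \<in> carrier M" for x
      using that unfolding d0(2)[symmetric] by (rule inv_into_into)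
  qed
  then have "proj R M"
    by (rule proj_retract[OF P0 "0.prems"(1) _ d0(1)]) (simp add: f_inv_into_f d0(2))
  then show ?case by simp
qed

lemma pdle_imp_projective_resolution:
  fixes M :: "('r, 'm) module"
  assumes "pdle n R M"
  shows "\<exists>P d. projective_resolution R M n P d"
  using assms
proof (induction n arbitrary: M)
  case 0
  then have M: "proj R M" by simp
  interpret left_module R M by (rule proj_left_module[OF M])
  let ?Z = "M\<lparr>carrier := {\<zero>\<^bsub>M\<^esub>}\<rparr>"
  have sub: "submodule {\<zero>\<^bsub>M\<^esub>} R M" by (rule submoduleI') auto
  have Z: "proj R ?Z" by (rule proj_zero[OF left_module_submodule[OF sub]]) simp
  interpret Z: left_module R ?Z by (rule proj_left_module[OF Z])
  define P where "P = (\<lambda>j::nat. if j = 0 then M else ?Z)"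
  define d where "d = (\<lambda>j::nat. if j = 0 then (\<lambda>x. x) else (\<lambda>_. \<zero>\<^bsub>M\<^esub>))"
  have P: "P 0 = M" "P (Suc j) = ?Z" and d: "d 0 = (\<lambda>x. x)" "d (Suc j) = (\<lambda>_. \<zero>\<^bsub>M\<^esub>)" for j
    by (simp_all add: P_def d_def)
  have "projective_resolution R M 0 P d"
    unfolding projective_resolution_def
  proof (intro conjI allI impI)
    fix j
    show "projective_module R (P j)"
      by (rule proj_imp_projective_module) (simp add: P_def M Z)
    show "d (Suc j) \<in> module_hom R (P (Suc j)) (P j)"
      by (cases j) (auto simp: P d intro!: module_homI)
    show "0 < j \<Longrightarrow> carrier (P j) = {\<zero>\<^bsub>P j\<^esub>}" by (simp add: P_def)
    show "d (Suc (Suc j)) ` carrier (P (Suc (Suc j))) = a_kernel (P (Suc j)) (P j) (d (Suc j))"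
      by (cases j) (auto simp: P d a_kernel_def')
  qed (auto simp: P d a_kernel_def' module_hom_ident)
  then show ?case by blast
next
  case (Suc n)
  obtain F :: "('r, 'm) module" and g where F: "proj R F" "g \<in> module_hom R F M" "g ` carrier F = carrier M"
    "pdle n R (F\<lparr>carrier := a_kernel F M g\<rparr>)" and M: "left_module R M"
    using Suc.prems unfolding pdle.simps(2) by (elim conjE exE) (rule that)
  let ?K = "F\<lparr>carrier := a_kernel F M g\<rparr>"
  have K: "a_kernel F M g \<subseteq> carrier F" by (auto simp: a_kernel_iff)
  obtain P d where res: "projective_resolution R ?K n P d"
    using Suc.IH[OF F(4)] by (elim exE) (rule that)
  have proj: "\<And>j. projective_module R (P j)" and zero: "\<And>j. j > n \<Longrightarrow> carrier (P j) = {\<zero>\<^bsub>P j\<^esub>}"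
    and d0: "d 0 \<in> module_hom R (P 0) ?K" "d 0 ` carrier (P 0) = carrier ?K"
    and d: "\<And>j. d (Suc j) \<in> module_hom R (P (Suc j)) (P j)"
    and ker0: "d (Suc 0) ` carrier (P (Suc 0)) = a_kernel (P 0) ?K (d 0)"
    and ker: "\<And>j. d (Suc (Suc j)) ` carrier (P (Suc (Suc j))) = a_kernel (P (Suc j)) (P j) (d (Suc j))"
    by (rule projective_resolutionD[OF res], assumption?)+
  define P' where "P' = (\<lambda>j. case j of 0 \<Rightarrow> F | Suc j \<Rightarrow> P j)"
  define d' where "d' = (\<lambda>j. case j of 0 \<Rightarrow> g | Suc j \<Rightarrow> d j)"
  have P': "P' 0 = F" "P' (Suc j) = P j" and d': "d' 0 = g" "d' (Suc j) = d j" for j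
    by (simp_all add: P'_def d'_def)
  have d0F: "d 0 \<in> module_hom R (P 0) F" by (rule module_hom_comp[OF d0(1) inclusion_hom[OF K]])
  have "projective_resolution R M (Suc n) P' d'"
    unfolding projective_resolution_def
  proof (intro conjI allI impI)
    fix j
    show "projective_module R (P' j)"
      by (cases j) (simp_all add: P' proj proj_imp_projective_module[OF F(1)])
    show "d' (Suc j) \<in> module_hom R (P' (Suc j)) (P' j)"
      by (cases j) (simp_all add: P' d' d d0F)
    show "Suc n < j \<Longrightarrow> carrier (P' j) = {\<zero>\<^bsub>P' j\<^esub>}" by (cases j) (simp_all add: P' zero)
    show "d' (Suc (Suc j)) ` carrier (P' (Suc (Suc j))) = a_kernel (P' (Suc j)) (P' j) (d' (Suc j))"
    proof (cases j)
      case 0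
      have "a_kernel (P 0) ?K (d 0) = a_kernel (P 0) F (d 0)" by (simp add: a_kernel_def')
      then show ?thesis by (simp add: 0 P' d' ker0)
    qed (simp add: P' d' ker)
  qed (use F d0 in \<open>simp_all add: P' d'\<close>)
  then show ?case by blast
qed

lemma projdim_le_iff:
  fixes M :: "('r, 'm) module"
  assumes "large (carrier R) TYPE('m)" "left_module R M"
  shows "projdim R M \<le> enat n \<longleftrightarrow> pdle n R M"
proof
  let ?S = "{enat n |n. \<exists>P d. projective_resolution R M n P d}"
  assume le: "projdim R M \<le> enat n"
  have "?S \<noteq> {}"
  proof
    assume "?S = {}"
    then have "projdim R M = \<infinity>" unfolding projdim_def by (simp only: Inf_empty top_enat_def)
    then show False using le by simp
  qed
  then have "projdim R M \<in> ?S" unfolding projdim_def by (metis (no_types, lifting) wellorder_InfI ex_in_conv)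
  then obtain m P d where m: "projdim R M = enat m" "projective_resolution R M m P d" by blast
  have "pdle m R M" by (rule projective_resolution_imp_pdle[OF assms m(2)])
  then show "pdle n R M" using le m(1) by (intro pdle_mono[of m n]) simp_all
next
  assume "pdle n R M"
  then have "\<exists>P d. projective_resolution R M n P d" by (rule pdle_imp_projective_resolution)
  then show "projdim R M \<le> enat n" unfolding projdim_def by (intro Inf_lower) blast
qed

lemma less_infinity_iff: "(x :: enat) < \<infinity> \<longleftrightarrow> (\<exists>n. x \<le> enat n)"
  by (cases x) auto

lemma projdim_finite_iff:
  fixes M :: "('r, 'm) module"
  assumes "large (carrier R) TYPE('m)" "left_module R M"
  shows "projdim R M < \<infinity> \<longleftrightarrow> (\<exists>n. pdle n R M)"
  unfolding less_infinity_iff projdim_le_iff[OF assms] ..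

lemma Sup_setcompr_le_iff:
  "Sup {f x |x. P x} \<le> (c :: 'a :: complete_lattice) \<longleftrightarrow> (\<forall>x. P x \<longrightarrow> f x \<le> c)"
  by (auto simp: Sup_le_iff)

lemma fin_dim_finite_iff:
  assumes "large (carrier R) TYPE('m)"
  shows "fin_dim TYPE('m) R < \<infinity> \<longleftrightarrow> (\<exists>n. \<forall>(M :: ('r, 'm) module) m.
    left_module R M \<longrightarrow> finitely_generated R M \<longrightarrow> pdle m R M \<longrightarrow> pdle n R M)"
proof -
  have "(left_module R M \<and> finitely_generated R M \<and> projdim R M < \<infinity> \<longrightarrow> projdim R M \<le> enat n) \<longleftrightarrow>
    (\<forall>m. left_module R M \<longrightarrow> finitely_generated R M \<longrightarrow> pdle m R M \<longrightarrow> pdle n R M)"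
    for M :: "('r, 'm) module" and n
    using projdim_le_iff[OF assms, of M n] projdim_finite_iff[OF assms, of M] by blast
  then show ?thesis
    by (simp only: fin_dim_def less_infinity_iff[of "Sup _"] Sup_setcompr_le_iff)
qed

lemma Fin_dim_finite_iff:
  assumes "large (carrier R) TYPE('m)"
  shows "Fin_dim TYPE('m) R < \<infinity> \<longleftrightarrow> (\<exists>n. \<forall>(M :: ('r, 'm) module) m.
    left_module R M \<longrightarrow> pdle m R M \<longrightarrow> pdle n R M)"
proof -
  have "(left_module R M \<and> projdim R M < \<infinity> \<longrightarrow> projdim R M \<le> enat n) \<longleftrightarrow>
    (\<forall>m. left_module R M \<longrightarrow> pdle m R M \<longrightarrow> pdle n R M)"
    for M :: "('r, 'm) module" and n
    using projdim_le_iff[OF assms, of M n] projdim_finite_iff[OF assms, of M] by blast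
  then show ?thesis
    by (simp only: Fin_dim_def less_infinity_iff[of "Sup _"] Sup_setcompr_le_iff)
qed

lemma gl_dim_finite_iff:
  assumes "large (carrier R) TYPE('m)"
  shows "gl_dim TYPE('m) R < \<infinity> \<longleftrightarrow> (\<exists>n. \<forall>(M :: ('r, 'm) module). left_module R M \<longrightarrow> pdle n R M)"
proof -
  have "(left_module R M \<longrightarrow> projdim R M \<le> enat n) \<longleftrightarrow> (left_module R M \<longrightarrow> pdle n R M)"
    for M :: "('r, 'm) module" and n
    using projdim_le_iff[OF assms, of M n] by blast
  then show ?thesis
    by (simp only: gl_dim_def less_infinity_iff[of "Sup _"] Sup_setcompr_le_iff)
qed

section \<open>Finite-dimensional algebras\<close>

text \<open>The linear span over the field acting through \<kappa>. With recursion over a spanning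
  list, inductions on that list replace bases and dimension counts.\<close>

primrec kspan :: "('k \<Rightarrow> 'r) \<Rightarrow> ('r, 'm) module \<Rightarrow> 'm list \<Rightarrow> 'm set" where
  "kspan \<kappa> M [] = {\<zero>\<^bsub>M\<^esub>}"
| "kspan \<kappa> M (x # xs) = {\<kappa> c \<odot>\<^bsub>M\<^esub> x \<oplus>\<^bsub>M\<^esub> y |c y. y \<in> kspan \<kappa> M xs}"

locale finite_dimensional_algebra =
  fixes R :: "'r ring" and \<kappa> :: "'k::field \<Rightarrow> 'r"
  assumes ring_R: "ring R"
    and \<kappa>_closed: "\<kappa> c \<in> carrier R" and \<kappa>_one: "\<kappa> 1 = \<one>\<^bsub>R\<^esub>"
    and \<kappa>_add: "\<kappa> (c + d) = \<kappa> c \<oplus>\<^bsub>R\<^esub> \<kappa> d" and \<kappa>_mult: "\<kappa> (c * d) = \<kappa> c \<otimes>\<^bsub>R\<^esub> \<kappa> d"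
    and \<kappa>_central: "r \<in> carrier R \<Longrightarrow> \<kappa> c \<otimes>\<^bsub>R\<^esub> r = r \<otimes>\<^bsub>R\<^esub> \<kappa> c"
    and finite_basis: "\<exists>B. set B \<subseteq> carrier R \<and> carrier R = kspan \<kappa> (regular_module R) B"
begin

sublocale R: ring R by (rule ring_R)

lemma \<kappa>_zero: "\<kappa> 0 = \<zero>\<^bsub>R\<^esub>"
  using \<kappa>_add[of 0 0] \<kappa>_closed[of 0] by (simp add: R.add.l_cancel_one)

lemma \<kappa>_minus: "\<kappa> (- c) = \<ominus>\<^bsub>R\<^esub> \<kappa> c"
  using \<kappa>_add[of "- c" c] \<kappa>_closed by (simp add: \<kappa>_zero R.minus_equality)

context
  fixes M :: "('r, 'm) module"
  assumes M: "left_module R M"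
begin

interpretation M: left_module R M by (rule M)

lemma kspan_carrier: "set xs \<subseteq> carrier M \<Longrightarrow> y \<in> kspan \<kappa> M xs \<Longrightarrow> y \<in> carrier M"
  by (induction xs arbitrary: y) (auto simp: \<kappa>_closed)

lemma kspan_zero: "set xs \<subseteq> carrier M \<Longrightarrow> \<zero>\<^bsub>M\<^esub> \<in> kspan \<kappa> M xs"
proof (induction xs)
  case (Cons x xs)
  then have "\<zero>\<^bsub>M\<^esub> = \<kappa> 0 \<odot>\<^bsub>M\<^esub> x \<oplus>\<^bsub>M\<^esub> \<zero>\<^bsub>M\<^esub>" by (simp add: \<kappa>_zero)
  with Cons show ?case by auto
qed simp

lemma kspan_add:
  "set xs \<subseteq> carrier M \<Longrightarrow> y \<in> kspan \<kappa> M xs \<Longrightarrow> z \<in> kspan \<kappa> M xs \<Longrightarrow> y \<oplus>\<^bsub>M\<^esub> z \<in> kspan \<kappa> M xs"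
proof (induction xs arbitrary: y z)
  case (Cons x xs)
  then obtain c y' d z' where *: "y = \<kappa> c \<odot>\<^bsub>M\<^esub> x \<oplus>\<^bsub>M\<^esub> y'" "y' \<in> kspan \<kappa> M xs"
    "z = \<kappa> d \<odot>\<^bsub>M\<^esub> x \<oplus>\<^bsub>M\<^esub> z'" "z' \<in> kspan \<kappa> M xs"
    by auto
  have "x \<in> carrier M" "y' \<in> carrier M" "z' \<in> carrier M" using Cons.prems * kspan_carrier by auto
  then have "y \<oplus>\<^bsub>M\<^esub> z = \<kappa> (c + d) \<odot>\<^bsub>M\<^esub> x \<oplus>\<^bsub>M\<^esub> (y' \<oplus>\<^bsub>M\<^esub> z')"
    using \<kappa>_closed by (simp add: * \<kappa>_add M.smult_l_distr M.M.a_ac)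
  moreover have "y' \<oplus>\<^bsub>M\<^esub> z' \<in> kspan \<kappa> M xs" using Cons * by simp
  ultimately show ?case by auto
qed simp

lemma kspan_smult:
  "set xs \<subseteq> carrier M \<Longrightarrow> y \<in> kspan \<kappa> M xs \<Longrightarrow> \<kappa> d \<odot>\<^bsub>M\<^esub> y \<in> kspan \<kappa> M xs"
proof (induction xs arbitrary: y)
  case (Cons x xs)
  then obtain c y' where *: "y = \<kappa> c \<odot>\<^bsub>M\<^esub> x \<oplus>\<^bsub>M\<^esub> y'" "y' \<in> kspan \<kappa> M xs"
    by auto
  have "x \<in> carrier M" "y' \<in> carrier M" using Cons.prems * kspan_carrier by auto
  then have "\<kappa> d \<odot>\<^bsub>M\<^esub> y = \<kappa> (d * c) \<odot>\<^bsub>M\<^esub> x \<oplus>\<^bsub>M\<^esub> \<kappa> d \<odot>\<^bsub>M\<^esub> y'"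
    using \<kappa>_closed by (simp add: * \<kappa>_mult M.smult_r_distr M.smult_assoc)
  moreover have "\<kappa> d \<odot>\<^bsub>M\<^esub> y' \<in> kspan \<kappa> M xs" using Cons * by simp
  ultimately show ?case by auto
qed (simp add: \<kappa>_closed)

lemma kspan_tail: "x \<in> carrier M \<Longrightarrow> set xs \<subseteq> carrier M \<Longrightarrow> y \<in> kspan \<kappa> M xs \<Longrightarrow> y \<in> kspan \<kappa> M (x # xs)"
proof -
  assume "x \<in> carrier M" "set xs \<subseteq> carrier M" "y \<in> kspan \<kappa> M xs"
  then have "y = \<kappa> 0 \<odot>\<^bsub>M\<^esub> x \<oplus>\<^bsub>M\<^esub> y" using kspan_carrier by (simp add: \<kappa>_zero)
  with \<open>y \<in> kspan \<kappa> M xs\<close> show ?thesis by auto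
qed

lemma kspan_elem: "set xs \<subseteq> carrier M \<Longrightarrow> x \<in> set xs \<Longrightarrow> x \<in> kspan \<kappa> M xs"
proof (induction xs)
  case (Cons z xs)
  show ?case
  proof (cases "x = z")
    case True
    have "z = \<kappa> 1 \<odot>\<^bsub>M\<^esub> z \<oplus>\<^bsub>M\<^esub> \<zero>\<^bsub>M\<^esub>" using Cons.prems by (simp add: \<kappa>_one)
    then show ?thesis using True kspan_zero[of xs] Cons.prems by auto
  next
    case False
    then show ?thesis using Cons kspan_tail[of z xs x] by simp
  qed
qed simp

lemma kspan_least:
  assumes "\<zero>\<^bsub>M\<^esub> \<in> H" "\<And>x y. x \<in> H \<Longrightarrow> y \<in> H \<Longrightarrow> x \<oplus>\<^bsub>M\<^esub> y \<in> H"
    "\<And>c x. x \<in> H \<Longrightarrow> \<kappa> c \<odot>\<^bsub>M\<^esub> x \<in> H" "set xs \<subseteq> H"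
  shows "kspan \<kappa> M xs \<subseteq> H"
  using assms(4)
proof (induction xs)
  case (Cons x xs)
  then show ?case using assms(2,3) by auto
qed (simp add: assms(1))

text \<open>Elimination along the spanning list. If some \<open>h\<close> in \<open>H\<close> has a
  nonzero coefficient c at \<open>x\<close>, then subtracting (d/c) h from an element of
  \<open>H\<close> with coefficient d leaves an element of \<open>H\<close> in the span of the tail.
  So \<open>h\<close> and a list spanning that intersection together span \<open>H\<close>.\<close>

lemma subspace_spanned:
  assumes H: "\<zero>\<^bsub>M\<^esub> \<in> H" "\<And>x y. x \<in> H \<Longrightarrow> y \<in> H \<Longrightarrow> x \<oplus>\<^bsub>M\<^esub> y \<in> H"
    "\<And>c x. x \<in> H \<Longrightarrow> \<kappa> c \<odot>\<^bsub>M\<^esub> x \<in> H"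
    and xs: "set xs \<subseteq> carrier M" "H \<subseteq> kspan \<kappa> M xs"
  shows "\<exists>ys. set ys \<subseteq> H \<and> H \<subseteq> kspan \<kappa> M ys"
  using H xs
proof (induction xs arbitrary: H)
  case Nil
  then show ?case by (intro exI[of _ "[]"]) simp
next
  case (Cons x xs)
  have xs: "x \<in> carrier M" "set xs \<subseteq> carrier M" using Cons.prems(4) by auto
  have HM: "h \<in> carrier M" if "h \<in> H" for h
    using that Cons.prems(5) kspan_carrier[OF Cons.prems(4)] by blast
  let ?H = "H \<inter> kspan \<kappa> M xs"
  have "\<exists>ys. set ys \<subseteq> ?H \<and> ?H \<subseteq> kspan \<kappa> M ys"
    by (rule Cons.IH) (use Cons.prems(1-3) kspan_zero[OF xs(2)] kspan_add[OF xs(2)]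
        kspan_smult[OF xs(2)] xs(2) in simp_all)
  then obtain ys where ys: "set ys \<subseteq> ?H" "?H \<subseteq> kspan \<kappa> M ys" by (elim exE conjE)
  show ?case
  proof (cases "H \<subseteq> kspan \<kappa> M xs")
    case True
    then show ?thesis using ys by (intro exI[of _ ys]) auto
  next
    case False
    then obtain h where h: "h \<in> H" "h \<notin> kspan \<kappa> M xs" by blast
    have "h \<in> kspan \<kappa> M (x # xs)" using h(1) Cons.prems(5) by blast
    then obtain c y where cy: "h = \<kappa> c \<odot>\<^bsub>M\<^esub> x \<oplus>\<^bsub>M\<^esub> y" "y \<in> kspan \<kappa> M xs" by auto
    have yM: "y \<in> carrier M" using cy(2) kspan_carrier xs(2) by blast
    have "c \<noteq> 0" using h(2) cy yM xs by (auto simp: \<kappa>_zero)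
    have "g \<in> kspan \<kappa> M (h # ys)" if g: "g \<in> H" for g
    proof -
      have "g \<in> kspan \<kappa> M (x # xs)" using g Cons.prems(5) by blast
      then obtain d z where dz: "g = \<kappa> d \<odot>\<^bsub>M\<^esub> x \<oplus>\<^bsub>M\<^esub> z" "z \<in> kspan \<kappa> M xs" by auto
      have zM: "z \<in> carrier M" using dz(2) kspan_carrier xs(2) by blast
      let ?e = "d / c" and ?w = "z \<oplus>\<^bsub>M\<^esub> \<kappa> (- (d / c)) \<odot>\<^bsub>M\<^esub> y"
      have [simp]: "\<kappa> a \<in> carrier R" for a by (rule \<kappa>_closed)
      have "\<kappa> ?e \<odot>\<^bsub>M\<^esub> h = \<kappa> d \<odot>\<^bsub>M\<^esub> x \<oplus>\<^bsub>M\<^esub> \<kappa> ?e \<odot>\<^bsub>M\<^esub> y"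
      proof -
        have "\<kappa> ?e \<odot>\<^bsub>M\<^esub> h = \<kappa> (?e * c) \<odot>\<^bsub>M\<^esub> x \<oplus>\<^bsub>M\<^esub> \<kappa> ?e \<odot>\<^bsub>M\<^esub> y"
          using xs(1) yM by (simp only: cy(1) M.smult_r_distr M.smult_closed \<kappa>_closed \<kappa>_mult M.smult_assoc)
        then show ?thesis using \<open>c \<noteq> 0\<close> by simp
      qed
      moreover have "\<kappa> (- ?e) \<odot>\<^bsub>M\<^esub> y = \<ominus>\<^bsub>M\<^esub> (\<kappa> ?e \<odot>\<^bsub>M\<^esub> y)"
        using yM unfolding \<kappa>_minus by (intro M.smult_l_minus) simp_all
      ultimately have g_eq: "g = \<kappa> ?e \<odot>\<^bsub>M\<^esub> h \<oplus>\<^bsub>M\<^esub> ?w"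
        using xs(1) yM zM by (simp add: dz(1) M.M.a_ac M.M.r_neg M.M.r_neg1)
      have "?w = g \<oplus>\<^bsub>M\<^esub> \<kappa> (- ?e) \<odot>\<^bsub>M\<^esub> h"
      proof -
        have "\<kappa> (- ?e) \<odot>\<^bsub>M\<^esub> h = \<ominus>\<^bsub>M\<^esub> (\<kappa> ?e \<odot>\<^bsub>M\<^esub> h)"
          using HM[OF h(1)] unfolding \<kappa>_minus by (intro M.smult_l_minus) simp_all
        moreover have "?w \<in> carrier M" "\<kappa> ?e \<odot>\<^bsub>M\<^esub> h \<in> carrier M" using zM yM HM[OF h(1)] by simp_all
        ultimately show ?thesis
          by (subst g_eq) (simp add: M.M.a_ac M.M.r_neg M.M.r_neg1 M.M.r_neg2)
      qed
      then have "?w \<in> H" using Cons.prems(2,3) g h(1) by simp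
      moreover have "?w \<in> kspan \<kappa> M xs" using dz(2) cy(2) kspan_add kspan_smult xs(2) by simp
      ultimately have "?w \<in> kspan \<kappa> M ys" using ys(2) by blast
      then show ?thesis using g_eq by auto
    qed
    then show ?thesis using h(1) ys(1) by (intro exI[of _ "h # ys"]) auto
  qed
qed

lemma smult_in_kspan:
  assumes "set B \<subseteq> carrier R" "r \<in> kspan \<kappa> (regular_module R) B" "s \<in> carrier M"
  shows "r \<odot>\<^bsub>M\<^esub> s \<in> kspan \<kappa> M (map (\<lambda>b. b \<odot>\<^bsub>M\<^esub> s) B)"
  using assms(1,2)
proof (induction B arbitrary: r)
  case (Cons b B)
  then obtain c r' where r: "r = \<kappa> c \<otimes>\<^bsub>R\<^esub> b \<oplus>\<^bsub>R\<^esub> r'" "r' \<in> kspan \<kappa> (regular_module R) B" by auto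
  have "b \<in> carrier R" using Cons.prems(1) by simp
  moreover have "r' \<in> carrier R"
    using finite_dimensional_algebra.kspan_carrier[OF finite_dimensional_algebra_axioms
      left_module_regular[OF ring_R], of B r'] r(2) Cons.prems(1) by simp
  ultimately have "r \<odot>\<^bsub>M\<^esub> s = \<kappa> c \<odot>\<^bsub>M\<^esub> (b \<odot>\<^bsub>M\<^esub> s) \<oplus>\<^bsub>M\<^esub> r' \<odot>\<^bsub>M\<^esub> s"
    using assms(3) \<kappa>_closed by (simp add: r(1) M.smult_l_distr M.smult_assoc)
  moreover have "r' \<odot>\<^bsub>M\<^esub> s \<in> kspan \<kappa> M (map (\<lambda>b. b \<odot>\<^bsub>M\<^esub> s) B)" using Cons r by simp
  ultimately show ?case by auto
qed (simp add: assms(3))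

lemma finitely_generated_kspan:
  assumes "finitely_generated R M"
  shows "\<exists>xs. set xs \<subseteq> carrier M \<and> carrier M \<subseteq> kspan \<kappa> M xs"
proof -
  obtain S where S: "finite S" "S \<subseteq> carrier M" "\<And>H. submodule H R M \<Longrightarrow> S \<subseteq> H \<Longrightarrow> H = carrier M"
    using assms by (elim finitely_generatedE) (rule that)
  obtain B where B: "set B \<subseteq> carrier R" "carrier R = kspan \<kappa> (regular_module R) B"
    using finite_basis by blast
  obtain ss where ss: "set ss = S" using finite_list[OF S(1)] by blast
  define xs where "xs = concat (map (\<lambda>s. map (\<lambda>b. b \<odot>\<^bsub>M\<^esub> s) B) ss)"
  have set_xs: "set xs = {b \<odot>\<^bsub>M\<^esub> s |b s. b \<in> set B \<and> s \<in> S}" unfolding xs_def using ss by auto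
  have xs: "set xs \<subseteq> carrier M" unfolding set_xs using B(1) S(2) by auto
  have Rs: "r \<odot>\<^bsub>M\<^esub> s \<in> kspan \<kappa> M xs" if "r \<in> carrier R" "s \<in> S" for r s
  proof -
    have "kspan \<kappa> M (map (\<lambda>b. b \<odot>\<^bsub>M\<^esub> s) B) \<subseteq> kspan \<kappa> M xs"
    proof (rule kspan_least[OF kspan_zero[OF xs] kspan_add[OF xs] kspan_smult[OF xs]])
      show "set (map (\<lambda>b. b \<odot>\<^bsub>M\<^esub> s) B) \<subseteq> kspan \<kappa> M xs"
        using that(2) by (intro subsetI kspan_elem[OF xs]) (simp add: set_xs image_iff, blast)
    qed
    moreover have "r \<odot>\<^bsub>M\<^esub> s \<in> kspan \<kappa> M (map (\<lambda>b. b \<odot>\<^bsub>M\<^esub> s) B)"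
      by (rule smult_in_kspan[OF B(1)]) (use that B(2) S(2) in auto)
    ultimately show ?thesis by blast
  qed
  \<comment> \<open>The elements whose multiples by \<open>R\<close> stay in the span form a
    subspace containing \<open>xs\<close>, so the span is stable under \<open>R\<close>.\<close>
  have "kspan \<kappa> M xs \<subseteq> {y \<in> carrier M. \<forall>r\<in>carrier R. r \<odot>\<^bsub>M\<^esub> y \<in> kspan \<kappa> M xs}"
  proof (rule kspan_least)
    show "set xs \<subseteq> {y \<in> carrier M. \<forall>r\<in>carrier R. r \<odot>\<^bsub>M\<^esub> y \<in> kspan \<kappa> M xs}"
    proof
      fix y assume y: "y \<in> set xs"
      then obtain b s where bs: "b \<in> set B" "s \<in> S" "y = b \<odot>\<^bsub>M\<^esub> s" unfolding set_xs by blast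
      then have "b \<in> carrier R" "s \<in> carrier M" using B(1) S(2) by auto
      then have "r \<odot>\<^bsub>M\<^esub> y \<in> kspan \<kappa> M xs" if "r \<in> carrier R" for r
        using that Rs[of "r \<otimes>\<^bsub>R\<^esub> b" s] bs by (simp add: M.smult_assoc)
      then show "y \<in> {y \<in> carrier M. \<forall>r\<in>carrier R. r \<odot>\<^bsub>M\<^esub> y \<in> kspan \<kappa> M xs}" using y xs by auto
    qed
    show "\<kappa> c \<odot>\<^bsub>M\<^esub> y \<in> {y \<in> carrier M. \<forall>r\<in>carrier R. r \<odot>\<^bsub>M\<^esub> y \<in> kspan \<kappa> M xs}"
      if "y \<in> {y \<in> carrier M. \<forall>r\<in>carrier R. r \<odot>\<^bsub>M\<^esub> y \<in> kspan \<kappa> M xs}" for c y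
      using that \<kappa>_closed by (auto simp flip: M.smult_assoc)
  qed (use xs in \<open>auto simp: M.smult_r_distr kspan_zero kspan_add\<close>)
  then have sub: "submodule (kspan \<kappa> M xs) R M"
    using kspan_carrier[OF xs] kspan_zero[OF xs] kspan_add[OF xs] by (intro M.submoduleI') auto
  have "S \<subseteq> kspan \<kappa> M xs"
  proof
    fix s assume s: "s \<in> S"
    then show "s \<in> kspan \<kappa> M xs" using Rs[OF R.one_closed s] S(2) by auto
  qed
  then have "kspan \<kappa> M xs = carrier M" by (rule S(3)[OF sub])
  then show ?thesis using xs by blast
qed

text \<open>A finitely generated module is spanned by a finite list over the field, a subspace is
  again so spanned, and a list spanning it also generates it as a module.\<close>

theorem finitely_generated_submodule:
  assumes "finitely_generated R M" "submodule H R M"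
  shows "finitely_generated R (M\<lparr>carrier := H\<rparr>)"
proof -
  note H = M.submoduleD[OF assms(2)]
  obtain xs where xs: "set xs \<subseteq> carrier M" "carrier M \<subseteq> kspan \<kappa> M xs"
    using finitely_generated_kspan[OF assms(1)] by blast
  have "\<exists>ys. set ys \<subseteq> H \<and> H \<subseteq> kspan \<kappa> M ys"
    by (rule subspace_spanned[OF H(2) H(4) H(7)[OF \<kappa>_closed] xs(1)]) (use H(1) xs(2) in auto)
  then obtain ys where ys: "set ys \<subseteq> H" "H \<subseteq> kspan \<kappa> M ys" by blast
  interpret MH: left_module R "M\<lparr>carrier := H\<rparr>" by (rule M.left_module_submodule) fact
  show ?thesis
  proof (rule finitely_generatedI[of "set ys"])
    fix N assume N: "submodule N R (M\<lparr>carrier := H\<rparr>)" "set ys \<subseteq> N"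
    note N' = MH.submoduleD[OF N(1)]
    have "kspan \<kappa> M ys \<subseteq> N"
      by (rule kspan_least) (use N' N(2) \<kappa>_closed in auto)
    then show "N = carrier (M\<lparr>carrier := H\<rparr>)" using N'(1) ys(2) by auto
  qed (use ys in auto)
qed

end

text \<open>A choice of coefficients along the spanning list codes each ring element as a list over
  the field. So a copy of the field in an infinite \<open>'m\<close> is enough.\<close>

lemma large_carrier:
  assumes "infinite (UNIV :: 'm set)" "inj (\<iota> :: 'k \<Rightarrow> 'm)"
  shows "large (carrier R) TYPE('m)"
proof -
  obtain c :: "'m list \<Rightarrow> 'm" where c: "inj c" by (rule infinite_list_injection[OF assms(1)])
  obtain B where B: "carrier R = kspan \<kappa> (regular_module R) B" using finite_basis by blast
  have "\<exists>f. inj_on f (kspan \<kappa> (regular_module R) B) \<and> range f \<subseteq> (UNIV :: 'k list set)"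
  proof (induction B)
    case Nil
    then show ?case by (intro exI[of _ "\<lambda>_. []"]) simp
  next
    case (Cons b B)
    then obtain f where f: "inj_on f (kspan \<kappa> (regular_module R) B)" "range f \<subseteq> (UNIV :: 'k list set)" by blast
    let ?rep = "\<lambda>x p. x = \<kappa> (fst p) \<odot>\<^bsub>regular_module R\<^esub> b \<oplus>\<^bsub>regular_module R\<^esub> snd p \<and>
      snd p \<in> kspan \<kappa> (regular_module R) B"
    define g where "g x = (SOME p. ?rep x p)" for x
    have g: "?rep x (g x)" if "x \<in> kspan \<kappa> (regular_module R) (b # B)" for x
    proof -
      have "\<exists>p. ?rep x p" using that by (simp del: regular_module_simps)
      then show ?thesis unfolding g_def by (rule someI_ex)
    qed
    have "inj_on (\<lambda>x. fst (g x) # f (snd (g x))) (kspan \<kappa> (regular_module R) (b # B))"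
    proof (rule inj_onI)
      fix x y assume xy: "x \<in> kspan \<kappa> (regular_module R) (b # B)" "y \<in> kspan \<kappa> (regular_module R) (b # B)"
        and "fst (g x) # f (snd (g x)) = fst (g y) # f (snd (g y))"
      then have "fst (g x) = fst (g y)" "f (snd (g x)) = f (snd (g y))" by simp_all
      moreover from this(2) have "snd (g x) = snd (g y)"
        by (rule inj_onD[OF f(1)]) (use g[OF xy(1)] g[OF xy(2)] in blast)+
      ultimately have "g x = g y" by (simp add: prod_eq_iff)
      then show "x = y" using g[OF xy(1)] g[OF xy(2)] by metis
    qed
    then show ?case by blast
  qed
  then obtain f :: "'r \<Rightarrow> 'k list" where f: "inj_on f (carrier R)" unfolding B by blast
  have "inj (\<lambda>xs. c (map \<iota> xs))"
    by (rule inj_compose[OF c, unfolded comp_def]) (use assms(2) in simp)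
  then have "inj_on (\<lambda>r. c (map \<iota> (f r))) (carrier R)"
    using f by (auto simp: inj_on_def)
  then show ?thesis unfolding large_def using assms(1) by blast
qed

end

section \<open>Opposite rings\<close>

lemma op_ring_simps [simp]:
  "carrier (op_ring R) = carrier R" "\<zero>\<^bsub>op_ring R\<^esub> = \<zero>\<^bsub>R\<^esub>" "\<one>\<^bsub>op_ring R\<^esub> = \<one>\<^bsub>R\<^esub>"
  "x \<oplus>\<^bsub>op_ring R\<^esub> y = x \<oplus>\<^bsub>R\<^esub> y" "x \<otimes>\<^bsub>op_ring R\<^esub> y = y \<otimes>\<^bsub>R\<^esub> x"
  "op_ring (op_ring R) = R"
  by (simp_all add: op_ring_def)

lemma ring_op_ring:
  assumes "ring R" shows "ring (op_ring R)"
proof -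
  interpret ring R by fact
  have "abelian_group (op_ring R)"
  proof (rule abelian_groupI)
    fix x assume "x \<in> carrier (op_ring R)"
    then show "\<exists>y\<in>carrier (op_ring R). y \<oplus>\<^bsub>op_ring R\<^esub> x = \<zero>\<^bsub>op_ring R\<^esub>"
      by (intro bexI[of _ "\<ominus>\<^bsub>R\<^esub> x"]) (auto simp: l_neg)
  qed (auto simp: a_ac)
  moreover have "Group.monoid (op_ring R)" by (rule monoidI) (auto simp: m_assoc)
  ultimately show ?thesis by (rule ringI) (auto simp: l_distr r_distr)
qed

text \<open>Scalars are central, so the same list spans the ring from both sides.\<close>

lemma (in finite_dimensional_algebra) op_finite_dimensional:
  "finite_dimensional_algebra (op_ring R) \<kappa>"
proof -
  have "kspan \<kappa> (regular_module (op_ring R)) B = kspan \<kappa> (regular_module R) B" if "set B \<subseteq> carrier R" for B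
    using that
  proof (induction B)
    case (Cons b B)
    then show ?case using \<kappa>_central by simp
  qed simp
  then have "\<exists>B. set B \<subseteq> carrier (op_ring R) \<and> carrier (op_ring R) = kspan \<kappa> (regular_module (op_ring R)) B"
    using finite_basis by auto
  then show ?thesis
    by (intro finite_dimensional_algebra.intro ring_op_ring ring_R)
      (simp_all add: \<kappa>_closed \<kappa>_one \<kappa>_add \<kappa>_central mult.commute[of _ "_ :: 'k"] flip: \<kappa>_mult)
qed

section \<open>Matrices over a ring and exactness of columns\<close>

abbreviation column_module :: "nat \<Rightarrow> ('r, 'm) module \<Rightarrow> ('r, nat \<Rightarrow> 'm) module" where
  "column_module n M \<equiv> power_module {..<n} M"

lemma column_carrier:
  "x \<in> carrier (column_module n M) \<longleftrightarrow> (\<forall>j<n. x j \<in> carrier M) \<and> (\<forall>j\<ge>n. x j = \<zero>\<^bsub>M\<^esub>)"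
proof -
  have "finite {j. x j \<noteq> \<zero>\<^bsub>M\<^esub>}" if "\<forall>j\<ge>n. x j = \<zero>\<^bsub>M\<^esub>"
    by (rule finite_subset[of _ "{..<n}"]) (use that not_less in auto)
  then show ?thesis by (auto simp: power_module_carrier not_less)
qed

definition matrix_over :: "'r ring \<Rightarrow> nat \<Rightarrow> nat \<Rightarrow> (nat \<Rightarrow> nat \<Rightarrow> 'r) \<Rightarrow> bool" where
  "matrix_over R n t \<phi> \<longleftrightarrow> (\<forall>s<n. \<forall>j<t. \<phi> s j \<in> carrier R)"

definition mact :: "('r, 'm) module \<Rightarrow> nat \<Rightarrow> nat \<Rightarrow> (nat \<Rightarrow> nat \<Rightarrow> 'r) \<Rightarrow> (nat \<Rightarrow> 'm) \<Rightarrow> nat \<Rightarrow> 'm" where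
  "mact M n t \<phi> x = (\<lambda>s. if s < n then finsum M (\<lambda>j. \<phi> s j \<odot>\<^bsub>M\<^esub> x j) {..<t} else \<zero>\<^bsub>M\<^esub>)"

lemma mact_carrier:
  assumes "left_module R M" "matrix_over R n t \<phi>" "x \<in> carrier (column_module t M)"
  shows "mact M n t \<phi> x \<in> carrier (column_module n M)"
proof -
  interpret left_module R M by fact
  show ?thesis using assms(2,3) unfolding column_carrier mact_def matrix_over_def
    by (auto intro!: M.finsum_closed)
qed

lemma mact_add:
  assumes "left_module R M" "matrix_over R n t \<phi>"
    "x \<in> carrier (column_module t M)" "y \<in> carrier (column_module t M)"
  shows "mact M n t \<phi> (\<lambda>j. x j \<oplus>\<^bsub>M\<^esub> y j) = (\<lambda>s. mact M n t \<phi> x s \<oplus>\<^bsub>M\<^esub> mact M n t \<phi> y s)"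
proof
  fix s
  interpret left_module R M by fact
  have c: "x j \<in> carrier M" "y j \<in> carrier M" if "j < t" for j
    using assms(3,4) that by (auto simp: column_carrier)
  show "mact M n t \<phi> (\<lambda>j. x j \<oplus>\<^bsub>M\<^esub> y j) s = mact M n t \<phi> x s \<oplus>\<^bsub>M\<^esub> mact M n t \<phi> y s"
  proof (cases "s < n")
    case True
    then have p: "\<phi> s j \<in> carrier R" if "j < t" for j using assms(2) that by (auto simp: matrix_over_def)
    have "finsum M (\<lambda>j. \<phi> s j \<odot>\<^bsub>M\<^esub> (x j \<oplus>\<^bsub>M\<^esub> y j)) {..<t} =
        finsum M (\<lambda>j. \<phi> s j \<odot>\<^bsub>M\<^esub> x j \<oplus>\<^bsub>M\<^esub> \<phi> s j \<odot>\<^bsub>M\<^esub> y j) {..<t}"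
      using p c by (intro M.finsum_cong') (auto simp: smult_r_distr)
    also have "\<dots> = finsum M (\<lambda>j. \<phi> s j \<odot>\<^bsub>M\<^esub> x j) {..<t} \<oplus>\<^bsub>M\<^esub> finsum M (\<lambda>j. \<phi> s j \<odot>\<^bsub>M\<^esub> y j) {..<t}"
      using p c by (intro M.finsum_addf) auto
    finally show ?thesis using True by (simp add: mact_def)
  qed (simp add: mact_def)
qed

lemma mact_hom:
  assumes "left_module R M" "left_module R N" "g \<in> module_hom R M N" "matrix_over R n t \<phi>"
    "x \<in> carrier (column_module t M)"
  shows "mact N n t \<phi> (\<lambda>j. g (x j)) = (\<lambda>s. g (mact M n t \<phi> x s))"
proof
  fix s
  interpret module_morphism R M N g by (rule module_morphismI) fact+
  show "mact N n t \<phi> (\<lambda>j. g (x j)) s = g (mact M n t \<phi> x s)"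
  proof (cases "s < n")
    case True
    have c: "x j \<in> carrier M" "\<phi> s j \<in> carrier R" if "j < t" for j
      using assms(4,5) that True by (auto simp: column_carrier matrix_over_def)
    have "g (finsum M (\<lambda>j. \<phi> s j \<odot>\<^bsub>M\<^esub> x j) {..<t}) = finsum N (\<lambda>j. g (\<phi> s j \<odot>\<^bsub>M\<^esub> x j)) {..<t}"
      using c by (intro finsum) auto
    also have "\<dots> = finsum N (\<lambda>j. \<phi> s j \<odot>\<^bsub>N\<^esub> g (x j)) {..<t}"
      using c by (intro N.M.finsum_cong') auto
    finally show ?thesis using True by (simp add: mact_def)
  qed (simp add: mact_def)
qed

lemma column_hom:
  assumes "left_module R M" "left_module R N" "g \<in> module_hom R M N" "x \<in> carrier (column_module t M)"
  shows "(\<lambda>j. g (x j)) \<in> carrier (column_module t N)"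
proof -
  interpret module_morphism R M N g by (rule module_morphismI) fact+
  show ?thesis using assms(4) by (auto simp: column_carrier)
qed

lemma column_submodule:
  assumes "left_module R M" "submodule H R M"
  shows "x \<in> carrier (column_module t (M\<lparr>carrier := H\<rparr>)) \<longleftrightarrow>
    x \<in> carrier (column_module t M) \<and> (\<forall>j<t. x j \<in> H)"
  using left_module.submoduleD(1)[OF assms] by (auto simp: column_carrier)

lemma mact_submodule:
  assumes "left_module R M" "submodule H R M" "matrix_over R n t \<phi>"
    "x \<in> carrier (column_module t (M\<lparr>carrier := H\<rparr>))"
  shows "mact (M\<lparr>carrier := H\<rparr>) n t \<phi> x = mact M n t \<phi> x"
  using mact_hom[OF left_module.left_module_submodule[OF assms(1,2)] assms(1)
    inclusion_hom[OF left_module.submoduleD(1)[OF assms(1,2)]] assms(3,4)] by simp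

lemma mact_minus:
  assumes "left_module R M" "matrix_over R n t \<phi>"
    "x \<in> carrier (column_module t M)" "y \<in> carrier (column_module t M)"
  shows "mact M n t \<phi> (\<lambda>j. x j \<ominus>\<^bsub>M\<^esub> y j) = (\<lambda>s. mact M n t \<phi> x s \<ominus>\<^bsub>M\<^esub> mact M n t \<phi> y s)"
proof -
  interpret left_module R M by fact
  have neg: "(\<lambda>x. \<ominus>\<^bsub>M\<^esub> x) \<in> module_hom R M M"
    by (rule module_homI) (auto simp: M.minus_add smult_r_minus)
  have "mact M n t \<phi> (\<lambda>j. x j \<oplus>\<^bsub>M\<^esub> (\<ominus>\<^bsub>M\<^esub> y j)) =
    (\<lambda>s. mact M n t \<phi> x s \<oplus>\<^bsub>M\<^esub> mact M n t \<phi> (\<lambda>j. \<ominus>\<^bsub>M\<^esub> y j) s)"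
    by (rule mact_add[OF assms(1-3) column_hom[OF assms(1,1) neg assms(4)]])
  then show ?thesis by (simp add: mact_hom[OF assms(1,1) neg assms(2,4)] a_minus_def)
qed

definition unit_column :: "'r ring \<Rightarrow> nat \<Rightarrow> nat \<Rightarrow> nat \<Rightarrow> 'r" where
  "unit_column R t = (\<lambda>j. if j < t then unit_vector R j else (\<lambda>_. \<zero>\<^bsub>R\<^esub>))"

text \<open>Every column over \<open>M\<close> is the image of the column of unit vectors over a free left module,
  whose coordinates are columns over \<open>R\<close>. So identities between matrices, as operators on
  columns over \<open>R\<close>, hold as operators on columns over \<open>M\<close>.\<close>

lemma unit_column_free:
  assumes "left_module R M" "x \<in> carrier (column_module t M)"
  defines "e \<equiv> unit_column R t"
  shows "e \<in> carrier (column_module t (free_module R {..<t}))"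
    "lin R M x \<in> module_hom R (free_module R {..<t}) M" "x = (\<lambda>j. lin R M x (e j))"
proof -
  interpret left_module R M by fact
  have x: "x \<in> {..<t} \<rightarrow> carrier M" using assms(2) by (auto simp: column_carrier)
  show e: "e \<in> carrier (column_module t (free_module R {..<t}))"
    using R.ring_axioms by (auto simp: column_carrier[where n = t and M = "free_module R {..<t}"] e_def unit_column_def)
  show hom: "lin R M x \<in> module_hom R (free_module R {..<t}) M" by (rule lin_hom[OF assms(1) x])
  interpret l: module_morphism R "free_module R {..<t}" M "lin R M x"
    by (rule module_morphismI[OF left_module_free[OF R.ring_axioms] assms(1) hom])
  show "x = (\<lambda>j. lin R M x (e j))"
  proof
    fix j
    show "x j = lin R M x (e j)"
    proof (cases "j < t")
      case True
      then show ?thesis using lin_unit_vector[OF assms(1) x, of j] by (simp add: e_def unit_column_def)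
    next
      case False
      then show ?thesis using l.zero assms(2) by (simp add: e_def unit_column_def column_carrier)
    qed
  qed
qed

lemma mact_eval:
  assumes "ring R" "matrix_over R n t \<phi>" "x \<in> carrier (column_module t (free_module R S))"
  shows "mact (free_module R S) n t \<phi> x s l = mact (regular_module R) n t \<phi> (\<lambda>j. x j l) s"
  using mact_hom[OF left_module_free[OF assms(1)] left_module_regular[OF assms(1)]
    power_module_eval_hom[OF left_module_regular[OF assms(1)]] assms(2,3), of l]
  by (simp add: fun_eq_iff)

lemma column_eval:
  assumes "ring R" "x \<in> carrier (column_module t (free_module R S))"
  shows "(\<lambda>j. x j l) \<in> carrier (column_module t (regular_module R))"
  by (rule column_hom[OF left_module_free left_module_regular power_module_eval_hom[OF left_module_regular]])
    (fact | rule assms(1))+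

lemma mact_comp_zero:
  assumes R: "ring R" and mat: "matrix_over R n t \<phi>" "matrix_over R t u \<psi>"
    and eq: "\<And>w. w \<in> carrier (column_module u (regular_module R)) \<Longrightarrow>
      mact (regular_module R) n t \<phi> (mact (regular_module R) t u \<psi> w) = (\<lambda>_. \<zero>\<^bsub>R\<^esub>)"
    and M: "left_module R M" and x: "x \<in> carrier (column_module u M)"
  shows "mact M n t \<phi> (mact M t u \<psi> x) = (\<lambda>_. \<zero>\<^bsub>M\<^esub>)"
proof -
  let ?F = "free_module R {..<u}"
  note F = left_module_free[OF R, of "{..<u}"]
  define e where "e = unit_column R u"
  note e = unit_column_free[OF M x, folded e_def]
  interpret l: module_morphism R ?F M "lin R M x" by (rule module_morphismI[OF F M e(2)])
  note pe = mact_carrier[OF F mat(2) e(1)]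
  have "mact M t u \<psi> x = (\<lambda>j. lin R M x (mact ?F t u \<psi> e j))"
    using mact_hom[OF F M e(2) mat(2) e(1)] e(3) by simp
  then have "mact M n t \<phi> (mact M t u \<psi> x) = (\<lambda>s. lin R M x (mact ?F n t \<phi> (mact ?F t u \<psi> e) s))"
    using mact_hom[OF F M e(2) mat(1) pe] by simp
  moreover have "mact ?F n t \<phi> (mact ?F t u \<psi> e) s = \<zero>\<^bsub>?F\<^esub>" for s
    using eq[OF column_eval[OF R e(1)]]
    by (simp add: fun_eq_iff mact_eval[OF R mat(1) pe] mact_eval[OF R mat(2) e(1)])
  ultimately show ?thesis using l.zero by simp
qed

lemma mact_regular_inverse:
  assumes R: "ring R" and mat: "matrix_over R n t \<phi>" "matrix_over R t n \<sigma>"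
    and eq: "\<And>w. w \<in> carrier (column_module t (regular_module R)) \<Longrightarrow>
      mact (regular_module R) n t \<phi> (mact (regular_module R) t n \<sigma> (mact (regular_module R) n t \<phi> w)) =
      mact (regular_module R) n t \<phi> w"
    and M: "left_module R M" and x: "x \<in> carrier (column_module t M)"
  shows "mact M n t \<phi> (mact M t n \<sigma> (mact M n t \<phi> x)) = mact M n t \<phi> x"
proof -
  let ?F = "free_module R {..<t}"
  note F = left_module_free[OF R, of "{..<t}"]
  define e where "e = unit_column R t"
  note e = unit_column_free[OF M x, folded e_def]
  note pe = mact_carrier[OF F mat(1) e(1)]
  note spe = mact_carrier[OF F mat(2) pe]
  have 1: "mact M n t \<phi> x = (\<lambda>j. lin R M x (mact ?F n t \<phi> e j))"
    using mact_hom[OF F M e(2) mat(1) e(1)] e(3) by simp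
  then have "mact M t n \<sigma> (mact M n t \<phi> x) = (\<lambda>s. lin R M x (mact ?F t n \<sigma> (mact ?F n t \<phi> e) s))"
    using mact_hom[OF F M e(2) mat(2) pe] by simp
  then have "mact M n t \<phi> (mact M t n \<sigma> (mact M n t \<phi> x)) =
      (\<lambda>s. lin R M x (mact ?F n t \<phi> (mact ?F t n \<sigma> (mact ?F n t \<phi> e)) s))"
    using mact_hom[OF F M e(2) mat(1) spe] by simp
  moreover have "mact ?F n t \<phi> (mact ?F t n \<sigma> (mact ?F n t \<phi> e)) = mact ?F n t \<phi> e"
    using eq[OF column_eval[OF R e(1)]]
    by (simp add: fun_eq_iff mact_eval[OF R mat(1) spe] mact_eval[OF R mat(2) pe] mact_eval[OF R mat(1) e(1)])
  ultimately show ?thesis using 1 by simp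
qed

text \<open>\<open>good k\<close> expresses through matrices that the cokernel of \<open>\<phi>\<close>, as a map of free right
  modules, has projective dimension at most \<open>k + 1\<close>.\<close>

primrec good :: "nat \<Rightarrow> 'r ring \<Rightarrow> nat \<Rightarrow> nat \<Rightarrow> (nat \<Rightarrow> nat \<Rightarrow> 'r) \<Rightarrow> bool" where
  "good 0 R n t \<phi> \<longleftrightarrow> (\<exists>\<sigma>. matrix_over R t n \<sigma> \<and>
     (\<forall>w\<in>carrier (column_module t (regular_module R)).
       mact (regular_module R) n t \<phi> (mact (regular_module R) t n \<sigma> (mact (regular_module R) n t \<phi> w)) =
       mact (regular_module R) n t \<phi> w))"
| "good (Suc k) R n t \<phi> \<longleftrightarrow> (\<exists>u \<psi>. matrix_over R t u \<psi> \<and>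
     (\<forall>x\<in>carrier (column_module t (regular_module R)).
       mact (regular_module R) n t \<phi> x = (\<lambda>_. \<zero>\<^bsub>R\<^esub>) \<longleftrightarrow>
       x \<in> mact (regular_module R) t u \<psi> ` carrier (column_module u (regular_module R))) \<and>
     good k R t u \<psi>)"

text \<open>Equality with the kernel rather than isomorphism: the syzygies stay on the type of the
  module and inherit the operations of the covering projective module.\<close>

primrec syzygy :: "nat \<Rightarrow> 'r ring \<Rightarrow> ('r, 'm) module \<Rightarrow> bool" where
  "syzygy 0 R N \<longleftrightarrow> left_module R N"
| "syzygy (Suc k) R N \<longleftrightarrow> (\<exists>P M g. left_module R M \<and> syzygy k R M \<and> proj R P \<and>
     g \<in> module_hom R P M \<and> g ` carrier P = carrier M \<and> N = P\<lparr>carrier := a_kernel P M g\<rparr>)"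

lemma syzygy_left_module:
  fixes N :: "('r, 'm) module"
  shows "syzygy k R N \<Longrightarrow> left_module R N"
proof (cases k)
  case (Suc j)
  assume "syzygy k R N"
  then obtain P M :: "('r, 'm) module" and g where "left_module R M" "proj R P" "g \<in> module_hom R P M"
    "N = P\<lparr>carrier := a_kernel P M g\<rparr>"
    unfolding Suc syzygy.simps(2) by (elim exE conjE) (rule that)
  then show ?thesis using left_module_kernel(1)[OF proj_left_module] by blast
qed simp

text \<open>A chain of k + 1 covers starting at a module is a chain of k covers starting at its
  first syzygy.\<close>

lemma syzygy_Suc_imp:
  fixes N :: "('r, 'm) module"
  shows "syzygy (Suc k) R N \<Longrightarrow> syzygy k R N"
proof (induction k arbitrary: N)
  case 0
  then show ?case using syzygy_left_module[OF "0.prems"] by simp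
next
  case (Suc k)
  from Suc.prems obtain P M :: "('r, 'm) module" and g where *: "left_module R M" "syzygy (Suc k) R M" "proj R P"
    "g \<in> module_hom R P M" "g ` carrier P = carrier M" "N = P\<lparr>carrier := a_kernel P M g\<rparr>"
    unfolding syzygy.simps(2)[of "Suc k"] by (elim exE conjE) (rule that)
  show ?case unfolding syzygy.simps(2)[of k]
    by (rule exI[of _ P], rule exI[of _ M], rule exI[of _ g])
      (intro conjI *(1) Suc.IH[OF *(2)] *(3-6))
qed

text \<open>Flatness of projective modules in matrix form. Solvability over \<open>R\<close> is used
  in each coordinate of the free module on \<open>carrier P\<close>, and the solution is mapped back
  to \<open>P\<close>.\<close>

lemma proj_flat:
  assumes P: "proj R P" and mat: "matrix_over R n t \<phi>" "matrix_over R t u \<psi>"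
    and exact: "\<And>x. x \<in> carrier (column_module t (regular_module R)) \<Longrightarrow>
      mact (regular_module R) n t \<phi> x = (\<lambda>_. \<zero>\<^bsub>R\<^esub>) \<Longrightarrow>
      x \<in> mact (regular_module R) t u \<psi> ` carrier (column_module u (regular_module R))"
    and x: "x \<in> carrier (column_module t P)" "mact P n t \<phi> x = (\<lambda>_. \<zero>\<^bsub>P\<^esub>)"
  obtains y where "y \<in> carrier (column_module u P)" "x = mact P t u \<psi> y"
proof -
  have PL: "left_module R P" by (rule proj_left_module[OF P])
  interpret left_module R P by (rule PL)
  let ?F = "free_module R (carrier P)" and ?A = "regular_module R"
  note R = R.ring_axioms
  note F = left_module_free[OF R, of "carrier P"]
  obtain \<sigma> where s: "\<sigma> \<in> module_hom R P ?F" "\<And>x. x \<in> carrier P \<Longrightarrow> lin R P (\<lambda>x. x) (\<sigma> x) = x"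
    using P unfolding proj_def by (elim conjE bexE) (rule that, assumption, erule bspec, assumption)
  interpret s: module_morphism R P ?F \<sigma> by (rule module_morphismI[OF PL F s(1)])
  note l = canonical_cover(1)[OF PL order_refl]
  interpret l: module_morphism R ?F P "lin R P (\<lambda>x. x)" by (rule module_morphismI[OF F PL l])
  define f where "f j = \<sigma> (x j)" for j
  have f: "f \<in> carrier (column_module t ?F)" unfolding f_def by (rule column_hom[OF PL F s(1) x(1)])
  have "mact ?F n t \<phi> f = (\<lambda>s. \<sigma> (mact P n t \<phi> x s))"
    unfolding f_def by (rule mact_hom[OF PL F s(1) mat(1) x(1)])
  then have f0: "mact ?F n t \<phi> f = (\<lambda>_. \<zero>\<^bsub>?F\<^esub>)" using s.zero by (simp add: x(2))
  have "\<exists>w\<in>carrier (column_module u ?A). (\<lambda>j. f j p) = mact ?A t u \<psi> w" for p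
  proof -
    have "mact ?A n t \<phi> (\<lambda>j. f j p) = (\<lambda>_. \<zero>\<^bsub>R\<^esub>)"
      using f0 by (simp add: fun_eq_iff mact_eval[OF R mat(1) f, symmetric])
    then show ?thesis using exact[OF column_eval[OF R f]] by (simp add: image_iff)
  qed
  then obtain w0 where w0: "\<And>p. w0 p \<in> carrier (column_module u ?A)" "\<And>p. (\<lambda>j. f j p) = mact ?A t u \<psi> (w0 p)"
    by metis
  \<comment> \<open>Where the whole coordinate column vanishes the zero solution is taken; arbitrary
    solutions there could make the support infinite.\<close>
  define w where "w p = (if \<forall>j. f j p = \<zero>\<^bsub>R\<^esub> then (\<lambda>_. \<zero>\<^bsub>R\<^esub>) else w0 p)" for p
  interpret A: left_module R ?A by (rule left_module_regular[OF R])
  have w: "w p \<in> carrier (column_module u ?A)" "(\<lambda>j. f j p) = mact ?A t u \<psi> (w p)" for p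
  proof -
    show "w p \<in> carrier (column_module u ?A)" using w0(1) by (simp add: w_def column_carrier)
    show "(\<lambda>j. f j p) = mact ?A t u \<psi> (w p)"
    proof (cases "\<forall>j. f j p = \<zero>\<^bsub>R\<^esub>")
      case True
      have "finsum ?A (\<lambda>j. \<psi> s j \<odot>\<^bsub>?A\<^esub> \<zero>\<^bsub>R\<^esub>) {..<u} = \<zero>\<^bsub>R\<^esub>" if "s < t" for s
      proof -
        have "finsum ?A (\<lambda>j. \<psi> s j \<odot>\<^bsub>?A\<^esub> \<zero>\<^bsub>R\<^esub>) {..<u} = finsum ?A (\<lambda>j. \<zero>\<^bsub>?A\<^esub>) {..<u}"
          using mat(2) that by (intro A.M.finsum_cong') (auto simp: matrix_over_def)
        then show ?thesis using A.M.finsum_zero[of "{..<u}"] by simp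
      qed
      then show ?thesis using True by (simp add: w_def mact_def cong: if_cong)
    next
      case False
      then have "w p = w0 p" unfolding w_def by (rule if_not_P)
      then show ?thesis using w0(2)[of p] by (simp only:)
    qed
  qed
  define g where "g m p = w p m" for m p
  have fin: "finite (\<Union>j<t. {p. f j p \<noteq> \<zero>\<^bsub>R\<^esub>})"
    using f by (auto simp: column_carrier[of f] power_module_carrier)
  have fz: "f j p = \<zero>\<^bsub>R\<^esub>" if "j \<ge> t" for j p
    using f that by (simp add: column_carrier[of f])
  have "g m \<in> carrier ?F" if m: "m < u" for m
  proof -
    have "{p. g m p \<noteq> \<zero>\<^bsub>R\<^esub>} \<subseteq> (\<Union>j<t. {p. f j p \<noteq> \<zero>\<^bsub>R\<^esub>})"
      using fz by (clarsimp simp: g_def w_def split: if_splits) (metis not_less lessThan_iff)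
    then have "finite {p. g m p \<noteq> \<zero>\<^bsub>R\<^esub>}" using fin by (rule finite_subset)
    moreover have "g m p \<in> carrier R" for p using w(1)[of p] m by (simp add: g_def column_carrier)
    moreover have "g m p = \<zero>\<^bsub>R\<^esub>" if "p \<notin> carrier P" for p
    proof -
      have "f j p = \<zero>\<^bsub>R\<^esub>" for j
        using f that fz[of j p] by (cases "j < t") (auto simp: column_carrier[of f] power_module_carrier)
      then show ?thesis by (simp add: g_def w_def)
    qed
    ultimately show ?thesis by (simp add: power_module_carrier)
  qed
  moreover have "g m = \<zero>\<^bsub>?F\<^esub>" if m: "m \<ge> u" for m
    using w(1) m by (simp add: g_def column_carrier fun_eq_iff)
  ultimately have g: "g \<in> carrier (column_module u ?F)" by (simp add: column_carrier[of g])
  have "f = mact ?F t u \<psi> g"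
    using w(2) by (simp add: fun_eq_iff mact_eval[OF R mat(2) g] g_def)
  then have "(\<lambda>j. lin R P (\<lambda>x. x) (f j)) = mact P t u \<psi> (\<lambda>m. lin R P (\<lambda>x. x) (g m))"
    using mact_hom[OF F PL l mat(2) g] by simp
  moreover have "lin R P (\<lambda>x. x) (f j) = x j" for j
  proof (cases "j < t")
    case True
    then show ?thesis using s(2) x(1) by (simp add: f_def column_carrier)
  next
    case False
    then show ?thesis using l.zero x(1) fz[of j] by (simp add: column_carrier) (metis ext not_less)
  qed
  ultimately have "x = mact P t u \<psi> (\<lambda>m. lin R P (\<lambda>x. x) (g m))" by simp
  then show ?thesis by (rule that[OF column_hom[OF F PL l g]])
qed

text \<open>This is Tor_1(C, N) = 0 for the cokernel C of \<phi>. An equation \<phi>\<sigma>\<phi> =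
  \<phi> makes C projective, and each further stage of \<open>good\<close> adds one, so
  \<open>good k\<close> gives C dimension at most k; and Tor_1(C, N) = Tor_(k+1)(C, M) if
  \<open>N\<close> is a k-th syzygy of M. In the induction step \<open>N\<close> lies in a
  projective \<open>P0\<close>. Flatness gives \<pi> x = \<psi> y over \<open>P0\<close>, the
  induction hypothesis replaces y by a column over \<open>N\<close>, and for a lift v of it to
  \<open>P\<close> the column x - \<psi> v lies over the kernel and has the same image because
  \<phi>\<psi> = 0.\<close>

theorem syzygy_exact:
  fixes P N :: "('r, 'm) module"
  assumes "syzygy k R N" "proj R P" "\<pi> \<in> module_hom R P N" "\<pi> ` carrier P = carrier N"
    "matrix_over R n t \<phi>" "good k R n t \<phi>"
    "x \<in> carrier (column_module t P)" "\<forall>s<n. mact P n t \<phi> x s \<in> a_kernel P N \<pi>"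
  shows "\<exists>y \<in> carrier (column_module t P). (\<forall>j<t. y j \<in> a_kernel P N \<pi>) \<and>
    mact P n t \<phi> y = mact P n t \<phi> x"
  using assms
proof (induction k arbitrary: N P \<pi> n t \<phi> x)
  case 0
  obtain \<sigma> where \<sigma>: "matrix_over R t n \<sigma>" "\<And>w. w\<in>carrier (column_module t (regular_module R)) \<Longrightarrow>
       mact (regular_module R) n t \<phi> (mact (regular_module R) t n \<sigma> (mact (regular_module R) n t \<phi> w)) =
       mact (regular_module R) n t \<phi> w"
    using "0.prems"(6) unfolding good.simps(1) by (elim exE conjE) (rule that, assumption, erule bspec, assumption)
  have PL: "left_module R P" and NL: "left_module R N"
    using proj_left_module[OF "0.prems"(2)] "0.prems"(1) by simp_all
  interpret p: module_morphism R P N \<pi> by (rule module_morphismI[OF PL NL "0.prems"(3)])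
  let ?K = "a_kernel P N \<pi>"
  \<comment> \<open>As \<phi> x lies over the kernel, so does \<sigma>\<phi> x, and
    \<phi>\<sigma>\<phi> = \<phi>.\<close>
  let ?y = "mact P t n \<sigma> (mact P n t \<phi> x)"
  note px = mact_carrier[OF PL "0.prems"(5,7)]
  have pxK: "mact P n t \<phi> x \<in> carrier (column_module n (P\<lparr>carrier := ?K\<rparr>))"
    using px "0.prems"(8) by (simp add: column_submodule[OF PL p.submodule_kernel])
  have "?y \<in> carrier (column_module t (P\<lparr>carrier := ?K\<rparr>))"
    using mact_carrier[OF p.M.left_module_submodule[OF p.submodule_kernel] \<sigma>(1) pxK]
    by (simp add: mact_submodule[OF PL p.submodule_kernel \<sigma>(1) pxK])
  then have "?y \<in> carrier (column_module t P)" "\<forall>j<t. ?y j \<in> ?K"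
    by (simp_all add: column_submodule[OF PL p.submodule_kernel])
  moreover have "mact P n t \<phi> ?y = mact P n t \<phi> x"
    by (rule mact_regular_inverse[OF p.M.R.ring_axioms "0.prems"(5) \<sigma> PL "0.prems"(7)])
  ultimately show ?case by blast
next
  case (Suc k)
  let ?A = "regular_module R"
  obtain u \<psi> where \<psi>: "matrix_over R t u \<psi>" and good: "good k R t u \<psi>"
    and ex: "\<And>x. x \<in> carrier (column_module t ?A) \<Longrightarrow> mact ?A n t \<phi> x = (\<lambda>_. \<zero>\<^bsub>R\<^esub>) \<longleftrightarrow>
       x \<in> mact ?A t u \<psi> ` carrier (column_module u ?A)"
    using Suc.prems(6) unfolding good.simps(2)
    by (elim exE conjE) (rule that, assumption, assumption, erule bspec, assumption)
  obtain P0 M :: "('r, 'm) module" and g where M: "left_module R M" "syzygy k R M" and P0: "proj R P0"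
    and g: "g \<in> module_hom R P0 M" "g ` carrier P0 = carrier M" and N: "N = P0\<lparr>carrier := a_kernel P0 M g\<rparr>"
    using Suc.prems(1) unfolding syzygy.simps(2) by (elim exE conjE) (rule that)
  note PL = proj_left_module[OF Suc.prems(2)] and P0L = proj_left_module[OF P0]
  note \<phi> = Suc.prems(5) and x = Suc.prems(7)
  interpret g: module_morphism R P0 M g by (rule module_morphismI[OF P0L M(1) g(1)])
  have NL: "left_module R N" unfolding N by (rule g.M.left_module_submodule[OF g.submodule_kernel])
  note R = g.M.R.ring_axioms
  interpret p: module_morphism R P N \<pi> by (rule module_morphismI[OF PL NL Suc.prems(3)])
  have px: "(\<lambda>j. \<pi> (x j)) \<in> carrier (column_module t N)" by (rule column_hom[OF PL NL Suc.prems(3) x])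
  note sub = column_submodule[OF P0L g.submodule_kernel, folded N]
    and subm = mact_submodule[OF P0L g.submodule_kernel, folded N]
  have pxP: "(\<lambda>j. \<pi> (x j)) \<in> carrier (column_module t P0)" "\<forall>j<t. \<pi> (x j) \<in> a_kernel P0 M g"
    using px by (simp_all add: sub)
  have A: "left_module R ?A" by (rule left_module_regular[OF R])
  have "mact P0 n t \<phi> (\<lambda>j. \<pi> (x j)) = (\<lambda>s. \<pi> (mact P n t \<phi> x s))"
    using mact_hom[OF PL NL Suc.prems(3) \<phi> x] by (simp add: subm[OF \<phi> px])
  also have "\<dots> = (\<lambda>_. \<zero>\<^bsub>P0\<^esub>)"
  proof
    fix s
    have "\<pi> (mact P n t \<phi> x s) = \<zero>\<^bsub>N\<^esub>"
    proof (cases "s < n")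
      case True
      then show ?thesis using Suc.prems(8) by (simp add: a_kernel_iff)
    next
      case False
      then show ?thesis using p.zero by (simp add: mact_def)
    qed
    then show "\<pi> (mact P n t \<phi> x s) = \<zero>\<^bsub>P0\<^esub>" by (simp add: N)
  qed
  finally obtain y where y: "y \<in> carrier (column_module u P0)" "(\<lambda>j. \<pi> (x j)) = mact P0 t u \<psi> y"
    using proj_flat[OF P0 \<phi> \<psi> _ pxP(1)] ex by metis
  have "\<exists>z\<in>carrier (column_module u P0). (\<forall>j<u. z j \<in> a_kernel P0 M g) \<and> mact P0 t u \<psi> z = mact P0 t u \<psi> y"
    by (rule Suc.IH[OF M(2) P0 g \<psi> good y(1)]) (use pxP(2) y(2) in \<open>metis\<close>)
  then obtain z where z: "z \<in> carrier (column_module u P0)" "\<forall>j<u. z j \<in> a_kernel P0 M g"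
    "(\<lambda>j. \<pi> (x j)) = mact P0 t u \<psi> z" using y(2) by (elim bexE conjE) (rule that, assumption, assumption, simp)
  have zN: "z \<in> carrier (column_module u N)" using z by (simp add: sub)
  define v where "v j = (if j < u then SOME p. p \<in> carrier P \<and> \<pi> p = z j else \<zero>\<^bsub>P\<^esub>)" for j
  have v': "v j \<in> carrier P \<and> \<pi> (v j) = z j" if "j < u" for j
  proof -
    have "z j \<in> \<pi> ` carrier P" using zN that Suc.prems(4) by (simp add: column_carrier)
    then have "\<exists>p. p \<in> carrier P \<and> \<pi> p = z j" by (auto simp: image_iff)
    from someI_ex[OF this] show ?thesis using that by (simp add: v_def)
  qed
  have v: "v \<in> carrier (column_module u P)" using v' by (simp add: column_carrier v_def)
  have pv: "(\<lambda>j. \<pi> (v j)) = z"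
  proof
    fix j show "\<pi> (v j) = z j"
      using v'[of j] zN p.zero by (cases "j < u") (simp_all add: v_def column_carrier)
  qed
  let ?w = "mact P t u \<psi> v"
  have w: "?w \<in> carrier (column_module t P)" by (rule mact_carrier[OF PL \<psi> v])
  have pw: "\<pi> (?w j) = \<pi> (x j)" for j
    using fun_cong[OF mact_hom[OF PL NL Suc.prems(3) \<psi> v], of j] fun_cong[OF z(3), of j]
    by (simp add: pv subm[OF \<psi> zN])
  define y' where "y' j = x j \<ominus>\<^bsub>P\<^esub> ?w j" for j
  have c: "x j \<in> carrier P" "?w j \<in> carrier P" for j
    using power_module_mem[OF PL x] power_module_mem[OF PL w] by auto
  have "y' \<in> carrier (column_module t P)"
    using x w c by (auto simp: y'_def column_carrier p.M.M.minus_eq_zero_iff)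
  moreover have "y' j \<in> a_kernel P N \<pi>" for j
    using c[of j] by (simp add: y'_def a_kernel_iff pw p.N.M.minus_eq_zero_iff)
  moreover have "mact P n t \<phi> y' = mact P n t \<phi> x"
  proof
    fix s
    have "mact P n t \<phi> ?w = (\<lambda>_. \<zero>\<^bsub>P\<^esub>)"
      by (rule mact_comp_zero[OF R \<phi> \<psi> _ PL v])
        (subst ex[OF mact_carrier[OF A \<psi>]], assumption, rule imageI)
    moreover have "mact P n t \<phi> x s \<in> carrier P"
      by (rule power_module_mem[OF PL mact_carrier[OF PL \<phi> x]])
    ultimately show "mact P n t \<phi> y' s = mact P n t \<phi> x s"
      unfolding y'_def by (simp add: mact_minus[OF PL \<phi> x w])
  qed
  ultimately show ?case by blast
qed

section \<open>Matrix presentations of right modules\<close>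

lemma finitely_generated_family:
  assumes "left_module R M" "finitely_generated R M"
  obtains u z where "\<And>m. m < (u::nat) \<Longrightarrow> z m \<in> carrier M"
    "lin R M z ` carrier (free_module R {..<u}) = carrier M"
proof -
  interpret left_module R M by fact
  obtain S where S: "finite S" "S \<subseteq> carrier M" "\<And>H. submodule H R M \<Longrightarrow> S \<subseteq> H \<Longrightarrow> H = carrier M"
    using assms(2) by (elim finitely_generatedE) (rule that)
  obtain z where z: "bij_betw z {0..<card S} S" using ex_bij_betw_nat_finite[OF S(1)] by blast
  let ?u = "card S"
  have zS: "z ` {..<?u} = S" using z by (simp add: bij_betw_def atLeast0LessThan)
  have zM: "z m \<in> carrier M" if "m < ?u" for m
    using zS S(2) that by blast
  then have zP: "z \<in> {..<?u} \<rightarrow> carrier M" by simp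
  note F = left_module_free[OF R.ring_axioms, of "{..<?u}"]
  interpret l: module_morphism R "free_module R {..<?u}" M "lin R M z"
    by (rule module_morphismI[OF F assms(1) lin_hom[OF assms(1) zP]])
  have "S \<subseteq> lin R M z ` carrier (free_module R {..<?u})"
  proof
    fix s assume "s \<in> S"
    then obtain m where "m < ?u" "s = z m" using zS by blast
    then show "s \<in> lin R M z ` carrier (free_module R {..<?u})"
      using lin_unit_vector[OF assms(1) zP, of m] R.ring_axioms
      by (intro image_eqI[of _ _ "unit_vector R m"]) auto
  qed
  then have "lin R M z ` carrier (free_module R {..<?u}) = carrier M"
    by (rule S(3)[OF l.submodule_image[OF l.M.submodule_carrier]])
  with zM show ?thesis by (rule that)
qed

lemma free_module_op_carrier: "carrier (free_module (op_ring R) S) = carrier (free_module R S)"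
  by (simp add: power_module_def)

lemma finsum_regular_op: "finsum (regular_module (op_ring R)) = finsum (regular_module R)"
  by (simp add: finsum_def regular_module_def ideal_module_def op_ring_def)

text \<open>Over the opposite ring coefficients multiply from the right, so a combination of the
  columns \<open>z m\<close> is the matrix with these columns applied to \<open>w\<close>.\<close>

lemma lin_op_mact:
  assumes R: "ring R" and z: "\<And>m. m < u \<Longrightarrow> z m \<in> carrier (free_module R {..<t})"
    and w: "w \<in> carrier (free_module R {..<u})"
  shows "lin (op_ring R) (free_module (op_ring R) {..<t}) z w = mact (regular_module R) t u (\<lambda>j m. z m j) w"
proof
  fix j
  let ?S = "op_ring R" and ?F = "free_module (op_ring R) {..<t}"
  note S = ring_op_ring[OF R]
  note SR = left_module_regular[OF S]
  interpret SR: left_module ?S "regular_module ?S" by (rule SR)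
  have zP: "z \<in> {..<u} \<rightarrow> carrier ?F" using z by (simp add: free_module_op_carrier)
  have wS: "w \<in> carrier (free_module ?S {..<u})" using w by (simp add: free_module_op_carrier)
  have zj: "z m j \<in> carrier R" if "m < u" for m
    using power_module_mem[OF left_module_regular[OF R] z[OF that], of j] by simp
  have w_zero: "w m = \<zero>\<^bsub>R\<^esub>" if "\<not> m < u" for m using w that by (simp add: column_carrier)
  show "lin ?S ?F z w j = mact (regular_module R) t u (\<lambda>j m. z m j) w j"
  proof (cases "j < t")
    case True
    have "lin ?S ?F z w j = lin ?S (regular_module ?S) (\<lambda>m. z m j) w"
      by (rule hom_lin[OF left_module_free[OF S] SR power_module_eval_hom[OF SR] zP wS])
    also have "\<dots> = finsum (regular_module ?S) (\<lambda>m. w m \<odot>\<^bsub>regular_module ?S\<^esub> z m j) {..<u}"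
      by (rule lin_eq_finsum[OF SR _ wS]) (use zj w_zero in auto)
    finally show ?thesis using True by (simp add: mact_def finsum_regular_op cong: if_cong)
  next
    case False
    have "lin ?S ?F z w \<in> carrier ?F"
      by (rule module_hom_mem[OF lin_hom[OF left_module_free[OF S] zP] wS])
    then show ?thesis using False by (simp add: column_carrier mact_def)
  qed
qed

text \<open>The relations among the generators \<open>y\<close> form a finitely generated right
  module because the algebra is finite-dimensional. Generators of it are the columns of \<psi>, and
  the recursion continues with the module of relations. This module lies in a free module on
  \<open>{..<t}\<close>, which is why all modules here live on
  \<open>nat \<Rightarrow> 'r\<close>.\<close>

theorem (in finite_dimensional_algebra) pdle_imp_good:
  fixes Y :: "('r, nat \<Rightarrow> 'r) module"
  assumes large: "large (carrier R) TYPE(nat \<Rightarrow> 'r)" and "pdle d (op_ring R) Y"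
    "\<And>j. j < t \<Longrightarrow> y j \<in> carrier Y" "lin (op_ring R) Y y ` carrier (free_module R {..<t}) = carrier Y"
  shows "\<exists>u \<psi>. matrix_over R t u \<psi> \<and>
    (\<forall>x\<in>carrier (free_module R {..<t}). lin (op_ring R) Y y x = \<zero>\<^bsub>Y\<^esub> \<longleftrightarrow>
      x \<in> mact (regular_module R) t u \<psi> ` carrier (free_module R {..<u})) \<and> good d R t u \<psi>"
  using assms(2-4)
proof (induction d arbitrary: Y t y)
  let ?S = "op_ring R" and ?A = "regular_module R"
  note S = ring_op_ring[OF ring_R]
  interpret op: finite_dimensional_algebra ?S \<kappa> by (rule op_finite_dimensional)
  have step: "\<exists>u z. (\<forall>m<u. z m \<in> carrier F \<and> p (z m) = \<zero>\<^bsub>Y\<^esub>) \<and> matrix_over R t u (\<lambda>j m. z m j) \<and>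
      lin ?S (F\<lparr>carrier := a_kernel F Y p\<rparr>) z ` carrier (free_module R {..<u}) = a_kernel F Y p \<and>
      (\<forall>w\<in>carrier (free_module R {..<u}). lin ?S (F\<lparr>carrier := a_kernel F Y p\<rparr>) z w = mact ?A t u (\<lambda>j m. z m j) w)"
    if Y: "left_module ?S Y" and p: "p \<in> module_hom ?S F Y" and F: "F = free_module ?S {..<t}"
    for t and F :: "('r, nat \<Rightarrow> 'r) module" and Y :: "('r, nat \<Rightarrow> 'r) module" and p
  proof -
    have FL: "left_module ?S F" unfolding F by (rule left_module_free[OF S])
    interpret p: module_morphism ?S F Y p by (rule module_morphismI[OF FL Y p])
    let ?K = "F\<lparr>carrier := a_kernel F Y p\<rparr>"
    have K: "left_module ?S ?K" by (rule p.M.left_module_submodule[OF p.submodule_kernel])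
    have "finitely_generated ?S F" unfolding F by (rule finitely_generated_free[OF S]) simp
    then have "finitely_generated ?S ?K"
      by (rule op.finitely_generated_submodule[OF FL _ p.submodule_kernel])
    then obtain u :: nat and z where z: "\<And>m. m < u \<Longrightarrow> z m \<in> carrier ?K"
      "lin ?S ?K z ` carrier (free_module ?S {..<u}) = carrier ?K"
      by (rule finitely_generated_family[OF K]) (rule that)
    have zF: "z m \<in> carrier F" "p (z m) = \<zero>\<^bsub>Y\<^esub>" if "m < u" for m
      using z(1)[OF that] by (simp_all add: a_kernel_iff)
    have zF': "z m \<in> carrier (free_module R {..<t})" if "m < u" for m
      using zF(1)[OF that] unfolding F free_module_op_carrier .
    have "lin ?S ?K z w = mact ?A t u (\<lambda>j m. z m j) w" if w: "w \<in> carrier (free_module R {..<u})" for w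
    proof -
      have "lin ?S ?K z w = lin ?S F z w"
        by (rule hom_lin[OF K FL inclusion_hom])
          (use z(1) w in \<open>auto simp: free_module_op_carrier a_kernel_iff\<close>)
      then show ?thesis unfolding F using lin_op_mact[OF ring_R zF' w] by simp
    qed
    moreover have "matrix_over R t u (\<lambda>j m. z m j)"
      using zF' by (simp add: matrix_over_def column_carrier)
    ultimately show ?thesis using zF z(2) by (intro exI[of _ u] exI[of _ z]) (simp add: free_module_op_carrier)
  qed
  {
    case 0
    let ?F = "free_module ?S {..<t}"
    have Y: "proj ?S Y" using "0.prems"(1) by simp
    note YL = proj_left_module[OF Y]
    have yP: "y \<in> {..<t} \<rightarrow> carrier Y" using "0.prems"(2) by simp
    note p = lin_hom[OF YL yP] and F = left_module_free[OF S, of "{..<t}"]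
    let ?p = "lin ?S Y y"
    interpret p: module_morphism ?S ?F Y ?p by (rule module_morphismI[OF F YL p])
    obtain u z where z0: "\<forall>m<u. z m \<in> carrier ?F \<and> ?p (z m) = \<zero>\<^bsub>Y\<^esub>"
      and mat: "matrix_over R t u (\<lambda>j m. z m j)"
      and im: "lin ?S (?F\<lparr>carrier := a_kernel ?F Y ?p\<rparr>) z ` carrier (free_module R {..<u}) = a_kernel ?F Y ?p"
      and ma0: "\<forall>w\<in>carrier (free_module R {..<u}).
        lin ?S (?F\<lparr>carrier := a_kernel ?F Y ?p\<rparr>) z w = mact ?A t u (\<lambda>j m. z m j) w"
      using step[OF YL p refl] by (elim exE conjE) (rule that)
    have z: "z m \<in> carrier ?F" "?p (z m) = \<zero>\<^bsub>Y\<^esub>" if "m < u" for m using z0 that by blast+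
    note ma = bspec[OF ma0]
    let ?\<psi> = "\<lambda>j m. z m j"
    have ker: "a_kernel ?F Y ?p = mact ?A t u ?\<psi> ` carrier (free_module R {..<u})"
      by (rule trans[OF im[symmetric] image_cong[OF refl ma]])
    have zl: "lin ?S ?F z w = mact ?A t u ?\<psi> w" if "w \<in> carrier (free_module R {..<u})" for w
      by (rule lin_op_mact[OF ring_R _ that]) (use z(1) in \<open>simp add: free_module_op_carrier\<close>)
    obtain s where s: "s \<in> module_hom ?S Y ?F" "\<And>x. x \<in> carrier Y \<Longrightarrow> ?p (s x) = x"
      by (rule proj_lift[OF Y F YL p _ module_hom_ident])
        (use "0.prems"(3) that in \<open>simp_all add: free_module_op_carrier\<close>)
    \<comment> \<open>A section of the projective \<open>Y\<close> yields an idempotent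
      \<open>e\<close> onto the kernel. Lifting \<open>e\<close> along the generators of the kernel
      gives a matrix \<sigma> with \<psi>\<sigma> = e, and hence \<psi>\<sigma>\<psi> =
      \<psi>.\<close>
    define e where "e x = x \<ominus>\<^bsub>?F\<^esub> s (?p x)" for x
    have e: "e \<in> module_hom ?S ?F ?F"
      unfolding e_def by (rule module_hom_minus[OF F F module_hom_ident module_hom_comp[OF p s(1)]])
    have e_ker: "e x \<in> a_kernel ?F Y ?p" if "x \<in> carrier ?F" for x
    proof -
      have "s (?p x) \<in> carrier ?F" by (rule module_hom_mem[OF s(1) p.closed[OF that]])
      then show ?thesis using that module_hom_mem[OF e that] s(2)[OF p.closed[OF that]] p.closed[OF that]
        unfolding a_kernel_iff by (simp add: e_def p.N.M.minus_eq_zero_iff del: power_module_simps)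
    qed
    have e_id: "e x = x" if "x \<in> a_kernel ?F Y ?p" for x
    proof -
      interpret s: module_morphism ?S Y ?F s by (rule module_morphismI[OF YL F s(1)])
      have "x \<in> carrier ?F" "s (?p x) = \<zero>\<^bsub>?F\<^esub>" using that s.zero by (simp_all add: a_kernel_iff)
      then show ?thesis unfolding e_def by (simp add: p.M.M.minus_zero_right del: power_module_simps)
    qed
    have "\<exists>w. w \<in> carrier (free_module R {..<u}) \<and> lin ?S ?F z w = e (unit_vector ?S j)" if "j < t" for j
    proof -
      have "e (unit_vector ?S j) \<in> a_kernel ?F Y ?p" by (rule e_ker) (use that S in simp)
      then show ?thesis unfolding ker using zl by (auto simp: image_iff)
    qed
    then obtain W where W: "\<And>j. j < t \<Longrightarrow> W j \<in> carrier (free_module R {..<u})"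
      "\<And>j. j < t \<Longrightarrow> lin ?S ?F z (W j) = e (unit_vector ?S j)" by metis
    let ?G = "free_module ?S {..<u}"
    note G = left_module_free[OF S, of "{..<u}"]
    have WP: "W \<in> {..<t} \<rightarrow> carrier ?G" using W(1) by (simp add: free_module_op_carrier)
    have zP: "z \<in> {..<u} \<rightarrow> carrier ?F" using z(1) by simp
    note tau = lin_hom[OF G WP]
    have etau: "lin ?S ?F z (lin ?S ?G W x) = e x" if "x \<in> carrier ?F" for x
    proof (rule free_module_hom_ext[OF S F module_hom_comp[OF tau lin_hom[OF F zP]] e _ that])
      fix j assume "j \<in> {..<t}"
      then show "lin ?S ?F z (lin ?S ?G W (unit_vector ?S j)) = e (unit_vector ?S j)"
        using lin_unit_vector[OF G WP, of j] W(2) by simp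
    qed
    let ?\<sigma> = "\<lambda>m j. W j m"
    have mat\<sigma>: "matrix_over R u t ?\<sigma>" using W(1) by (simp add: matrix_over_def column_carrier)
    have "mact ?A t u ?\<psi> (mact ?A u t ?\<sigma> (mact ?A t u ?\<psi> w)) = mact ?A t u ?\<psi> w"
      if w: "w \<in> carrier (free_module R {..<u})" for w
    proof -
      let ?x = "mact ?A t u ?\<psi> w"
      have xK: "?x \<in> a_kernel ?F Y ?p" unfolding ker using w by simp
      then have x: "?x \<in> carrier ?F" by (simp add: a_kernel_iff)
      then have xR: "?x \<in> carrier (free_module R {..<t})" by (simp add: free_module_op_carrier)
      have lx: "lin ?S ?G W ?x = mact ?A u t ?\<sigma> ?x" by (rule lin_op_mact[OF ring_R W(1) xR])
      have "mact ?A u t ?\<sigma> ?x \<in> carrier (free_module R {..<u})"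
        by (rule mact_carrier[OF left_module_regular[OF ring_R] mat\<sigma> xR])
      then have "mact ?A t u ?\<psi> (mact ?A u t ?\<sigma> ?x) = lin ?S ?F z (lin ?S ?G W ?x)"
        using zl lx by simp
      also have "\<dots> = ?x" using etau[OF x] e_id[OF xK] by simp
      finally show ?thesis .
    qed
    then have "good 0 R t u ?\<psi>" unfolding good.simps(1) using mat\<sigma> by blast
    moreover have "\<forall>x\<in>carrier (free_module R {..<t}). ?p x = \<zero>\<^bsub>Y\<^esub> \<longleftrightarrow>
      x \<in> mact ?A t u ?\<psi> ` carrier (free_module R {..<u})"
      unfolding ker[symmetric] by (simp add: a_kernel_iff free_module_op_carrier)
    ultimately show ?case using mat by blast
  next
    case (Suc d)
    let ?F = "free_module ?S {..<t}"
    have YL: "left_module ?S Y" by (rule pdle_left_module[OF Suc.prems(1)])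
    have yP: "y \<in> {..<t} \<rightarrow> carrier Y" using Suc.prems(2) by simp
    note p = lin_hom[OF YL yP] and F = left_module_free[OF S, of "{..<t}"]
    let ?p = "lin ?S Y y"
    let ?K = "?F\<lparr>carrier := a_kernel ?F Y ?p\<rparr>"
    obtain u z where z0: "\<forall>m<u. z m \<in> carrier ?F \<and> ?p (z m) = \<zero>\<^bsub>Y\<^esub>"
      and mat: "matrix_over R t u (\<lambda>j m. z m j)"
      and im: "lin ?S ?K z ` carrier (free_module R {..<u}) = a_kernel ?F Y ?p"
      and ma0: "\<forall>w\<in>carrier (free_module R {..<u}).
        lin ?S ?K z w = mact ?A t u (\<lambda>j m. z m j) w"
      using step[OF YL p refl] by (elim exE conjE) (rule that)
    have z: "z m \<in> carrier ?F" "?p (z m) = \<zero>\<^bsub>Y\<^esub>" if "m < u" for m using z0 that by blast+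
    note ma = bspec[OF ma0]
    let ?\<psi> = "\<lambda>j m. z m j"
    have ker: "a_kernel ?F Y ?p = mact ?A t u ?\<psi> ` carrier (free_module R {..<u})"
      by (rule trans[OF im[symmetric] image_cong[OF refl ma]])
    have "pdle d ?S ?K"
      by (rule schanuel[OF _ Suc.prems(1) proj_free[OF S] p])
        (use large Suc.prems(3) in \<open>simp_all add: free_module_op_carrier\<close>)
    then have "\<exists>u' \<psi>'. matrix_over R u u' \<psi>' \<and>
      (\<forall>x\<in>carrier (free_module R {..<u}). lin ?S ?K z x = \<zero>\<^bsub>?K\<^esub> \<longleftrightarrow>
        x \<in> mact ?A u u' \<psi>' ` carrier (free_module R {..<u'})) \<and> good d R u u' \<psi>'"
      by (rule Suc.IH) (use z im in \<open>simp_all add: a_kernel_iff\<close>)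
    then have "good (Suc d) R t u ?\<psi>" unfolding good.simps(2) by (simp add: ma)
    moreover have "\<forall>x\<in>carrier (free_module R {..<t}). ?p x = \<zero>\<^bsub>Y\<^esub> \<longleftrightarrow>
      x \<in> mact ?A t u ?\<psi> ` carrier (free_module R {..<u})"
      unfolding ker[symmetric] by (simp add: a_kernel_iff free_module_op_carrier)
    ultimately show ?case using mat by blast
  }
qed

theorem (in finite_dimensional_algebra) presentation_good:
  fixes Y :: "('r, 'r) module"
  assumes large: "large (carrier R) TYPE(nat \<Rightarrow> 'r)" and Y: "pdle d (op_ring R) Y"
    and fg: "finitely_generated (op_ring R) Y"
  obtains t y u \<psi> where "\<And>j. j < t \<Longrightarrow> y j \<in> carrier Y"
    "lin (op_ring R) Y y ` carrier (free_module R {..<t}) = carrier Y"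
    "matrix_over R t u \<psi>"
    "\<And>x. x\<in>carrier (free_module R {..<t}) \<Longrightarrow> lin (op_ring R) Y y x = \<zero>\<^bsub>Y\<^esub> \<longleftrightarrow>
      x \<in> mact (regular_module R) t u \<psi> ` carrier (free_module R {..<u})"
    "good d R t u \<psi>"
proof -
  let ?S = "op_ring R"
  have YL: "left_module ?S Y" by (rule pdle_left_module[OF Y])
  obtain t :: nat and y where y: "\<And>j. j < t \<Longrightarrow> y j \<in> carrier Y" "lin ?S Y y ` carrier (free_module ?S {..<t}) = carrier Y"
    by (rule finitely_generated_family[OF YL fg]) (rule that)
  have yP: "y \<in> {..<t} \<rightarrow> carrier Y" using y(1) by simp
  \<comment> \<open>Elements are turned into constant sequences, since \<open>pdle_imp_good\<close>
    speaks of modules on \<open>nat \<Rightarrow> 'r\<close>.\<close>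
  define c where "c x = (\<lambda>_::nat. x)" for x :: 'r
  have inj: "inj_on c (carrier Y)" by (auto simp: c_def inj_on_def fun_eq_iff)
  let ?Z = "image_module c Y"
  note t = transport_module[OF YL inj]
  interpret Y: left_module ?S Y by (rule YL)
  interpret c: module_morphism ?S Y ?Z c by (rule module_morphismI[OF YL t(1,2)])
  have pdZ: "pdle d ?S ?Z"
    by (rule pdle_module_retract[OF _ t(1,4,2) _ Y]) (use large t(3) in \<open>simp_all add: f_inv_into_f\<close>)
  have lc: "lin ?S ?Z (\<lambda>j. c (y j)) x = c (lin ?S Y y x)" if "x \<in> carrier (free_module R {..<t})" for x
    by (rule hom_lin[OF YL t(1,2) yP, symmetric]) (use that in \<open>simp add: free_module_op_carrier\<close>)
  have surj: "lin ?S ?Z (\<lambda>j. c (y j)) ` carrier (free_module R {..<t}) = carrier ?Z"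
  proof -
    have "lin ?S ?Z (\<lambda>j. c (y j)) ` carrier (free_module R {..<t}) = (\<lambda>x. c (lin ?S Y y x)) ` carrier (free_module R {..<t})"
      by (rule image_cong[OF refl lc])
    also have "\<dots> = c ` carrier Y" unfolding y(2)[symmetric] free_module_op_carrier by (simp add: image_image)
    finally show ?thesis using t(3) by simp
  qed
  obtain u \<psi> where \<psi>: "matrix_over R t u \<psi>" "good d R t u \<psi>"
    and ex0: "\<forall>x\<in>carrier (free_module R {..<t}). lin ?S ?Z (\<lambda>j. c (y j)) x = \<zero>\<^bsub>?Z\<^esub> \<longleftrightarrow>
      x \<in> mact (regular_module R) t u \<psi> ` carrier (free_module R {..<u})"
  proof -
    have "\<exists>u \<psi>. matrix_over R t u \<psi> \<and>
      (\<forall>x\<in>carrier (free_module R {..<t}). lin ?S ?Z (\<lambda>j. c (y j)) x = \<zero>\<^bsub>?Z\<^esub> \<longleftrightarrow>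
        x \<in> mact (regular_module R) t u \<psi> ` carrier (free_module R {..<u})) \<and> good d R t u \<psi>"
      by (rule pdle_imp_good[OF large pdZ _ surj]) (rule c.closed[OF y(1)])
    then show ?thesis by (elim exE conjE) (rule that)
  qed
  note ex = bspec[OF ex0]
  have "lin ?S Y y x = \<zero>\<^bsub>Y\<^esub> \<longleftrightarrow>
      x \<in> mact (regular_module R) t u \<psi> ` carrier (free_module R {..<u})"
    if x: "x \<in> carrier (free_module R {..<t})" for x
  proof -
    have "lin ?S Y y x \<in> carrier Y"
      by (rule module_hom_mem[OF lin_hom[OF YL yP]]) (use x in \<open>simp add: free_module_op_carrier\<close>)
    then have "lin ?S Y y x = \<zero>\<^bsub>Y\<^esub> \<longleftrightarrow> c (lin ?S Y y x) = \<zero>\<^bsub>?Z\<^esub>"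
      using inj_on_eq_iff[OF inj _ Y.M.zero_closed] c.zero by metis
    then show ?thesis using ex[OF x] lc[OF x] by simp
  qed
  with y(1) y(2)[unfolded free_module_op_carrier] \<psi>(1) show ?thesis
    using \<psi>(2) by (rule that)
qed

lemma (in finite_dimensional_algebra) syzygy_exists:
  fixes M :: "('r, 'm) module"
  assumes large: "large (carrier R) TYPE('m)" and M: "left_module R M"
  shows "\<exists>N :: ('r, 'm) module. syzygy d R N \<and> (finitely_generated R M \<longrightarrow> finitely_generated R N) \<and>
    (\<forall>p. pdle p R M \<longrightarrow> pdle p R N) \<and> (\<forall>f. pdle f R N \<longrightarrow> pdle (f + d) R M)"
proof (induction d)
  case 0
  show ?case by (rule exI[of _ M]) (simp add: M)
next
  case (Suc d)
  then obtain N :: "('r, 'm) module" where N: "syzygy d R N" "finitely_generated R M \<Longrightarrow> finitely_generated R N"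
    "\<And>p. pdle p R M \<Longrightarrow> pdle p R N" "\<And>f. pdle f R N \<Longrightarrow> pdle (f + d) R M"
    by (elim exE conjE) (rule that, assumption, simp, simp, simp)
  note NL = syzygy_left_module[OF N(1)]
  obtain P :: "('r, 'm) module" and g S c c' where P: "proj R P" "g \<in> module_hom R P N" "g ` carrier P = carrier N"
    "finitely_generated R N \<Longrightarrow> finitely_generated R P"
    by (rule free_cover_exists[OF NL large]) (rule that)
  let ?K = "P\<lparr>carrier := a_kernel P N g\<rparr>"
  note PL = proj_left_module[OF P(1)]
  have K: "submodule (a_kernel P N g) R P" by (rule left_module_kernel(2)[OF PL NL P(2)])
  show ?case
  proof (intro exI[of _ ?K] conjI impI allI)
    show "syzygy (Suc d) R ?K" unfolding syzygy.simps(2)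
      by (rule exI[of _ P], rule exI[of _ N], rule exI[of _ g]) (intro conjI NL N(1) P(1-3) refl)
    show "finitely_generated R ?K" if "finitely_generated R M"
      by (rule finitely_generated_submodule[OF PL P(4)[OF N(2)[OF that]] K])
    \<comment> \<open>The bound p is first weakened to p + 1 so that \<open>schanuel\<close> returns
      p itself; this covers p = 0.\<close>
    show "pdle p R ?K" if "pdle p R M" for p
      by (rule schanuel[OF large pdle_Suc[OF N(3)[OF that]] P(1-3)])
    show "pdle (f + Suc d) R M" if "pdle f R ?K" for f
      using N(4)[OF pdle_SucI[OF NL P(1-3) that]] by simp
  qed
qed

section \<open>Cleft extensions with nilpotent kernel\<close>

lemma (in left_module) smult_finsum:
  assumes "a \<in> carrier R" "h \<in> T \<rightarrow> carrier M"
  shows "a \<odot>\<^bsub>M\<^esub> finsum M h T = finsum M (\<lambda>s. a \<odot>\<^bsub>M\<^esub> h s) T"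
  using assms(2)
proof (induction T rule: infinite_finite_induct)
  case (insert x F)
  then have "h x \<in> carrier M" "h \<in> F \<rightarrow> carrier M" "(\<lambda>s. a \<odot>\<^bsub>M\<^esub> h s) \<in> F \<rightarrow> carrier M" using assms(1) by auto
  then show ?case using insert assms(1) by (simp add: smult_r_distr)
qed (simp_all add: assms(1))

lemma (in abelian_monoid) finsum_in_closed_set:
  assumes "H \<subseteq> carrier G" "\<zero> \<in> H" "\<And>x y. x \<in> H \<Longrightarrow> y \<in> H \<Longrightarrow> x \<oplus> y \<in> H" "f \<in> A \<rightarrow> H"
  shows "finsum G f A \<in> H"
  using assms(4)
proof (induction A rule: infinite_finite_induct)
  case (insert x F)
  then have "f x \<in> H" "finsum G f F \<in> H" by auto
  moreover have "f \<in> F \<rightarrow> carrier G" "f x \<in> carrier G" using insert.prems assms(1) by blast+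
  then have "finsum G f (insert x F) = f x \<oplus> finsum G f F"
    using insert.hyps by (intro finsum_insert)
  ultimately show ?case using assms(3) by simp
qed (simp_all add: assms(2))

text \<open>As an additive group \<Lambda> is the direct sum of the subring i(\<Gamma>) and the
  ideal \<open>J\<close>. Nilpotency is stated for products of lists from \<open>J\<close>, the form
  in which it arises from paths and in which it acts on modules.\<close>

locale cleft_extension = ring_retraction \<Gamma> \<Lambda> i \<pi> +
  L: finite_dimensional_algebra \<Lambda> \<kappa> + G: finite_dimensional_algebra \<Gamma> \<kappa>'
  for \<Gamma> \<Lambda> :: "'r ring" and i \<pi> and \<kappa> \<kappa>' :: "'k::field \<Rightarrow> 'r" +
  fixes J
  assumes J_def: "J = {x \<in> carrier \<Lambda>. \<pi> x = \<zero>\<^bsub>\<Gamma>\<^esub>}"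
    and nilpotent: "\<exists>N. \<forall>xs. set xs \<subseteq> J \<longrightarrow> length xs = N \<longrightarrow> foldr (\<otimes>\<^bsub>\<Lambda>\<^esub>) xs \<one>\<^bsub>\<Lambda>\<^esub> = \<zero>\<^bsub>\<Lambda>\<^esub>"
begin

lemma i_closed: "x \<in> carrier \<Gamma> \<Longrightarrow> i x \<in> carrier \<Lambda>"
  and \<pi>_closed: "y \<in> carrier \<Lambda> \<Longrightarrow> \<pi> y \<in> carrier \<Gamma>"
  by (rule ring_hom_closed[OF i_hom], assumption) (rule ring_hom_closed[OF \<pi>_hom], assumption)

lemma \<pi>_zero: "\<pi> \<zero>\<^bsub>\<Lambda>\<^esub> = \<zero>\<^bsub>\<Gamma>\<^esub>"
  by (rule ring_hom_zero[OF \<pi>_hom ring_\<Lambda> ring_\<Gamma>])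

lemma J_closed: "c \<in> J \<Longrightarrow> c \<in> carrier \<Lambda>"
  by (simp add: J_def)

lemma J_mult: "r \<in> carrier \<Lambda> \<Longrightarrow> c \<in> J \<Longrightarrow> r \<otimes>\<^bsub>\<Lambda>\<^esub> c \<in> J" "r \<in> carrier \<Lambda> \<Longrightarrow> c \<in> J \<Longrightarrow> c \<otimes>\<^bsub>\<Lambda>\<^esub> r \<in> J"
  by (simp_all add: J_def ring_hom_mult[OF \<pi>_hom] \<pi>_closed)

lemma J_zero: "\<zero>\<^bsub>\<Lambda>\<^esub> \<in> J"
  by (simp add: J_def \<pi>_zero)

lemma J_add: "c \<in> J \<Longrightarrow> d \<in> J \<Longrightarrow> c \<oplus>\<^bsub>\<Lambda>\<^esub> d \<in> J"
  by (simp add: J_def ring_hom_add[OF \<pi>_hom])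

lemma J_diff: "y \<in> carrier \<Lambda> \<Longrightarrow> y \<ominus>\<^bsub>\<Lambda>\<^esub> i (\<pi> y) \<in> J"
proof -
  assume y: "y \<in> carrier \<Lambda>"
  interpret h: ring_hom_ring \<Lambda> \<Gamma> \<pi> by (rule ring_hom_ringI2[OF ring_\<Lambda> ring_\<Gamma> \<pi>_hom])
  show ?thesis using y
    by (simp add: J_def a_minus_def i_closed \<pi>_closed \<pi>_i G.R.r_neg)
qed

lemma left_module_regular_op: "left_module (op_ring \<Lambda>) (regular_module (op_ring \<Lambda>))"
  by (rule left_module_regular[OF ring_op_ring[OF ring_\<Lambda>]])

lemma J_right_submodule: "submodule J (op_ring \<Lambda>) (regular_module (op_ring \<Lambda>))"
  by (rule left_module.submoduleI'[OF left_module_regular_op])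
    (use J_closed J_zero J_add J_mult in auto)

lemma ideal_module_op: "ideal_module (op_ring \<Lambda>) J = (regular_module (op_ring \<Lambda>))\<lparr>carrier := J\<rparr>"
  by (simp add: regular_module_def ideal_module_def)

lemma finitely_generated_regular:
  assumes "ring R" shows "finitely_generated R (regular_module R)"
proof -
  interpret ring R by fact
  interpret A: left_module R "regular_module R" by (rule left_module_regular) fact
  show ?thesis
  proof (rule finitely_generatedI[of "{\<one>\<^bsub>R\<^esub>}"])
    fix H assume H: "submodule H R (regular_module R)" "{\<one>\<^bsub>R\<^esub>} \<subseteq> H"
    note H' = A.submoduleD[OF H(1)]
    have "r \<in> H" if "r \<in> carrier R" for r using H'(7)[OF that, of "\<one>\<^bsub>R\<^esub>"] H(2) that by simp
    then show "H = carrier (regular_module R)" using H'(1) by auto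
  qed simp_all
qed

lemma J_right_finitely_generated: "finitely_generated (op_ring \<Lambda>) (ideal_module (op_ring \<Lambda>) J)"
proof -
  interpret op: finite_dimensional_algebra "op_ring \<Lambda>" \<kappa> by (rule L.op_finite_dimensional)
  show ?thesis unfolding ideal_module_op
    by (rule op.finitely_generated_submodule[OF left_module_regular_op
      finitely_generated_regular[OF op.ring_R] J_right_submodule])
qed

end

text \<open>A finite list \<open>j\<close> generating \<open>J\<close> as a right ideal. Multiplying
  a module by \<open>J\<close> then becomes the action of one row matrix on columns, to which
  \<open>syzygy_exact\<close> applies.\<close>

locale right_generated = cleft_extension \<Gamma> \<Lambda> i \<pi> \<kappa> \<kappa>' J
  for \<Gamma> \<Lambda> :: "'r ring" and i \<pi> and \<kappa> \<kappa>' :: "'k::field \<Rightarrow> 'r" and J +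
  fixes t :: nat and j :: "nat \<Rightarrow> 'r"
  assumes j_J: "\<And>l. l < t \<Longrightarrow> j l \<in> J"
    and J_generated: "\<And>c. c \<in> J \<Longrightarrow> \<exists>x\<in>carrier (column_module t (regular_module \<Lambda>)).
      c = mact (regular_module \<Lambda>) 1 t (\<lambda>_. j) x 0"
begin

definition jm :: "('r, 'm) module \<Rightarrow> (nat \<Rightarrow> 'm) \<Rightarrow> 'm" where
  "jm M x = mact M 1 t (\<lambda>_. j) x 0"

text \<open>The submodule J H. No additive closure is taken: if c = \<Sigma> j_l x_l, then c h =
  \<Sigma> j_l (x_l h), so sums over the fixed generators already contain all products.\<close>

definition jmul :: "('r, 'm) module \<Rightarrow> 'm set \<Rightarrow> 'm set" where
  "jmul M H = {jm M x |x. x \<in> carrier (column_module t M) \<and> (\<forall>l<t. x l \<in> H)}"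

lemma jmulI: "x \<in> carrier (column_module t M) \<Longrightarrow> (\<And>l. l < t \<Longrightarrow> x l \<in> H) \<Longrightarrow> jm M x \<in> jmul M H"
  by (auto simp: jmul_def)

lemma jmulE:
  assumes "y \<in> jmul M H"
  obtains x where "x \<in> carrier (column_module t M)" "\<And>l. l < t \<Longrightarrow> x l \<in> H" "y = jm M x"
  using assms by (auto simp: jmul_def)

lemma j_matrix: "matrix_over \<Lambda> 1 t (\<lambda>_. j)"
  using j_J J_closed by (simp add: matrix_over_def)

lemma jm_finsum: "jm M x = finsum M (\<lambda>l. j l \<odot>\<^bsub>M\<^esub> x l) {..<t}"
  by (simp add: jm_def mact_def)

lemma jm_hom:
  "left_module \<Lambda> M \<Longrightarrow> left_module \<Lambda> N \<Longrightarrow> g \<in> module_hom \<Lambda> M N \<Longrightarrow> x \<in> carrier (column_module t M) \<Longrightarrow>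
    jm N (\<lambda>l. g (x l)) = g (jm M x)"
  unfolding jm_def using mact_hom[OF _ _ _ j_matrix] by fastforce

lemma jm_closed: "left_module \<Lambda> M \<Longrightarrow> x \<in> carrier (column_module t M) \<Longrightarrow> jm M x \<in> carrier M"
  unfolding jm_def by (rule power_module_mem[OF _ mact_carrier[OF _ j_matrix]])

lemma jm_submodule:
  "left_module \<Lambda> M \<Longrightarrow> submodule H \<Lambda> M \<Longrightarrow> x \<in> carrier (column_module t (M\<lparr>carrier := H\<rparr>)) \<Longrightarrow>
    jm (M\<lparr>carrier := H\<rparr>) x = jm M x"
  unfolding jm_def using mact_submodule[OF _ _ j_matrix] by fastforce

lemma jmul_submodule_module:
  assumes "left_module \<Lambda> M" "submodule H \<Lambda> M"
  shows "jmul (M\<lparr>carrier := H\<rparr>) H = jmul M H"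
proof -
  have "x \<in> carrier (column_module t (M\<lparr>carrier := H\<rparr>)) \<longleftrightarrow> x \<in> carrier (column_module t M) \<and> (\<forall>l<t. x l \<in> H)" for x
    by (rule column_submodule[OF assms])
  then show ?thesis unfolding jmul_def using jm_submodule[OF assms] by (metis (lifting))
qed

context
  fixes M :: "('r, 'm) module" and H
  assumes M: "left_module \<Lambda> M" and H: "submodule H \<Lambda> M"
begin

interpretation M: left_module \<Lambda> M by (rule M)

lemma smult_jmul:
  assumes "c \<in> J" "h \<in> H" shows "c \<odot>\<^bsub>M\<^esub> h \<in> jmul M H"
proof -
  let ?A = "regular_module \<Lambda>"
  note A = left_module_regular[OF ring_\<Lambda>]
  have h: "h \<in> carrier M" using M.submoduleD(3)[OF H assms(2)] .
  have hom: "(\<lambda>r. r \<odot>\<^bsub>M\<^esub> h) \<in> module_hom \<Lambda> ?A M"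
    using h by (intro module_homI) (simp_all add: M.smult_l_distr M.smult_assoc)
  obtain x where x: "x \<in> carrier (column_module t ?A)" "c = jm ?A x"
    using J_generated[OF assms(1)] unfolding jm_def by blast
  have "c \<odot>\<^bsub>M\<^esub> h = jm M (\<lambda>l. x l \<odot>\<^bsub>M\<^esub> h)" unfolding x(2) by (rule jm_hom[OF A M hom x(1), symmetric])
  moreover have "x l \<in> carrier \<Lambda>" for l using power_module_mem[OF A x(1), of l] by simp
  ultimately show ?thesis
    using jmulI[OF column_hom[OF A M hom x(1)]] M.submoduleD(7)[OF H _ assms(2)] by simp
qed

text \<open>Stability under \<Lambda> uses that \<open>J\<close> is two-sided: r j_l is again in
  \<open>J\<close>, and \<open>smult_jmul\<close> rewrites its products in the generators.\<close>

lemma submodule_jmul: "submodule (jmul M H) \<Lambda> M"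
proof (rule M.submoduleI')
  show sub: "jmul M H \<subseteq> carrier M" by (auto elim!: jmulE intro: jm_closed[OF M])
  show zero: "\<zero>\<^bsub>M\<^esub> \<in> jmul M H"
    using smult_jmul[OF J_zero M.submoduleD(2)[OF H]] by simp
  show add: "x \<oplus>\<^bsub>M\<^esub> y \<in> jmul M H" if xy: "x \<in> jmul M H" "y \<in> jmul M H" for x y
  proof -
    obtain a where a: "a \<in> carrier (column_module t M)" "\<And>l. l < t \<Longrightarrow> a l \<in> H" "x = jm M a"
      using xy(1) by (rule jmulE) (rule that)
    obtain b where b: "b \<in> carrier (column_module t M)" "\<And>l. l < t \<Longrightarrow> b l \<in> H" "y = jm M b"
      using xy(2) by (rule jmulE) (rule that)
    have "x \<oplus>\<^bsub>M\<^esub> y = jm M (\<lambda>l. a l \<oplus>\<^bsub>M\<^esub> b l)"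
      unfolding a(3) b(3) jm_def using mact_add[OF M j_matrix a(1) b(1)] by (simp add: fun_eq_iff)
    moreover have "(\<lambda>l. a l \<oplus>\<^bsub>M\<^esub> b l) \<in> carrier (column_module t M)"
      using a(1) b(1) by (simp add: column_carrier)
    then have "jm M (\<lambda>l. a l \<oplus>\<^bsub>M\<^esub> b l) \<in> jmul M H"
      by (rule jmulI) (rule M.submoduleD(4)[OF H a(2) b(2)])
    ultimately show ?thesis by (simp only:)
  qed
  show "r \<odot>\<^bsub>M\<^esub> x \<in> jmul M H" if r: "r \<in> carrier \<Lambda>" and x: "x \<in> jmul M H" for r x
  proof -
    obtain a where a: "a \<in> carrier (column_module t M)" "\<And>l. l < t \<Longrightarrow> a l \<in> H" "x = jm M a"
      using x by (rule jmulE) (rule that)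
    have c: "a l \<in> carrier M" for l by (rule power_module_mem[OF M a(1)])
    have "r \<odot>\<^bsub>M\<^esub> x = finsum M (\<lambda>l. r \<odot>\<^bsub>M\<^esub> (j l \<odot>\<^bsub>M\<^esub> a l)) {..<t}"
      unfolding a(3) jm_finsum using r c j_J J_closed by (intro M.smult_finsum) auto
    also have "\<dots> \<in> jmul M H"
    proof (rule M.M.finsum_in_closed_set[OF sub zero add], assumption, assumption, rule Pi_I)
      fix l assume "l \<in> {..<t}"
      then have "r \<odot>\<^bsub>M\<^esub> (j l \<odot>\<^bsub>M\<^esub> a l) = (r \<otimes>\<^bsub>\<Lambda>\<^esub> j l) \<odot>\<^bsub>M\<^esub> a l"
        using r c j_J J_closed by (simp add: M.smult_assoc)
      then show "r \<odot>\<^bsub>M\<^esub> (j l \<odot>\<^bsub>M\<^esub> a l) \<in> jmul M H"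
        using smult_jmul[OF J_mult(1)[OF r j_J] a(2)] \<open>l \<in> {..<t}\<close> by simp
    qed
    finally show ?thesis .
  qed
qed

end

lemma foldr_mult: "set xs \<subseteq> carrier \<Lambda> \<Longrightarrow> a \<in> carrier \<Lambda> \<Longrightarrow>
    foldr (\<otimes>\<^bsub>\<Lambda>\<^esub>) xs \<one>\<^bsub>\<Lambda>\<^esub> \<in> carrier \<Lambda> \<and> foldr (\<otimes>\<^bsub>\<Lambda>\<^esub>) xs a = foldr (\<otimes>\<^bsub>\<Lambda>\<^esub>) xs \<one>\<^bsub>\<Lambda>\<^esub> \<otimes>\<^bsub>\<Lambda>\<^esub> a"
  by (induction xs) (auto simp: L.R.m_assoc)

text \<open>Lifting of the splitting modulo \<open>J\<close>: each round replaces \<open>1 - r\<close> by \<open>(1 - \<tau>)(1 - r)\<close>,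
  which moves \<open>K\<close> one step down the filtration by powers of \<open>J\<close>.\<close>

lemma nilpotent_retraction:
  assumes P: "left_module \<Lambda> P" and K: "submodule K \<Lambda> P"
    and \<tau>: "\<tau> \<in> module_hom \<Lambda> P P" "\<And>x. x \<in> carrier P \<Longrightarrow> \<tau> x \<in> K"
    and \<tau>_mod: "\<And>k. k \<in> K \<Longrightarrow> k \<ominus>\<^bsub>P\<^esub> \<tau> k \<in> jmul P K"
  obtains r where "r \<in> module_hom \<Lambda> P P" "\<And>x. x \<in> carrier P \<Longrightarrow> r x \<in> K" "\<And>k. k \<in> K \<Longrightarrow> r k = k"
proof -
  interpret P: left_module \<Lambda> P by (rule P)
  \<comment> \<open>The filtration K, J K, J J K, and so on.\<close>
  define D where "D = rec_nat K (\<lambda>_. jmul P)"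
  have D: "D 0 = K" "D (Suc m) = jmul P (D m)" for m by (simp_all add: D_def)
  have Dsub: "submodule (D m) \<Lambda> P" for m
    by (induction m) (simp_all add: D K submodule_jmul[OF P])
  have DP: "x \<in> carrier P" if "x \<in> D m" for x m using P.submoduleD(3)[OF Dsub that] .
  interpret \<tau>: module_morphism \<Lambda> P P \<tau> by (rule module_morphismI[OF P P \<tau>(1)])
  have hom1: "(\<lambda>x. x \<ominus>\<^bsub>P\<^esub> \<tau> x) \<in> module_hom \<Lambda> P P"
    by (rule module_hom_minus[OF P P module_hom_ident \<tau>(1)])
  have step: "x \<ominus>\<^bsub>P\<^esub> \<tau> x \<in> D (Suc m)" if "x \<in> D m" for x m
    using that
  proof (induction m arbitrary: x)
    case 0
    then show ?case using \<tau>_mod by (simp add: D)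
  next
    case (Suc m)
    then have "x \<in> jmul P (D m)" by (simp add: D)
    then obtain h where h: "h \<in> carrier (column_module t P)" "\<And>l. l < t \<Longrightarrow> h l \<in> D m" "x = jm P h"
      by (rule jmulE) (rule that)
    have "x \<ominus>\<^bsub>P\<^esub> \<tau> x = jm P (\<lambda>l. h l \<ominus>\<^bsub>P\<^esub> \<tau> (h l))" unfolding h(3) by (rule jm_hom[OF P P hom1 h(1), symmetric])
    also have "\<dots> \<in> jmul P (D (Suc m))"
      by (rule jmulI[OF column_hom[OF P P hom1 h(1)] Suc.IH[OF h(2)]])
    finally show ?case by (simp add: D)
  qed
  have approx: "\<exists>r\<in>module_hom \<Lambda> P P. (\<forall>x\<in>carrier P. r x \<in> K) \<and> (\<forall>k\<in>K. k \<ominus>\<^bsub>P\<^esub> r k \<in> D (Suc n))" for n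
  proof (induction n)
    case 0
    show ?case using \<tau> \<tau>_mod by (intro bexI[of _ \<tau>]) (auto simp: D)
  next
    case (Suc n)
    then obtain r where r: "r \<in> module_hom \<Lambda> P P" "\<And>x. x \<in> carrier P \<Longrightarrow> r x \<in> K"
      "\<And>k. k \<in> K \<Longrightarrow> k \<ominus>\<^bsub>P\<^esub> r k \<in> D (Suc n)" by blast
    have rP: "r x \<in> carrier P" if "x \<in> carrier P" for x by (rule module_hom_mem[OF r(1) that])
    let ?r = "\<lambda>x. r x \<oplus>\<^bsub>P\<^esub> \<tau> (x \<ominus>\<^bsub>P\<^esub> r x)"
    have hom: "?r \<in> module_hom \<Lambda> P P"
      by (rule module_hom_add[OF P P r(1) module_hom_comp[OF module_hom_minus[OF P P module_hom_ident r(1)] \<tau>(1)]])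
    have "k \<ominus>\<^bsub>P\<^esub> ?r k \<in> D (Suc (Suc n))" if k: "k \<in> K" for k
    proof -
      have kP: "k \<in> carrier P" by (rule P.submoduleD(3)[OF K k])
      have d: "k \<ominus>\<^bsub>P\<^esub> r k \<in> carrier P" using kP rP by simp
      have "k \<ominus>\<^bsub>P\<^esub> ?r k = (k \<ominus>\<^bsub>P\<^esub> r k) \<ominus>\<^bsub>P\<^esub> \<tau> (k \<ominus>\<^bsub>P\<^esub> r k)"
        using kP rP[OF kP] \<tau>.closed[OF d] by (simp add: a_minus_def P.M.minus_add P.M.a_ac)
      then show ?thesis using step[OF r(3)[OF k]] by simp
    qed
    moreover have "?r x \<in> K" if "x \<in> carrier P" for x
      using that by (intro P.submoduleD(4)[OF K] r(2) \<tau>(2) P.M.minus_closed rP)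
    ultimately show ?case using hom by (intro bexI[of _ ?r] conjI ballI)
  qed
  obtain N where N: "\<And>xs. set xs \<subseteq> J \<Longrightarrow> length xs = N \<Longrightarrow> foldr (\<otimes>\<^bsub>\<Lambda>\<^esub>) xs \<one>\<^bsub>\<Lambda>\<^esub> = \<zero>\<^bsub>\<Lambda>\<^esub>"
    using nilpotent by blast
  \<comment> \<open>An element of \<open>D m\<close> carries m factors from \<open>J\<close>, which
    are moved into the list one at a time. The total is N + 1 rather than N because the
    approximations end in \<open>D (Suc N)\<close>; the surplus first factor then multiplies a
    product that vanishes.\<close>
  have nil: "foldr (\<otimes>\<^bsub>\<Lambda>\<^esub>) xs \<one>\<^bsub>\<Lambda>\<^esub> \<odot>\<^bsub>P\<^esub> x = \<zero>\<^bsub>P\<^esub>"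
    if "x \<in> D m" "set xs \<subseteq> J" "length xs + m = Suc N" for x m xs
    using that
  proof (induction m arbitrary: x xs)
    case 0
    then obtain a ys where xs: "xs = a # ys" by (cases xs) auto
    then have "foldr (\<otimes>\<^bsub>\<Lambda>\<^esub>) xs \<one>\<^bsub>\<Lambda>\<^esub> = \<zero>\<^bsub>\<Lambda>\<^esub>" using N[of ys] 0 J_closed by simp
    then show ?case using DP[OF 0(1)] by simp
  next
    case (Suc m)
    then have "x \<in> jmul P (D m)" by (simp add: D)
    then obtain h where h: "h \<in> carrier (column_module t P)" "\<And>l. l < t \<Longrightarrow> h l \<in> D m" "x = jm P h"
      by (rule jmulE) (rule that)
    let ?c = "foldr (\<otimes>\<^bsub>\<Lambda>\<^esub>) xs \<one>\<^bsub>\<Lambda>\<^esub>"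
    have xsL: "set xs \<subseteq> carrier \<Lambda>" using Suc.prems(2) J_closed by blast
    have c: "?c \<in> carrier \<Lambda>" using foldr_mult[OF xsL L.R.one_closed] by blast
    have hP: "h l \<in> carrier P" if "l < t" for l by (rule DP[OF h(2)[OF that]])
    have "?c \<odot>\<^bsub>P\<^esub> x = finsum P (\<lambda>l. ?c \<odot>\<^bsub>P\<^esub> (j l \<odot>\<^bsub>P\<^esub> h l)) {..<t}"
      unfolding h(3) jm_finsum using c hP j_J J_closed by (intro P.smult_finsum) auto
    also have "\<dots> = finsum P (\<lambda>l. \<zero>\<^bsub>P\<^esub>) {..<t}"
    proof (rule P.M.finsum_cong'[OF refl])
      fix l assume "l \<in> {..<t}"
      then have l: "l < t" by simp
      note jl = J_closed[OF j_J[OF l]]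
      have "?c \<otimes>\<^bsub>\<Lambda>\<^esub> j l = foldr (\<otimes>\<^bsub>\<Lambda>\<^esub>) (xs @ [j l]) \<one>\<^bsub>\<Lambda>\<^esub>"
        using foldr_mult[OF xsL jl] jl by simp
      moreover have "foldr (\<otimes>\<^bsub>\<Lambda>\<^esub>) (xs @ [j l]) \<one>\<^bsub>\<Lambda>\<^esub> \<odot>\<^bsub>P\<^esub> h l = \<zero>\<^bsub>P\<^esub>"
        by (rule Suc.IH[OF h(2)[OF l]]) (use Suc.prems j_J[OF l] in auto)
      ultimately show "?c \<odot>\<^bsub>P\<^esub> (j l \<odot>\<^bsub>P\<^esub> h l) = \<zero>\<^bsub>P\<^esub>"
        using c jl hP[OF l] by (simp flip: P.smult_assoc)
    qed simp
    finally show ?case by simp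
  qed
  obtain r where r: "r \<in> module_hom \<Lambda> P P" "\<And>x. x \<in> carrier P \<Longrightarrow> r x \<in> K"
    "\<And>k. k \<in> K \<Longrightarrow> k \<ominus>\<^bsub>P\<^esub> r k \<in> D (Suc N)" using approx[of N] by blast
  have "r k = k" if "k \<in> K" for k
  proof -
    have kP: "k \<in> carrier P" by (rule P.submoduleD(3)[OF K that])
    have "\<one>\<^bsub>\<Lambda>\<^esub> \<odot>\<^bsub>P\<^esub> (k \<ominus>\<^bsub>P\<^esub> r k) = \<zero>\<^bsub>P\<^esub>" using nil[OF r(3)[OF that], of "[]"] by simp
    moreover have rk: "r k \<in> carrier P" by (rule module_hom_mem[OF r(1) kP])
    ultimately show ?thesis using kP by (simp add: P.M.minus_eq_zero_iff)
  qed
  with r(1,2) show ?thesis by (rule that)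
qed

text \<open>\<open>q\<close> presents the \<open>\<Gamma>\<close>-module \<open>X'\<close> as \<open>X / J X\<close>.\<close>

definition reduction :: "('r, 'm) module \<Rightarrow> ('r, 'n) module \<Rightarrow> ('m \<Rightarrow> 'n) \<Rightarrow> bool" where
  "reduction X X' q \<longleftrightarrow> left_module \<Lambda> X \<and> left_module \<Gamma> X' \<and>
    q \<in> module_hom \<Lambda> X (restrict_scalars \<pi> X') \<and> q ` carrier X = carrier X' \<and>
    (\<forall>x\<in>carrier X. q x = \<zero>\<^bsub>X'\<^esub> \<longrightarrow> x \<in> jmul X (carrier X))"

lemma reductionD:
  assumes "reduction X X' q"
  shows "left_module \<Lambda> X" "left_module \<Gamma> X'" "q \<in> module_hom \<Lambda> X (restrict_scalars \<pi> X')"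
    "q ` carrier X = carrier X'" "\<And>x. x \<in> carrier X \<Longrightarrow> q x = \<zero>\<^bsub>X'\<^esub> \<Longrightarrow> x \<in> jmul X (carrier X)"
    "left_module \<Lambda> (restrict_scalars \<pi> X')"
  using assms left_module_restrict_scalars[OF ring_\<Lambda> \<pi>_hom] unfolding reduction_def by blast+

lemma hom_inflation_jmul:
  assumes X: "left_module \<Lambda> X" "left_module \<Gamma> Z" "h \<in> module_hom \<Lambda> X (restrict_scalars \<pi> Z)"
    and x: "x \<in> jmul X (carrier X)"
  shows "h x = \<zero>\<^bsub>Z\<^esub>"
proof -
  interpret Z: left_module \<Gamma> Z by (rule X(2))
  note Z' = left_module_restrict_scalars[OF ring_\<Lambda> \<pi>_hom X(2)]
  interpret Z': left_module \<Lambda> "restrict_scalars \<pi> Z" by (rule Z')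
  obtain a where a: "a \<in> carrier (column_module t X)" "x = jm X a" using x by (rule jmulE)
  have ha: "h (a l) \<in> carrier Z" for l
    using module_hom_mem[OF X(3) power_module_mem[OF X(1) a(1)], of l] by simp
  have "h x = jm (restrict_scalars \<pi> Z) (\<lambda>l. h (a l))" unfolding a(2) by (rule jm_hom[OF X(1) Z' X(3) a(1), symmetric])
  also have "\<dots> = finsum (restrict_scalars \<pi> Z) (\<lambda>l. \<zero>\<^bsub>restrict_scalars \<pi> Z\<^esub>) {..<t}"
    unfolding jm_finsum
  proof (rule Z'.M.finsum_cong'[OF refl])
    fix l assume "l \<in> {..<t}"
    then have "\<pi> (j l) = \<zero>\<^bsub>\<Gamma>\<^esub>" using j_J by (simp add: J_def)
    then show "j l \<odot>\<^bsub>restrict_scalars \<pi> Z\<^esub> h (a l) = \<zero>\<^bsub>restrict_scalars \<pi> Z\<^esub>" using ha by simp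
  qed simp
  also have "\<dots> = \<zero>\<^bsub>Z\<^esub>" using Z'.M.finsum_zero[of "{..<t}"] by simp
  finally show ?thesis .
qed

text \<open>On X / J X the scalars r and i(\<pi> r) act alike, since they differ by an element of
  \<open>J\<close>. Hence the quotient is the inflation of its own restriction to \<Gamma>.\<close>

lemma reduction_exists:
  fixes X :: "('r, 'm) module"
  assumes X: "left_module \<Lambda> X"
  obtains X' :: "('r, 'm) module" and q where "reduction X X' q"
proof -
  interpret X: left_module \<Lambda> X by (rule X)
  let ?H = "jmul X (carrier X)"
  note sub = submodule_jmul[OF X X.submodule_carrier]
  obtain N :: "('r, 'm) module" and q where N: "left_module \<Lambda> N" "q \<in> module_hom \<Lambda> X N"
    "q ` carrier X = carrier N" "a_kernel X N q = ?H"
    by (rule quotient_module_exists[OF X sub]) (rule that)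
  interpret q: module_morphism \<Lambda> X N q by (rule module_morphismI[OF X N(1,2)])
  have zero: "c \<odot>\<^bsub>N\<^esub> q x = \<zero>\<^bsub>N\<^esub>" if "c \<in> J" "x \<in> carrier X" for c x
  proof -
    have "c \<odot>\<^bsub>X\<^esub> x \<in> a_kernel X N q" unfolding N(4) by (rule smult_jmul[OF X X.submodule_carrier that])
    then show ?thesis using that J_closed by (simp add: a_kernel_iff)
  qed
  have "r \<odot>\<^bsub>N\<^esub> q x = i (\<pi> r) \<odot>\<^bsub>N\<^esub> q x" if r: "r \<in> carrier \<Lambda>" and x: "x \<in> carrier X" for r x
  proof -
    have c: "i (\<pi> r) \<in> carrier \<Lambda>" using r by (simp add: i_closed \<pi>_closed)
    have "r = (r \<ominus>\<^bsub>\<Lambda>\<^esub> i (\<pi> r)) \<oplus>\<^bsub>\<Lambda>\<^esub> i (\<pi> r)"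
      using r c by (simp add: a_minus_def L.R.a_assoc L.R.l_neg)
    then have "r \<odot>\<^bsub>N\<^esub> q x = (r \<ominus>\<^bsub>\<Lambda>\<^esub> i (\<pi> r)) \<odot>\<^bsub>N\<^esub> q x \<oplus>\<^bsub>N\<^esub> i (\<pi> r) \<odot>\<^bsub>N\<^esub> q x"
      using q.N.smult_l_distr[of "r \<ominus>\<^bsub>\<Lambda>\<^esub> i (\<pi> r)" "i (\<pi> r)" "q x"] r c x by simp
    then show ?thesis using zero[OF J_diff[OF r] x] c x by simp
  qed
  then have "q \<in> module_hom \<Lambda> X (restrict_scalars \<pi> (restrict_scalars i N))"
    by (intro module_homI) auto
  then have "reduction X (restrict_scalars i N) q"
    unfolding reduction_def using X left_module_restrict_scalars[OF ring_\<Gamma> i_hom N(1)] N(3,4)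
    by (auto simp: a_kernel_iff)
  then show ?thesis by (rule that)
qed

text \<open>Every \<Lambda>-map to an inflated module kills J X, so its value at x depends on q x
  only. Linearity over \<Gamma> is checked on the scalars i(a).\<close>

lemma reduction_factor:
  assumes red: "reduction X X' q" and Z: "left_module \<Gamma> Z" "h \<in> module_hom \<Lambda> X (restrict_scalars \<pi> Z)"
  obtains s where "s \<in> module_hom \<Gamma> X' Z" "\<And>x. x \<in> carrier X \<Longrightarrow> s (q x) = h x"
proof -
  note red = reductionD[OF red]
  note Z' = left_module_restrict_scalars[OF ring_\<Lambda> \<pi>_hom Z(1)]
  interpret q: module_morphism \<Lambda> X "restrict_scalars \<pi> X'" q by (rule module_morphismI[OF red(1,6,3)])
  interpret h: module_morphism \<Lambda> X "restrict_scalars \<pi> Z" h by (rule module_morphismI[OF red(1) Z' Z(2)])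
  interpret Z: left_module \<Gamma> Z by (rule Z(1))
  interpret X': left_module \<Gamma> X' by (rule red(2))
  have wd: "h x = h y" if "x \<in> carrier X" "y \<in> carrier X" "q x = q y" for x y
  proof -
    have "q (x \<ominus>\<^bsub>X\<^esub> y) = \<zero>\<^bsub>X'\<^esub>" using that q.minus[of x y] q.closed[of y] q.N.M.minus_eq_zero_iff by simp
    then have "x \<ominus>\<^bsub>X\<^esub> y \<in> jmul X (carrier X)" using that by (intro red(5)) auto
    then have "h (x \<ominus>\<^bsub>X\<^esub> y) = \<zero>\<^bsub>Z\<^esub>" by (rule hom_inflation_jmul[OF red(1) Z])
    then show ?thesis using that h.minus[of x y] h.N.M.minus_eq_zero_iff[of "h x" "h y"] h.closed by simp
  qed
  define s where "s y = h (inv_into (carrier X) q y)" for y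
  have s: "s (q x) = h x" if "x \<in> carrier X" for x
    unfolding s_def using that by (intro wd) (auto intro: inv_into_into f_inv_into_f)
  have "s \<in> module_hom \<Gamma> X' Z"
  proof (rule module_homI)
    fix y assume "y \<in> carrier X'"
    then obtain x where "x \<in> carrier X" "y = q x" using red(4) by blast
    then show "s y \<in> carrier Z" using s h.closed by simp
  next
    fix y y' assume "y \<in> carrier X'" "y' \<in> carrier X'"
    then obtain x x' where x: "x \<in> carrier X" "y = q x" "x' \<in> carrier X" "y' = q x'" using red(4) by blast
    then have "y \<oplus>\<^bsub>X'\<^esub> y' = q (x \<oplus>\<^bsub>X\<^esub> x')" using q.add by simp
    moreover have "s (q (x \<oplus>\<^bsub>X\<^esub> x')) = h x \<oplus>\<^bsub>Z\<^esub> h x'" using x h.add by (simp add: s del: q.add)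
    ultimately show "s (y \<oplus>\<^bsub>X'\<^esub> y') = s y \<oplus>\<^bsub>Z\<^esub> s y'" using x s by (simp only:)
  next
    fix a y assume a: "a \<in> carrier \<Gamma>" and "y \<in> carrier X'"
    then obtain x where x: "x \<in> carrier X" "y = q x" using red(4) by blast
    then have "a \<odot>\<^bsub>X'\<^esub> y = q (i a \<odot>\<^bsub>X\<^esub> x)" using q.smult[OF i_closed[OF a]] a by (simp add: \<pi>_i)
    moreover have "s (q (i a \<odot>\<^bsub>X\<^esub> x)) = a \<odot>\<^bsub>Z\<^esub> h x"
      using x a h.smult[OF i_closed[OF a]] by (simp add: s i_closed \<pi>_i del: q.smult)
    ultimately show "s (a \<odot>\<^bsub>X'\<^esub> y) = a \<odot>\<^bsub>Z\<^esub> s y" using x s by (simp only:)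
  qed
  then show ?thesis using s by (rule that)
qed

text \<open>The projective \<open>P\<close> lifts \<open>q\<close> through the inflation of a cover
  of P'. The lift factors through P' and splits the cover.\<close>

lemma reduction_proj:
  fixes P' :: "('r, 'm) module"
  assumes large: "large (carrier \<Gamma>) TYPE('m)" and red: "reduction P P' q" and P: "proj \<Lambda> P"
  shows "proj \<Gamma> P'"
proof -
  note redD = reductionD[OF red]
  obtain Q :: "('r, 'm) module" and p where Q: "proj \<Gamma> Q" "p \<in> module_hom \<Gamma> Q P'" "p ` carrier Q = carrier P'"
    by (rule free_cover_exists[OF redD(2) large]) (rule that)
  note QL = proj_left_module[OF Q(1)]
  obtain h where h: "h \<in> module_hom \<Lambda> P (restrict_scalars \<pi> Q)" "\<And>x. x \<in> carrier P \<Longrightarrow> p (h x) = q x"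
    by (rule proj_lift[OF P left_module_restrict_scalars[OF ring_\<Lambda> \<pi>_hom QL] redD(6)
      module_hom_restrict_scalars[OF Q(2) \<pi>_hom] _ redD(3)]) (simp add: Q(3), rule that)
  obtain s where s: "s \<in> module_hom \<Gamma> P' Q" "\<And>x. x \<in> carrier P \<Longrightarrow> s (q x) = h x"
    by (rule reduction_factor[OF red QL h(1)]) (rule that)
  have "p (s y) = y" if "y \<in> carrier P'" for y
    using that h(2) s(2) unfolding redD(4)[symmetric] by auto
  then show ?thesis by (rule proj_retract[OF Q(1) redD(2) s(1) Q(2)])
qed

text \<open>For the row \<open>j\<close> the statement of \<open>syzygy_exact\<close> is that the
  kernel meets J P in J times the kernel. So the kernel of the reduced map is the reduction of the
  kernel, and the sequence stays exact modulo \<open>J\<close>.\<close>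

lemma reduction_kernel:
  fixes P X :: "('r, 'm) module" and P' X' :: "('r, 'm) module"
  assumes syz: "syzygy d \<Lambda> X" and good: "good d \<Lambda> 1 t (\<lambda>_. j)"
    and P: "proj \<Lambda> P" "g \<in> module_hom \<Lambda> P X" "g ` carrier P = carrier X"
    and redP: "reduction P P' p" and redX: "reduction X X' q"
  obtains g' where "g' \<in> module_hom \<Gamma> P' X'" "g' ` carrier P' = carrier X'"
    "reduction (P\<lparr>carrier := a_kernel P X g\<rparr>) (P'\<lparr>carrier := a_kernel P' X' g'\<rparr>) p"
proof -
  note p = reductionD[OF redP] and q = reductionD[OF redX]
  obtain g' where g': "g' \<in> module_hom \<Gamma> P' X'" "\<And>x. x \<in> carrier P \<Longrightarrow> g' (p x) = q (g x)"
    by (rule reduction_factor[OF redP q(2) module_hom_comp[OF P(2) q(3)]]) (rule that)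
  have surj: "g' ` carrier P' = carrier X'"
  proof -
    have "g' ` carrier P' = (\<lambda>x. g' (p x)) ` carrier P" unfolding p(4)[symmetric] by (simp add: image_image)
    also have "\<dots> = (\<lambda>x. q (g x)) ` carrier P" by (rule image_cong[OF refl g'(2)])
    also have "\<dots> = q ` (g ` carrier P)" by (simp add: image_image)
    finally show ?thesis using P(3) q(4) by simp
  qed
  interpret g: module_morphism \<Lambda> P X g by (rule module_morphismI[OF p(1) q(1) P(2)])
  interpret p: module_morphism \<Lambda> P "restrict_scalars \<pi> P'" p by (rule module_morphismI[OF p(1,6,3)])
  interpret q: module_morphism \<Lambda> X "restrict_scalars \<pi> X'" q by (rule module_morphismI[OF q(1,6,3)])
  interpret g': module_morphism \<Gamma> P' X' g' by (rule module_morphismI[OF p(2) q(2) g'(1)])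
  let ?K = "a_kernel P X g" and ?K' = "a_kernel P' X' g'"
  have K: "?K \<subseteq> carrier P" by (auto simp: a_kernel_iff)
  have pK: "p x \<in> ?K'" if "x \<in> ?K" for x
    using that g'(2)[of x] q.zero p.closed[of x] by (simp add: a_kernel_iff)
  \<comment> \<open>A preimage x of y has its image in J X. That image lifts to an element of J P,
    which \<open>p\<close> kills and whose subtraction moves x into the kernel.\<close>
  have "p ` ?K = ?K'"
  proof (rule equalityI[OF image_subsetI[OF pK] subsetI])
    fix y assume y: "y \<in> ?K'"
    then obtain x where x: "x \<in> carrier P" "y = p x" using p(4) by (auto simp: a_kernel_iff)
    then have "q (g x) = \<zero>\<^bsub>X'\<^esub>" using y g'(2) by (simp add: a_kernel_iff)
    then have "g x \<in> jmul X (carrier X)" using x by (intro q(5)) auto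
    then obtain h where h: "h \<in> carrier (column_module t X)" "g x = jm X h" by (rule jmulE)
    define h' where "h' l = (if l < t then inv_into (carrier P) g (h l) else \<zero>\<^bsub>P\<^esub>)" for l
    have hl: "h l \<in> g ` carrier P" for l using power_module_mem[OF q(1) h(1)] P(3) by simp
    have h': "h' \<in> carrier (column_module t P)" using hl by (simp add: column_carrier h'_def inv_into_into)
    have gh: "(\<lambda>l. g (h' l)) = h"
    proof
      fix l show "g (h' l) = h l"
        using h(1) by (cases "l < t") (simp_all add: h'_def f_inv_into_f[OF hl] column_carrier)
    qed
    have "g (jm P h') = g x" unfolding h(2) using jm_hom[OF p(1) q(1) P(2) h'] by (simp add: gh)
    moreover have jP: "jm P h' \<in> carrier P" by (rule jm_closed[OF p(1) h'])
    ultimately have "x \<ominus>\<^bsub>P\<^esub> jm P h' \<in> ?K" using x(1) by (simp add: a_kernel_iff g.N.M.minus_eq_zero_iff)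
    moreover have "p (x \<ominus>\<^bsub>P\<^esub> jm P h') = y"
    proof -
      have "jm P h' \<in> jmul P (carrier P)" by (rule jmulI[OF h' power_module_mem[OF p(1) h']])
      then have "p (jm P h') = \<zero>\<^bsub>restrict_scalars \<pi> P'\<^esub>"
        using hom_inflation_jmul[OF p(1,2,3)] by simp
      moreover have "p x \<in> carrier (restrict_scalars \<pi> P')" using x(1) by (rule p.closed)
      ultimately show ?thesis using x jP p.minus[of x "jm P h'"] p.N.M.minus_zero_right by metis
    qed
    ultimately show "y \<in> p ` ?K" by blast
  qed
  moreover have "x \<in> jmul (P\<lparr>carrier := ?K\<rparr>) ?K" if x: "x \<in> ?K" "p x = \<zero>\<^bsub>P'\<^esub>" for x
  proof -
    have "x \<in> jmul P (carrier P)" using x by (intro p(5)) (auto simp: a_kernel_iff)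
    then obtain h where h: "h \<in> carrier (column_module t P)" "x = jm P h" by (rule jmulE)
    have "\<exists>y \<in> carrier (column_module t P). (\<forall>l<t. y l \<in> ?K) \<and> mact P 1 t (\<lambda>_. j) y = mact P 1 t (\<lambda>_. j) h"
      by (rule syzygy_exact[OF syz P j_matrix good h(1)]) (use x(1) h(2) in \<open>simp add: jm_def\<close>)
    then obtain y where y: "y \<in> carrier (column_module t P)" "\<forall>l<t. y l \<in> ?K"
      "mact P 1 t (\<lambda>_. j) y = mact P 1 t (\<lambda>_. j) h" by (elim bexE conjE) (rule that)
    have "x = jm P y" unfolding h(2) jm_def y(3) ..
    then show ?thesis
      unfolding jmul_submodule_module[OF p(1) g.submodule_kernel] using y(1,2) by (auto intro!: jmulI)
  qed
  moreover have "p \<in> module_hom \<Lambda> (P\<lparr>carrier := ?K\<rparr>) (restrict_scalars \<pi> (P'\<lparr>carrier := ?K'\<rparr>))"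
    using module_hom_into_submodule[OF module_hom_restrict[OF p(3) K], of ?K'] pK by simp
  ultimately have "reduction (P\<lparr>carrier := ?K\<rparr>) (P'\<lparr>carrier := ?K'\<rparr>) p"
    unfolding reduction_def
    using g.M.left_module_submodule[OF g.submodule_kernel] g'.M.left_module_submodule[OF g'.submodule_kernel]
    by simp
  then show ?thesis by (rule that[OF g'(1) surj])
qed

text \<open>The map 1 - r vanishes on the kernel of \<open>g\<close>, hence factors through
  \<open>X\<close>, where it becomes a section of \<open>g\<close>.\<close>

lemma proj_of_retraction:
  assumes P: "proj R P" and X: "left_module R X" and g: "g \<in> module_hom R P X" "g ` carrier P = carrier X"
    and r: "r \<in> module_hom R P P" "\<And>x. x \<in> carrier P \<Longrightarrow> r x \<in> a_kernel P X g"
      "\<And>k. k \<in> a_kernel P X g \<Longrightarrow> r k = k"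
  shows "proj R X"
proof -
  note PL = proj_left_module[OF P]
  interpret g: module_morphism R P X g by (rule module_morphismI[OF PL X g(1)])
  interpret r: module_morphism R P P r by (rule module_morphismI[OF PL PL r(1)])
  define e where "e x = x \<ominus>\<^bsub>P\<^esub> r x" for x
  have e: "e \<in> module_hom R P P"
    unfolding e_def by (rule module_hom_minus[OF PL PL module_hom_ident r(1)])
  interpret e: module_morphism R P P e by (rule module_morphismI[OF PL PL e])
  have wd: "e x = e y" if "x \<in> carrier P" "y \<in> carrier P" "g x = g y" for x y
  proof -
    have "x \<ominus>\<^bsub>P\<^esub> y \<in> a_kernel P X g" using that by (simp add: a_kernel_iff g.N.M.minus_eq_zero_iff)
    then have "e (x \<ominus>\<^bsub>P\<^esub> y) = \<zero>\<^bsub>P\<^esub>" using that r(3) unfolding e_def by (simp add: g.M.M.minus_eq_zero_iff)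
    then show ?thesis using that by (simp add: g.M.M.minus_eq_zero_iff)
  qed
  define s where "s y = e (inv_into (carrier P) g y)" for y
  have s: "s (g x) = e x" if "x \<in> carrier P" for x
    unfolding s_def using that by (intro wd) (auto intro: inv_into_into f_inv_into_f)
  have "s \<in> module_hom R X P"
  proof (rule module_homI)
    fix y assume "y \<in> carrier X"
    then obtain x where "x \<in> carrier P" "y = g x" using g(2) by blast
    then show "s y \<in> carrier P" using s by simp
  next
    fix y y' assume "y \<in> carrier X" "y' \<in> carrier X"
    then obtain x x' where x: "x \<in> carrier P" "y = g x" "x' \<in> carrier P" "y' = g x'" using g(2) by blast
    then show "s (y \<oplus>\<^bsub>X\<^esub> y') = s y \<oplus>\<^bsub>P\<^esub> s y'" using s by (simp flip: g.add)
  next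
    fix a y assume a: "a \<in> carrier R" and "y \<in> carrier X"
    then obtain x where x: "x \<in> carrier P" "y = g x" using g(2) by blast
    then show "s (a \<odot>\<^bsub>X\<^esub> y) = a \<odot>\<^bsub>P\<^esub> s y" using a s by (simp flip: g.smult)
  qed
  moreover have "g (s y) = y" if "y \<in> carrier X" for y
  proof -
    obtain x where x: "x \<in> carrier P" "y = g x" using g(2) \<open>y \<in> carrier X\<close> by blast
    have "g (r x) = \<zero>\<^bsub>X\<^esub>" using r(2)[OF x(1)] by (simp add: a_kernel_iff)
    then show ?thesis using x s by (simp add: e_def)
  qed
  ultimately show ?thesis by (intro proj_retract[OF P X _ g(1)])
qed

text \<open>A section of P' -> X' gives a projection \<rho> of P' onto the reduced kernel. As
  \<open>P\<close> is projective, \<rho> lifts to a map \<tau> from \<open>P\<close> to the kernel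
  K, and \<tau> is the identity on K modulo J K because the reduced kernel is K / J K. Nilpotency of
  \<open>J\<close> improves \<tau> to a retraction onto K.\<close>

lemma proj_of_reduction:
  fixes X X' :: "('r, 'm) module"
  assumes large: "large (carrier \<Lambda>) TYPE('m)" "large (carrier \<Gamma>) TYPE('m)"
    and syz: "syzygy d \<Lambda> X" and good: "good d \<Lambda> 1 t (\<lambda>_. j)"
    and redX: "reduction X X' q" and X': "proj \<Gamma> X'"
  shows "proj \<Lambda> X"
proof -
  note q = reductionD[OF redX]
  obtain P :: "('r, 'm) module" and g where P: "proj \<Lambda> P" "g \<in> module_hom \<Lambda> P X" "g ` carrier P = carrier X"
    by (rule free_cover_exists[OF q(1) large(1)]) (rule that)
  note PL = proj_left_module[OF P(1)]
  obtain P' :: "('r, 'm) module" and p where redP: "reduction P P' p" by (rule reduction_exists[OF PL]) (rule that)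
  note p = reductionD[OF redP]
  obtain g' where g': "g' \<in> module_hom \<Gamma> P' X'" "g' ` carrier P' = carrier X'"
    and redK: "reduction (P\<lparr>carrier := a_kernel P X g\<rparr>) (P'\<lparr>carrier := a_kernel P' X' g'\<rparr>) p"
    by (rule reduction_kernel[OF syz good P redP redX]) (rule that)
  let ?K = "a_kernel P X g" and ?K' = "a_kernel P' X' g'"
  note k = reductionD[OF redK]
  interpret g: module_morphism \<Lambda> P X g by (rule module_morphismI[OF PL q(1) P(2)])
  interpret g': module_morphism \<Gamma> P' X' g' by (rule module_morphismI[OF p(2) q(2) g'(1)])
  obtain s where s: "s \<in> module_hom \<Gamma> X' P'" "\<And>y. y \<in> carrier X' \<Longrightarrow> g' (s y) = y"
    by (rule proj_lift[OF X' p(2) q(2) g' module_hom_ident]) (rule that)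
  define \<rho> where "\<rho> y = y \<ominus>\<^bsub>P'\<^esub> s (g' y)" for y
  have \<rho>: "\<rho> \<in> module_hom \<Gamma> P' P'"
    unfolding \<rho>_def by (rule module_hom_minus[OF p(2,2) module_hom_ident module_hom_comp[OF g'(1) s(1)]])
  have \<rho>K: "\<rho> y \<in> ?K'" if "y \<in> carrier P'" for y
    using that module_hom_mem[OF s(1) g'.closed[OF that]] s(2)[OF g'.closed[OF that]]
    by (simp add: a_kernel_iff \<rho>_def g'.N.M.minus_eq_zero_iff)
  have \<rho>id: "\<rho> y = y" if "y \<in> ?K'" for y
  proof -
    interpret s: module_morphism \<Gamma> X' P' s by (rule module_morphismI[OF q(2) p(2) s(1)])
    show ?thesis using that by (simp add: a_kernel_iff \<rho>_def)
  qed
  have \<rho>p: "(\<lambda>x. \<rho> (p x)) \<in> module_hom \<Lambda> P (restrict_scalars \<pi> (P'\<lparr>carrier := ?K'\<rparr>))"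
    by (rule module_hom_comp[OF p(3) module_hom_restrict_scalars[OF module_hom_into_submodule[OF \<rho> \<rho>K] \<pi>_hom]])
  obtain \<tau> where \<tau>: "\<tau> \<in> module_hom \<Lambda> P (P\<lparr>carrier := ?K\<rparr>)" "\<And>x. x \<in> carrier P \<Longrightarrow> p (\<tau> x) = \<rho> (p x)"
    by (rule proj_lift[OF P(1) k(1,6,3) _ \<rho>p]) (use k(4) that in simp_all)
  have KP: "?K \<subseteq> carrier P" by (auto simp: a_kernel_iff)
  have \<tau>K: "\<tau> x \<in> ?K" if "x \<in> carrier P" for x using module_hom_mem[OF \<tau>(1) that] by simp
  have \<tau>P: "\<tau> \<in> module_hom \<Lambda> P P" by (rule module_hom_comp[OF \<tau>(1) inclusion_hom[OF KP]])
  have mod: "x \<ominus>\<^bsub>P\<^esub> \<tau> x \<in> jmul P ?K" if x: "x \<in> ?K" for x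
  proof -
    note \<tau>x = \<tau>K[OF subsetD[OF KP x]]
    have d: "x \<ominus>\<^bsub>P\<^esub> \<tau> x \<in> ?K" by (rule g.M.submoduleD(6)[OF g.submodule_kernel x \<tau>x])
    interpret p: module_morphism \<Lambda> P "restrict_scalars \<pi> P'" p by (rule module_morphismI[OF p(1,6,3)])
    have "p x \<in> ?K'" using k(4) x by auto
    then have "p (\<tau> x) = p x" using \<tau>(2)[OF subsetD[OF KP x]] \<rho>id by simp
    then have "p (x \<ominus>\<^bsub>P\<^esub> \<tau> x) = \<zero>\<^bsub>P'\<^esub>"
      using p.minus[of x "\<tau> x"] p.closed[of x] p.N.M.minus_eq_zero_iff[of "p x" "p x"] subsetD[OF KP x] subsetD[OF KP \<tau>x]
      by simp
    then show ?thesis using k(5)[of "x \<ominus>\<^bsub>P\<^esub> \<tau> x"] d jmul_submodule_module[OF PL g.submodule_kernel] by simp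
  qed
  obtain r where "r \<in> module_hom \<Lambda> P P" "\<And>x. x \<in> carrier P \<Longrightarrow> r x \<in> ?K" "\<And>x. x \<in> ?K \<Longrightarrow> r x = x"
    by (rule nilpotent_retraction[OF PL g.submodule_kernel \<tau>P])
      (rule \<tau>K, assumption, rule mod, assumption, rule that)
  then show ?thesis by (rule proj_of_retraction[OF P(1) q(1) P(2,3)])
qed

lemma syzygy_kernel:
  fixes P X :: "('r, 'm) module"
  assumes "syzygy d R X" "proj R P" "g \<in> module_hom R P X" "g ` carrier P = carrier X"
  shows "syzygy d R (P\<lparr>carrier := a_kernel P X g\<rparr>)"
proof (rule syzygy_Suc_imp)
  show "syzygy (Suc d) R (P\<lparr>carrier := a_kernel P X g\<rparr>)" unfolding syzygy.simps(2)
    by (rule exI[of _ P], rule exI[of _ X], rule exI[of _ g])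
      (intro conjI syzygy_left_module[OF assms(1)] assms refl)
qed

text \<open>Induction along a cover of \<open>X\<close> by a projective module: the kernel is again
  a d-th syzygy, and its reduction is the kernel of the reduced cover.\<close>

theorem pdle_reduction:
  fixes X X' :: "('r, 'm) module"
  assumes large: "large (carrier \<Lambda>) TYPE('m)" "large (carrier \<Gamma>) TYPE('m)"
    and good: "good d \<Lambda> 1 t (\<lambda>_. j)"
    and "syzygy d \<Lambda> X" "reduction X X' q"
  shows "pdle n \<Lambda> X \<longleftrightarrow> pdle n \<Gamma> X'"
  using assms(4,5)
proof (induction n arbitrary: X X' q)
  case 0
  then show ?case using reduction_proj[OF large(2)] proj_of_reduction[OF large _ good] by auto
next
  case (Suc n)
  note q = reductionD[OF Suc.prems(2)]
  have step: "\<exists>(P' :: ('r, 'm) module) g'. proj \<Gamma> P' \<and> g' \<in> module_hom \<Gamma> P' X' \<and> g' ` carrier P' = carrier X' \<and>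
      (pdle n \<Lambda> (P\<lparr>carrier := a_kernel P X g\<rparr>) \<longleftrightarrow> pdle n \<Gamma> (P'\<lparr>carrier := a_kernel P' X' g'\<rparr>))"
    if P: "proj \<Lambda> P" "g \<in> module_hom \<Lambda> P X" "g ` carrier P = carrier X" for P :: "('r, 'm) module" and g
  proof -
    obtain P' :: "('r, 'm) module" and p where redP: "reduction P P' p"
      by (rule reduction_exists[OF proj_left_module[OF P(1)]]) (rule that)
    obtain g' where g': "g' \<in> module_hom \<Gamma> P' X'" "g' ` carrier P' = carrier X'"
      and redK: "reduction (P\<lparr>carrier := a_kernel P X g\<rparr>) (P'\<lparr>carrier := a_kernel P' X' g'\<rparr>) p"
      by (rule reduction_kernel[OF Suc.prems(1) good P redP Suc.prems(2)]) (rule that)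
    show ?thesis
      by (rule exI[of _ P'], rule exI[of _ g'])
        (intro conjI reduction_proj[OF large(2) redP P(1)] g' Suc.IH[OF syzygy_kernel[OF Suc.prems(1) P] redK])
  qed
  show ?case
  proof
    assume "pdle (Suc n) \<Lambda> X"
    then obtain P :: "('r, 'm) module" and g where P: "proj \<Lambda> P" "g \<in> module_hom \<Lambda> P X" "g ` carrier P = carrier X"
      "pdle n \<Lambda> (P\<lparr>carrier := a_kernel P X g\<rparr>)"
      unfolding pdle.simps(2) by (elim conjE exE) (rule that)
    obtain P' :: "('r, 'm) module" and g' where P': "proj \<Gamma> P'" "g' \<in> module_hom \<Gamma> P' X'" "g' ` carrier P' = carrier X'"
      "pdle n \<Lambda> (P\<lparr>carrier := a_kernel P X g\<rparr>) \<longleftrightarrow> pdle n \<Gamma> (P'\<lparr>carrier := a_kernel P' X' g'\<rparr>)"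
      using step[OF P(1-3)] by (elim conjE exE) (rule that)
    show "pdle (Suc n) \<Gamma> X'" by (rule pdle_SucI[OF q(2) P'(1-3)]) (use P'(4) P(4) in simp)
  next
    \<comment> \<open>The bound on X' comes with an unknown cover; \<open>schanuel\<close> moves it
      to the reduction of a free cover of \<open>X\<close>.\<close>
    assume X': "pdle (Suc n) \<Gamma> X'"
    obtain P :: "('r, 'm) module" and g where P: "proj \<Lambda> P" "g \<in> module_hom \<Lambda> P X" "g ` carrier P = carrier X"
      by (rule free_cover_exists[OF q(1) large(1)]) (rule that)
    obtain P' :: "('r, 'm) module" and g' where P': "proj \<Gamma> P'" "g' \<in> module_hom \<Gamma> P' X'" "g' ` carrier P' = carrier X'"
      "pdle n \<Lambda> (P\<lparr>carrier := a_kernel P X g\<rparr>) \<longleftrightarrow> pdle n \<Gamma> (P'\<lparr>carrier := a_kernel P' X' g'\<rparr>)"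
      using step[OF P(1-3)] by (elim conjE exE) (rule that)
    show "pdle (Suc n) \<Lambda> X" by (rule pdle_SucI[OF q(1) P])
      (use P'(4) schanuel[OF large(2) X' P'(1-3)] in simp)
  qed
qed

end

section \<open>Passage of the dimensions from \<Gamma> to \<Lambda>\<close>

context cleft_extension
begin

text \<open>The row \<open>j\<close> has image \<open>J\<close> and cokernel \<Lambda>/J. Its
  relations present \<open>J\<close>, so the stage reached for \<Lambda>/J is one above that for
  \<open>J\<close>.\<close>

lemma right_generated_good:
  assumes large: "large (carrier \<Lambda>) TYPE(nat \<Rightarrow> 'r)" and "pdle d (op_ring \<Lambda>) (ideal_module (op_ring \<Lambda>) J)"
  obtains t j where "right_generated \<Gamma> \<Lambda> i \<pi> \<kappa> \<kappa>' J t j" "good (Suc d) \<Lambda> 1 t (\<lambda>_. j)"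
proof -
  let ?Y = "ideal_module (op_ring \<Lambda>) J" and ?A = "regular_module \<Lambda>" and ?S = "op_ring \<Lambda>"
  have YJ: "carrier ?Y = J" "\<zero>\<^bsub>?Y\<^esub> = \<zero>\<^bsub>\<Lambda>\<^esub>" by (simp_all add: ideal_module_def)
  obtain t :: nat and j u \<psi> where j: "\<And>l. l < t \<Longrightarrow> j l \<in> carrier ?Y"
    "lin ?S ?Y j ` carrier (free_module \<Lambda> {..<t}) = carrier ?Y"
    and \<psi>: "matrix_over \<Lambda> t u \<psi>"
    and ex: "\<And>x. x\<in>carrier (free_module \<Lambda> {..<t}) \<Longrightarrow> lin ?S ?Y j x = \<zero>\<^bsub>?Y\<^esub> \<longleftrightarrow>
      x \<in> mact ?A t u \<psi> ` carrier (free_module \<Lambda> {..<u})"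
    and good: "good d \<Lambda> t u \<psi>"
    by (rule L.presentation_good[OF large assms(2) J_right_finitely_generated]) (rule that)
  have lin: "lin ?S ?Y j x = mact ?A 1 t (\<lambda>_. j) x 0" if x: "x \<in> carrier (free_module \<Lambda> {..<t})" for x
  proof -
    note SA = left_module_regular_op
    interpret SA: left_module ?S "regular_module ?S" by (rule SA)
    have jP: "j \<in> {..<t} \<rightarrow> J" using j(1) by (simp add: YJ)
    then have jP': "j \<in> {..<t} \<rightarrow> carrier (regular_module ?S)" using J_closed by auto
    have xS: "x \<in> carrier (free_module ?S {..<t})" using x by (simp add: free_module_op_carrier)
    have "lin ?S ?Y j x = lin ?S (regular_module ?S) j x"
      unfolding ideal_module_op
      by (rule hom_lin[OF SA.left_module_submodule[OF J_right_submodule] SA inclusion_hom _ xS])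
        (use SA.submoduleD(1)[OF J_right_submodule] jP in auto)
    also have "\<dots> = finsum (regular_module ?S) (\<lambda>l. x l \<odot>\<^bsub>regular_module ?S\<^esub> j l) {..<t}"
      by (rule lin_eq_finsum[OF SA jP' xS]) (use x in \<open>auto simp: column_carrier not_less[symmetric]\<close>)
    finally show ?thesis by (simp add: mact_def finsum_regular_op)
  qed
  have "right_generated \<Gamma> \<Lambda> i \<pi> \<kappa> \<kappa>' J t j"
  proof (unfold_locales)
    show "j l \<in> J" if "l < t" for l using j(1)[OF that] by (simp add: YJ)
    show "\<exists>x\<in>carrier (free_module \<Lambda> {..<t}). c = mact ?A 1 t (\<lambda>_. j) x 0" if "c \<in> J" for c
    proof -
      have "c \<in> lin ?S ?Y j ` carrier (free_module \<Lambda> {..<t})" using that j(2) YJ by simp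
      then obtain x where "c = lin ?S ?Y j x" "x \<in> carrier (free_module \<Lambda> {..<t})" by (rule imageE) (rule that)
      then show ?thesis using lin by (intro bexI[of _ x]) simp_all
    qed
  qed
  moreover have "mact ?A 1 t (\<lambda>_. j) x = (\<lambda>_. \<zero>\<^bsub>\<Lambda>\<^esub>) \<longleftrightarrow> lin ?S ?Y j x = \<zero>\<^bsub>?Y\<^esub>"
    if "x \<in> carrier (free_module \<Lambda> {..<t})" for x
    unfolding lin[OF that] YJ by (simp add: fun_eq_iff mact_def)
  then have "good (Suc d) \<Lambda> 1 t (\<lambda>_. j)"
    unfolding good.simps(2) using \<psi> good ex by (intro exI[of _ u] exI[of _ \<psi>]) simp
  ultimately show ?thesis by (rule that)
qed

text \<open>A \<Lambda>-module M is compared with the reduction N' of a (d+1)-st syzygy of M: N' has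
  finite dimension if M has, and dim M \<le> dim N' + d + 1. So passing to \<Lambda> raises the
  dimension by at most d + 1.\<close>

theorem dimension_transfer_up:
  assumes large: "large (carrier \<Lambda>) TYPE('m)" "large (carrier \<Gamma>) TYPE('m)" "large (carrier \<Lambda>) TYPE(nat \<Rightarrow> 'r)"
    and pd: "pdle d (op_ring \<Lambda>) (ideal_module (op_ring \<Lambda>) J)"
  shows "fin_dim TYPE('m) \<Gamma> < \<infinity> \<Longrightarrow> fin_dim TYPE('m) \<Lambda> < \<infinity>"
    and "Fin_dim TYPE('m) \<Gamma> < \<infinity> \<Longrightarrow> Fin_dim TYPE('m) \<Lambda> < \<infinity>"
    and "gl_dim TYPE('m) \<Gamma> < \<infinity> \<Longrightarrow> gl_dim TYPE('m) \<Lambda> < \<infinity>"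
proof -
  obtain t j where "right_generated \<Gamma> \<Lambda> i \<pi> \<kappa> \<kappa>' J t j" and good: "good (Suc d) \<Lambda> 1 t (\<lambda>_. j)"
    by (rule right_generated_good[OF large(3) pd])
  then interpret right_generated \<Gamma> \<Lambda> i \<pi> \<kappa> \<kappa>' J t j by simp
  have key: "\<exists>X' :: ('r, 'm) module. left_module \<Gamma> X' \<and>
      (finitely_generated \<Lambda> M \<longrightarrow> finitely_generated \<Gamma> X') \<and> (\<forall>p. pdle p \<Lambda> M \<longrightarrow> pdle p \<Gamma> X') \<and>
      (\<forall>n. pdle n \<Gamma> X' \<longrightarrow> pdle (n + Suc d) \<Lambda> M)"
    if M: "left_module \<Lambda> M" for M :: "('r, 'm) module"
  proof -
    obtain N :: "('r, 'm) module" where N: "syzygy (Suc d) \<Lambda> N"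
      "finitely_generated \<Lambda> M \<longrightarrow> finitely_generated \<Lambda> N"
      "\<forall>p. pdle p \<Lambda> M \<longrightarrow> pdle p \<Lambda> N" "\<forall>f. pdle f \<Lambda> N \<longrightarrow> pdle (f + Suc d) \<Lambda> M"
      using L.syzygy_exists[OF large(1) M, of "Suc d"] by (elim exE conjE) (rule that)
    note NL = syzygy_left_module[OF N(1)]
    obtain N' :: "('r, 'm) module" and q where red: "reduction N N' q"
      by (rule reduction_exists[OF NL]) (rule that)
    note q = reductionD[OF red]
    have iff: "pdle n \<Lambda> N \<longleftrightarrow> pdle n \<Gamma> N'" for n by (rule pdle_reduction[OF large(1,2) good N(1) red])
    have "finitely_generated \<Gamma> N'" if fgN: "finitely_generated \<Lambda> N"
    proof -
      obtain S where S: "finite S" "S \<subseteq> carrier N" "\<And>H. submodule H \<Lambda> N \<Longrightarrow> S \<subseteq> H \<Longrightarrow> H = carrier N"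
        using fgN by (elim finitely_generatedE) (rule that)
      interpret q: module_morphism \<Lambda> N "restrict_scalars \<pi> N'" q by (rule module_morphismI[OF q(1,6,3)])
      interpret N': left_module \<Gamma> N' by (rule q(2))
      show ?thesis
      proof (rule finitely_generatedI[of "q ` S"])
        fix H assume H: "submodule H \<Gamma> N'" "q ` S \<subseteq> H"
        note H' = N'.submoduleD[OF H(1)]
        have "submodule H \<Lambda> (restrict_scalars \<pi> N')"
          by (rule q.N.submoduleI') (use H' \<pi>_closed in auto)
        then have "{x \<in> carrier N. q x \<in> H} = carrier N"
          using S(2) H(2) by (intro S(3)[OF q.submodule_vimage]) auto
        then have "carrier N' \<subseteq> H" unfolding q(4)[symmetric] by blast
        then show "H = carrier N'" using H'(1) by blast
      qed (use S(1,2) q.closed in auto)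
    qed
    then show ?thesis using N(2-4) q(2) iff by (intro exI[of _ N']) simp
  qed
  show "fin_dim TYPE('m) \<Lambda> < \<infinity>" if fin: "fin_dim TYPE('m) \<Gamma> < \<infinity>"
  proof -
    obtain n where "\<forall>(M :: ('r, 'm) module) m. left_module \<Gamma> M \<longrightarrow> finitely_generated \<Gamma> M \<longrightarrow>
        pdle m \<Gamma> M \<longrightarrow> pdle n \<Gamma> M"
      using fin unfolding fin_dim_finite_iff[OF large(2)] ..
    then have "\<forall>(M :: ('r, 'm) module) m. left_module \<Lambda> M \<longrightarrow> finitely_generated \<Lambda> M \<longrightarrow>
        pdle m \<Lambda> M \<longrightarrow> pdle (n + Suc d) \<Lambda> M" using key by meson
    then show ?thesis unfolding fin_dim_finite_iff[OF large(1)] ..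
  qed
  show "Fin_dim TYPE('m) \<Lambda> < \<infinity>" if fin: "Fin_dim TYPE('m) \<Gamma> < \<infinity>"
  proof -
    obtain n where "\<forall>(M :: ('r, 'm) module) m. left_module \<Gamma> M \<longrightarrow> pdle m \<Gamma> M \<longrightarrow> pdle n \<Gamma> M"
      using fin unfolding Fin_dim_finite_iff[OF large(2)] ..
    then have "\<forall>(M :: ('r, 'm) module) m. left_module \<Lambda> M \<longrightarrow> pdle m \<Lambda> M \<longrightarrow> pdle (n + Suc d) \<Lambda> M"
      using key by meson
    then show ?thesis unfolding Fin_dim_finite_iff[OF large(1)] ..
  qed
  show "gl_dim TYPE('m) \<Lambda> < \<infinity>" if fin: "gl_dim TYPE('m) \<Gamma> < \<infinity>"
  proof -
    obtain n where "\<forall>(M :: ('r, 'm) module). left_module \<Gamma> M \<longrightarrow> pdle n \<Gamma> M"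
      using fin unfolding gl_dim_finite_iff[OF large(2)] ..
    then have "\<forall>(M :: ('r, 'm) module). left_module \<Lambda> M \<longrightarrow> pdle (n + Suc d) \<Lambda> M" using key by meson
    then show ?thesis unfolding gl_dim_finite_iff[OF large(1)] ..
  qed
qed

end

section \<open>Extension of scalars when the kernel squares to zero\<close>

lemma (in abelian_monoid) finsum_swap:
  assumes "finite A" "\<And>l m. l \<in> A \<Longrightarrow> m \<in> B \<Longrightarrow> f l m \<in> carrier G"
  shows "finsum G (\<lambda>l. finsum G (\<lambda>m. f l m) B) A = finsum G (\<lambda>m. finsum G (\<lambda>l. f l m) A) B"
  using assms
proof (induction A rule: finite_induct)
  case empty
  then show ?case by (simp add: finsum_zero)
next
  case (insert a A)
  have c: "f a m \<in> carrier G" "l \<in> A \<Longrightarrow> f l m \<in> carrier G" if "m \<in> B" for l m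
    using insert.prems that by auto
  have "finsum G (\<lambda>l. finsum G (\<lambda>m. f l m) B) (insert a A) =
      finsum G (\<lambda>m. f a m) B \<oplus> finsum G (\<lambda>l. finsum G (\<lambda>m. f l m) B) A"
    using insert.hyps c by (intro finsum_insert) (auto intro!: finsum_closed)
  also have "\<dots> = finsum G (\<lambda>m. f a m) B \<oplus> finsum G (\<lambda>m. finsum G (\<lambda>l. f l m) A) B"
    using insert.IH insert.prems by simp
  also have "\<dots> = finsum G (\<lambda>m. f a m \<oplus> finsum G (\<lambda>l. f l m) A) B"
    using c by (intro finsum_addf[symmetric]) (auto intro!: finsum_closed)
  also have "\<dots> = finsum G (\<lambda>m. finsum G (\<lambda>l. f l m) (insert a A)) B"
    using insert.hyps c by (intro finsum_cong' refl) (auto intro!: finsum_closed finsum_insert[symmetric])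
  finally show ?case .
qed

lemma column_add:
  assumes "left_module R N" "x \<in> carrier (column_module t N)" "x' \<in> carrier (column_module t N)"
  shows "(\<lambda>l. x l \<oplus>\<^bsub>N\<^esub> x' l) \<in> carrier (column_module t N)"
proof -
  interpret left_module R N by fact
  show ?thesis using assms(2,3) by (simp add: column_carrier)
qed

lemma column_minus:
  assumes "left_module R N" "x \<in> carrier (column_module t N)" "x' \<in> carrier (column_module t N)"
  shows "(\<lambda>l. x l \<ominus>\<^bsub>N\<^esub> x' l) \<in> carrier (column_module t N)"
proof -
  interpret left_module R N by fact
  show ?thesis using assms(2,3) by (simp add: column_carrier)
qed

text \<open>\<open>J\<close> as a right \<open>\<Gamma>\<close>-module, presented by generators \<open>y\<close> and relations \<open>\<psi>\<close>.\<close>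

locale right_presented = cleft_extension \<Gamma> \<Lambda> i \<pi> \<kappa> \<kappa>' J
  for \<Gamma> \<Lambda> :: "'r ring" and i \<pi> and \<kappa> \<kappa>' :: "'k::field \<Rightarrow> 'r" and J +
  fixes t u :: nat and y :: "nat \<Rightarrow> 'r" and \<psi>
  assumes y_J: "\<And>l. l < t \<Longrightarrow> y l \<in> J"
    and \<psi>_matrix: "matrix_over \<Gamma> t u \<psi>"
    and J_spanned: "\<And>c. c \<in> J \<Longrightarrow> \<exists>x\<in>carrier (column_module t (regular_module \<Gamma>)).
      c = finsum (regular_module \<Lambda>) (\<lambda>l. y l \<otimes>\<^bsub>\<Lambda>\<^esub> i (x l)) {..<t}"
    and relations: "\<And>x. x \<in> carrier (column_module t (regular_module \<Gamma>)) \<Longrightarrow>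
      finsum (regular_module \<Lambda>) (\<lambda>l. y l \<otimes>\<^bsub>\<Lambda>\<^esub> i (x l)) {..<t} = \<zero>\<^bsub>\<Lambda>\<^esub> \<longleftrightarrow>
      x \<in> mact (regular_module \<Gamma>) t u \<psi> ` carrier (column_module u (regular_module \<Gamma>))"
begin

lemma y_closed: "l < t \<Longrightarrow> y l \<in> carrier \<Lambda>"
  using y_J J_closed by blast

lemma \<pi>_y: "l < t \<Longrightarrow> \<pi> (y l) = \<zero>\<^bsub>\<Gamma>\<^esub>"
  using y_J by (simp add: J_def)

lemma i_zero: "i \<zero>\<^bsub>\<Gamma>\<^esub> = \<zero>\<^bsub>\<Lambda>\<^esub>"
  by (rule ring_hom_zero[OF i_hom ring_\<Gamma> ring_\<Lambda>])

lemma relation_columns: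
  assumes "m < u"
  shows "finsum (regular_module \<Lambda>) (\<lambda>l. y l \<otimes>\<^bsub>\<Lambda>\<^esub> i (\<psi> l m)) {..<t} = \<zero>\<^bsub>\<Lambda>\<^esub>"
proof -
  let ?A = "regular_module \<Gamma>"
  interpret A: left_module \<Gamma> ?A by (rule left_module_regular[OF ring_\<Gamma>])
  interpret B: left_module \<Lambda> "regular_module \<Lambda>" by (rule left_module_regular[OF ring_\<Lambda>])
  have c: "\<psi> l m' \<in> carrier \<Gamma>" if "l < t" "m' < u" for l m' using \<psi>_matrix that by (simp add: matrix_over_def)
  let ?x = "mact ?A t u \<psi> (unit_vector \<Gamma> m)"
  have x: "?x l = \<psi> l m" if "l < t" for l
  proof -
    have "finsum ?A (\<lambda>m'. \<psi> l m' \<odot>\<^bsub>?A\<^esub> unit_vector \<Gamma> m m') {..<u} =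
      finsum ?A (\<lambda>m'. if m = m' then \<psi> l m' else \<zero>\<^bsub>?A\<^esub>) {..<u}"
      using c that by (intro A.M.finsum_cong') (auto simp: unit_vector_def)
    also have "\<dots> = \<psi> l m" using assms c that by (intro A.M.finsum_singleton) auto
    finally show ?thesis using that by (simp add: mact_def cong: if_cong)
  qed
  have u: "unit_vector \<Gamma> m \<in> carrier (column_module u ?A)" using assms ring_\<Gamma> by simp
  have "finsum (regular_module \<Lambda>) (\<lambda>l. y l \<otimes>\<^bsub>\<Lambda>\<^esub> i (?x l)) {..<t} = \<zero>\<^bsub>\<Lambda>\<^esub>"
    using relations[OF mact_carrier[OF left_module_regular[OF ring_\<Gamma>] \<psi>_matrix u]] u by blast
  moreover have "finsum (regular_module \<Lambda>) (\<lambda>l. y l \<otimes>\<^bsub>\<Lambda>\<^esub> i (?x l)) {..<t} =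
    finsum (regular_module \<Lambda>) (\<lambda>l. y l \<otimes>\<^bsub>\<Lambda>\<^esub> i (\<psi> l m)) {..<t}"
    using x y_closed c assms i_closed by (intro B.M.finsum_cong') auto
  ultimately show ?thesis by simp
qed

text \<open>The image of \<Sigma> y_l \<otimes> x_l under the map from J \<otimes> N to
  \<open>L\<close> induced by \<open>f\<close>.\<close>

definition jn :: "('r, 'n) module \<Rightarrow> ('m \<Rightarrow> 'n) \<Rightarrow> (nat \<Rightarrow> 'm) \<Rightarrow> 'n" where
  "jn L f x = finsum L (\<lambda>l. y l \<odot>\<^bsub>L\<^esub> f (x l)) {..<t}"

context
  fixes N :: "('r, 'm) module" and L :: "('r, 'n) module" and f
  assumes N: "left_module \<Gamma> N" and L: "left_module \<Lambda> L" and f: "f \<in> module_hom \<Gamma> N (restrict_scalars i L)"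
begin

interpretation N: left_module \<Gamma> N by (rule N)
interpretation L: left_module \<Lambda> L by (rule L)
interpretation f: module_morphism \<Gamma> N "restrict_scalars i L" f
  by (rule module_morphismI[OF N left_module_restrict_scalars[OF ring_\<Gamma> i_hom L] f])

lemma f_closed: "n \<in> carrier N \<Longrightarrow> f n \<in> carrier L"
  using f.closed by simp

lemma jn_closed:
  assumes "x \<in> carrier (column_module t N)" shows "jn L f x \<in> carrier L"
  unfolding jn_def using y_closed f_closed[OF power_module_mem[OF N assms]]
  by (intro L.M.finsum_closed) auto

text \<open>This is how \<open>J\<close> acts on the image of \<open>f\<close>: the coefficients of
  an element of \<open>J\<close> in the generators \<open>y\<close> are absorbed by n.\<close>

lemma smult_jn:
  assumes "x \<in> carrier (column_module t (regular_module \<Gamma>))" "n \<in> carrier N"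
  shows "finsum (regular_module \<Lambda>) (\<lambda>l. y l \<otimes>\<^bsub>\<Lambda>\<^esub> i (x l)) {..<t} \<odot>\<^bsub>L\<^esub> f n = jn L f (\<lambda>l. x l \<odot>\<^bsub>N\<^esub> n)"
    and "(\<lambda>l. x l \<odot>\<^bsub>N\<^esub> n) \<in> carrier (column_module t N)"
proof -
  have xc: "x l \<in> carrier \<Gamma>" for l
    using power_module_mem[OF left_module_regular[OF ring_\<Gamma>] assms(1), of l] by simp
  show "(\<lambda>l. x l \<odot>\<^bsub>N\<^esub> n) \<in> carrier (column_module t N)" using assms xc by (simp add: column_carrier)
  interpret h: module_morphism \<Lambda> "regular_module \<Lambda>" L "\<lambda>r. r \<odot>\<^bsub>L\<^esub> f n"
    using f_closed[OF assms(2)] by (intro module_morphismI left_module_regular ring_\<Lambda> L module_homI)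
      (simp_all add: L.smult_l_distr L.smult_assoc)
  have "finsum (regular_module \<Lambda>) (\<lambda>l. y l \<otimes>\<^bsub>\<Lambda>\<^esub> i (x l)) {..<t} \<odot>\<^bsub>L\<^esub> f n =
      finsum L (\<lambda>l. (y l \<otimes>\<^bsub>\<Lambda>\<^esub> i (x l)) \<odot>\<^bsub>L\<^esub> f n) {..<t}"
    using xc i_closed y_closed by (intro h.finsum) auto
  also have "\<dots> = jn L f (\<lambda>l. x l \<odot>\<^bsub>N\<^esub> n)"
    unfolding jn_def using xc i_closed y_closed f_closed assms(2) f.smult
    by (intro L.M.finsum_cong') (auto simp: L.smult_assoc)
  finally show "finsum (regular_module \<Lambda>) (\<lambda>l. y l \<otimes>\<^bsub>\<Lambda>\<^esub> i (x l)) {..<t} \<odot>\<^bsub>L\<^esub> f n = jn L f (\<lambda>l. x l \<odot>\<^bsub>N\<^esub> n)" .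
qed

lemma jn_add:
  assumes "x \<in> carrier (column_module t N)" "x' \<in> carrier (column_module t N)"
  shows "jn L f (\<lambda>l. x l \<oplus>\<^bsub>N\<^esub> x' l) = jn L f x \<oplus>\<^bsub>L\<^esub> jn L f x'"
proof -
  have c: "x l \<in> carrier N" "x' l \<in> carrier N" for l
    using power_module_mem[OF N assms(1)] power_module_mem[OF N assms(2)] by auto
  have "jn L f (\<lambda>l. x l \<oplus>\<^bsub>N\<^esub> x' l) = finsum L (\<lambda>l. y l \<odot>\<^bsub>L\<^esub> f (x l) \<oplus>\<^bsub>L\<^esub> y l \<odot>\<^bsub>L\<^esub> f (x' l)) {..<t}"
    unfolding jn_def using c y_closed f_closed f.add
    by (intro L.M.finsum_cong') (auto simp: L.smult_r_distr)
  also have "\<dots> = jn L f x \<oplus>\<^bsub>L\<^esub> jn L f x'"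
    unfolding jn_def using c y_closed f_closed by (intro L.M.finsum_addf) auto
  finally show ?thesis .
qed

lemma jn_minus:
  assumes "x \<in> carrier (column_module t N)" "x' \<in> carrier (column_module t N)"
  shows "jn L f (\<lambda>l. x l \<ominus>\<^bsub>N\<^esub> x' l) = jn L f x \<ominus>\<^bsub>L\<^esub> jn L f x'"
proof -
  note d = column_minus[OF N assms]
  have c: "x l \<in> carrier N" "x' l \<in> carrier N" for l
    using power_module_mem[OF N assms(1)] power_module_mem[OF N assms(2)] by auto
  have "x = (\<lambda>l. (x l \<ominus>\<^bsub>N\<^esub> x' l) \<oplus>\<^bsub>N\<^esub> x' l)"
    using c by (simp add: a_minus_def N.M.a_assoc N.M.l_neg)
  then have "jn L f x = jn L f (\<lambda>l. x l \<ominus>\<^bsub>N\<^esub> x' l) \<oplus>\<^bsub>L\<^esub> jn L f x'"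
    using jn_add[OF d assms(2)] by simp
  then show ?thesis using jn_closed[OF d] jn_closed[OF assms(2)]
    by (simp add: a_minus_def L.M.a_assoc L.M.r_neg)
qed

text \<open>Interchanging the sums moves \<psi> to the generators, where its columns are relations
  of \<open>J\<close>.\<close>

lemma jn_relation:
  assumes w: "w \<in> carrier (column_module u N)"
  shows "jn L f (mact N t u \<psi> w) = \<zero>\<^bsub>L\<^esub>"
proof -
  let ?B = "regular_module \<Lambda>"
  have c: "w m \<in> carrier N" for m by (rule power_module_mem[OF N w])
  have p: "\<psi> l m \<in> carrier \<Gamma>" if "l < t" "m < u" for l m using \<psi>_matrix that by (simp add: matrix_over_def)
  have "jn L f (mact N t u \<psi> w) =
      finsum L (\<lambda>l. finsum L (\<lambda>m. (y l \<otimes>\<^bsub>\<Lambda>\<^esub> i (\<psi> l m)) \<odot>\<^bsub>L\<^esub> f (w m)) {..<u}) {..<t}"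
    unfolding jn_def
  proof (rule L.M.finsum_cong'[OF refl])
    fix l assume "l \<in> {..<t}"
    then have l: "l < t" by simp
    have "f (mact N t u \<psi> w l) = f (finsum N (\<lambda>m. \<psi> l m \<odot>\<^bsub>N\<^esub> w m) {..<u})" using l by (simp add: mact_def)
    also have "\<dots> = finsum (restrict_scalars i L) (\<lambda>m. f (\<psi> l m \<odot>\<^bsub>N\<^esub> w m)) {..<u}"
      using c p l by (intro f.finsum) auto
    also have "\<dots> = finsum L (\<lambda>m. f (\<psi> l m \<odot>\<^bsub>N\<^esub> w m)) {..<u}"
      by (simp add: finsum_def restrict_scalars_def)
    also have "\<dots> = finsum L (\<lambda>m. i (\<psi> l m) \<odot>\<^bsub>L\<^esub> f (w m)) {..<u}"
      using c p l f.smult f_closed i_closed by (intro L.M.finsum_cong') auto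
    finally have "y l \<odot>\<^bsub>L\<^esub> f (mact N t u \<psi> w l) = finsum L (\<lambda>m. y l \<odot>\<^bsub>L\<^esub> (i (\<psi> l m) \<odot>\<^bsub>L\<^esub> f (w m))) {..<u}"
      using c p l f_closed i_closed y_closed by (simp add: L.smult_finsum Pi_iff)
    also have "\<dots> = finsum L (\<lambda>m. (y l \<otimes>\<^bsub>\<Lambda>\<^esub> i (\<psi> l m)) \<odot>\<^bsub>L\<^esub> f (w m)) {..<u}"
      using c p l f_closed i_closed y_closed by (intro L.M.finsum_cong') (auto simp: L.smult_assoc)
    finally show "y l \<odot>\<^bsub>L\<^esub> f (mact N t u \<psi> w l) = finsum L (\<lambda>m. (y l \<otimes>\<^bsub>\<Lambda>\<^esub> i (\<psi> l m)) \<odot>\<^bsub>L\<^esub> f (w m)) {..<u}" .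
  qed (use c p f_closed i_closed y_closed in \<open>auto intro!: L.M.finsum_closed\<close>)
  also have "\<dots> = finsum L (\<lambda>m. finsum L (\<lambda>l. (y l \<otimes>\<^bsub>\<Lambda>\<^esub> i (\<psi> l m)) \<odot>\<^bsub>L\<^esub> f (w m)) {..<t}) {..<u}"
    using c p f_closed i_closed y_closed by (intro L.M.finsum_swap) auto
  also have "\<dots> = finsum L (\<lambda>m. \<zero>\<^bsub>L\<^esub>) {..<u}"
  proof (rule L.M.finsum_cong'[OF refl])
    fix m assume "m \<in> {..<u}"
    then have m: "m < u" by simp
    interpret h: module_morphism \<Lambda> ?B L "\<lambda>r. r \<odot>\<^bsub>L\<^esub> f (w m)"
      using f_closed[OF c[of m]] by (intro module_morphismI left_module_regular ring_\<Lambda> L module_homI)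
        (simp_all add: L.smult_l_distr L.smult_assoc)
    have "finsum L (\<lambda>l. (y l \<otimes>\<^bsub>\<Lambda>\<^esub> i (\<psi> l m)) \<odot>\<^bsub>L\<^esub> f (w m)) {..<t} =
        finsum ?B (\<lambda>l. y l \<otimes>\<^bsub>\<Lambda>\<^esub> i (\<psi> l m)) {..<t} \<odot>\<^bsub>L\<^esub> f (w m)"
      using p m i_closed y_closed by (intro h.finsum[symmetric]) auto
    then show "finsum L (\<lambda>l. (y l \<otimes>\<^bsub>\<Lambda>\<^esub> i (\<psi> l m)) \<odot>\<^bsub>L\<^esub> f (w m)) {..<t} = \<zero>\<^bsub>L\<^esub>"
      using relation_columns[OF m] f_closed[OF c] by simp
  qed simp
  finally show ?thesis by (simp add: L.M.finsum_zero)
qed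

end

lemma jn_comp:
  assumes "left_module \<Lambda> L" "left_module \<Lambda> L'" "h \<in> module_hom \<Lambda> L L'"
    "\<And>l. l < t \<Longrightarrow> f (x l) \<in> carrier L"
  shows "h (jn L f x) = jn L' (\<lambda>n. h (f n)) x"
proof -
  interpret h: module_morphism \<Lambda> L L' h by (rule module_morphismI) fact+
  have "h (jn L f x) = finsum L' (\<lambda>l. h (y l \<odot>\<^bsub>L\<^esub> f (x l))) {..<t}"
    unfolding jn_def using assms(4) y_closed by (intro h.finsum) auto
  also have "\<dots> = jn L' (\<lambda>n. h (f n)) x"
    unfolding jn_def using assms(4) y_closed by (intro h.N.M.finsum_cong') auto
  finally show ?thesis .
qed

text \<open>\<open>N'\<close> is \<open>\<Lambda> \<otimes>\<^sub>\<Gamma> N\<close>, characterised without tensor products: as an additive group it is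
  the direct sum of \<open>\<iota> N\<close> and the module \<open>J \<otimes>\<^sub>\<Gamma> N\<close> presented by \<open>y\<close> and \<open>\<psi>\<close>.\<close>

definition induced ::
  "('r, 'm) module \<Rightarrow> ('r, 'n) module \<Rightarrow> ('m \<Rightarrow> 'n) \<Rightarrow> ('n \<Rightarrow> 'm) \<Rightarrow> bool" where
  "induced N N' \<iota> \<beta> \<longleftrightarrow> left_module \<Gamma> N \<and> left_module \<Lambda> N' \<and>
    \<iota> \<in> module_hom \<Gamma> N (restrict_scalars i N') \<and> \<beta> \<in> module_hom \<Lambda> N' (restrict_scalars \<pi> N) \<and>
    (\<forall>n\<in>carrier N. \<beta> (\<iota> n) = n) \<and>
    (\<forall>z\<in>carrier N'. \<exists>n\<in>carrier N. \<exists>x\<in>carrier (column_module t N). z = \<iota> n \<oplus>\<^bsub>N'\<^esub> jn N' \<iota> x) \<and>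
    (\<forall>x\<in>carrier (column_module t N). jn N' \<iota> x = \<zero>\<^bsub>N'\<^esub> \<longrightarrow>
      x \<in> mact N t u \<psi> ` carrier (column_module u N))"

lemma inducedD:
  assumes "induced N N' \<iota> \<beta>"
  shows "left_module \<Gamma> N" "left_module \<Lambda> N'" "\<iota> \<in> module_hom \<Gamma> N (restrict_scalars i N')"
    "\<beta> \<in> module_hom \<Lambda> N' (restrict_scalars \<pi> N)" "\<And>n. n \<in> carrier N \<Longrightarrow> \<beta> (\<iota> n) = n"
    "\<And>z. z \<in> carrier N' \<Longrightarrow> \<exists>n\<in>carrier N. \<exists>x\<in>carrier (column_module t N). z = \<iota> n \<oplus>\<^bsub>N'\<^esub> jn N' \<iota> x"
    "\<And>x. x \<in> carrier (column_module t N) \<Longrightarrow> jn N' \<iota> x = \<zero>\<^bsub>N'\<^esub> \<Longrightarrow>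
      x \<in> mact N t u \<psi> ` carrier (column_module u N)"
  using assms unfolding induced_def by simp_all

text \<open>\<pi> kills every \<open>y l\<close>, so \<beta> vanishes on the part coming from
  \<open>J\<close>. Consequently the component n of an element is unique, although the column x need
  not be.\<close>

lemma induced_\<beta>_jn:
  assumes "induced N N' \<iota> \<beta>" "x \<in> carrier (column_module t N)" "n \<in> carrier N"
  shows "\<beta> (\<iota> n \<oplus>\<^bsub>N'\<^esub> jn N' \<iota> x) = n"
proof -
  note I = inducedD[OF assms(1)]
  note L = left_module_restrict_scalars[OF ring_\<Lambda> \<pi>_hom I(1)]
  interpret \<beta>: module_morphism \<Lambda> N' "restrict_scalars \<pi> N" \<beta> by (rule module_morphismI[OF I(2) L I(4)])
  interpret N: left_module \<Gamma> N by (rule I(1))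
  have c: "x l \<in> carrier N" for l by (rule power_module_mem[OF I(1) assms(2)])
  have \<iota>c: "\<iota> m \<in> carrier N'" if "m \<in> carrier N" for m using f_closed[OF I(1-3) that] .
  have "\<beta> (jn N' \<iota> x) = jn (restrict_scalars \<pi> N) (\<lambda>n. \<beta> (\<iota> n)) x"
    by (rule jn_comp[OF I(2) L I(4)]) (rule \<iota>c[OF c])
  also have "\<dots> = finsum (restrict_scalars \<pi> N) (\<lambda>l. \<zero>\<^bsub>restrict_scalars \<pi> N\<^esub>) {..<t}"
    unfolding jn_def using c by (intro \<beta>.N.M.finsum_cong') (auto simp: I(5) \<pi>_y)
  also have "\<dots> = \<zero>\<^bsub>N\<^esub>" using \<beta>.N.M.finsum_zero[of "{..<t}"] by simp
  finally have "\<beta> (jn N' \<iota> x) = \<zero>\<^bsub>N\<^esub>" .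
  then show ?thesis
    using \<beta>.add[OF \<iota>c[OF assms(3)] jn_closed[OF I(1-3) assms(2)]] I(5)[OF assms(3)] assms(3) by simp
qed

text \<open>The universal property of \<Lambda> \<otimes> N. The extension is built as a graph,
  because an element may be written with several columns x; two of them differ by a relation \<psi>
  w, which \<open>jn\<close> sends to zero in \<open>L\<close> as well.\<close>

lemma induced_extend:
  fixes N :: "('r, 'm) module" and N' :: "('r, 'n) module" and L :: "('r, 'l) module"
  assumes ind: "induced N N' \<iota> \<beta>" and L: "left_module \<Lambda> L" and f: "f \<in> module_hom \<Gamma> N (restrict_scalars i L)"
  obtains f' where "f' \<in> module_hom \<Lambda> N' L"
    "\<And>n x. n \<in> carrier N \<Longrightarrow> x \<in> carrier (column_module t N) \<Longrightarrow>
      f' (\<iota> n \<oplus>\<^bsub>N'\<^esub> jn N' \<iota> x) = f n \<oplus>\<^bsub>L\<^esub> jn L f x"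
proof -
  note I = inducedD[OF ind]
  note N = I(1) and N' = I(2) and \<iota> = I(3)
  interpret N: left_module \<Gamma> N by (rule N)
  interpret N': left_module \<Lambda> N' by (rule N')
  interpret L: left_module \<Lambda> L by (rule L)
  interpret f: module_morphism \<Gamma> N "restrict_scalars i L" f
    by (rule module_morphismI[OF N left_module_restrict_scalars[OF ring_\<Gamma> i_hom L] f])
  interpret \<iota>: module_morphism \<Gamma> N "restrict_scalars i N'" \<iota>
    by (rule module_morphismI[OF N left_module_restrict_scalars[OF ring_\<Gamma> i_hom N'] \<iota>])
  note fc = f_closed[OF N L f] and \<iota>c = f_closed[OF N N' \<iota>]
    and jc = jn_closed[OF N L f] and jc' = jn_closed[OF N N' \<iota>]
  define G where "G = {(\<iota> n \<oplus>\<^bsub>N'\<^esub> jn N' \<iota> x, f n \<oplus>\<^bsub>L\<^esub> jn L f x) |n x.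
    n \<in> carrier N \<and> x \<in> carrier (column_module t N)}"
  have GI: "(\<iota> n \<oplus>\<^bsub>N'\<^esub> jn N' \<iota> x, f n \<oplus>\<^bsub>L\<^esub> jn L f x) \<in> G"
    if "n \<in> carrier N" "x \<in> carrier (column_module t N)" for n x
    using that unfolding G_def by blast
  have z: "(\<lambda>l. \<zero>\<^bsub>N\<^esub>) \<in> carrier (column_module t N)" by (simp add: column_carrier)
  have jz: "jn N' \<iota> (\<lambda>l. \<zero>\<^bsub>N\<^esub>) = \<zero>\<^bsub>N'\<^esub>" "jn L f (\<lambda>l. \<zero>\<^bsub>N\<^esub>) = \<zero>\<^bsub>L\<^esub>"
    using jn_minus[OF N N' \<iota> z z] jn_minus[OF N L f z z] jc'[OF z] jc[OF z]
    by (simp_all add: a_minus_def N.M.r_neg N'.M.r_neg L.M.r_neg)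
  have G\<iota>: "(\<iota> n, f n) \<in> G" if "n \<in> carrier N" for n
    using GI[OF that z] that \<iota>c fc by (simp add: jz)
  have Gj: "(jn N' \<iota> x, jn L f x) \<in> G" if "x \<in> carrier (column_module t N)" for x
    using GI[OF N.M.zero_closed that] \<iota>.zero f.zero jc[OF that] jc'[OF that] by simp
  have G0: "(\<zero>\<^bsub>N'\<^esub>, \<zero>\<^bsub>L\<^esub>) \<in> G" using Gj[OF z] by (simp add: jz)
  have GE: thesis
    if "(a, b) \<in> G" "\<And>n x. n \<in> carrier N \<Longrightarrow> x \<in> carrier (column_module t N) \<Longrightarrow>
      a = \<iota> n \<oplus>\<^bsub>N'\<^esub> jn N' \<iota> x \<Longrightarrow> b = f n \<oplus>\<^bsub>L\<^esub> jn L f x \<Longrightarrow> thesis" for a b thesis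
    using that(1) unfolding G_def by (auto intro: that(2))
  have Gadd: "(a \<oplus>\<^bsub>N'\<^esub> a', b \<oplus>\<^bsub>L\<^esub> b') \<in> G" if ab: "(a, b) \<in> G" "(a', b') \<in> G" for a b a' b'
  proof -
    obtain n x where 1: "n \<in> carrier N" "x \<in> carrier (column_module t N)"
      "a = \<iota> n \<oplus>\<^bsub>N'\<^esub> jn N' \<iota> x" "b = f n \<oplus>\<^bsub>L\<^esub> jn L f x" by (rule GE[OF ab(1)])
    obtain n' x' where 2: "n' \<in> carrier N" "x' \<in> carrier (column_module t N)"
      "a' = \<iota> n' \<oplus>\<^bsub>N'\<^esub> jn N' \<iota> x'" "b' = f n' \<oplus>\<^bsub>L\<^esub> jn L f x'" by (rule GE[OF ab(2)])
    have "a \<oplus>\<^bsub>N'\<^esub> a' = \<iota> (n \<oplus>\<^bsub>N\<^esub> n') \<oplus>\<^bsub>N'\<^esub> jn N' \<iota> (\<lambda>l. x l \<oplus>\<^bsub>N\<^esub> x' l)"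
      using 1 2 \<iota>c jc' \<iota>.add by (simp add: jn_add[OF N N' \<iota>] N'.M.a_ac)
    moreover have "b \<oplus>\<^bsub>L\<^esub> b' = f (n \<oplus>\<^bsub>N\<^esub> n') \<oplus>\<^bsub>L\<^esub> jn L f (\<lambda>l. x l \<oplus>\<^bsub>N\<^esub> x' l)"
      using 1 2 fc jc f.add by (simp add: jn_add[OF N L f] L.M.a_ac)
    ultimately show ?thesis using GI[OF N.M.a_closed[OF 1(1) 2(1)] column_add[OF N 1(2) 2(2)]] by simp
  qed
  have Gsub: "a \<in> carrier N'" "b \<in> carrier L" if "(a, b) \<in> G" for a b
    using that \<iota>c jc' fc jc unfolding G_def by auto
  have Gfun: "b = b'" if ab: "(a, b) \<in> G" "(a, b') \<in> G" for a b b'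
  proof -
    obtain n x where 1: "n \<in> carrier N" "x \<in> carrier (column_module t N)"
      "a = \<iota> n \<oplus>\<^bsub>N'\<^esub> jn N' \<iota> x" "b = f n \<oplus>\<^bsub>L\<^esub> jn L f x" by (rule GE[OF ab(1)])
    obtain n' x' where 2: "n' \<in> carrier N" "x' \<in> carrier (column_module t N)"
      "a = \<iota> n' \<oplus>\<^bsub>N'\<^esub> jn N' \<iota> x'" "b' = f n' \<oplus>\<^bsub>L\<^esub> jn L f x'" by (rule GE[OF ab(2)])
    have nn: "n = n'"
      using induced_\<beta>_jn[OF ind 1(2,1)] induced_\<beta>_jn[OF ind 2(2,1)] 1(3) 2(3) by simp
    then have "jn N' \<iota> x = jn N' \<iota> x'"
      using 1 2 \<iota>c jc' by simp
    then have "jn N' \<iota> (\<lambda>l. x l \<ominus>\<^bsub>N\<^esub> x' l) = \<zero>\<^bsub>N'\<^esub>"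
      using jn_minus[OF N N' \<iota> 1(2) 2(2)] jc'[OF 2(2)] by (simp add: a_minus_def N'.M.r_neg)
    then obtain w where w: "w \<in> carrier (column_module u N)" "(\<lambda>l. x l \<ominus>\<^bsub>N\<^esub> x' l) = mact N t u \<psi> w"
      using I(7)[OF column_minus[OF N 1(2) 2(2)]] by blast
    have "jn L f x \<ominus>\<^bsub>L\<^esub> jn L f x' = \<zero>\<^bsub>L\<^esub>"
      using jn_minus[OF N L f 1(2) 2(2)] jn_relation[OF N L f w(1)] by (simp add: w(2))
    then have "jn L f x = jn L f x'" using jc[OF 1(2)] jc[OF 2(2)] by (simp add: L.M.minus_eq_zero_iff)
    then show ?thesis using 1(4) 2(4) nn by simp
  qed
  have GJ: "(c \<odot>\<^bsub>N'\<^esub> \<iota> n, c \<odot>\<^bsub>L\<^esub> f n) \<in> G" if c: "c \<in> J" and n: "n \<in> carrier N" for c n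
  proof -
    obtain x where x: "x \<in> carrier (column_module t (regular_module \<Gamma>))"
      "c = finsum (regular_module \<Lambda>) (\<lambda>l. y l \<otimes>\<^bsub>\<Lambda>\<^esub> i (x l)) {..<t}"
      using J_spanned[OF c] by (rule bexE) (rule that)
    note s = smult_jn[OF N N' \<iota> x(1) n] smult_jn(1)[OF N L f x(1) n]
    show ?thesis using Gj[OF s(2)] unfolding x(2) s(1,3) .
  qed
  have Gsmult: "(r \<odot>\<^bsub>N'\<^esub> a, r \<odot>\<^bsub>L\<^esub> b) \<in> G" if r: "r \<in> carrier \<Lambda>" and ab: "(a, b) \<in> G" for r a b
  proof -
    obtain n x where 1: "n \<in> carrier N" "x \<in> carrier (column_module t N)"
      "a = \<iota> n \<oplus>\<^bsub>N'\<^esub> jn N' \<iota> x" "b = f n \<oplus>\<^bsub>L\<^esub> jn L f x" by (rule GE[OF ab])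
    have xc: "x l \<in> carrier N" for l by (rule power_module_mem[OF N 1(2)])
    let ?c = "r \<ominus>\<^bsub>\<Lambda>\<^esub> i (\<pi> r)"
    have pr: "\<pi> r \<in> carrier \<Gamma>" "i (\<pi> r) \<in> carrier \<Lambda>" using r by (simp_all add: i_closed \<pi>_closed)
    have cL: "?c \<in> carrier \<Lambda>" using J_diff[OF r] J_closed by blast
    \<comment> \<open>Scalars are split into a part from \<Gamma>, over which \<iota> and
      \<open>f\<close> are linear, and a part from \<open>J\<close>, treated by
      \<open>GJ\<close>.\<close>
    have "r = i (\<pi> r) \<oplus>\<^bsub>\<Lambda>\<^esub> ?c" using r pr by (simp add: a_minus_def L.R.a_lcomm[of _ r] L.R.r_neg)
    then have split: "r \<odot>\<^bsub>N'\<^esub> \<iota> n = \<iota> (\<pi> r \<odot>\<^bsub>N\<^esub> n) \<oplus>\<^bsub>N'\<^esub> ?c \<odot>\<^bsub>N'\<^esub> \<iota> n"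
      "r \<odot>\<^bsub>L\<^esub> f n = f (\<pi> r \<odot>\<^bsub>N\<^esub> n) \<oplus>\<^bsub>L\<^esub> ?c \<odot>\<^bsub>L\<^esub> f n"
      using N'.smult_l_distr[OF pr(2) cL \<iota>c[OF 1(1)]] L.smult_l_distr[OF pr(2) cL fc[OF 1(1)]]
        \<iota>.smult[OF pr(1) 1(1)] f.smult[OF pr(1) 1(1)] by simp_all
    have A: "(r \<odot>\<^bsub>N'\<^esub> \<iota> n, r \<odot>\<^bsub>L\<^esub> f n) \<in> G"
      unfolding split by (rule Gadd[OF G\<iota> GJ[OF J_diff[OF r] 1(1)]]) (use pr 1 in simp)
    \<comment> \<open>The graph is closed under binary sums, so its closure under these sums of
      products is obtained by adding one term at a time.\<close>
    have "(finsum N' (\<lambda>l. (r \<otimes>\<^bsub>\<Lambda>\<^esub> y l) \<odot>\<^bsub>N'\<^esub> \<iota> (x l)) {..<s}, finsum L (\<lambda>l. (r \<otimes>\<^bsub>\<Lambda>\<^esub> y l) \<odot>\<^bsub>L\<^esub> f (x l)) {..<s}) \<in> G"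
      if "s \<le> t" for s
      using that
    proof (induction s)
      case 0
      then show ?case by (simp add: G0)
    next
      case (Suc s)
      have c: "(r \<otimes>\<^bsub>\<Lambda>\<^esub> y l) \<odot>\<^bsub>N'\<^esub> \<iota> (x l) \<in> carrier N'" "(r \<otimes>\<^bsub>\<Lambda>\<^esub> y l) \<odot>\<^bsub>L\<^esub> f (x l) \<in> carrier L" if "l < t" for l
        using r y_closed[OF that] \<iota>c[OF xc] fc[OF xc] by simp_all
      have "finsum N' (\<lambda>l. (r \<otimes>\<^bsub>\<Lambda>\<^esub> y l) \<odot>\<^bsub>N'\<^esub> \<iota> (x l)) {..<Suc s} =
        (r \<otimes>\<^bsub>\<Lambda>\<^esub> y s) \<odot>\<^bsub>N'\<^esub> \<iota> (x s) \<oplus>\<^bsub>N'\<^esub> finsum N' (\<lambda>l. (r \<otimes>\<^bsub>\<Lambda>\<^esub> y l) \<odot>\<^bsub>N'\<^esub> \<iota> (x l)) {..<s}"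
        unfolding lessThan_Suc using Suc.prems c by (intro N'.M.finsum_insert) auto
      moreover have "finsum L (\<lambda>l. (r \<otimes>\<^bsub>\<Lambda>\<^esub> y l) \<odot>\<^bsub>L\<^esub> f (x l)) {..<Suc s} =
        (r \<otimes>\<^bsub>\<Lambda>\<^esub> y s) \<odot>\<^bsub>L\<^esub> f (x s) \<oplus>\<^bsub>L\<^esub> finsum L (\<lambda>l. (r \<otimes>\<^bsub>\<Lambda>\<^esub> y l) \<odot>\<^bsub>L\<^esub> f (x l)) {..<s}"
        unfolding lessThan_Suc using Suc.prems c by (intro L.M.finsum_insert) auto
      moreover have "s < t" "s \<le> t" using Suc.prems by simp_all
      ultimately show ?case using Gadd[OF GJ[OF J_mult(1)[OF r y_J] xc] Suc.IH] by simp
    qed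
    moreover have "r \<odot>\<^bsub>N'\<^esub> jn N' \<iota> x = finsum N' (\<lambda>l. (r \<otimes>\<^bsub>\<Lambda>\<^esub> y l) \<odot>\<^bsub>N'\<^esub> \<iota> (x l)) {..<t}"
    proof -
      have "r \<odot>\<^bsub>N'\<^esub> jn N' \<iota> x = finsum N' (\<lambda>l. r \<odot>\<^bsub>N'\<^esub> (y l \<odot>\<^bsub>N'\<^esub> \<iota> (x l))) {..<t}"
        unfolding jn_def using r y_closed \<iota>c[OF xc] by (intro N'.smult_finsum) auto
      also have "\<dots> = finsum N' (\<lambda>l. (r \<otimes>\<^bsub>\<Lambda>\<^esub> y l) \<odot>\<^bsub>N'\<^esub> \<iota> (x l)) {..<t}"
        using r y_closed \<iota>c[OF xc] by (intro N'.M.finsum_cong') (auto simp: N'.smult_assoc)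
      finally show ?thesis .
    qed
    moreover have "r \<odot>\<^bsub>L\<^esub> jn L f x = finsum L (\<lambda>l. (r \<otimes>\<^bsub>\<Lambda>\<^esub> y l) \<odot>\<^bsub>L\<^esub> f (x l)) {..<t}"
    proof -
      have "r \<odot>\<^bsub>L\<^esub> jn L f x = finsum L (\<lambda>l. r \<odot>\<^bsub>L\<^esub> (y l \<odot>\<^bsub>L\<^esub> f (x l))) {..<t}"
        unfolding jn_def using r y_closed fc[OF xc] by (intro L.smult_finsum) auto
      also have "\<dots> = finsum L (\<lambda>l. (r \<otimes>\<^bsub>\<Lambda>\<^esub> y l) \<odot>\<^bsub>L\<^esub> f (x l)) {..<t}"
        using r y_closed fc[OF xc] by (intro L.M.finsum_cong') (auto simp: L.smult_assoc)
      finally show ?thesis .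
    qed
    ultimately have "(r \<odot>\<^bsub>N'\<^esub> jn N' \<iota> x, r \<odot>\<^bsub>L\<^esub> jn L f x) \<in> G" by simp
    from Gadd[OF A this] show ?thesis
      using r \<iota>c[OF 1(1)] jc'[OF 1(2)] fc[OF 1(1)] jc[OF 1(2)] unfolding 1(3,4)
      by (simp add: N'.smult_r_distr L.smult_r_distr)
  qed
  define f' where "f' a = (THE b. (a, b) \<in> G)" for a
  have f': "f' a = b" if "(a, b) \<in> G" for a b
    unfolding f'_def using that Gfun by blast
  have Gex: "\<exists>b. (a, b) \<in> G" if a: "a \<in> carrier N'" for a
  proof -
    obtain n x where "n \<in> carrier N" "x \<in> carrier (column_module t N)" "a = \<iota> n \<oplus>\<^bsub>N'\<^esub> jn N' \<iota> x"
      using I(6)[OF a] by blast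
    then show ?thesis using GI by blast
  qed
  have Gf': "(a, f' a) \<in> G" if "a \<in> carrier N'" for a
    using Gex[OF that] f' by blast
  have "f' \<in> module_hom \<Lambda> N' L"
  proof (rule module_homI)
    show "f' a \<in> carrier L" if "a \<in> carrier N'" for a by (rule Gsub(2)[OF Gf'[OF that]])
    show "f' (a \<oplus>\<^bsub>N'\<^esub> b) = f' a \<oplus>\<^bsub>L\<^esub> f' b" if "a \<in> carrier N'" "b \<in> carrier N'" for a b
      by (rule f'[OF Gadd[OF Gf'[OF that(1)] Gf'[OF that(2)]]])
    show "f' (r \<odot>\<^bsub>N'\<^esub> a) = r \<odot>\<^bsub>L\<^esub> f' a" if "r \<in> carrier \<Lambda>" "a \<in> carrier N'" for r a
      by (rule f'[OF Gsmult[OF that(1) Gf'[OF that(2)]]])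
  qed
  then show ?thesis using f'[OF GI] by (rule that)
qed

end

section \<open>Exactness of extension of scalars on syzygies\<close>

context right_presented
begin

text \<open>The hypothesis \<open>exact\<close> says that relations with values in \<open>K\<close>
  come from columns over \<open>K\<close>, so J \<otimes> K embeds into J \<otimes> F. Then
  \<Lambda> \<otimes> K can be found inside the induced module of \<open>F\<close>, and no tensor
  product has to be formed.\<close>

lemma induced_submodule:
  fixes F :: "('r, 'm) module" and F' :: "('r, 'n) module"
  assumes ind: "induced F F' \<iota> \<beta>" and K: "submodule K \<Gamma> F"
    and exact: "\<And>x. x \<in> carrier (column_module u F) \<Longrightarrow> \<forall>l<t. mact F t u \<psi> x l \<in> K \<Longrightarrow>
      \<exists>z \<in> carrier (column_module u F). (\<forall>m<u. z m \<in> K) \<and> mact F t u \<psi> z = mact F t u \<psi> x"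
  defines "K' \<equiv> {\<iota> n \<oplus>\<^bsub>F'\<^esub> jn F' \<iota> x |n x. n \<in> K \<and> x \<in> carrier (column_module t F) \<and> (\<forall>l<t. x l \<in> K)}"
  shows "submodule K' \<Lambda> F'" "induced (F\<lparr>carrier := K\<rparr>) (F'\<lparr>carrier := K'\<rparr>) \<iota> \<beta>"
proof -
  note I = inducedD[OF ind]
  note F = I(1) and F' = I(2) and \<iota> = I(3)
  interpret F: left_module \<Gamma> F by (rule F)
  interpret F': left_module \<Lambda> F' by (rule F')
  let ?FK = "F\<lparr>carrier := K\<rparr>" and ?FK' = "F'\<lparr>carrier := K'\<rparr>"
  note KF = F.submoduleD[OF K]
  note FK = F.left_module_submodule[OF K]
  have \<iota>K: "\<iota> \<in> module_hom \<Gamma> ?FK (restrict_scalars i F')" by (rule module_hom_restrict[OF \<iota> KF(1)])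
  have incl: "(\<lambda>x. x) \<in> module_hom \<Lambda> F' F'" by (rule module_hom_ident)
  have col: "x \<in> carrier (column_module t ?FK) \<longleftrightarrow> x \<in> carrier (column_module t F) \<and> (\<forall>l<t. x l \<in> K)" for x t
    by (rule column_submodule[OF F K])
  have K': "z \<in> K' \<longleftrightarrow> (\<exists>n x. n \<in> K \<and> x \<in> carrier (column_module t ?FK) \<and> z = \<iota> n \<oplus>\<^bsub>F'\<^esub> jn F' \<iota> x)" for z
    unfolding K'_def col by blast
  note \<iota>c = f_closed[OF FK F' \<iota>K, simplified] and jc = jn_closed[OF FK F' \<iota>K]
  interpret \<iota>: module_morphism \<Gamma> ?FK "restrict_scalars i F'" \<iota>
    by (rule module_morphismI[OF FK left_module_restrict_scalars[OF ring_\<Gamma> i_hom F'] \<iota>K])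
  have z: "(\<lambda>l. \<zero>\<^bsub>F\<^esub>) \<in> carrier (column_module t ?FK)" using KF(2) by (simp add: column_carrier)
  have jz: "jn F' \<iota> (\<lambda>l. \<zero>\<^bsub>F\<^esub>) = \<zero>\<^bsub>F'\<^esub>"
  proof -
    have "jn F' \<iota> (\<lambda>l. \<zero>\<^bsub>F\<^esub> \<oplus>\<^bsub>F\<^esub> \<zero>\<^bsub>F\<^esub>) = jn F' \<iota> (\<lambda>l. \<zero>\<^bsub>F\<^esub>) \<oplus>\<^bsub>F'\<^esub> jn F' \<iota> (\<lambda>l. \<zero>\<^bsub>F\<^esub>)"
      using jn_add[OF FK F' \<iota>K z z] by simp
    then show ?thesis using jc[OF z] by (simp add: F'.M.add.l_cancel_one)
  qed
  have \<iota>K': "\<iota> n \<in> K'" if "n \<in> K" for n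
    unfolding K' using that z \<iota>c by (intro exI[of _ n] exI[of _ "\<lambda>l. \<zero>\<^bsub>F\<^esub>"]) (simp add: jz)
  have jK': "jn F' \<iota> x \<in> K'" if "x \<in> carrier (column_module t ?FK)" for x
    unfolding K' using that KF(2) jc[OF that] \<iota>.zero by (intro exI[of _ "\<zero>\<^bsub>F\<^esub>"] exI[of _ x]) simp
  have sub: "K' \<subseteq> carrier F'" using \<iota>c jc by (auto simp: K')
  have zero: "\<zero>\<^bsub>F'\<^esub> \<in> K'" using jK'[OF z] by (simp add: jz)
  have add: "a \<oplus>\<^bsub>F'\<^esub> b \<in> K'" if ab: "a \<in> K'" "b \<in> K'" for a b
  proof -
    obtain n x where 1: "n \<in> K" "x \<in> carrier (column_module t ?FK)" "a = \<iota> n \<oplus>\<^bsub>F'\<^esub> jn F' \<iota> x"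
      using ab(1) unfolding K' by (elim exE conjE) (rule that)
    obtain n' x' where 2: "n' \<in> K" "x' \<in> carrier (column_module t ?FK)" "b = \<iota> n' \<oplus>\<^bsub>F'\<^esub> jn F' \<iota> x'"
      using ab(2) unfolding K' by (elim exE conjE) (rule that)
    have "a \<oplus>\<^bsub>F'\<^esub> b = \<iota> (n \<oplus>\<^bsub>F\<^esub> n') \<oplus>\<^bsub>F'\<^esub> jn F' \<iota> (\<lambda>l. x l \<oplus>\<^bsub>F\<^esub> x' l)"
      using 1 2 \<iota>c jc \<iota>.add[of n n'] jn_add[OF FK F' \<iota>K 1(2) 2(2)] by (simp add: F'.M.a_ac)
    moreover have "n \<oplus>\<^bsub>F\<^esub> n' \<in> K" by (rule KF(4)[OF 1(1) 2(1)])
    moreover have "(\<lambda>l. x l \<oplus>\<^bsub>F\<^esub> x' l) \<in> carrier (column_module t ?FK)"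
      using column_add[OF FK 1(2) 2(2)] by simp
    ultimately show ?thesis unfolding K' by blast
  qed
  have JK': "c \<odot>\<^bsub>F'\<^esub> \<iota> n \<in> K'" if c: "c \<in> J" and n: "n \<in> K" for c n
  proof -
    obtain x where x: "x \<in> carrier (column_module t (regular_module \<Gamma>))"
      "c = finsum (regular_module \<Lambda>) (\<lambda>l. y l \<otimes>\<^bsub>\<Lambda>\<^esub> i (x l)) {..<t}"
      using J_spanned[OF c] by (rule bexE) (rule that)
    note s = smult_jn[OF FK F' \<iota>K x(1), of n]
    show ?thesis using s n jK' unfolding x(2) by simp
  qed
  have smult: "r \<odot>\<^bsub>F'\<^esub> a \<in> K'" if r: "r \<in> carrier \<Lambda>" and a: "a \<in> K'" for r a
  proof -
    obtain n x where 1: "n \<in> K" "x \<in> carrier (column_module t ?FK)" "a = \<iota> n \<oplus>\<^bsub>F'\<^esub> jn F' \<iota> x"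
      using a unfolding K' by (elim exE conjE) (rule that)
    have xK: "x l \<in> K" for l using power_module_mem[OF FK 1(2), of l] by simp
    have pr: "\<pi> r \<in> carrier \<Gamma>" "i (\<pi> r) \<in> carrier \<Lambda>" using r by (simp_all add: i_closed \<pi>_closed)
    let ?c = "r \<ominus>\<^bsub>\<Lambda>\<^esub> i (\<pi> r)"
    have cL: "?c \<in> carrier \<Lambda>" using J_diff[OF r] J_closed by blast
    have "r = i (\<pi> r) \<oplus>\<^bsub>\<Lambda>\<^esub> ?c" using r pr by (simp add: a_minus_def L.R.a_lcomm[of _ r] L.R.r_neg)
    then have "r \<odot>\<^bsub>F'\<^esub> \<iota> n = \<iota> (\<pi> r \<odot>\<^bsub>F\<^esub> n) \<oplus>\<^bsub>F'\<^esub> ?c \<odot>\<^bsub>F'\<^esub> \<iota> n"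
      using F'.smult_l_distr[OF pr(2) cL \<iota>c[OF 1(1)]] \<iota>.smult[OF pr(1), of n] 1(1) by simp
    also have "\<dots> \<in> K'" by (rule add[OF \<iota>K'[OF KF(7)[OF pr(1) 1(1)]] JK'[OF J_diff[OF r] 1(1)]])
    finally have A: "r \<odot>\<^bsub>F'\<^esub> \<iota> n \<in> K'" .
    have "r \<odot>\<^bsub>F'\<^esub> jn F' \<iota> x = finsum F' (\<lambda>l. r \<odot>\<^bsub>F'\<^esub> (y l \<odot>\<^bsub>F'\<^esub> \<iota> (x l))) {..<t}"
      unfolding jn_def using r y_closed \<iota>c[OF xK] by (intro F'.smult_finsum) auto
    also have "\<dots> \<in> K'"
    proof (rule F'.M.finsum_in_closed_set[OF sub zero add], assumption, assumption, rule Pi_I)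
      fix l assume "l \<in> {..<t}"
      then have l: "l < t" by simp
      have "r \<odot>\<^bsub>F'\<^esub> (y l \<odot>\<^bsub>F'\<^esub> \<iota> (x l)) = (r \<otimes>\<^bsub>\<Lambda>\<^esub> y l) \<odot>\<^bsub>F'\<^esub> \<iota> (x l)"
        using r y_closed[OF l] \<iota>c[OF xK] by (simp add: F'.smult_assoc)
      then show "r \<odot>\<^bsub>F'\<^esub> (y l \<odot>\<^bsub>F'\<^esub> \<iota> (x l)) \<in> K'" using JK'[OF J_mult(1)[OF r y_J[OF l]] xK] by simp
    qed
    finally have "r \<odot>\<^bsub>F'\<^esub> jn F' \<iota> x \<in> K'" .
    from add[OF A this] show ?thesis
      using r \<iota>c[OF 1(1)] jc[OF 1(2)] unfolding 1(3) by (simp add: F'.smult_r_distr)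
  qed
  show K'sub: "submodule K' \<Lambda> F'" by (rule F'.submoduleI'[OF sub zero add smult])
  note FK' = F'.left_module_submodule[OF K'sub]
  have jn_eq: "jn ?FK' \<iota> x = jn F' \<iota> x" if "x \<in> carrier (column_module t ?FK)" for x
  proof -
    have "\<iota> (x l) \<in> carrier ?FK'" for l using \<iota>K' power_module_mem[OF FK that, of l] by simp
    then show ?thesis by (rule jn_comp[OF FK' F' inclusion_hom[OF sub]])
  qed
  show "induced ?FK ?FK' \<iota> \<beta>"
    unfolding induced_def
  proof (intro conjI ballI impI)
    show "left_module \<Gamma> ?FK" "left_module \<Lambda> ?FK'" by (rule FK, rule FK')
    show "\<iota> \<in> module_hom \<Gamma> ?FK (restrict_scalars i ?FK')"
      using module_hom_into_submodule[OF \<iota>K, of K'] \<iota>K' by simp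
    have "\<beta> a \<in> K" if a: "a \<in> K'" for a
    proof -
      obtain n x where 1: "n \<in> K" "x \<in> carrier (column_module t ?FK)" "a = \<iota> n \<oplus>\<^bsub>F'\<^esub> jn F' \<iota> x"
        using a unfolding K' by (elim exE conjE) (rule that)
      then show ?thesis using induced_\<beta>_jn[OF ind _ KF(3)[OF 1(1)]] by (simp add: col)
    qed
    then show "\<beta> \<in> module_hom \<Lambda> ?FK' (restrict_scalars \<pi> ?FK)"
      using module_hom_into_submodule[OF module_hom_restrict[OF I(4) sub], of K] by simp
    show "\<beta> (\<iota> n) = n" if "n \<in> carrier ?FK" for n using that KF(3) I(5) by simp
    show "\<exists>n\<in>carrier ?FK. \<exists>x\<in>carrier (column_module t ?FK). a = \<iota> n \<oplus>\<^bsub>?FK'\<^esub> jn ?FK' \<iota> x"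
      if a: "a \<in> carrier ?FK'" for a
    proof -
      have "a \<in> K'" using a by simp
      then obtain n x where 1: "n \<in> K" "x \<in> carrier (column_module t ?FK)" "a = \<iota> n \<oplus>\<^bsub>F'\<^esub> jn F' \<iota> x"
        unfolding K' by (elim exE conjE) (rule that)
      then show ?thesis by (intro bexI[of _ n] bexI[of _ x]) (simp_all add: jn_eq)
    qed
    show "x \<in> mact ?FK t u \<psi> ` carrier (column_module u ?FK)"
      if x: "x \<in> carrier (column_module t ?FK)" "jn ?FK' \<iota> x = \<zero>\<^bsub>?FK'\<^esub>" for x
    proof -
      have xF: "x \<in> carrier (column_module t F)" "\<forall>l<t. x l \<in> K" using x(1) by (simp_all add: col)
      have "jn F' \<iota> x = \<zero>\<^bsub>F'\<^esub>" using x jn_eq by simp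
      then obtain w where w: "w \<in> carrier (column_module u F)" "x = mact F t u \<psi> w" using I(7)[OF xF(1)] by blast
      obtain z where z: "z \<in> carrier (column_module u F)" "\<forall>m<u. z m \<in> K" "mact F t u \<psi> z = mact F t u \<psi> w"
        using exact[OF w(1)] xF(2) w(2) by blast
      have "z \<in> carrier (column_module u ?FK)" using z(1,2) by (simp add: col)
      then show ?thesis using mact_submodule[OF F K \<psi>_matrix] z(3) w(2) by (intro image_eqI[of _ _ z]) simp_all
    qed
  qed
qed

lemma induced_transport:
  fixes N :: "('r, 'm) module" and N' :: "('r, 'n) module" and N1 :: "('r, 'p) module" and N1' :: "('r, 'q) module"
  assumes ind: "induced N N' \<iota> \<beta>" and N1: "left_module \<Gamma> N1" "left_module \<Lambda> N1'"
    and c: "c \<in> module_hom \<Gamma> N N1" "c' \<in> module_hom \<Gamma> N1 N" "\<And>x. x \<in> carrier N1 \<Longrightarrow> c (c' x) = x"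
    and d: "d \<in> module_hom \<Lambda> N' N1'" "d' \<in> module_hom \<Lambda> N1' N'"
      "\<And>x. x \<in> carrier N' \<Longrightarrow> d' (d x) = x" "\<And>x. x \<in> carrier N1' \<Longrightarrow> d (d' x) = x"
    and c'c: "\<And>x. x \<in> carrier N \<Longrightarrow> c' (c x) = x"
  shows "induced N1 N1' (\<lambda>x. d (\<iota> (c' x))) (\<lambda>z. c (\<beta> (d' z)))"
proof -
  note I = inducedD[OF ind]
  interpret d: module_morphism \<Lambda> N' N1' d by (rule module_morphismI[OF I(2) N1(2) d(1)])
  interpret d': module_morphism \<Lambda> N1' N' d' by (rule module_morphismI[OF N1(2) I(2) d(2)])
  note \<iota>c = f_closed[OF I(1-3)]
  have jn: "jn N1' (\<lambda>x. d (\<iota> (c' x))) x = d (jn N' \<iota> (\<lambda>l. c' (x l)))" if x: "x \<in> carrier (column_module t N1)" for x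
  proof -
    have "\<iota> (c' (x l)) \<in> carrier N'" for l
      by (rule \<iota>c[OF module_hom_mem[OF c(2) power_module_mem[OF N1(1) x]]])
    then have "d (jn N' \<iota> (\<lambda>l. c' (x l))) = jn N1' (\<lambda>n. d (\<iota> n)) (\<lambda>l. c' (x l))"
      by (rule jn_comp[OF I(2) N1(2) d(1)])
    then show ?thesis by (simp add: jn_def)
  qed
  show ?thesis unfolding induced_def
  proof (intro conjI ballI impI N1)
    show "(\<lambda>x. d (\<iota> (c' x))) \<in> module_hom \<Gamma> N1 (restrict_scalars i N1')"
      by (rule module_hom_comp[OF module_hom_comp[OF c(2) I(3)] module_hom_restrict_scalars[OF d(1) i_hom]])
    show "(\<lambda>z. c (\<beta> (d' z))) \<in> module_hom \<Lambda> N1' (restrict_scalars \<pi> N1)"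
      by (rule module_hom_comp[OF module_hom_comp[OF d(2) I(4)] module_hom_restrict_scalars[OF c(1) \<pi>_hom]])
    show "c (\<beta> (d' (d (\<iota> (c' n))))) = n" if n: "n \<in> carrier N1" for n
    proof -
      have "c' n \<in> carrier N" by (rule module_hom_mem[OF c(2) n])
      then show ?thesis using d(3)[OF \<iota>c] I(5) c(3)[OF n] by simp
    qed
    show "\<exists>n\<in>carrier N1. \<exists>x\<in>carrier (column_module t N1). z = d (\<iota> (c' n)) \<oplus>\<^bsub>N1'\<^esub> jn N1' (\<lambda>x. d (\<iota> (c' x))) x"
      if z: "z \<in> carrier N1'" for z
    proof -
      obtain n x where nx: "n \<in> carrier N" "x \<in> carrier (column_module t N)" "d' z = \<iota> n \<oplus>\<^bsub>N'\<^esub> jn N' \<iota> x"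
        using I(6)[OF d'.closed[OF z]] by (elim bexE) (rule that)
      have cx: "(\<lambda>l. c (x l)) \<in> carrier (column_module t N1)" by (rule column_hom[OF I(1) N1(1) c(1) nx(2)])
      have "(\<lambda>l. c' (c (x l))) = x" using c'c power_module_mem[OF I(1) nx(2)] by simp
      then have "d (d' z) = d (\<iota> (c' (c n))) \<oplus>\<^bsub>N1'\<^esub> jn N1' (\<lambda>x. d (\<iota> (c' x))) (\<lambda>l. c (x l))"
        unfolding nx(3) jn[OF cx] using c'c[OF nx(1)] \<iota>c[OF nx(1)] jn_closed[OF I(1-3) nx(2)] by simp
      then show ?thesis using d(4)[OF z] cx module_hom_mem[OF c(1) nx(1)]
        by (intro bexI[of _ "c n"] bexI[of _ "\<lambda>l. c (x l)"]) simp_all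
    qed
    show "x \<in> mact N1 t u \<psi> ` carrier (column_module u N1)"
      if x: "x \<in> carrier (column_module t N1)" "jn N1' (\<lambda>x. d (\<iota> (c' x))) x = \<zero>\<^bsub>N1'\<^esub>" for x
    proof -
      have cx: "(\<lambda>l. c' (x l)) \<in> carrier (column_module t N)" by (rule column_hom[OF N1(1) I(1) c(2) x(1)])
      have "d' (d (jn N' \<iota> (\<lambda>l. c' (x l)))) = \<zero>\<^bsub>N'\<^esub>" using x(2) jn[OF x(1)] d'.zero by simp
      then have "jn N' \<iota> (\<lambda>l. c' (x l)) = \<zero>\<^bsub>N'\<^esub>" using d(3)[OF jn_closed[OF I(1-3) cx]] by simp
      then obtain w where w: "w \<in> carrier (column_module u N)" "(\<lambda>l. c' (x l)) = mact N t u \<psi> w"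
        using I(7)[OF cx] by blast
      have "x = (\<lambda>l. c (c' (x l)))" using c(3) power_module_mem[OF N1(1) x(1)] by simp
      also have "\<dots> = (\<lambda>l. c (mact N t u \<psi> w l))" using fun_cong[OF w(2)] by simp
      also have "\<dots> = mact N1 t u \<psi> (\<lambda>m. c (w m))" by (rule mact_hom[OF I(1) N1(1) c(1) \<psi>_matrix w(1), symmetric])
      finally show ?thesis using column_hom[OF I(1) N1(1) c(1) w(1)] by blast
    qed
  qed
qed

text \<open>Extension of scalars of a direct sum of copies of \<Gamma> is formed coordinatewise,
  with \<open>J_spanned\<close> and \<open>relations\<close> applied in each coordinate.\<close>

lemma induced_free:
  fixes S :: "'s set"
  shows "induced (free_module \<Gamma> S) (free_module \<Lambda> S) (\<lambda>f s. i (f s)) (\<lambda>f s. \<pi> (f s))"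
proof -
  let ?F = "free_module \<Gamma> S" and ?F' = "free_module \<Lambda> S"
  let ?\<iota> = "\<lambda>f s. i (f s)"
  note A = left_module_regular[OF ring_\<Gamma>] and B = left_module_regular[OF ring_\<Lambda>]
  note F = left_module_free[OF ring_\<Gamma>, of S] and F' = left_module_free[OF ring_\<Lambda>, of S]
  interpret B: left_module \<Lambda> "regular_module \<Lambda>" by (rule B)
  have fc: "f s \<in> carrier \<Gamma>" if "f \<in> carrier ?F" for f s using power_module_mem[OF A that, of s] by simp
  have fc': "f s \<in> carrier \<Lambda>" if "f \<in> carrier ?F'" for f s using power_module_mem[OF B that, of s] by simp
  have \<iota>F: "?\<iota> f \<in> carrier ?F'" if "f \<in> carrier ?F" for f
  proof -
    have "{s. i (f s) \<noteq> \<zero>\<^bsub>\<Lambda>\<^esub>} \<subseteq> {s. f s \<noteq> \<zero>\<^bsub>\<Gamma>\<^esub>}" using i_zero by auto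
    then show ?thesis using that i_closed i_zero by (auto simp: power_module_carrier elim: finite_subset)
  qed
  have \<pi>F: "(\<lambda>s. \<pi> (f s)) \<in> carrier ?F" if "f \<in> carrier ?F'" for f
  proof -
    have "{s. \<pi> (f s) \<noteq> \<zero>\<^bsub>\<Gamma>\<^esub>} \<subseteq> {s. f s \<noteq> \<zero>\<^bsub>\<Lambda>\<^esub>}" using \<pi>_zero by auto
    then show ?thesis using that \<pi>_closed \<pi>_zero by (auto simp: power_module_carrier elim: finite_subset)
  qed
  have \<iota>: "?\<iota> \<in> module_hom \<Gamma> ?F (restrict_scalars i ?F')"
    by (rule module_homI) (use \<iota>F fc in \<open>simp_all add: ring_hom_add[OF i_hom] ring_hom_mult[OF i_hom]\<close>)
  have jn: "jn ?F' ?\<iota> x s = finsum (regular_module \<Lambda>) (\<lambda>l. y l \<otimes>\<^bsub>\<Lambda>\<^esub> i (x l s)) {..<t}"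
    if x: "x \<in> carrier (column_module t ?F)" for x s
  proof -
    have "(\<lambda>l. y l \<odot>\<^bsub>?F'\<^esub> ?\<iota> (x l)) \<in> {..<t} \<rightarrow> carrier ?F'"
      using left_module.smult_closed[OF F' y_closed \<iota>F[OF power_module_mem[OF F x]]] by blast
    then show ?thesis unfolding jn_def by (subst power_module_finsum[OF B]) simp_all
  qed
  show ?thesis unfolding induced_def
  proof (intro conjI ballI impI F F' \<iota>)
    show "(\<lambda>f s. \<pi> (f s)) \<in> module_hom \<Lambda> ?F' (restrict_scalars \<pi> ?F)"
      by (rule module_homI) (use \<pi>F fc' in \<open>simp_all add: ring_hom_add[OF \<pi>_hom] ring_hom_mult[OF \<pi>_hom]\<close>)
    show "(\<lambda>s. \<pi> (i (n s))) = n" if "n \<in> carrier ?F" for n using fc[OF that] by (simp add: \<pi>_i)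
    show "\<exists>n\<in>carrier ?F. \<exists>x\<in>carrier (column_module t ?F). z = ?\<iota> n \<oplus>\<^bsub>?F'\<^esub> jn ?F' ?\<iota> x"
      if z: "z \<in> carrier ?F'" for z
    proof -
      define n where "n s = \<pi> (z s)" for s
      have n: "n \<in> carrier ?F" unfolding n_def by (rule \<pi>F[OF z])
      have "\<exists>x\<in>carrier (column_module t (regular_module \<Gamma>)).
          z s \<ominus>\<^bsub>\<Lambda>\<^esub> i (n s) = finsum (regular_module \<Lambda>) (\<lambda>l. y l \<otimes>\<^bsub>\<Lambda>\<^esub> i (x l)) {..<t}" for s
        unfolding n_def by (rule J_spanned[OF J_diff[OF fc'[OF z]]])
      then obtain X where X: "\<And>s. X s \<in> carrier (column_module t (regular_module \<Gamma>))"
        "\<And>s. z s \<ominus>\<^bsub>\<Lambda>\<^esub> i (n s) = finsum (regular_module \<Lambda>) (\<lambda>l. y l \<otimes>\<^bsub>\<Lambda>\<^esub> i (X s l)) {..<t}"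
        by metis
      \<comment> \<open>Zero is prescribed where \<open>z\<close> vanishes, which keeps the supports
        finite.\<close>
      define x where "x l s = (if z s = \<zero>\<^bsub>\<Lambda>\<^esub> then \<zero>\<^bsub>\<Gamma>\<^esub> else X s l)" for l s
      have Xc: "X s l \<in> carrier \<Gamma>" for s l using power_module_mem[OF A X(1), of s l] by simp
      have "x l \<in> carrier ?F" for l
      proof -
        have "{s. x l s \<noteq> \<zero>\<^bsub>\<Gamma>\<^esub>} \<subseteq> {s. z s \<noteq> \<zero>\<^bsub>\<Lambda>\<^esub>}" by (auto simp: x_def)
        then show ?thesis using z Xc by (auto simp: power_module_carrier x_def elim: finite_subset)
      qed
      moreover have "x l = (\<lambda>s. \<zero>\<^bsub>\<Gamma>\<^esub>)" if "l \<ge> t" for l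
        using X(1) that by (auto simp: x_def column_carrier fun_eq_iff)
      ultimately have x: "x \<in> carrier (column_module t ?F)" by (simp add: column_carrier[of x])
      have "z s = i (n s) \<oplus>\<^bsub>\<Lambda>\<^esub> jn ?F' ?\<iota> x s" for s
      proof (cases "z s = \<zero>\<^bsub>\<Lambda>\<^esub>")
        case True
        then have "jn ?F' ?\<iota> x s = finsum (regular_module \<Lambda>) (\<lambda>l. \<zero>\<^bsub>regular_module \<Lambda>\<^esub>) {..<t}"
          unfolding jn[OF x] using y_closed by (intro B.M.finsum_cong') (auto simp: x_def i_zero)
        then show ?thesis using True B.M.finsum_zero[of "{..<t}"] by (simp add: n_def \<pi>_zero i_zero)
      next
        case False
        then have "jn ?F' ?\<iota> x s = z s \<ominus>\<^bsub>\<Lambda>\<^esub> i (n s)"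
          unfolding jn[OF x] X(2) by (simp add: x_def)
        then show ?thesis using fc'[OF z, of s] i_closed[OF fc[OF n, of s]]
          by (simp add: a_minus_def L.R.a_lcomm[of _ "z s"] L.R.r_neg)
      qed
      then have "z = ?\<iota> n \<oplus>\<^bsub>?F'\<^esub> jn ?F' ?\<iota> x" by (simp add: fun_eq_iff)
      then show ?thesis using n x by blast
    qed
    show "x \<in> mact ?F t u \<psi> ` carrier (column_module u ?F)"
      if x: "x \<in> carrier (column_module t ?F)" "jn ?F' ?\<iota> x = \<zero>\<^bsub>?F'\<^esub>" for x
    proof -
      have "(\<lambda>l. x l s) \<in> mact (regular_module \<Gamma>) t u \<psi> ` carrier (column_module u (regular_module \<Gamma>))" for s
        using relations[OF column_eval[OF ring_\<Gamma> x(1), of s]] jn[OF x(1), of s] fun_cong[OF x(2), of s] by simp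
      then have "\<exists>w. w \<in> carrier (column_module u (regular_module \<Gamma>)) \<and>
          (\<lambda>l. x l s) = mact (regular_module \<Gamma>) t u \<psi> w" for s by blast
      then obtain W where W: "\<And>s. W s \<in> carrier (column_module u (regular_module \<Gamma>))"
        "\<And>s. (\<lambda>l. x l s) = mact (regular_module \<Gamma>) t u \<psi> (W s)" by metis
      define w where "w m s = (if \<forall>l. x l s = \<zero>\<^bsub>\<Gamma>\<^esub> then \<zero>\<^bsub>\<Gamma>\<^esub> else W s m)" for m s
      have Wc: "W s m \<in> carrier \<Gamma>" for s m using power_module_mem[OF A W(1), of s m] by simp
      have xz: "x l s = \<zero>\<^bsub>\<Gamma>\<^esub>" if "l \<ge> t \<or> s \<notin> S" for l s
        using x(1) that by (cases "l < t") (auto simp: column_carrier[of x] power_module_carrier)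
      have fin: "finite (\<Union>l<t. {s. x l s \<noteq> \<zero>\<^bsub>\<Gamma>\<^esub>})"
        using x(1) by (auto simp: column_carrier[of x] power_module_carrier)
      have "w m \<in> carrier ?F" for m
      proof -
        have "{s. w m s \<noteq> \<zero>\<^bsub>\<Gamma>\<^esub>} \<subseteq> (\<Union>l<t. {s. x l s \<noteq> \<zero>\<^bsub>\<Gamma>\<^esub>})"
        proof
          fix s assume "s \<in> {s. w m s \<noteq> \<zero>\<^bsub>\<Gamma>\<^esub>}"
          then obtain l where "x l s \<noteq> \<zero>\<^bsub>\<Gamma>\<^esub>" by (auto simp: w_def split: if_splits)
          moreover then have "l < t" using xz[of l s] by (cases "l < t") auto
          ultimately show "s \<in> (\<Union>l<t. {s. x l s \<noteq> \<zero>\<^bsub>\<Gamma>\<^esub>})" by blast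
        qed
        then have "finite {s. w m s \<noteq> \<zero>\<^bsub>\<Gamma>\<^esub>}" using fin by (rule finite_subset)
        then show ?thesis using Wc xz by (simp add: power_module_carrier w_def)
      qed
      moreover have "w m = (\<lambda>s. \<zero>\<^bsub>\<Gamma>\<^esub>)" if "m \<ge> u" for m
        using W(1) that by (auto simp: w_def column_carrier fun_eq_iff)
      ultimately have w: "w \<in> carrier (column_module u ?F)" by (simp add: column_carrier[of w])
      have "x l s = mact ?F t u \<psi> w l s" for l s
      proof (cases "\<forall>l. x l s = \<zero>\<^bsub>\<Gamma>\<^esub>")
        case True
        interpret A: left_module \<Gamma> "regular_module \<Gamma>" by (rule A)
        have "mact ?F t u \<psi> w l s = mact (regular_module \<Gamma>) t u \<psi> (\<lambda>m. \<zero>\<^bsub>\<Gamma>\<^esub>) l"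
          unfolding mact_eval[OF ring_\<Gamma> \<psi>_matrix w] using True by (simp add: w_def)
        also have "\<dots> = \<zero>\<^bsub>\<Gamma>\<^esub>"
        proof (cases "l < t")
          case True
          have "finsum (regular_module \<Gamma>) (\<lambda>m. \<psi> l m \<odot>\<^bsub>regular_module \<Gamma>\<^esub> \<zero>\<^bsub>\<Gamma>\<^esub>) {..<u} =
            finsum (regular_module \<Gamma>) (\<lambda>m. \<zero>\<^bsub>regular_module \<Gamma>\<^esub>) {..<u}"
            using \<psi>_matrix True by (intro A.M.finsum_cong') (auto simp: matrix_over_def)
          then show ?thesis using True A.M.finsum_zero[of "{..<u}"] by (simp add: mact_def cong: if_cong)
        qed (simp add: mact_def)
        finally show ?thesis using True by simp
      next
        case False
        then have "(\<lambda>m. w m s) = W s" unfolding w_def by (simp only: if_False)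
        then show ?thesis using fun_cong[OF W(2)[of s], of l] by (simp add: mact_eval[OF ring_\<Gamma> \<psi>_matrix w])
      qed
      then have "x = mact ?F t u \<psi> w" by (intro ext)
      then show ?thesis using w by blast
    qed
  qed
qed

text \<open>The free modules over \<Gamma> and \<Lambda> are taken on the same basis, so the second
  is induced from the first.\<close>

lemma induced_cover_exists:
  fixes N :: "('r, 'm) module"
  assumes large: "large (carrier \<Lambda>) TYPE('m)" "large (carrier \<Gamma>) TYPE('m)" and N: "left_module \<Gamma> N"
  obtains F F' :: "('r, 'm) module" and g \<iota> \<beta> where "proj \<Gamma> F" "g \<in> module_hom \<Gamma> F N" "g ` carrier F = carrier N"
    "finitely_generated \<Gamma> N \<Longrightarrow> finitely_generated \<Gamma> F" "proj \<Lambda> F'" "induced F F' \<iota> \<beta>"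
proof -
  obtain F :: "('r, 'm) module" and g and S :: "'m set" and c c' where "S \<subseteq> carrier N"
    "finitely_generated \<Gamma> N \<Longrightarrow> finite S"
    and F: "proj \<Gamma> F" "g \<in> module_hom \<Gamma> F N" "g ` carrier F = carrier N"
    "finitely_generated \<Gamma> N \<Longrightarrow> finitely_generated \<Gamma> F"
    and c: "c \<in> module_hom \<Gamma> (free_module \<Gamma> S) F" "c' \<in> module_hom \<Gamma> F (free_module \<Gamma> S)"
    "\<And>f. f \<in> carrier (free_module \<Gamma> S) \<Longrightarrow> c' (c f) = f" "\<And>x. x \<in> carrier F \<Longrightarrow> c (c' x) = x"
    by (rule free_cover_exists[OF N large(2)]) (rule that)
  obtain F' :: "('r, 'm) module" and d d' where F': "proj \<Lambda> F'"
    and d: "d \<in> module_hom \<Lambda> (free_module \<Lambda> S) F'" "d' \<in> module_hom \<Lambda> F' (free_module \<Lambda> S)"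
    "\<And>f. f \<in> carrier (free_module \<Lambda> S) \<Longrightarrow> d' (d f) = f" "\<And>x. x \<in> carrier F' \<Longrightarrow> d (d' x) = x"
    by (rule free_module_copy[OF ring_\<Lambda> large(1), of S]) (rule that)
  have "induced F F' (\<lambda>x. d (\<lambda>s. i (c' x s))) (\<lambda>z. c (\<lambda>s. \<pi> (d' z s)))"
    by (rule induced_transport[OF induced_free proj_left_module[OF F(1)] proj_left_module[OF F'] c(1,2) _ d(1,2)]) (simp_all only: c(3,4) d(3,4))
  with F(1-4) F' show ?thesis by (rule that)
qed

lemma induced_hom:
  fixes F N :: "('r, 'm) module" and F' N' :: "('r, 'n) module"
  assumes F: "induced F F' \<iota> \<beta>" and N: "induced N N' \<iota>' \<beta>'" and g: "g \<in> module_hom \<Gamma> F N"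
  obtains g' where "g' \<in> module_hom \<Lambda> F' N'"
    "\<And>n x. n \<in> carrier F \<Longrightarrow> x \<in> carrier (column_module t F) \<Longrightarrow>
      g' (\<iota> n \<oplus>\<^bsub>F'\<^esub> jn F' \<iota> x) = \<iota>' (g n) \<oplus>\<^bsub>N'\<^esub> jn N' \<iota>' (\<lambda>l. g (x l))"
proof -
  note I = inducedD[OF F] and I' = inducedD[OF N]
  obtain g' where g': "g' \<in> module_hom \<Lambda> F' N'"
    "\<And>n x. n \<in> carrier F \<Longrightarrow> x \<in> carrier (column_module t F) \<Longrightarrow>
      g' (\<iota> n \<oplus>\<^bsub>F'\<^esub> jn F' \<iota> x) = \<iota>' (g n) \<oplus>\<^bsub>N'\<^esub> jn N' (\<lambda>n. \<iota>' (g n)) x"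
    by (rule induced_extend[OF F I'(2) module_hom_comp[OF g I'(3)]]) (rule that)
  have "jn N' (\<lambda>n. \<iota>' (g n)) x = jn N' \<iota>' (\<lambda>l. g (x l))" for x by (simp add: jn_def)
  then show ?thesis using g' by (intro that) simp_all
qed

text \<open>An element with components n and x maps to zero only if g n = 0, by \<beta>', and g x =
  \<psi> w for some w. Lifting w to \<open>F\<close> and subtracting its image under \<psi> moves x
  into the kernel of \<open>g\<close> without changing the element, since \<open>jn\<close> kills
  relations. That the resulting submodule is induced from the kernel of \<open>g\<close> is the
  vanishing of Tor(J, N) supplied by \<open>syzygy_exact\<close>.\<close>

lemma induced_kernel:
  fixes F N :: "('r, 'm) module" and F' N' :: "('r, 'n) module"
  assumes syz: "syzygy d \<Gamma> N" and good: "good d \<Gamma> t u \<psi>"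
    and F: "induced F F' \<iota> \<beta>" and N: "induced N N' \<iota>' \<beta>'" and projF: "proj \<Gamma> F"
    and g: "g \<in> module_hom \<Gamma> F N" "g ` carrier F = carrier N"
  obtains g' where "g' \<in> module_hom \<Lambda> F' N'" "g' ` carrier F' = carrier N'"
    "induced (F\<lparr>carrier := a_kernel F N g\<rparr>) (F'\<lparr>carrier := a_kernel F' N' g'\<rparr>) \<iota> \<beta>"
proof -
  note I = inducedD[OF F] and I' = inducedD[OF N]
  obtain g' where g': "g' \<in> module_hom \<Lambda> F' N'"
    "\<And>n x. n \<in> carrier F \<Longrightarrow> x \<in> carrier (column_module t F) \<Longrightarrow>
      g' (\<iota> n \<oplus>\<^bsub>F'\<^esub> jn F' \<iota> x) = \<iota>' (g n) \<oplus>\<^bsub>N'\<^esub> jn N' \<iota>' (\<lambda>l. g (x l))"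
    by (rule induced_hom[OF F N g(1)]) (rule that)
  interpret g: module_morphism \<Gamma> F N g by (rule module_morphismI[OF I(1) I'(1) g(1)])
  interpret g': module_morphism \<Lambda> F' N' g' by (rule module_morphismI[OF I(2) I'(2) g'(1)])
  interpret \<iota>': module_morphism \<Gamma> N "restrict_scalars i N'" \<iota>'
    by (rule module_morphismI[OF I'(1) left_module_restrict_scalars[OF ring_\<Gamma> i_hom I'(2)] I'(3)])
  have lift: "\<exists>x\<in>carrier (column_module s F). (\<lambda>l. g (x l)) = w" if w: "w \<in> carrier (column_module s N)" for w s
  proof -
    define x where "x l = (if l < s then inv_into (carrier F) g (w l) else \<zero>\<^bsub>F\<^esub>)" for l
    have wl: "w l \<in> g ` carrier F" for l using power_module_mem[OF I'(1) w] g(2) by simp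
    have "x \<in> carrier (column_module s F)" using wl by (simp add: column_carrier x_def inv_into_into)
    moreover have "(\<lambda>l. g (x l)) = w"
    proof
      fix l show "g (x l) = w l"
        using w by (cases "l < s") (simp_all add: x_def f_inv_into_f[OF wl] column_carrier)
    qed
    ultimately show ?thesis by blast
  qed
  have surj: "g' ` carrier F' = carrier N'"
  proof
    show "g' ` carrier F' \<subseteq> carrier N'" by auto
    show "carrier N' \<subseteq> g' ` carrier F'"
    proof
      fix z assume "z \<in> carrier N'"
      then obtain n x where nx: "n \<in> carrier N" "x \<in> carrier (column_module t N)" "z = \<iota>' n \<oplus>\<^bsub>N'\<^esub> jn N' \<iota>' x"
        using I'(6) by blast
      have "n \<in> g ` carrier F" using nx(1) g(2) by simp
      then obtain n0 where n0: "n0 \<in> carrier F" "g n0 = n" by (elim imageE) (simp add: that)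
      obtain x0 where x0: "x0 \<in> carrier (column_module t F)" "(\<lambda>l. g (x0 l)) = x" using lift[OF nx(2)] by blast
      have "g' (\<iota> n0 \<oplus>\<^bsub>F'\<^esub> jn F' \<iota> x0) = z" using g'(2)[OF n0(1) x0(1)] n0(2) x0(2) nx(3) by simp
      moreover have "\<iota> n0 \<oplus>\<^bsub>F'\<^esub> jn F' \<iota> x0 \<in> carrier F'"
        using f_closed[OF I(1-3) n0(1)] jn_closed[OF I(1-3) x0(1)] by simp
      ultimately show "z \<in> g' ` carrier F'" by blast
    qed
  qed
  let ?K = "a_kernel F N g"
  let ?K' = "{\<iota> n \<oplus>\<^bsub>F'\<^esub> jn F' \<iota> x |n x. n \<in> ?K \<and> x \<in> carrier (column_module t F) \<and> (\<forall>l<t. x l \<in> ?K)}"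
  have exact: "\<exists>z \<in> carrier (column_module u F). (\<forall>m<u. z m \<in> ?K) \<and> mact F t u \<psi> z = mact F t u \<psi> x"
    if "x \<in> carrier (column_module u F)" "\<forall>l<t. mact F t u \<psi> x l \<in> ?K" for x
    by (rule syzygy_exact[OF syz projF g \<psi>_matrix good that])
  note sub = induced_submodule[OF F g.submodule_kernel exact]
  have "a_kernel F' N' g' = ?K'"
  proof (rule equalityI)
    show "?K' \<subseteq> a_kernel F' N' g'"
    proof
      fix z assume z: "z \<in> ?K'"
      then obtain n x where nx: "n \<in> ?K" "x \<in> carrier (column_module t F)" "\<forall>l<t. x l \<in> ?K"
        "z = \<iota> n \<oplus>\<^bsub>F'\<^esub> jn F' \<iota> x" by blast
      have n: "n \<in> carrier F" "g n = \<zero>\<^bsub>N\<^esub>" using nx(1) by (simp_all add: a_kernel_iff)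
      have "g (x l) = \<zero>\<^bsub>N\<^esub>" for l
        using nx(2,3) by (cases "l < t") (simp_all add: a_kernel_iff column_carrier)
      then have "jn N' \<iota>' (\<lambda>l. g (x l)) = finsum N' (\<lambda>l. \<zero>\<^bsub>N'\<^esub>) {..<t}"
        unfolding jn_def using y_closed \<iota>'.zero by (intro g'.N.M.finsum_cong') auto
      then have "g' z = \<zero>\<^bsub>N'\<^esub>"
        unfolding nx(4) g'(2)[OF n(1) nx(2)] n(2) using \<iota>'.zero g'.N.M.finsum_zero[of "{..<t}"] by simp
      moreover have "z \<in> carrier F'"
        unfolding nx(4) using f_closed[OF I(1-3) n(1)] jn_closed[OF I(1-3) nx(2)] by simp
      ultimately show "z \<in> a_kernel F' N' g'" by (simp add: a_kernel_iff)
    qed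
    show "a_kernel F' N' g' \<subseteq> ?K'"
    proof
      fix z assume z: "z \<in> a_kernel F' N' g'"
      then obtain n x where nx: "n \<in> carrier F" "x \<in> carrier (column_module t F)" "z = \<iota> n \<oplus>\<^bsub>F'\<^esub> jn F' \<iota> x"
        using I(6)[of z] by (auto simp: a_kernel_iff)
      have gx: "(\<lambda>l. g (x l)) \<in> carrier (column_module t N)" by (rule column_hom[OF I(1) I'(1) g(1) nx(2)])
      have zero: "\<iota>' (g n) \<oplus>\<^bsub>N'\<^esub> jn N' \<iota>' (\<lambda>l. g (x l)) = \<zero>\<^bsub>N'\<^esub>"
        using z g'(2)[OF nx(1,2)] nx(3) by (simp add: a_kernel_iff)
      interpret \<beta>': module_morphism \<Lambda> N' "restrict_scalars \<pi> N" \<beta>'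
        by (rule module_morphismI[OF I'(2) left_module_restrict_scalars[OF ring_\<Lambda> \<pi>_hom I'(1)] I'(4)])
      have gn: "g n = \<zero>\<^bsub>N\<^esub>" using induced_\<beta>_jn[OF N gx g.closed[OF nx(1)]] \<beta>'.zero by (simp add: zero)
      then have "jn N' \<iota>' (\<lambda>l. g (x l)) = \<zero>\<^bsub>N'\<^esub>"
        using zero \<iota>'.zero jn_closed[OF I'(1-3) gx] by simp
      then obtain w where w: "w \<in> carrier (column_module u N)" "(\<lambda>l. g (x l)) = mact N t u \<psi> w"
        using I'(7)[OF gx] by blast
      obtain v where v: "v \<in> carrier (column_module u F)" "(\<lambda>l. g (v l)) = w" using lift[OF w(1)] by blast
      let ?p = "mact F t u \<psi> v"
      have p: "?p \<in> carrier (column_module t F)" by (rule mact_carrier[OF I(1) \<psi>_matrix v(1)])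
      have gp: "g (?p l) = g (x l)" for l
        using fun_cong[OF mact_hom[OF I(1) I'(1) g(1) \<psi>_matrix v(1)], of l] fun_cong[OF w(2), of l] by (simp add: v(2))
      let ?x = "\<lambda>l. x l \<ominus>\<^bsub>F\<^esub> ?p l"
      have x': "?x \<in> carrier (column_module t F)" by (rule column_minus[OF I(1) nx(2) p])
      have "?x l \<in> ?K" for l
        using power_module_mem[OF I(1) nx(2), of l] power_module_mem[OF I(1) p, of l] gp[of l]
        by (simp add: a_kernel_iff g.N.M.minus_eq_zero_iff)
      moreover have "jn F' \<iota> ?x = jn F' \<iota> x"
        using jn_minus[OF I(1-3) nx(2) p] jn_relation[OF I(1-3) v(1)] jn_closed[OF I(1-3) nx(2)] by simp
      moreover have "n \<in> ?K" using nx(1) gn by (simp add: a_kernel_iff)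
      ultimately show "z \<in> ?K'" using x' nx(3) by (intro CollectI exI[of _ n] exI[of _ ?x]) simp
    qed
  qed
  then show ?thesis using sub(2) by (intro that[OF g'(1) surj]) simp
qed

text \<open>If \<open>N\<close> is projective, a section of its cover extends to the induced
  modules, so N' is a retract of a projective module. In the step \<open>N\<close> is replaced by
  the kernel of a cover, again a d-th syzygy.\<close>

theorem pdle_induced:
  fixes N N' :: "('r, 'm) module"
  assumes large: "large (carrier \<Lambda>) TYPE('m)" "large (carrier \<Gamma>) TYPE('m)"
    and good: "good d \<Gamma> t u \<psi>"
    and "syzygy d \<Gamma> N" "induced N N' \<iota> \<beta>" "pdle n \<Gamma> N"
  shows "pdle n \<Lambda> N'"
  using assms(4-6)
proof (induction n arbitrary: N N' \<iota> \<beta>)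
  case 0
  note I' = inducedD[OF "0.prems"(2)]
  obtain F F' :: "('r, 'm) module" and g \<iota>F \<beta>F where F: "proj \<Gamma> F" "g \<in> module_hom \<Gamma> F N" "g ` carrier F = carrier N"
    and F': "proj \<Lambda> F'" "induced F F' \<iota>F \<beta>F"
    by (rule induced_cover_exists[OF large I'(1)]) (rule that)
  note I = inducedD[OF F'(2)]
  have "proj \<Gamma> N" using "0.prems"(3) by simp
  then obtain s where s: "s \<in> module_hom \<Gamma> N F" "\<And>x. x \<in> carrier N \<Longrightarrow> g (s x) = x"
    by (rule proj_lift[OF _ I(1) I'(1) F(2,3) module_hom_ident]) (rule that)
  obtain g' where g': "g' \<in> module_hom \<Lambda> F' N'"
    "\<And>n x. n \<in> carrier F \<Longrightarrow> x \<in> carrier (column_module t F) \<Longrightarrow>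
      g' (\<iota>F n \<oplus>\<^bsub>F'\<^esub> jn F' \<iota>F x) = \<iota> (g n) \<oplus>\<^bsub>N'\<^esub> jn N' \<iota> (\<lambda>l. g (x l))"
    by (rule induced_hom[OF F'(2) "0.prems"(2) F(2)]) (rule that)
  obtain s' where s': "s' \<in> module_hom \<Lambda> N' F'"
    "\<And>n x. n \<in> carrier N \<Longrightarrow> x \<in> carrier (column_module t N) \<Longrightarrow>
      s' (\<iota> n \<oplus>\<^bsub>N'\<^esub> jn N' \<iota> x) = \<iota>F (s n) \<oplus>\<^bsub>F'\<^esub> jn F' \<iota>F (\<lambda>l. s (x l))"
    by (rule induced_hom[OF "0.prems"(2) F'(2) s(1)]) (rule that)
  have "g' (s' z) = z" if z: "z \<in> carrier N'" for z
  proof -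
    obtain n x where nx: "n \<in> carrier N" "x \<in> carrier (column_module t N)" "z = \<iota> n \<oplus>\<^bsub>N'\<^esub> jn N' \<iota> x"
      using I'(6)[OF z] by (elim bexE) (rule that)
    have "(\<lambda>l. g (s (x l))) = x" using s(2) power_module_mem[OF I'(1) nx(2)] by simp
    then show ?thesis
      unfolding nx(3) s'(2)[OF nx(1,2)] g'(2)[OF module_hom_mem[OF s(1) nx(1)] column_hom[OF I'(1) I(1) s(1) nx(2)]]
      using s(2)[OF nx(1)] by simp
  qed
  then have "proj \<Lambda> N'" by (rule proj_retract[OF F'(1) I'(2) s'(1) g'(1)])
  then show ?case by simp
next
  case (Suc n)
  note I' = inducedD[OF Suc.prems(2)]
  obtain F F' :: "('r, 'm) module" and g \<iota>F \<beta>F where F: "proj \<Gamma> F" "g \<in> module_hom \<Gamma> F N" "g ` carrier F = carrier N"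
    and F': "proj \<Lambda> F'" "induced F F' \<iota>F \<beta>F"
    by (rule induced_cover_exists[OF large I'(1)]) (rule that)
  obtain g' where g': "g' \<in> module_hom \<Lambda> F' N'" "g' ` carrier F' = carrier N'"
    "induced (F\<lparr>carrier := a_kernel F N g\<rparr>) (F'\<lparr>carrier := a_kernel F' N' g'\<rparr>) \<iota>F \<beta>F"
    by (rule induced_kernel[OF Suc.prems(1) good F'(2) Suc.prems(2) F]) (rule that)
  have syz: "syzygy d \<Gamma> (F\<lparr>carrier := a_kernel F N g\<rparr>)"
  proof (rule syzygy_Suc_imp)
    show "syzygy (Suc d) \<Gamma> (F\<lparr>carrier := a_kernel F N g\<rparr>)" unfolding syzygy.simps(2)
      by (rule exI[of _ F], rule exI[of _ N], rule exI[of _ g]) (intro conjI I'(1) Suc.prems(1) F refl)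
  qed
  show ?case
    by (rule pdle_SucI[OF I'(2) F'(1) g'(1,2) Suc.IH[OF syz g'(3) schanuel[OF large(2) Suc.prems(3) F]]])
qed

text \<open>The first d syzygies make Tor(J, N) vanish. One more places the module inside a free
  module, in whose induced module its own is found by \<open>induced_submodule\<close>; this
  accounts for \<open>Suc d\<close>.\<close>

lemma induced_syzygy_exists:
  fixes M :: "('r, 'm) module"
  assumes large: "large (carrier \<Lambda>) TYPE('m)" "large (carrier \<Gamma>) TYPE('m)"
    and good: "good d \<Gamma> t u \<psi>" and M: "left_module \<Gamma> M"
  shows "\<exists>(N :: ('r, 'm) module) (N' :: ('r, 'm) module) \<iota> \<beta>. syzygy d \<Gamma> N \<and> induced N N' \<iota> \<beta> \<and>
    (finitely_generated \<Gamma> M \<longrightarrow> finitely_generated \<Gamma> N) \<and>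
    (\<forall>p. pdle p \<Gamma> M \<longrightarrow> pdle p \<Gamma> N) \<and> (\<forall>f. pdle f \<Gamma> N \<longrightarrow> pdle (f + Suc d) \<Gamma> M)"
proof -
  obtain N :: "('r, 'm) module" where N: "syzygy d \<Gamma> N" "finitely_generated \<Gamma> M \<longrightarrow> finitely_generated \<Gamma> N"
    "\<forall>p. pdle p \<Gamma> M \<longrightarrow> pdle p \<Gamma> N" "\<forall>f. pdle f \<Gamma> N \<longrightarrow> pdle (f + d) \<Gamma> M"
    using G.syzygy_exists[OF large(2) M, of d] by (elim exE conjE) (rule that)
  note NL = syzygy_left_module[OF N(1)]
  obtain F F' :: "('r, 'm) module" and g \<iota> \<beta> where F: "proj \<Gamma> F" "g \<in> module_hom \<Gamma> F N" "g ` carrier F = carrier N"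
    "finitely_generated \<Gamma> N \<Longrightarrow> finitely_generated \<Gamma> F"
    and F': "proj \<Lambda> F'" "induced F F' \<iota> \<beta>"
    by (rule induced_cover_exists[OF large NL]) (rule that)
  note I = inducedD[OF F'(2)]
  let ?K = "a_kernel F N g"
  note sub = left_module_kernel(2)[OF I(1) NL F(2)]
  have exact: "\<exists>z \<in> carrier (column_module u F). (\<forall>m<u. z m \<in> ?K) \<and> mact F t u \<psi> z = mact F t u \<psi> x"
    if "x \<in> carrier (column_module u F)" "\<forall>l<t. mact F t u \<psi> x l \<in> ?K" for x
    by (rule syzygy_exact[OF N(1) F(1-3) \<psi>_matrix good that])
  have syz: "syzygy d \<Gamma> (F\<lparr>carrier := ?K\<rparr>)"
  proof (rule syzygy_Suc_imp)
    show "syzygy (Suc d) \<Gamma> (F\<lparr>carrier := ?K\<rparr>)" unfolding syzygy.simps(2)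
      by (rule exI[of _ F], rule exI[of _ N], rule exI[of _ g]) (intro conjI NL N(1) F(1-3) refl)
  qed
  have "finitely_generated \<Gamma> (F\<lparr>carrier := ?K\<rparr>)" if "finitely_generated \<Gamma> M"
    using G.finitely_generated_submodule[OF I(1) F(4) sub] N(2) that by blast
  moreover have "pdle p \<Gamma> (F\<lparr>carrier := ?K\<rparr>)" if "pdle p \<Gamma> M" for p
    using schanuel[OF large(2) pdle_Suc F(1-3)] N(3) that by blast
  moreover have "pdle (f + Suc d) \<Gamma> M" if "pdle f \<Gamma> (F\<lparr>carrier := ?K\<rparr>)" for f
    using N(4)[rule_format, OF pdle_SucI[OF NL F(1-3) that]] by simp
  ultimately show ?thesis using syz induced_submodule(2)[OF F'(2) sub exact] by blast
qed

lemma finitely_generated_induced: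
  assumes ind: "induced N N' \<iota> \<beta>" and fg: "finitely_generated \<Gamma> N"
  shows "finitely_generated \<Lambda> N'"
proof -
  note I = inducedD[OF ind]
  obtain S where S: "finite S" "S \<subseteq> carrier N" "\<And>H. submodule H \<Gamma> N \<Longrightarrow> S \<subseteq> H \<Longrightarrow> H = carrier N"
    using fg by (elim finitely_generatedE) (rule that)
  interpret N: left_module \<Gamma> N by (rule I(1))
  interpret N': left_module \<Lambda> N' by (rule I(2))
  interpret \<iota>: module_morphism \<Gamma> N "restrict_scalars i N'" \<iota>
    by (rule module_morphismI[OF I(1) left_module_restrict_scalars[OF ring_\<Gamma> i_hom I(2)] I(3)])
  show ?thesis
  proof (rule finitely_generatedI[of "\<iota> ` S"])
    fix H assume H: "submodule H \<Lambda> N'" "\<iota> ` S \<subseteq> H"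
    note H' = N'.submoduleD[OF H(1)]
    have "submodule H \<Gamma> (restrict_scalars i N')"
      by (rule \<iota>.N.submoduleI') (use H' i_closed in auto)
    then have "{n \<in> carrier N. \<iota> n \<in> H} = carrier N"
      using S(2) H(2) by (intro S(3)[OF \<iota>.submodule_vimage]) auto
    then have \<iota>H: "\<iota> n \<in> H" if "n \<in> carrier N" for n using that by blast
    have "z \<in> H" if z: "z \<in> carrier N'" for z
    proof -
      obtain n x where nx: "n \<in> carrier N" "x \<in> carrier (column_module t N)" "z = \<iota> n \<oplus>\<^bsub>N'\<^esub> jn N' \<iota> x"
        using I(6)[OF z] by (elim bexE) (rule that)
      have "jn N' \<iota> x \<in> H" unfolding jn_def
        by (rule submodule_finsum[OF I(2) H(1)]) (use H'(7) y_closed \<iota>H power_module_mem[OF I(1) nx(2)] in blast)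
      then show ?thesis unfolding nx(3) by (intro H'(4) \<iota>H nx(1))
    qed
    then show "H = carrier N'" using H'(1) by blast
  qed (use S(1,2) \<iota>.closed in auto)
qed

end

section \<open>Passage from \<Lambda> to \<Gamma>: kernel of square zero, and global
  dimension\<close>

context cleft_extension
begin

text \<open>As the square of \<open>J\<close> is zero, multiplying \<open>J\<close> from the right
  by a and by i(\<pi> a) is the same. So the right module \<open>J\<close> is the inflation of its
  restriction to \<Gamma>, and the identity map exhibits the retract over the opposite
  rings.\<close>

lemma J_right_\<Gamma>_pdle:
  assumes large: "large (carrier \<Gamma>) TYPE('r)" and sq: "\<And>a b. a \<in> J \<Longrightarrow> b \<in> J \<Longrightarrow> a \<otimes>\<^bsub>\<Lambda>\<^esub> b = \<zero>\<^bsub>\<Lambda>\<^esub>"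
    and pd: "pdle d (op_ring \<Lambda>) (ideal_module (op_ring \<Lambda>) J)"
  shows "pdle d (op_ring \<Gamma>) (restrict_scalars i (ideal_module (op_ring \<Lambda>) J))"
    "finitely_generated (op_ring \<Gamma>) (restrict_scalars i (ideal_module (op_ring \<Lambda>) J))"
proof -
  let ?N = "ideal_module (op_ring \<Lambda>) J"
  let ?Y = "restrict_scalars i ?N"
  note N = pdle_left_module[OF pd]
  have i_op: "i \<in> ring_hom (op_ring \<Gamma>) (op_ring \<Lambda>)" and \<pi>_op: "\<pi> \<in> ring_hom (op_ring \<Lambda>) (op_ring \<Gamma>)"
    using i_hom \<pi>_hom by (simp_all add: ring_hom_def)
  interpret op: ring_retraction "op_ring \<Gamma>" "op_ring \<Lambda>" i \<pi>
    by (intro ring_retraction.intro ring_op_ring ring_\<Gamma> ring_\<Lambda> i_op \<pi>_op) (simp add: \<pi>_i)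
  note Y = left_module_restrict_scalars[OF ring_op_ring[OF ring_\<Gamma>] i_op N]
  have N_simps: "carrier ?N = J" "x \<oplus>\<^bsub>?N\<^esub> x' = x \<oplus>\<^bsub>\<Lambda>\<^esub> x'" "a \<odot>\<^bsub>?N\<^esub> x = x \<otimes>\<^bsub>\<Lambda>\<^esub> a" for x x' a
    by (simp_all add: ideal_module_def)
  have act: "x \<otimes>\<^bsub>\<Lambda>\<^esub> a = x \<otimes>\<^bsub>\<Lambda>\<^esub> i (\<pi> a)" if "x \<in> J" "a \<in> carrier \<Lambda>" for x a
  proof -
    have c: "i (\<pi> a) \<in> carrier \<Lambda>" using that by (simp add: i_closed \<pi>_closed)
    have "x \<otimes>\<^bsub>\<Lambda>\<^esub> (a \<ominus>\<^bsub>\<Lambda>\<^esub> i (\<pi> a)) = \<zero>\<^bsub>\<Lambda>\<^esub>" by (rule sq[OF that(1) J_diff[OF that(2)]])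
    then have "x \<otimes>\<^bsub>\<Lambda>\<^esub> a \<ominus>\<^bsub>\<Lambda>\<^esub> x \<otimes>\<^bsub>\<Lambda>\<^esub> i (\<pi> a) = \<zero>\<^bsub>\<Lambda>\<^esub>"
      using c that J_closed[OF that(1)] by (simp add: a_minus_def L.R.r_distr L.R.r_minus)
    then show ?thesis using c that J_closed[OF that(1)] by (simp add: L.R.minus_eq_zero_iff)
  qed
  show "pdle d (op_ring \<Gamma>) ?Y"
  proof (rule op.pdle_retract[OF _ Y _ _ _ pd, of "\<lambda>x. x" "\<lambda>x. x"])
    show "(\<lambda>x. x) \<in> module_hom (op_ring \<Gamma>) ?Y (restrict_scalars i ?N)" by (rule module_hom_ident)
    show "(\<lambda>x. x) \<in> module_hom (op_ring \<Lambda>) ?N (restrict_scalars \<pi> ?Y)"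
      by (rule module_homI) (simp_all add: N_simps act)
  qed (use large in simp_all)
  show "finitely_generated (op_ring \<Gamma>) ?Y"
  proof -
    interpret N: left_module "op_ring \<Lambda>" ?N by (rule N)
    interpret Y: left_module "op_ring \<Gamma>" ?Y by (rule Y)
    obtain S where S: "finite S" "S \<subseteq> carrier ?N" "\<And>H. submodule H (op_ring \<Lambda>) ?N \<Longrightarrow> S \<subseteq> H \<Longrightarrow> H = carrier ?N"
      using J_right_finitely_generated by (elim finitely_generatedE) (rule that)
    show ?thesis
    proof (rule finitely_generatedI[of S])
      fix H assume H: "submodule H (op_ring \<Gamma>) ?Y" "S \<subseteq> H"
      note H' = Y.submoduleD[OF H(1)]
      have HJ: "x \<in> J" if "x \<in> H" for x using H'(3)[OF that] by (simp add: N_simps)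
      have "submodule H (op_ring \<Lambda>) ?N"
      proof (rule N.submoduleI')
        show "H \<subseteq> carrier ?N" "\<zero>\<^bsub>?N\<^esub> \<in> H" using H'(1,2) by simp_all
        show "x \<oplus>\<^bsub>?N\<^esub> x' \<in> H" if "x \<in> H" "x' \<in> H" for x x' using H'(4)[OF that] by simp
        show "a \<odot>\<^bsub>?N\<^esub> x \<in> H" if "a \<in> carrier (op_ring \<Lambda>)" "x \<in> H" for a x
          using H'(7)[of "\<pi> a" x] that act[OF HJ[OF that(2)]] \<pi>_closed by (simp add: N_simps)
      qed
      then show "H = carrier ?Y" using S(3) H(2) by simp
    qed (use S(1,2) in simp_all)
  qed
qed

lemma right_presented_good:
  assumes large: "large (carrier \<Gamma>) TYPE('r)" "large (carrier \<Gamma>) TYPE(nat \<Rightarrow> 'r)"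
    and sq: "\<And>a b. a \<in> J \<Longrightarrow> b \<in> J \<Longrightarrow> a \<otimes>\<^bsub>\<Lambda>\<^esub> b = \<zero>\<^bsub>\<Lambda>\<^esub>"
    and pd: "pdle d (op_ring \<Lambda>) (ideal_module (op_ring \<Lambda>) J)"
  obtains t u y \<psi> where "right_presented \<Gamma> \<Lambda> i \<pi> \<kappa> \<kappa>' J t u y \<psi>" "good d \<Gamma> t u \<psi>"
proof -
  let ?N = "ideal_module (op_ring \<Lambda>) J"
  let ?Y = "restrict_scalars i ?N" and ?S = "op_ring \<Gamma>"
  have Y: "pdle d ?S ?Y" "finitely_generated ?S ?Y"
    by (rule J_right_\<Gamma>_pdle[OF large(1) _ pd], erule (1) sq)+
  note YL = pdle_left_module[OF Y(1)]
  interpret Y: left_module ?S ?Y by (rule YL)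
  have YJ: "carrier ?Y = J" "\<zero>\<^bsub>?Y\<^esub> = \<zero>\<^bsub>\<Lambda>\<^esub>" "a \<odot>\<^bsub>?Y\<^esub> x = x \<otimes>\<^bsub>\<Lambda>\<^esub> i a" for a x by (simp_all add: ideal_module_def)
  obtain t :: nat and y u \<psi> where y: "\<And>l. l < t \<Longrightarrow> y l \<in> carrier ?Y"
    "lin ?S ?Y y ` carrier (free_module \<Gamma> {..<t}) = carrier ?Y"
    and \<psi>: "matrix_over \<Gamma> t u \<psi>"
    and ex: "\<And>x. x\<in>carrier (free_module \<Gamma> {..<t}) \<Longrightarrow> lin ?S ?Y y x = \<zero>\<^bsub>?Y\<^esub> \<longleftrightarrow>
      x \<in> mact (regular_module \<Gamma>) t u \<psi> ` carrier (free_module \<Gamma> {..<u})"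
    and good: "good d \<Gamma> t u \<psi>"
    by (rule G.presentation_good[OF large(2) Y]) (rule that)
  have lin: "lin ?S ?Y y x = finsum (regular_module \<Lambda>) (\<lambda>l. y l \<otimes>\<^bsub>\<Lambda>\<^esub> i (x l)) {..<t}"
    if x: "x \<in> carrier (free_module \<Gamma> {..<t})" for x
  proof -
    have yP: "y \<in> {..<t} \<rightarrow> carrier ?Y" using y(1) by simp
    have xS: "x \<in> carrier (free_module ?S {..<t})" using x by (simp add: free_module_op_carrier)
    have xc: "x l \<in> carrier \<Gamma>" for l
      using power_module_mem[OF left_module_regular[OF ring_\<Gamma>] x, of l] by simp
    have "lin ?S ?Y y x = finsum ?Y (\<lambda>l. x l \<odot>\<^bsub>?Y\<^esub> y l) {..<t}"
      by (rule lin_eq_finsum[OF YL yP xS]) (use x in \<open>auto simp: column_carrier not_less[symmetric]\<close>)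
    also have "\<dots> = finsum (regular_module (op_ring \<Lambda>)) (\<lambda>l. y l \<otimes>\<^bsub>\<Lambda>\<^esub> i (x l)) {..<t}"
    proof -
      note SA = left_module_regular_op
      interpret SA: left_module "op_ring \<Lambda>" "regular_module (op_ring \<Lambda>)" by (rule SA)
      interpret K: module_morphism "op_ring \<Lambda>" ?N "regular_module (op_ring \<Lambda>)" "\<lambda>x. x"
        unfolding ideal_module_op
        by (rule module_morphismI[OF SA.left_module_submodule[OF J_right_submodule] SA inclusion_hom])
          (rule SA.submoduleD(1)[OF J_right_submodule])
      have "finsum ?Y (\<lambda>l. x l \<odot>\<^bsub>?Y\<^esub> y l) {..<t} = finsum ?N (\<lambda>l. y l \<otimes>\<^bsub>\<Lambda>\<^esub> i (x l)) {..<t}"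
        by (simp add: finsum_def restrict_scalars_def ideal_module_def)
      also have "\<dots> = finsum (regular_module (op_ring \<Lambda>)) (\<lambda>l. y l \<otimes>\<^bsub>\<Lambda>\<^esub> i (x l)) {..<t}"
        by (rule K.finsum) (use y(1) J_mult(2)[OF i_closed[OF xc]] in \<open>auto simp: ideal_module_def\<close>)
      finally show ?thesis .
    qed
    finally show ?thesis by (simp add: finsum_regular_op)
  qed
  have "right_presented \<Gamma> \<Lambda> i \<pi> \<kappa> \<kappa>' J t u y \<psi>"
  proof unfold_locales
    show "y l \<in> J" if "l < t" for l using y(1)[OF that] unfolding YJ(1) .
    show "matrix_over \<Gamma> t u \<psi>" by (rule \<psi>)
    show "\<exists>x\<in>carrier (free_module \<Gamma> {..<t}). c = finsum (regular_module \<Lambda>) (\<lambda>l. y l \<otimes>\<^bsub>\<Lambda>\<^esub> i (x l)) {..<t}"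
      if "c \<in> J" for c
    proof -
      have "c \<in> lin ?S ?Y y ` carrier (free_module \<Gamma> {..<t})" using that y(2) YJ(1) by simp
      then obtain x where "c = lin ?S ?Y y x" "x \<in> carrier (free_module \<Gamma> {..<t})" by (rule imageE) (rule that)
      then show ?thesis using lin by (intro bexI[of _ x]) simp_all
    qed
    show "finsum (regular_module \<Lambda>) (\<lambda>l. y l \<otimes>\<^bsub>\<Lambda>\<^esub> i (x l)) {..<t} = \<zero>\<^bsub>\<Lambda>\<^esub> \<longleftrightarrow>
      x \<in> mact (regular_module \<Gamma>) t u \<psi> ` carrier (free_module \<Gamma> {..<u})"
      if "x \<in> carrier (free_module \<Gamma> {..<t})" for x
      using ex[OF that] lin[OF that] YJ(2) by simp
  qed
  then show ?thesis using good by (rule that)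
qed

text \<open>The identity \<beta> \<iota> = 1 makes \<open>N\<close> a retract over \<Gamma> of its
  induced module, and \<open>pdle_induced\<close> bounds the induced module by \<open>N\<close>. The
  loss d + 1 comes from replacing M by a syzygy.\<close>

theorem dimension_transfer_down_square_zero:
  assumes large: "large (carrier \<Lambda>) TYPE('m)" "large (carrier \<Gamma>) TYPE('m)"
    "large (carrier \<Gamma>) TYPE('r)" "large (carrier \<Gamma>) TYPE(nat \<Rightarrow> 'r)"
    and sq: "\<And>a b. a \<in> J \<Longrightarrow> b \<in> J \<Longrightarrow> a \<otimes>\<^bsub>\<Lambda>\<^esub> b = \<zero>\<^bsub>\<Lambda>\<^esub>"
    and pd: "pdle d (op_ring \<Lambda>) (ideal_module (op_ring \<Lambda>) J)"
  shows "fin_dim TYPE('m) \<Lambda> < \<infinity> \<Longrightarrow> fin_dim TYPE('m) \<Gamma> < \<infinity>"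
    and "Fin_dim TYPE('m) \<Lambda> < \<infinity> \<Longrightarrow> Fin_dim TYPE('m) \<Gamma> < \<infinity>"
proof -
  obtain t u y \<psi> where "right_presented \<Gamma> \<Lambda> i \<pi> \<kappa> \<kappa>' J t u y \<psi>" and good: "good d \<Gamma> t u \<psi>"
    by (rule right_presented_good[OF large(3,4) sq pd])
  then interpret right_presented \<Gamma> \<Lambda> i \<pi> \<kappa> \<kappa>' J t u y \<psi> by simp
  have key: "\<exists>N' :: ('r, 'm) module. left_module \<Lambda> N' \<and>
      (finitely_generated \<Gamma> M \<longrightarrow> finitely_generated \<Lambda> N') \<and> (\<forall>p. pdle p \<Gamma> M \<longrightarrow> pdle p \<Lambda> N') \<and>
      (\<forall>n. pdle n \<Lambda> N' \<longrightarrow> pdle (n + Suc d) \<Gamma> M)"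
    if M: "left_module \<Gamma> M" for M :: "('r, 'm) module"
  proof -
    obtain N N' :: "('r, 'm) module" and \<iota> \<beta> where N: "syzygy d \<Gamma> N" "induced N N' \<iota> \<beta>"
      "finitely_generated \<Gamma> M \<longrightarrow> finitely_generated \<Gamma> N"
      "\<forall>p. pdle p \<Gamma> M \<longrightarrow> pdle p \<Gamma> N" "\<forall>f. pdle f \<Gamma> N \<longrightarrow> pdle (f + Suc d) \<Gamma> M"
      using induced_syzygy_exists[OF large(1,2) good M] by (elim exE conjE) (rule that)
    note I = inducedD[OF N(2)]
    have "pdle n \<Gamma> N" if "pdle n \<Lambda> N'" for n
      by (rule pdle_retract[OF large(2) I(1) I(3,4) I(5) that])
    then show ?thesis
      using I(2) N(3-5) finitely_generated_induced[OF N(2)] pdle_induced[OF large(1,2) good N(1,2)]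
      by (intro exI[of _ N'] conjI allI impI) (simp_all del: pdle.simps)
  qed
  show "fin_dim TYPE('m) \<Gamma> < \<infinity>" if fin: "fin_dim TYPE('m) \<Lambda> < \<infinity>"
  proof -
    obtain n where "\<forall>(M :: ('r, 'm) module) m. left_module \<Lambda> M \<longrightarrow> finitely_generated \<Lambda> M \<longrightarrow>
        pdle m \<Lambda> M \<longrightarrow> pdle n \<Lambda> M"
      using fin unfolding fin_dim_finite_iff[OF large(1)] ..
    then have "\<forall>(M :: ('r, 'm) module) m. left_module \<Gamma> M \<longrightarrow> finitely_generated \<Gamma> M \<longrightarrow>
        pdle m \<Gamma> M \<longrightarrow> pdle (n + Suc d) \<Gamma> M" using key by meson
    then show ?thesis unfolding fin_dim_finite_iff[OF large(2)] ..
  qed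
  show "Fin_dim TYPE('m) \<Gamma> < \<infinity>" if fin: "Fin_dim TYPE('m) \<Lambda> < \<infinity>"
  proof -
    obtain n where "\<forall>(M :: ('r, 'm) module) m. left_module \<Lambda> M \<longrightarrow> pdle m \<Lambda> M \<longrightarrow> pdle n \<Lambda> M"
      using fin unfolding Fin_dim_finite_iff[OF large(1)] ..
    then have "\<forall>(M :: ('r, 'm) module) m. left_module \<Gamma> M \<longrightarrow> pdle m \<Gamma> M \<longrightarrow> pdle (n + Suc d) \<Gamma> M"
      using key by meson
    then show ?thesis unfolding Fin_dim_finite_iff[OF large(2)] ..
  qed
qed

text \<open>As \<pi> i = 1, a \<Gamma>-module is the restriction of its own inflation, so the
  identity serves as both maps of the retract.\<close>

lemma pdle_inflation:
  fixes M :: "('r, 'm) module"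
  assumes "large (carrier \<Gamma>) TYPE('m)" "left_module \<Gamma> M" "pdle n \<Lambda> (restrict_scalars \<pi> M)"
  shows "pdle n \<Gamma> M"
proof (rule pdle_retract[OF assms(1,2) _ _ _ assms(3), of "\<lambda>x. x" "\<lambda>x. x"])
  show "(\<lambda>x. x) \<in> module_hom \<Gamma> M (restrict_scalars i (restrict_scalars \<pi> M))"
    by (rule module_homI) (simp_all add: \<pi>_i)
qed (simp_all add: module_hom_ident)

text \<open>All inflations have bounded dimension over \<Lambda>, so \<open>pdle_inflation\<close>
  applies to every \<Gamma>-module with the same bound.\<close>

theorem gl_dim_transfer_down:
  assumes large: "large (carrier \<Lambda>) TYPE('m)" "large (carrier \<Gamma>) TYPE('m)"
    and fin: "gl_dim TYPE('m) \<Lambda> < \<infinity>"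
  shows "gl_dim TYPE('m) \<Gamma> < \<infinity>"
proof -
  obtain n where "\<forall>(M :: ('r, 'm) module). left_module \<Lambda> M \<longrightarrow> pdle n \<Lambda> M"
    using fin unfolding gl_dim_finite_iff[OF large(1)] ..
  then have "\<forall>(M :: ('r, 'm) module). left_module \<Gamma> M \<longrightarrow> pdle n \<Gamma> M"
    using pdle_inflation[OF large(2)] left_module_restrict_scalars[OF ring_\<Lambda> \<pi>_hom] by blast
  then show ?thesis unfolding gl_dim_finite_iff[OF large(2)] ..
qed

end

section \<open>Inflation when the kernel has finite projective dimension\<close>

text \<open>Every x splits into x - s(p x), which lies in the kernel, and s(p x). Lifting the two
  parts, by projectivity of the kernel and of \<open>C\<close>, gives a section of a free cover of
  \<open>B\<close>.\<close>

lemma extension_proj: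
  fixes B C :: "('r, 'm) module"
  assumes large: "large (carrier R) TYPE('m)" and B: "left_module R B" and C: "proj R C"
    and p: "p \<in> module_hom R B C" "p ` carrier B = carrier C"
    and A: "proj R (B\<lparr>carrier := a_kernel B C p\<rparr>)"
  shows "proj R B"
proof -
  note CL = proj_left_module[OF C]
  let ?A = "B\<lparr>carrier := a_kernel B C p\<rparr>"
  interpret p: module_morphism R B C p by (rule module_morphismI[OF B CL p(1)])
  obtain Q :: "('r, 'm) module" and g S c c' where "S \<subseteq> carrier B" "finitely_generated R B \<Longrightarrow> finite S"
    and Q: "proj R Q" "g \<in> module_hom R Q B" "g ` carrier Q = carrier B"
    and "finitely_generated R B \<Longrightarrow> finitely_generated R Q"
    "c \<in> module_hom R (free_module R S) Q" "c' \<in> module_hom R Q (free_module R S)"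
    "\<And>f. f \<in> carrier (free_module R S) \<Longrightarrow> c' (c f) = f" "\<And>x. x \<in> carrier Q \<Longrightarrow> c (c' x) = x"
    by (rule free_cover_exists[OF B large]) (rule that)
  note QL = proj_left_module[OF Q(1)]
  interpret g: module_morphism R Q B g by (rule module_morphismI[OF QL B Q(2)])
  obtain s where s: "s \<in> module_hom R C B" "\<And>x. x \<in> carrier C \<Longrightarrow> p (s x) = x"
    by (rule proj_lift[OF C B CL p module_hom_ident]) (rule that)
  have inc: "(\<lambda>x. x) \<in> module_hom R ?A B" by (rule inclusion_hom) (auto simp: a_kernel_iff)
  obtain h where h: "h \<in> module_hom R ?A Q" "\<And>x. x \<in> carrier ?A \<Longrightarrow> g (h x) = x"
    by (rule proj_lift[OF A QL B Q(2,3) inc]) (rule that)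
  obtain k where k: "k \<in> module_hom R C Q" "\<And>x. x \<in> carrier C \<Longrightarrow> g (k x) = s x"
    by (rule proj_lift[OF C QL B Q(2,3) s(1)]) (rule that)
  have sp: "(\<lambda>x. s (p x)) \<in> module_hom R B B" by (rule module_hom_comp[OF p(1) s(1)])
  have r: "(\<lambda>x. x \<ominus>\<^bsub>B\<^esub> s (p x)) \<in> module_hom R B ?A"
  proof (rule module_hom_into_submodule[OF module_hom_minus[OF B B module_hom_ident sp]])
    show "x \<ominus>\<^bsub>B\<^esub> s (p x) \<in> a_kernel B C p" if "x \<in> carrier B" for x
      using that module_hom_mem[OF sp that] s(2) by (simp add: a_kernel_iff p.N.M.r_neg p.N.M.minus_eq)
  qed
  have m: "(\<lambda>x. h (x \<ominus>\<^bsub>B\<^esub> s (p x)) \<oplus>\<^bsub>Q\<^esub> k (p x)) \<in> module_hom R B Q"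
    by (rule module_hom_add[OF B QL module_hom_comp[OF r h(1)] module_hom_comp[OF p(1) k(1)]])
  show ?thesis
  proof (rule proj_retract[OF Q(1) B m Q(2)])
    fix x assume x: "x \<in> carrier B"
    have "g (h (x \<ominus>\<^bsub>B\<^esub> s (p x)) \<oplus>\<^bsub>Q\<^esub> k (p x)) = (x \<ominus>\<^bsub>B\<^esub> s (p x)) \<oplus>\<^bsub>B\<^esub> s (p x)"
      using x h(2)[OF module_hom_mem[OF r x]] k(2) module_hom_mem[OF h(1) module_hom_mem[OF r x]]
        module_hom_mem[OF k(1)] by simp
    also have "\<dots> = x" using x module_hom_mem[OF sp x] by (simp add: p.M.M.minus_eq p.M.M.a_assoc p.M.M.l_neg)
    finally show "g (h (x \<ominus>\<^bsub>B\<^esub> s (p x)) \<oplus>\<^bsub>Q\<^esub> k (p x)) = x" .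
  qed
qed

text \<open>Covering the middle term of \<open>0 \<rightarrow> A \<rightarrow> B \<rightarrow> C \<rightarrow> 0\<close> yields
  \<open>0 \<rightarrow> \<Omega>B \<rightarrow> \<Omega>C \<rightarrow> A \<rightarrow> 0\<close>. Iterating this rotation gives the usual comparison of
  projective dimensions without forming direct sums.\<close>

lemma rotate_exact_sequence:
  fixes B C :: "('r, 'm) module"
  assumes large: "large (carrier R) TYPE('m)" and B: "left_module R B" and C: "left_module R C"
    and p: "p \<in> module_hom R B C" "p ` carrier B = carrier C"
  obtains Q L :: "('r, 'm) module" and g where
    "proj R Q" "g \<in> module_hom R Q B" "g ` carrier Q = carrier B"
    "\<And>n. pdle (Suc n) R C \<Longrightarrow> pdle n R L" "\<And>n. pdle n R L \<Longrightarrow> pdle (Suc n) R C" "left_module R L"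
    "g \<in> module_hom R L (B\<lparr>carrier := a_kernel B C p\<rparr>)" "g ` carrier L = a_kernel B C p"
    "L\<lparr>carrier := a_kernel L (B\<lparr>carrier := a_kernel B C p\<rparr>) g\<rparr> = Q\<lparr>carrier := a_kernel Q B g\<rparr>"
proof -
  obtain Q :: "('r, 'm) module" and g S c c' where "S \<subseteq> carrier B" "finitely_generated R B \<Longrightarrow> finite S"
    and Q: "proj R Q" "g \<in> module_hom R Q B" "g ` carrier Q = carrier B"
    and "finitely_generated R B \<Longrightarrow> finitely_generated R Q"
    "c \<in> module_hom R (free_module R S) Q" "c' \<in> module_hom R Q (free_module R S)"
    "\<And>f. f \<in> carrier (free_module R S) \<Longrightarrow> c' (c f) = f" "\<And>x. x \<in> carrier Q \<Longrightarrow> c (c' x) = x"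
    by (rule free_cover_exists[OF B large]) (rule that)
  note QL = proj_left_module[OF Q(1)]
  interpret p: module_morphism R B C p by (rule module_morphismI[OF B C p(1)])
  interpret g: module_morphism R Q B g by (rule module_morphismI[OF QL B Q(2)])
  let ?K = "a_kernel B C p" and ?L = "Q\<lparr>carrier := a_kernel Q C (\<lambda>x. p (g x))\<rparr>"
  have pg: "(\<lambda>x. p (g x)) \<in> module_hom R Q C" by (rule module_hom_comp[OF Q(2) p(1)])
  have pgs: "(\<lambda>x. p (g x)) ` carrier Q = carrier C" using Q(3) p(2) by (simp add: image_image[symmetric])
  have gL: "g \<in> module_hom R ?L (B\<lparr>carrier := ?K\<rparr>)"
    by (rule module_hom_into_submodule[OF module_hom_restrict[OF Q(2)]]) (auto simp: a_kernel_iff)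
  have "?K \<subseteq> g ` carrier ?L"
  proof
    fix x assume x: "x \<in> ?K"
    then have "x \<in> g ` carrier Q" using Q(3) by (simp add: a_kernel_iff)
    then obtain y where y: "y \<in> carrier Q" "x = g y" by (elim imageE) (rule that)
    then have "y \<in> carrier ?L" using x by (simp add: a_kernel_iff)
    then show "x \<in> g ` carrier ?L" using y(2) by simp
  qed
  moreover have "g ` carrier ?L \<subseteq> ?K" by (auto simp: a_kernel_iff)
  ultimately have gLs: "g ` carrier ?L = ?K" by (rule subset_antisym[rotated])
  have "a_kernel ?L (B\<lparr>carrier := ?K\<rparr>) g = a_kernel Q B g" by (auto simp: a_kernel_iff)
  then have eq: "?L\<lparr>carrier := a_kernel ?L (B\<lparr>carrier := ?K\<rparr>) g\<rparr> = Q\<lparr>carrier := a_kernel Q B g\<rparr>" by simp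
  show ?thesis
    by (rule that[OF Q _ _ left_module_kernel(1)[OF QL C pg] gL gLs eq])
      (rule schanuel[OF large _ Q(1) pg pgs], assumption, rule pdle_SucI[OF C Q(1) pg pgs], assumption)
qed

text \<open>In the rotated sequence \<Omega>C is an extension of the kernel of \<open>p\<close> by
  \<Omega>B, both of dimension at most n. Closure under extensions is a hypothesis so that the step
  can be used inside the induction that proves this closure.\<close>

lemma pdle_quotient_step:
  fixes B C :: "('r, 'm) module"
  assumes large: "large (carrier R) TYPE('m)"
    and extension: "\<And>(B :: ('r, 'm) module) (C :: ('r, 'm) module) p. left_module R B \<Longrightarrow> left_module R C \<Longrightarrow>
      p \<in> module_hom R B C \<Longrightarrow> p ` carrier B = carrier C \<Longrightarrow>
      pdle n R (B\<lparr>carrier := a_kernel B C p\<rparr>) \<Longrightarrow> pdle n R C \<Longrightarrow> pdle n R B"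
    and BC: "left_module R B" "left_module R C" and p: "p \<in> module_hom R B C" "p ` carrier B = carrier C"
    and A: "pdle n R (B\<lparr>carrier := a_kernel B C p\<rparr>)" and B: "pdle (Suc n) R B"
  shows "pdle (Suc n) R C"
proof -
  obtain Q L :: "('r, 'm) module" and g where Q: "proj R Q" "g \<in> module_hom R Q B" "g ` carrier Q = carrier B"
    and up: "\<And>n. pdle (Suc n) R C \<Longrightarrow> pdle n R L" and down: "\<And>n. pdle n R L \<Longrightarrow> pdle (Suc n) R C"
    and L: "left_module R L"
    "g \<in> module_hom R L (B\<lparr>carrier := a_kernel B C p\<rparr>)" "g ` carrier L = a_kernel B C p"
    "L\<lparr>carrier := a_kernel L (B\<lparr>carrier := a_kernel B C p\<rparr>) g\<rparr> = Q\<lparr>carrier := a_kernel Q B g\<rparr>"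
    by (rule rotate_exact_sequence[OF large BC p]) (rule that)
  have "pdle n R L"
    by (rule extension[OF L(1) pdle_left_module[OF A] L(2) _ _ A])
      (simp_all add: L(3,4) schanuel[OF large B Q])
  then show ?thesis by (rule down)
qed

text \<open>The two claims feed each other: the first for n + 1 is the second for n on the rotated
  sequence, and the second for n + 1 follows from \<open>pdle_quotient_step\<close>, which uses the
  first for n.\<close>

lemma pdle_exact_sequence:
  fixes B C :: "('r, 'm) module"
  assumes large: "large (carrier R) TYPE('m)"
    and "left_module R B" "left_module R C" "p \<in> module_hom R B C" "p ` carrier B = carrier C"
  shows "(pdle n R (B\<lparr>carrier := a_kernel B C p\<rparr>) \<longrightarrow> pdle n R C \<longrightarrow> pdle n R B) \<and>
    (pdle n R B \<longrightarrow> pdle (Suc n) R C \<longrightarrow> pdle n R (B\<lparr>carrier := a_kernel B C p\<rparr>))"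
  using assms(2-5)
proof (induction n arbitrary: B C p)
  case 0
  show ?case
    using extension_proj[OF large "0.prems"(1) _ "0.prems"(3,4)] schanuel[OF large _ _ "0.prems"(3,4), of 0] by (simp del: pdle.simps(2))
next
  case (Suc n)
  let ?A = "B\<lparr>carrier := a_kernel B C p\<rparr>"
  obtain Q L :: "('r, 'm) module" and g where Q: "proj R Q" "g \<in> module_hom R Q B" "g ` carrier Q = carrier B"
    and up: "\<And>n. pdle (Suc n) R C \<Longrightarrow> pdle n R L" and down: "\<And>n. pdle n R L \<Longrightarrow> pdle (Suc n) R C"
    and L: "left_module R L" "g \<in> module_hom R L ?A" "g ` carrier L = a_kernel B C p"
    "L\<lparr>carrier := a_kernel L ?A g\<rparr> = Q\<lparr>carrier := a_kernel Q B g\<rparr>"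
    by (rule rotate_exact_sequence[OF large Suc.prems]) (rule that)
  have AL: "left_module R ?A" by (rule left_module_kernel(1)[OF Suc.prems(1-3)])
  have gs: "g ` carrier L = carrier ?A" using L(3) by simp
  note IH = Suc.IH[OF L(1) AL L(2) gs, unfolded L(4)]
  have ext: "pdle n R B" if "left_module R B" "left_module R C" "p \<in> module_hom R B C" "p ` carrier B = carrier C"
      "pdle n R (B\<lparr>carrier := a_kernel B C p\<rparr>)" "pdle n R C" for B C :: "('r, 'm) module" and p
    using Suc.IH[OF that(1-4)] that(5,6) by (elim conjE) (simp only: simp_thms)
  show ?case
  proof (intro conjI impI)
    assume "pdle (Suc n) R ?A" "pdle (Suc n) R C"
    then have "pdle n R (Q\<lparr>carrier := a_kernel Q B g\<rparr>)"
      using IH up[of n] by (elim conjE) (simp only: simp_thms)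
    then show "pdle (Suc n) R B" by (rule pdle_SucI[OF Suc.prems(1) Q])
  next
    assume B: "pdle (Suc n) R B" and C: "pdle (Suc (Suc n)) R C"
    show "pdle (Suc n) R ?A"
    proof (rule pdle_quotient_step[OF large _ L(1) AL L(2) gs _ up[OF C]])
      show "pdle n R B'" if "left_module R B'" "left_module R C'" "p' \<in> module_hom R B' C'"
        "p' ` carrier B' = carrier C'" "pdle n R (B'\<lparr>carrier := a_kernel B' C' p'\<rparr>)" "pdle n R C'"
        for B' C' :: "('r, 'm) module" and p' by (rule ext[OF that])
      show "pdle n R (L\<lparr>carrier := a_kernel L ?A g\<rparr>)" unfolding L(4) by (rule schanuel[OF large B Q])
    qed
  qed
qed

lemma pdle_quotient:
  fixes B C :: "('r, 'm) module"
  assumes large: "large (carrier R) TYPE('m)" and C: "left_module R C"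
    and p: "p \<in> module_hom R B C" "p ` carrier B = carrier C"
    and A: "pdle n R (B\<lparr>carrier := a_kernel B C p\<rparr>)" and B: "pdle (Suc n) R B"
  shows "pdle (Suc n) R C"
proof (rule pdle_quotient_step[OF large _ pdle_left_module[OF B] C p A B])
  show "pdle n R B'" if "left_module R B'" "left_module R C'" "p' \<in> module_hom R B' C'" "p' ` carrier B' = carrier C'"
      "pdle n R (B'\<lparr>carrier := a_kernel B' C' p'\<rparr>)" "pdle n R C'" for B' C' :: "('r, 'm) module" and p'
    using pdle_exact_sequence[OF large that(1-4), of n] that(5,6) by (elim conjE) (simp only: simp_thms)
qed

lemma power_module_map:
  fixes M :: "('r, 'm) module" and N :: "('r, 'n) module" and S :: "'s set"
  assumes M: "left_module R M" and N: "left_module R N" and g: "g \<in> module_hom R M N"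
  shows "(\<lambda>f s. g (f s)) \<in> module_hom R (power_module S M) (power_module S N)"
    and "(power_module S M)\<lparr>carrier := a_kernel (power_module S M) (power_module S N) (\<lambda>f s. g (f s))\<rparr> =
      power_module S (M\<lparr>carrier := a_kernel M N g\<rparr>)"
    and "g ` carrier M = carrier N \<Longrightarrow> (\<lambda>f s. g (f s)) ` carrier (power_module S M) = carrier (power_module S N)"
proof -
  interpret g: module_morphism R M N g by (rule module_morphismI[OF M N g])
  note mem = power_module_mem[OF M, of _ S] and memN = power_module_mem[OF N]
  have fin: "finite {s. g (f s) \<noteq> \<zero>\<^bsub>N\<^esub>}" if "finite {s. f s \<noteq> \<zero>\<^bsub>M\<^esub>}" for f :: "'s \<Rightarrow> 'm"
    by (rule finite_subset[OF _ that]) auto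
  show hom: "(\<lambda>f s. g (f s)) \<in> module_hom R (power_module S M) (power_module S N)"
    by (rule module_homI) (use mem fin in \<open>auto simp: power_module_carrier\<close>)
  have "a_kernel (power_module S M) (power_module S N) (\<lambda>f s. g (f s)) =
      carrier (power_module S (M\<lparr>carrier := a_kernel M N g\<rparr>))"
    by (auto simp: a_kernel_iff power_module_carrier fun_eq_iff) (metis g.zero)
  then show "(power_module S M)\<lparr>carrier := a_kernel (power_module S M) (power_module S N) (\<lambda>f s. g (f s))\<rparr> =
      power_module S (M\<lparr>carrier := a_kernel M N g\<rparr>)"
    by (simp add: power_module_def)
  show "(\<lambda>f s. g (f s)) ` carrier (power_module S M) = carrier (power_module S N)" if surj: "g ` carrier M = carrier N"
  proof
    show "(\<lambda>f s. g (f s)) ` carrier (power_module S M) \<subseteq> carrier (power_module S N)"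
      using module_hom_mem[OF hom] by blast
    show "carrier (power_module S N) \<subseteq> (\<lambda>f s. g (f s)) ` carrier (power_module S M)"
    proof
      fix f assume f: "f \<in> carrier (power_module S N)"
      \<comment> \<open>Zero is lifted to zero, which keeps the support finite.\<close>
      define h where "h s = (if f s = \<zero>\<^bsub>N\<^esub> then \<zero>\<^bsub>M\<^esub> else inv_into (carrier M) g (f s))" for s
      have fs: "f s \<in> g ` carrier M" for s using memN[OF f] surj by simp
      have "{s. h s \<noteq> \<zero>\<^bsub>M\<^esub>} \<subseteq> {s. f s \<noteq> \<zero>\<^bsub>N\<^esub>}" by (auto simp: h_def)
      then have "h \<in> carrier (power_module S M)"
        using f by (auto simp: power_module_carrier h_def inv_into_into[OF fs] elim: finite_subset)
      moreover have "f = (\<lambda>s. g (h s))" by (simp add: h_def fun_eq_iff f_inv_into_f[OF fs])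
      ultimately show "f \<in> (\<lambda>f s. g (f s)) ` carrier (power_module S M)" by (rule rev_image_eqI[where f = "\<lambda>f s. g (f s)"])
    qed
  qed
qed

text \<open>The splitting of the canonical cover of \<open>P\<close>, applied in each coordinate,
  makes the direct sum a retract of the free module on the pairs of an index and an element of
  \<open>P\<close>.\<close>

lemma proj_power:
  fixes S :: "'s set" and P :: "('r, 'm) module"
  assumes R: "ring R" and P: "proj R P"
  shows "proj R (power_module S P)"
proof -
  note PL = proj_left_module[OF P]
  interpret P: left_module R P by (rule PL)
  let ?c = "carrier P"
  obtain \<sigma> where s: "\<sigma> \<in> module_hom R P (free_module R ?c)" "\<And>x. x \<in> ?c \<Longrightarrow> lin R P (\<lambda>x. x) (\<sigma> x) = x"
    using P unfolding proj_def by (elim conjE bexE) (rule that, assumption, blast)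
  interpret s: module_morphism R P "free_module R ?c" \<sigma>
    by (rule module_morphismI[OF PL left_module_free[OF R] s(1)])
  note l = canonical_cover(1)[OF PL order_refl]
  interpret l: module_morphism R "free_module R ?c" P "lin R P (\<lambda>x. x)"
    by (rule module_morphismI[OF left_module_free[OF R] PL l])
  let ?F = "free_module R (S \<times> ?c)" and ?X = "power_module S P"
  note reg = left_module_regular[OF R] and X = left_module_power[OF PL, of S]
  have \<sigma>c: "\<sigma> (f s) \<in> carrier (free_module R ?c)" if "f \<in> carrier ?X" for f s
    by (rule s.closed[OF power_module_mem[OF PL that]])
  have \<sigma>z: "\<sigma> \<zero>\<^bsub>P\<^esub> = (\<lambda>s. \<zero>\<^bsub>R\<^esub>)" using s.zero by simp
  have a: "(\<lambda>f (s, x). \<sigma> (f s) x) \<in> module_hom R ?X ?F"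
  proof (rule module_homI)
    fix f assume f: "f \<in> carrier ?X"
    have "{sx. (case sx of (s, x) \<Rightarrow> \<sigma> (f s) x) \<noteq> \<zero>\<^bsub>R\<^esub>} \<subseteq>
        (SIGMA s : {s. f s \<noteq> \<zero>\<^bsub>P\<^esub>}. {x. \<sigma> (f s) x \<noteq> \<zero>\<^bsub>R\<^esub>})" using \<sigma>z by auto
    moreover have "finite \<dots>"
      using f \<sigma>c[OF f] by (intro finite_SigmaI) (simp_all add: power_module_carrier)
    ultimately have "finite {sx. (case sx of (s, x) \<Rightarrow> \<sigma> (f s) x) \<noteq> \<zero>\<^bsub>R\<^esub>}" by (rule finite_subset)
    moreover have "\<sigma> (f s) x \<in> carrier R" for s x using power_module_mem[OF reg \<sigma>c[OF f]] by simp
    moreover have "\<sigma> (f s) x = \<zero>\<^bsub>R\<^esub>" if "(s, x) \<notin> S \<times> ?c" for s x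
      using that f \<sigma>c[OF f, of s] \<sigma>z by (cases "s \<in> S") (simp_all add: power_module_carrier)
    ultimately show "(\<lambda>(s, x). \<sigma> (f s) x) \<in> carrier ?F" by (simp add: power_module_carrier)
  qed (use power_module_mem[OF PL, of _ S] in \<open>auto simp: fun_eq_iff\<close>)
  have slice: "(\<lambda>x. F (s, x)) \<in> carrier (free_module R ?c)" if F: "F \<in> carrier ?F" for F s
  proof -
    have "(\<lambda>x. (s, x)) ` {x. F (s, x) \<noteq> \<zero>\<^bsub>R\<^esub>} \<subseteq> {sx. F sx \<noteq> \<zero>\<^bsub>R\<^esub>}" by auto
    then have "finite ((\<lambda>x. (s, x)) ` {x. F (s, x) \<noteq> \<zero>\<^bsub>R\<^esub>})"
      by (rule finite_subset) (use F in \<open>simp add: power_module_carrier\<close>)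
    then have "finite {x. F (s, x) \<noteq> \<zero>\<^bsub>R\<^esub>}" by (rule finite_imageD) (simp add: inj_on_def)
    moreover have "F (s, x) \<in> carrier R" for x using power_module_mem[OF reg F] by simp
    moreover have "F (s, x) = \<zero>\<^bsub>R\<^esub>" if "x \<notin> ?c" for x using F that by (simp add: power_module_carrier)
    ultimately show ?thesis by (simp add: power_module_carrier)
  qed
  have lz: "lin R P (\<lambda>x. x) (\<lambda>x. \<zero>\<^bsub>R\<^esub>) = \<zero>\<^bsub>P\<^esub>" using l.zero by simp
  have b: "(\<lambda>F s. lin R P (\<lambda>x. x) (\<lambda>x. F (s, x))) \<in> module_hom R ?F ?X"
  proof (rule module_homI)
    fix F assume F: "F \<in> carrier ?F"
    have "{s. lin R P (\<lambda>x. x) (\<lambda>x. F (s, x)) \<noteq> \<zero>\<^bsub>P\<^esub>} \<subseteq> fst ` {sx. F sx \<noteq> \<zero>\<^bsub>R\<^esub>}"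
    proof
      fix s assume "s \<in> {s. lin R P (\<lambda>x. x) (\<lambda>x. F (s, x)) \<noteq> \<zero>\<^bsub>P\<^esub>}"
      then have "(\<lambda>x. F (s, x)) \<noteq> (\<lambda>x. \<zero>\<^bsub>R\<^esub>)" using lz by auto
      then show "s \<in> fst ` {sx. F sx \<noteq> \<zero>\<^bsub>R\<^esub>}" by (force simp: fun_eq_iff)
    qed
    then have "finite {s. lin R P (\<lambda>x. x) (\<lambda>x. F (s, x)) \<noteq> \<zero>\<^bsub>P\<^esub>}"
      by (rule finite_subset) (use F in \<open>simp add: power_module_carrier\<close>)
    moreover have "lin R P (\<lambda>x. x) (\<lambda>x. F (s, x)) = \<zero>\<^bsub>P\<^esub>" if "s \<notin> S" for s
    proof -
      have "F (s, x) = \<zero>\<^bsub>R\<^esub>" for x using F that by (simp add: power_module_carrier)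
      then show ?thesis using lz by simp
    qed
    ultimately show "(\<lambda>s. lin R P (\<lambda>x. x) (\<lambda>x. F (s, x))) \<in> carrier ?X"
      using l.closed[OF slice[OF F]] by (simp add: power_module_carrier)
  next
    fix F G assume "F \<in> carrier ?F" "G \<in> carrier ?F"
    then show "(\<lambda>s. lin R P (\<lambda>x. x) (\<lambda>x. (F \<oplus>\<^bsub>?F\<^esub> G) (s, x))) =
        (\<lambda>s. lin R P (\<lambda>x. x) (\<lambda>x. F (s, x))) \<oplus>\<^bsub>?X\<^esub> (\<lambda>s. lin R P (\<lambda>x. x) (\<lambda>x. G (s, x)))"
      using l.add[OF slice slice] by (simp add: fun_eq_iff)
  next
    fix a F assume "a \<in> carrier R" "F \<in> carrier ?F"
    then show "(\<lambda>s. lin R P (\<lambda>x. x) (\<lambda>x. (a \<odot>\<^bsub>?F\<^esub> F) (s, x))) =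
        a \<odot>\<^bsub>?X\<^esub> (\<lambda>s. lin R P (\<lambda>x. x) (\<lambda>x. F (s, x)))"
      using l.smult[OF _ slice] by (simp add: fun_eq_iff)
  qed
  show ?thesis
  proof (rule proj_retract[OF proj_free[OF R] X a b])
    fix f assume "f \<in> carrier ?X"
    then show "(\<lambda>s. lin R P (\<lambda>x. x) (\<lambda>x. case (s, x) of (s, x) \<Rightarrow> \<sigma> (f s) x)) = f"
      using s(2)[OF power_module_mem[OF PL, of _ S]] by simp
  qed
qed

lemma pdle_power:
  fixes M :: "('r, 'm) module"
  assumes R: "ring R" shows "pdle n R M \<Longrightarrow> pdle n R (power_module S M)"
proof (induction n arbitrary: M)
  case 0
  then show ?case using proj_power[OF R] by simp
next
  case (Suc n)
  obtain P :: "('r, 'm) module" and g where P: "proj R P" "g \<in> module_hom R P M" "g ` carrier P = carrier M"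
    "pdle n R (P\<lparr>carrier := a_kernel P M g\<rparr>)"
    using Suc.prems by (simp only: pdle.simps(2)) (elim conjE exE, rule that)
  note L = proj_left_module[OF P(1)] pdle_left_module[OF Suc.prems]
  note maps = power_module_map[OF L P(2), of S]
  show ?case
    by (rule pdle_SucI[OF left_module_power[OF L(2)] proj_power[OF R P(1)] maps(1) maps(3)[OF P(3)]])
      (unfold maps(2), rule Suc.IH[OF P(4)])
qed

section \<open>Dimensions of inflated modules\<close>

context cleft_extension
begin

text \<open>This is the sequence 0 -> J^(S) -> \<Lambda>^(S) -> \<Gamma>^(S) -> 0 with free middle
  term.\<close>

lemma pdle_inflated_free:
  assumes "pdle e \<Lambda> (ideal_module \<Lambda> J)"
  shows "pdle (Suc e) \<Lambda> (restrict_scalars \<pi> (free_module \<Gamma> S))"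
proof -
  let ?G = "regular_module \<Gamma>" and ?L = "regular_module \<Lambda>"
  note G = left_module_restrict_scalars[OF ring_\<Lambda> \<pi>_hom left_module_regular[OF ring_\<Gamma>]]
  have \<pi>: "\<pi> \<in> module_hom \<Lambda> ?L (restrict_scalars \<pi> ?G)"
    by (rule module_homI) (simp_all add: \<pi>_closed ring_hom_add[OF \<pi>_hom] ring_hom_mult[OF \<pi>_hom])
  have "carrier \<Gamma> \<subseteq> \<pi> ` carrier \<Lambda>"
  proof
    fix x assume "x \<in> carrier \<Gamma>"
    then show "x \<in> \<pi> ` carrier \<Lambda>" using \<pi>_i[of x] i_closed[of x] by (intro rev_image_eqI[of "i x"]) simp_all
  qed
  then have surj: "\<pi> ` carrier ?L = carrier (restrict_scalars \<pi> ?G)" using \<pi>_closed by auto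
  note maps = power_module_map[OF left_module_regular[OF ring_\<Lambda>] G \<pi>, of S]
  have ker: "?L\<lparr>carrier := a_kernel ?L (restrict_scalars \<pi> ?G) \<pi>\<rparr> = ideal_module \<Lambda> J"
    by (auto simp: regular_module_def ideal_module_def a_kernel_def' J_def)
  have eq: "power_module S (restrict_scalars \<pi> ?G) = restrict_scalars \<pi> (free_module \<Gamma> S)"
    by (simp add: power_module_def restrict_scalars_def)
  show ?thesis unfolding eq[symmetric]
    by (rule pdle_SucI[OF left_module_power[OF G] proj_free[OF ring_\<Lambda>] maps(1) maps(3)[OF surj]])
      (unfold maps(2) ker, rule pdle_power[OF ring_\<Lambda> assms])
qed

text \<open>A projective \<Gamma>-module is a retract of a free one, whose inflation has dimension
  at most e + 1. In the step the inflated cover and the inflated kernel bound the quotient by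
  \<open>pdle_quotient\<close>.\<close>

lemma pdle_inflate:
  fixes M :: "('r, 'm) module"
  assumes large: "large (carrier \<Lambda>) TYPE('m)" and J: "pdle e \<Lambda> (ideal_module \<Lambda> J)"
  shows "pdle n \<Gamma> M \<Longrightarrow> pdle (n + Suc e) \<Lambda> (restrict_scalars \<pi> M)"
proof (induction n arbitrary: M)
  case 0
  let ?F = "free_module \<Gamma> (carrier M)"
  have M: "proj \<Gamma> M" using "0.prems" by simp
  note M_left = proj_left_module[OF M]
  obtain \<sigma> where s: "\<sigma> \<in> module_hom \<Gamma> M ?F" "\<And>x. x \<in> carrier M \<Longrightarrow> lin \<Gamma> M (\<lambda>x. x) (\<sigma> x) = x"
    using M unfolding proj_def by (elim conjE bexE) (rule that, assumption, blast)
  show ?case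
    using pdle_module_retract[OF large left_module_restrict_scalars[OF ring_\<Lambda> \<pi>_hom M_left]
        module_hom_restrict_scalars[OF s(1) \<pi>_hom]
        module_hom_restrict_scalars[OF canonical_cover(1)[OF M_left order_refl] \<pi>_hom] _ pdle_inflated_free[OF J]] s(2)
    by (simp del: pdle.simps)
next
  case (Suc n)
  obtain P :: "('r, 'm) module" and g where P: "proj \<Gamma> P" "g \<in> module_hom \<Gamma> P M" "g ` carrier P = carrier M"
    "pdle n \<Gamma> (P\<lparr>carrier := a_kernel P M g\<rparr>)"
    using Suc.prems by (simp only: pdle.simps(2)) (elim conjE exE, rule that)
  have "pdle n \<Gamma> P" by (rule pdle_mono[of 0]) (simp_all add: P(1))
  then have "pdle (Suc (n + Suc e)) \<Lambda> (restrict_scalars \<pi> P)" by (rule pdle_Suc[OF Suc.IH])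
  moreover have "pdle (n + Suc e) \<Lambda>
      ((restrict_scalars \<pi> P)\<lparr>carrier := a_kernel (restrict_scalars \<pi> P) (restrict_scalars \<pi> M) g\<rparr>)"
    using Suc.IH[OF P(4)] by (simp del: pdle.simps)
  ultimately have "pdle (Suc (n + Suc e)) \<Lambda> (restrict_scalars \<pi> M)"
    using P(3) by (intro pdle_quotient[OF large left_module_restrict_scalars[OF ring_\<Lambda> \<pi>_hom pdle_left_module[OF Suc.prems]]
        module_hom_restrict_scalars[OF P(2) \<pi>_hom]]) (simp_all del: pdle.simps)
  then show ?case by (simp only: add_Suc)
qed

lemma finitely_generated_inflate:
  assumes M: "left_module \<Gamma> M" and fg: "finitely_generated \<Gamma> M"
  shows "finitely_generated \<Lambda> (restrict_scalars \<pi> M)"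
proof -
  interpret M: left_module \<Gamma> M by (rule M)
  interpret N: left_module \<Lambda> "restrict_scalars \<pi> M" by (rule left_module_restrict_scalars[OF ring_\<Lambda> \<pi>_hom M])
  obtain S where S: "finite S" "S \<subseteq> carrier M" "\<And>H. submodule H \<Gamma> M \<Longrightarrow> S \<subseteq> H \<Longrightarrow> H = carrier M"
    using fg by (elim finitely_generatedE) (rule that)
  show ?thesis
  proof (rule finitely_generatedI[of S])
    fix H assume H: "submodule H \<Lambda> (restrict_scalars \<pi> M)" "S \<subseteq> H"
    note H' = N.submoduleD[OF H(1)]
    have "submodule H \<Gamma> M"
    proof (rule M.submoduleI')
      show "a \<odot>\<^bsub>M\<^esub> x \<in> H" if "a \<in> carrier \<Gamma>" "x \<in> H" for a x
        using H'(7)[OF i_closed[OF that(1)] that(2)] that(1) by (simp add: \<pi>_i)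
    qed (use H'(1,2,4) in simp_all)
    then show "H = carrier (restrict_scalars \<pi> M)" using S(3) H(2) by simp
  qed (use S(1,2) in simp_all)
qed

text \<open>Finite dimension of \<open>J\<close> on the left gives inflations of \<Gamma>-modules of
  finite dimension a finite dimension over \<Lambda>. The bound for \<Lambda> then applies to them
  and returns to \<Gamma> unchanged by \<open>pdle_inflation\<close>.\<close>

theorem dimension_transfer_down_two_sided:
  assumes large: "large (carrier \<Lambda>) TYPE('m)" "large (carrier \<Gamma>) TYPE('m)"
    and pd: "pdle e \<Lambda> (ideal_module \<Lambda> J)"
  shows "fin_dim TYPE('m) \<Lambda> < \<infinity> \<Longrightarrow> fin_dim TYPE('m) \<Gamma> < \<infinity>"
    and "Fin_dim TYPE('m) \<Lambda> < \<infinity> \<Longrightarrow> Fin_dim TYPE('m) \<Gamma> < \<infinity>"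
proof -
  have key: "\<exists>N' :: ('r, 'm) module. left_module \<Lambda> N' \<and>
      (finitely_generated \<Gamma> M \<longrightarrow> finitely_generated \<Lambda> N') \<and> (\<forall>p. pdle p \<Gamma> M \<longrightarrow> pdle (p + Suc e) \<Lambda> N') \<and>
      (\<forall>n. pdle n \<Lambda> N' \<longrightarrow> pdle n \<Gamma> M)"
    if M: "left_module \<Gamma> M" for M :: "('r, 'm) module"
    using left_module_restrict_scalars[OF ring_\<Lambda> \<pi>_hom M] finitely_generated_inflate[OF M]
      pdle_inflate[OF large(1) pd] pdle_inflation[OF large(2) M]
    by (intro exI[of _ "restrict_scalars \<pi> M"] conjI allI impI) (simp_all del: pdle.simps)
  show "fin_dim TYPE('m) \<Gamma> < \<infinity>" if fin: "fin_dim TYPE('m) \<Lambda> < \<infinity>"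
  proof -
    obtain n where "\<forall>(M :: ('r, 'm) module) m. left_module \<Lambda> M \<longrightarrow> finitely_generated \<Lambda> M \<longrightarrow>
        pdle m \<Lambda> M \<longrightarrow> pdle n \<Lambda> M"
      using fin unfolding fin_dim_finite_iff[OF large(1)] ..
    then have "\<forall>(M :: ('r, 'm) module) m. left_module \<Gamma> M \<longrightarrow> finitely_generated \<Gamma> M \<longrightarrow>
        pdle m \<Gamma> M \<longrightarrow> pdle n \<Gamma> M" using key by meson
    then show ?thesis unfolding fin_dim_finite_iff[OF large(2)] ..
  qed
  show "Fin_dim TYPE('m) \<Gamma> < \<infinity>" if fin: "Fin_dim TYPE('m) \<Lambda> < \<infinity>"
  proof -
    obtain n where "\<forall>(M :: ('r, 'm) module) m. left_module \<Lambda> M \<longrightarrow> pdle m \<Lambda> M \<longrightarrow> pdle n \<Lambda> M"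
      using fin unfolding Fin_dim_finite_iff[OF large(1)] ..
    then have "\<forall>(M :: ('r, 'm) module) m. left_module \<Gamma> M \<longrightarrow> pdle m \<Gamma> M \<longrightarrow> pdle n \<Gamma> M"
      using key by meson
    then show ?thesis unfolding Fin_dim_finite_iff[OF large(2)] ..
  qed
qed

end

section \<open>Removing arrows from a bound quiver\<close>

lemma lookup_part_avoiding:
  "Poly_Mapping.lookup (part_avoiding A z) p = (if path_arrows p \<inter> A = {} then Poly_Mapping.lookup z p else 0)"
  by (auto simp: part_avoiding_def lookup_sum lookup_single when_def in_keys_iff sum.delta)

lemma lookup_part_through:
  "Poly_Mapping.lookup (part_through A z) p = (if path_arrows p \<inter> A = {} then 0 else Poly_Mapping.lookup z p)"
  by (auto simp: part_through_def lookup_sum lookup_single when_def in_keys_iff sum.delta)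

lemma part_through_add_avoiding: "part_through A z + part_avoiding A z = z"
  by (rule poly_mapping_eqI) (simp add: lookup_add lookup_part_avoiding lookup_part_through)

lemma part_avoiding_simps [simp]:
  "part_avoiding A 0 = 0"
  "part_avoiding A (x + y) = part_avoiding A x + part_avoiding A y"
  by (rule poly_mapping_eqI, auto simp: lookup_add lookup_part_avoiding)+

lemma part_avoiding_single [simp]:
  "part_avoiding A (Poly_Mapping.single p c) = (if path_arrows p \<inter> A = {} then Poly_Mapping.single p c else 0)"
  by (cases "path_arrows p \<inter> A = {}"; rule poly_mapping_eqI)
    (auto simp: lookup_part_avoiding lookup_single when_def)

lemma part_avoiding_uminus: "part_avoiding A (- x) = - part_avoiding A x"
  by (rule poly_mapping_eqI) (simp add: lookup_part_avoiding)

lemma part_avoiding_basis_mult: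
  "part_avoiding A (basis_mult p q c) =
    (if path_arrows p \<inter> A = {} \<and> path_arrows q \<inter> A = {} then basis_mult p q c else 0)"
  by (auto simp: basis_mult_def path_arrows_def Int_Un_distrib2)

text \<open>A concatenation avoids \<open>A\<close> exactly when both factors do.\<close>

lemma part_avoiding_path_mult: "part_avoiding A (path_mult x y) = path_mult (part_avoiding A x) (part_avoiding A y)"
proof (induction x rule: path_single_induct)
  case (single p c)
  show ?case
  proof (induction y rule: path_single_induct)
    case (single q d)
    show ?case by (simp add: path_mult_single part_avoiding_basis_mult path_mult_zero)
  qed (simp_all add: path_mult_zero path_mult_add_right)
qed (simp_all add: path_mult_zero path_mult_add_left)

lemma part_avoiding_id: "(\<And>p. p \<in> Poly_Mapping.keys z \<Longrightarrow> path_arrows p \<inter> A = {}) \<Longrightarrow> part_avoiding A z = z"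
  by (rule poly_mapping_eqI) (auto simp: lookup_part_avoiding in_keys_iff)

lemma keys_part_avoiding:
  "p \<in> Poly_Mapping.keys (part_avoiding A z) \<longleftrightarrow> p \<in> Poly_Mapping.keys z \<and> path_arrows p \<inter> A = {}"
  by (simp add: in_keys_iff lookup_part_avoiding)

lemma keys_part_through:
  "p \<in> Poly_Mapping.keys (part_through A z) \<longleftrightarrow> p \<in> Poly_Mapping.keys z \<and> path_arrows p \<inter> A \<noteq> {}"
  by (simp add: in_keys_iff lookup_part_through)

lemma path_algebra_simps:
  "z \<in> carrier (path_algebra Q) \<longleftrightarrow> Poly_Mapping.keys z \<subseteq> paths Q"
  "\<zero>\<^bsub>path_algebra Q\<^esub> = 0" "x \<oplus>\<^bsub>path_algebra Q\<^esub> y = x + y" "x \<otimes>\<^bsub>path_algebra Q\<^esub> y = path_mult x y"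
  "\<one>\<^bsub>path_algebra Q\<^esub> = (\<Sum>v\<in>verts Q. Poly_Mapping.single (v, [], v) 1)"
  by (simp_all add: path_algebra_def)

lemma cas_quiver_minus: "pre_digraph.cas (quiver_minus Q A) u p v \<longleftrightarrow> pre_digraph.cas Q u p v"
  by (induction p arbitrary: u) (simp_all add: pre_digraph.cas.simps quiver_minus_def)

lemma paths_quiver_minus: "paths (quiver_minus Q A) = {p \<in> paths Q. path_arrows p \<inter> A = {}}"
  unfolding paths_def path_arrows_def pre_digraph.awalk_def cas_quiver_minus
  by (auto simp: quiver_minus_def)

lemma fin_digraph_quiver_minus: "fin_digraph Q \<Longrightarrow> fin_digraph (quiver_minus Q A)"
proof -
  assume "fin_digraph Q"
  then interpret fin_digraph Q .
  show ?thesis by unfold_locales (auto simp: quiver_minus_def)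
qed

lemma verts_quiver_minus: "verts (quiver_minus Q A) = verts Q"
  by (simp add: quiver_minus_def)

lemma quiver_minus_quiver_minus: "quiver_minus (quiver_minus Q U) B = quiver_minus Q (U \<union> B)"
  by (simp add: quiver_minus_def Diff_eq Int_assoc)

lemma ideal_avoiding_ideal_avoiding: "ideal_avoiding (ideal_avoiding I U) B = ideal_avoiding I (U \<union> B)"
  by (auto simp: ideal_avoiding_def)

lemma quiver_minus_empty: "quiver_minus Q {} = Q"
  by (simp add: quiver_minus_def)

lemma ideal_avoiding_empty: "ideal_avoiding I {} = I"
  by (auto simp: ideal_avoiding_def)

lemma paths_split:
  assumes "(u, xs @ ys, v) \<in> paths Q" "fin_digraph Q"
  obtains w where "(u, xs, w) \<in> paths Q" "(w, ys, v) \<in> paths Q"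
proof -
  interpret fin_digraph Q by fact
  show ?thesis using assms(1) that by (auto simp: paths_def)
qed

text \<open>Depends on \<open>I\<close> and on addition only, so that the path algebras of both
  quivers share it.\<close>

definition coset :: "'z::ab_group_add set \<Rightarrow> 'z \<Rightarrow> 'z set" where
  "coset I z = (\<lambda>x. x + z) ` I"

lemma a_r_coset_path_algebra: "I +>\<^bsub>path_algebra Q\<^esub> z = coset I z"
  by (auto simp: a_r_coset_def' path_algebra_def coset_def)

section \<open>Bound quiver algebras as finite-dimensional algebras\<close>

locale bound_quiver_presentation =
  fixes Q :: "('v, 'a) pre_digraph" and I :: "(('v, 'a) qpath \<Rightarrow>\<^sub>0 'k::field) set"
  assumes bound: "bound_quiver Q I"
begin

abbreviation "K \<equiv> path_algebra Q :: (('v, 'a) qpath \<Rightarrow>\<^sub>0 'k) ring"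
abbreviation "\<Lambda> \<equiv> bound_quiver_algebra Q I"

lemma fin_digraph: "fin_digraph Q"
  and admissible: "admissible_ideal Q I"
  using bound by (simp_all add: bound_quiver_def)

sublocale fin_digraph Q by (rule fin_digraph)

lemma ideal_I: "ideal I K"
  using admissible by (simp add: admissible_ideal_def)

lemma I_carrier: "x \<in> I \<Longrightarrow> Poly_Mapping.keys x \<subseteq> paths Q"
  using ideal.Icarr[OF ideal_I] by (simp add: path_algebra_simps)

lemma I_zero: "0 \<in> I"
  using additive_subgroup.zero_closed[OF ideal.axioms(1)[OF ideal_I]] by (simp add: path_algebra_simps)

lemma I_add: "x \<in> I \<Longrightarrow> y \<in> I \<Longrightarrow> x + y \<in> I"
  using additive_subgroup.a_closed[OF ideal.axioms(1)[OF ideal_I]] by (simp add: path_algebra_simps)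

lemma I_mult:
  "x \<in> I \<Longrightarrow> Poly_Mapping.keys z \<subseteq> paths Q \<Longrightarrow> path_mult z x \<in> I"
  "x \<in> I \<Longrightarrow> Poly_Mapping.keys z \<subseteq> paths Q \<Longrightarrow> path_mult x z \<in> I"
  using ideal.I_l_closed[OF ideal_I] ideal.I_r_closed[OF ideal_I] by (simp_all add: path_algebra_simps)

definition scalar :: "'k \<Rightarrow> ('v, 'a) qpath \<Rightarrow>\<^sub>0 'k" where
  "scalar c = (\<Sum>v\<in>verts Q. Poly_Mapping.single (v, [], v) c)"

lemma path_ends: "p \<in> paths Q \<Longrightarrow> fst p \<in> verts Q \<and> snd (snd p) \<in> verts Q"
  by (cases p) (auto simp: paths_def dest: awalk_hd_in_verts awalk_last_in_verts)

lemma scalar_mult_single: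
  assumes "p \<in> paths Q"
  shows "path_mult (scalar c) (Poly_Mapping.single p d) = Poly_Mapping.single p (c * d)"
    "path_mult (Poly_Mapping.single p d) (scalar c) = Poly_Mapping.single p (d * c)"
  using path_ends[OF assms]
  by (simp_all add: scalar_def path_mult_sum path_mult_single basis_mult_def sum.delta sum.delta')

lemma scalar_carrier: "Poly_Mapping.keys (scalar c) \<subseteq> paths Q"
proof -
  have "Poly_Mapping.keys (scalar c) \<subseteq> (\<Union>v\<in>verts Q. Poly_Mapping.keys (Poly_Mapping.single (v, [], v) c))"
    unfolding scalar_def by (rule Poly_Mapping.keys_sum)
  also have "\<dots> \<subseteq> paths Q" by (auto simp: paths_def awalk_Nil_iff split: if_splits)
  finally show ?thesis .
qed

lemma scalar_one: "scalar 1 = \<one>\<^bsub>K\<^esub>"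
  by (simp add: scalar_def path_algebra_simps)

lemma scalar_add: "scalar (c + d) = scalar c + scalar d"
  by (simp add: scalar_def single_add sum.distrib)

lemma scalar_mult: "path_mult (scalar c) (scalar d) = scalar (c * d)"
proof -
  have "path_mult (scalar c) (scalar d) = (\<Sum>v\<in>verts Q. path_mult (scalar c) (Poly_Mapping.single (v, [], v) d))"
    by (subst (2) scalar_def) (rule path_mult_sum(2))
  also have "\<dots> = scalar (c * d)"
    unfolding scalar_def[of "c * d"]
    by (intro sum.cong refl scalar_mult_single) (simp add: paths_def awalk_Nil_iff)
  finally show ?thesis .
qed

lemma scalar_central:
  assumes "Poly_Mapping.keys z \<subseteq> paths Q"
  shows "path_mult (scalar c) z = path_mult z (scalar c)"
proof (induction z rule: path_single_induct)
  case (single p d)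
  then show ?case using assms by (auto simp: scalar_mult_single mult.commute)
qed (simp_all add: path_mult_zero path_mult_add_left path_mult_add_right)

lemma I_uminus: "x \<in> I \<Longrightarrow> - x \<in> I"
proof -
  assume x: "x \<in> I"
  interpret ideal I K by (rule ideal_I)
  have "\<ominus>\<^bsub>K\<^esub> x = - x"
    by (rule minus_equality) (use I_carrier[OF x] in \<open>simp_all add: path_algebra_simps\<close>)
  then show "- x \<in> I" using additive_subgroup.a_inv_closed[OF ideal.axioms(1)[OF ideal_I] x] by simp
qed

lemma I_minus: "x \<in> I \<Longrightarrow> y \<in> I \<Longrightarrow> x - y \<in> I"
  using I_add[OF _ I_uminus] by force

lemma coset_eq_iff: "coset I z = coset I w \<longleftrightarrow> z - w \<in> I"
proof
  assume "coset I z = coset I w"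
  moreover have "z \<in> coset I z" using I_zero by (force simp: coset_def)
  ultimately obtain x where "x \<in> I" "z = x + w" by (auto simp: coset_def)
  then show "z - w \<in> I" by simp
next
  assume zw: "z - w \<in> I"
  have "x + z \<in> coset I w" if "x \<in> I" for x
    unfolding coset_def using I_add[OF that zw] by (intro rev_image_eqI[of "x + (z - w)"]) simp_all
  moreover have "x + w \<in> coset I z" if "x \<in> I" for x
    unfolding coset_def using I_minus[OF that zw] by (intro rev_image_eqI[of "x - (z - w)"]) simp_all
  ultimately show "coset I z = coset I w" by (auto simp: coset_def)
qed

lemma carrier_\<Lambda>: "carrier \<Lambda> = coset I ` carrier K"
  by (auto simp: bound_quiver_algebra_def FactRing_def A_RCOSETS_def' a_r_coset_path_algebra)

lemma coset_hom: "coset I \<in> ring_hom K \<Lambda>"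
  using ideal.rcos_ring_hom[OF ideal_I] by (simp add: bound_quiver_algebra_def a_r_coset_path_algebra[abs_def])

lemma \<Lambda>_zero: "\<zero>\<^bsub>\<Lambda>\<^esub> = coset I 0"
  by (simp add: bound_quiver_algebra_def FactRing_def coset_def)

lemma \<Lambda>_one: "\<one>\<^bsub>\<Lambda>\<^esub> = coset I (scalar 1)"
  by (simp add: bound_quiver_algebra_def FactRing_def a_r_coset_path_algebra scalar_one)

lemma coset_closed: "Poly_Mapping.keys z \<subseteq> paths Q \<Longrightarrow> coset I z \<in> carrier \<Lambda>"
  by (auto simp: carrier_\<Lambda> path_algebra_simps)

lemma coset_add:
  "Poly_Mapping.keys z \<subseteq> paths Q \<Longrightarrow> Poly_Mapping.keys w \<subseteq> paths Q \<Longrightarrow>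
    coset I z \<oplus>\<^bsub>\<Lambda>\<^esub> coset I w = coset I (z + w)"
  using ring_hom_add[OF coset_hom, of z w] by (simp add: path_algebra_simps)

lemma coset_mult:
  "Poly_Mapping.keys z \<subseteq> paths Q \<Longrightarrow> Poly_Mapping.keys w \<subseteq> paths Q \<Longrightarrow>
    coset I z \<otimes>\<^bsub>\<Lambda>\<^esub> coset I w = coset I (path_mult z w)"
  using ring_hom_mult[OF coset_hom, of z w] by (simp add: path_algebra_simps)

lemma ring_\<Lambda>: "ring \<Lambda>"
  unfolding bound_quiver_algebra_def by (rule ideal.quotient_is_ring[OF ideal_I])

lemma \<Lambda>_cases:
  assumes "X \<in> carrier \<Lambda>" obtains z where "Poly_Mapping.keys z \<subseteq> paths Q" "X = coset I z"
  using assms by (auto simp: carrier_\<Lambda> path_algebra_simps)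

lemma keys_add_paths:
  fixes x y :: "('v, 'a) qpath \<Rightarrow>\<^sub>0 'k"
  shows "Poly_Mapping.keys x \<subseteq> S \<Longrightarrow> Poly_Mapping.keys y \<subseteq> S \<Longrightarrow> Poly_Mapping.keys (x + y) \<subseteq> S"
  using Poly_Mapping.keys_add[of x y] by blast

lemma kspan_paths:
  assumes "set xs \<subseteq> paths Q"
  shows "kspan (\<lambda>c. coset I (scalar c)) (regular_module \<Lambda>) (map (\<lambda>p. coset I (Poly_Mapping.single p 1)) xs) =
    coset I ` {z. Poly_Mapping.keys z \<subseteq> set xs}"
  using assms
proof (induction xs)
  case Nil
  show ?case by (simp add: \<Lambda>_zero)
next
  case (Cons p xs)
  then have p: "p \<in> paths Q" and xs: "set xs \<subseteq> paths Q" by simp_all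
  have elem: "coset I (scalar c) \<otimes>\<^bsub>\<Lambda>\<^esub> coset I (Poly_Mapping.single p 1) \<oplus>\<^bsub>\<Lambda>\<^esub> coset I z =
      coset I (Poly_Mapping.single p c + z)" if "Poly_Mapping.keys z \<subseteq> set xs" for c z
  proof -
    have "Poly_Mapping.keys (Poly_Mapping.single p d) \<subseteq> paths Q" for d :: 'k using p by simp
    moreover have "Poly_Mapping.keys z \<subseteq> paths Q" using that xs by blast
    ultimately show ?thesis
      using scalar_carrier p by (simp add: coset_mult coset_add scalar_mult_single)
  qed
  have "\<exists>c y. coset I z = coset I (Poly_Mapping.single p c + y) \<and> Poly_Mapping.keys y \<subseteq> set xs"
    if "Poly_Mapping.keys z \<subseteq> insert p (set xs)" for z
  proof (intro exI conjI)
    let ?c = "Poly_Mapping.lookup z p" let ?y = "z - Poly_Mapping.single p ?c"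
    show "coset I z = coset I (Poly_Mapping.single p ?c + ?y)" by simp
    show "Poly_Mapping.keys ?y \<subseteq> set xs"
      using that by (auto simp: in_keys_iff lookup_minus lookup_single when_def split: if_splits)
  qed
  moreover have "Poly_Mapping.keys (Poly_Mapping.single p c + y) \<subseteq> insert p (set xs)"
    if "Poly_Mapping.keys y \<subseteq> set xs" for c :: 'k and y
    by (rule keys_add_paths) (use that in \<open>auto split: if_splits\<close>)
  moreover have "kspan (\<lambda>c. coset I (scalar c)) (regular_module \<Lambda>)
      (map (\<lambda>p. coset I (Poly_Mapping.single p 1)) (p # xs)) =
      {coset I (Poly_Mapping.single p c + z) |c z. Poly_Mapping.keys z \<subseteq> set xs}"
    unfolding list.map kspan.simps(2) Cons.IH[OF xs] regular_module_simps
  proof (intro equalityI subsetI)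
    fix X assume "X \<in> {coset I (scalar c) \<otimes>\<^bsub>\<Lambda>\<^esub> coset I (Poly_Mapping.single p 1) \<oplus>\<^bsub>\<Lambda>\<^esub> y |c y.
      y \<in> coset I ` {z. Poly_Mapping.keys z \<subseteq> set xs}}"
    then obtain c z where z: "Poly_Mapping.keys z \<subseteq> set xs"
      "X = coset I (scalar c) \<otimes>\<^bsub>\<Lambda>\<^esub> coset I (Poly_Mapping.single p 1) \<oplus>\<^bsub>\<Lambda>\<^esub> coset I z" by blast
    then show "X \<in> {coset I (Poly_Mapping.single p c + z) |c z. Poly_Mapping.keys z \<subseteq> set xs}"
      unfolding elem[OF z(1)] by blast
  next
    fix X assume "X \<in> {coset I (Poly_Mapping.single p c + z) |c z. Poly_Mapping.keys z \<subseteq> set xs}"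
    then obtain c z where z: "Poly_Mapping.keys z \<subseteq> set xs" "X = coset I (Poly_Mapping.single p c + z)" by blast
    then show "X \<in> {coset I (scalar c) \<otimes>\<^bsub>\<Lambda>\<^esub> coset I (Poly_Mapping.single p 1) \<oplus>\<^bsub>\<Lambda>\<^esub> y |c y.
        y \<in> coset I ` {z. Poly_Mapping.keys z \<subseteq> set xs}}"
      using elem[OF z(1), of c] by (intro CollectI exI[of _ c] exI[of _ "coset I z"]) simp
  qed
  ultimately show ?case by (auto; blast)
qed

text \<open>Admissibility provides the paths of length exactly N; a longer path has one of them as
  an initial segment.\<close>

lemma long_in_I:
  obtains N where
    "\<And>z. Poly_Mapping.keys z \<subseteq> paths Q \<Longrightarrow> \<forall>p\<in>Poly_Mapping.keys z. N \<le> path_length p \<Longrightarrow> z \<in> I"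
proof -
  obtain N where N: "N > 1" "\<And>p. p \<in> paths Q \<Longrightarrow> path_length p = N \<Longrightarrow> Poly_Mapping.single p 1 \<in> I"
    using admissible by (auto simp: admissible_ideal_def)
  have single: "Poly_Mapping.single p c \<in> I" if p: "p \<in> paths Q" "N \<le> path_length p" for p c
  proof -
    obtain u ps v where uv: "p = (u, ps, v)" by (cases p)
    have "(u, take N ps @ drop N ps, v) \<in> paths Q" using p(1) uv by simp
    then obtain w where w: "(u, take N ps, w) \<in> paths Q" "(w, drop N ps, v) \<in> paths Q"
      by (rule paths_split[OF _ fin_digraph]) (rule that)
    have "Poly_Mapping.single (u, take N ps, w) (1::'k) \<in> I"
      by (rule N(2)[OF w(1)]) (use p(2) uv in \<open>simp add: path_length_def\<close>)
    then have "path_mult (Poly_Mapping.single (u, take N ps, w) 1) (Poly_Mapping.single (w, drop N ps, v) c) \<in> I"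
      by (rule I_mult(2)) (use w(2) in simp)
    then show ?thesis by (simp add: path_mult_single basis_mult_def uv)
  qed
  have "z \<in> I" if z: "Poly_Mapping.keys z \<subseteq> paths Q" "\<forall>p\<in>Poly_Mapping.keys z. N \<le> path_length p" for z
  proof (rule path_single_induct[of "\<lambda>z. z \<in> I" z])
    show "Poly_Mapping.single p c \<in> I" if "p \<in> Poly_Mapping.keys z" for p c
      by (rule single) (use that z in auto)
  qed (simp_all add: I_zero I_add)
  then show ?thesis by (rule that)
qed

lemma finite_short_paths: "finite {p \<in> paths Q. path_length p < N}"
proof (rule finite_subset)
  show "{p \<in> paths Q. path_length p < N} \<subseteq> verts Q \<times> {ps. set ps \<subseteq> arcs Q \<and> length ps \<le> N} \<times> verts Q"
    using path_ends by (force simp: paths_def path_length_def awalk_def)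
  show "finite (verts Q \<times> {ps. set ps \<subseteq> arcs Q \<and> length ps \<le> N} \<times> verts Q)"
    by (intro finite_cartesian_product finite_verts finite_lists_length_le finite_arcs)
qed

text \<open>Modulo \<open>I\<close> all paths of length at least N vanish, and the finitely many
  shorter ones therefore span.\<close>

sublocale finite_dimensional_algebra \<Lambda> "\<lambda>c. coset I (scalar c)"
proof (rule finite_dimensional_algebra.intro)
  show "ring \<Lambda>" by (rule ring_\<Lambda>)
  show "coset I (scalar c) \<in> carrier \<Lambda>" for c by (rule coset_closed[OF scalar_carrier])
  show "coset I (scalar 1) = \<one>\<^bsub>\<Lambda>\<^esub>" by (simp add: \<Lambda>_one)
  show "coset I (scalar (c + d)) = coset I (scalar c) \<oplus>\<^bsub>\<Lambda>\<^esub> coset I (scalar d)" for c d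
    by (simp add: scalar_add coset_add scalar_carrier)
  show "coset I (scalar (c * d)) = coset I (scalar c) \<otimes>\<^bsub>\<Lambda>\<^esub> coset I (scalar d)" for c d
    by (simp add: scalar_mult coset_mult scalar_carrier)
  show "coset I (scalar c) \<otimes>\<^bsub>\<Lambda>\<^esub> r = r \<otimes>\<^bsub>\<Lambda>\<^esub> coset I (scalar c)" if "r \<in> carrier \<Lambda>" for c r
    by (rule \<Lambda>_cases[OF that]) (simp add: coset_mult scalar_carrier scalar_central)
  obtain N where N:
    "\<And>z. Poly_Mapping.keys z \<subseteq> paths Q \<Longrightarrow> \<forall>p\<in>Poly_Mapping.keys z. N \<le> path_length p \<Longrightarrow> z \<in> I"
    by (rule long_in_I) (rule that)
  obtain xs where xs: "set xs = {p \<in> paths Q. path_length p < N}" using finite_list[OF finite_short_paths] by blast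
  let ?B = "map (\<lambda>p. coset I (Poly_Mapping.single p 1)) xs"
  have "carrier \<Lambda> = coset I ` {z. Poly_Mapping.keys z \<subseteq> set xs}"
  proof
    show "coset I ` {z. Poly_Mapping.keys z \<subseteq> set xs} \<subseteq> carrier \<Lambda>" using coset_closed xs by auto
    show "carrier \<Lambda> \<subseteq> coset I ` {z. Poly_Mapping.keys z \<subseteq> set xs}"
    proof
      fix X assume "X \<in> carrier \<Lambda>"
      then obtain z where z: "Poly_Mapping.keys z \<subseteq> paths Q" "X = coset I z" by (rule \<Lambda>_cases)
      define y where "y = (\<Sum>p\<in>Poly_Mapping.keys z \<inter> set xs. Poly_Mapping.single p (Poly_Mapping.lookup z p))"
      have y: "Poly_Mapping.lookup y p = (if p \<in> set xs then Poly_Mapping.lookup z p else 0)" for p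
        by (auto simp: y_def lookup_sum lookup_single when_def in_keys_iff sum.delta)
      have "z - y \<in> I"
      proof (rule N)
        have k: "p \<in> Poly_Mapping.keys z \<and> p \<notin> set xs" if "p \<in> Poly_Mapping.keys (z - y)" for p
          using that by (cases "p \<in> set xs") (auto simp: in_keys_iff lookup_minus y)
        show "Poly_Mapping.keys (z - y) \<subseteq> paths Q" using k z(1) by blast
        show "\<forall>p\<in>Poly_Mapping.keys (z - y). N \<le> path_length p"
        proof
          fix p assume "p \<in> Poly_Mapping.keys (z - y)"
          then have "p \<in> paths Q" "p \<notin> set xs" using k z(1) by blast+
          then show "N \<le> path_length p" unfolding xs by simp
        qed
      qed
      then have "X = coset I y" by (simp add: z(2) coset_eq_iff)
      moreover have "Poly_Mapping.keys y \<subseteq> set xs" by (auto simp: in_keys_iff y split: if_splits)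
      ultimately show "X \<in> coset I ` {z. Poly_Mapping.keys z \<subseteq> set xs}" by blast
    qed
  qed
  then have "carrier \<Lambda> = kspan (\<lambda>c. coset I (scalar c)) (regular_module \<Lambda>) ?B" using kspan_paths[of xs] xs by auto
  moreover have "set ?B \<subseteq> carrier \<Lambda>"
    unfolding set_map by (rule image_subsetI, rule coset_closed) (simp add: xs)
  ultimately show "\<exists>B. set B \<subseteq> carrier \<Lambda> \<and> carrier \<Lambda> = kspan (\<lambda>c. coset I (scalar c)) (regular_module \<Lambda>) B"
    by blast
qed

end

section \<open>The retraction onto the algebra of the remaining arrows\<close>

locale pre_removable_arrows = bound_quiver_presentation Q I
  for Q :: "('v, 'a) pre_digraph" and I :: "(('v, 'a) qpath \<Rightarrow>\<^sub>0 'k::field) set" +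
  fixes A
  assumes pre_removable: "pre_removable Q I A"
begin

abbreviation "Q' \<equiv> quiver_minus Q A"
abbreviation "I' \<equiv> ideal_avoiding I A"

lemma A_arcs: "A \<subseteq> arcs Q" and part_closed: "z \<in> I \<Longrightarrow> part_through A z \<in> I" "z \<in> I \<Longrightarrow> part_avoiding A z \<in> I"
  using pre_removable by (auto simp: pre_removable_def)

lemma I'_iff: "z \<in> I' \<longleftrightarrow> z \<in> I \<and> part_avoiding A z = z"
proof -
  have "(\<forall>p\<in>Poly_Mapping.keys z. path_arrows p \<inter> A = {}) \<longleftrightarrow> part_avoiding A z = z"
    using part_avoiding_id[of z A] keys_part_avoiding[of _ A z] by metis
  then show ?thesis by (simp add: ideal_avoiding_def)
qed

lemma part_avoiding_idem: "part_avoiding A (part_avoiding A z) = part_avoiding A z"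
  by (rule part_avoiding_id) (simp add: keys_part_avoiding)

lemma keys_Q': "Poly_Mapping.keys z \<subseteq> paths Q' \<longleftrightarrow> Poly_Mapping.keys z \<subseteq> paths Q \<and> part_avoiding A z = z"
proof -
  have "(\<forall>p\<in>Poly_Mapping.keys z. path_arrows p \<inter> A = {}) \<longleftrightarrow> part_avoiding A z = z"
    using part_avoiding_id[of z A] keys_part_avoiding[of _ A z] by metis
  then show ?thesis by (auto simp: paths_quiver_minus)
qed

lemma bound': "bound_quiver Q' I'"
proof -
  let ?K = "path_algebra Q' :: (('v, 'a) qpath \<Rightarrow>\<^sub>0 'k) ring"
  note fin = fin_digraph_quiver_minus[OF fin_digraph, of A]
  have "ideal I' ?K"
  proof (rule idealI)
    show R: "ring ?K" by (rule ring_path_algebra[OF fin])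
    interpret R: ring ?K by (rule R)
    show "subgroup I' (add_monoid ?K)"
    proof
      show "I' \<subseteq> carrier (add_monoid ?K)"
      proof
        fix x assume "x \<in> I'"
        then show "x \<in> carrier (add_monoid ?K)" using I_carrier by (simp add: path_algebra_simps keys_Q' I'_iff)
      qed
      show "\<one>\<^bsub>add_monoid ?K\<^esub> \<in> I'" by (simp add: path_algebra_simps I'_iff I_zero)
      fix x y assume x: "x \<in> I'" and y: "y \<in> I'"
      then show "x \<otimes>\<^bsub>add_monoid ?K\<^esub> y \<in> I'" by (simp add: path_algebra_simps I'_iff I_add)
      have kx: "Poly_Mapping.keys x \<subseteq> paths Q'" using x I_carrier by (simp add: keys_Q' I'_iff)
      have "\<ominus>\<^bsub>?K\<^esub> x = - x"
        by (rule R.minus_equality) (use kx in \<open>simp_all add: path_algebra_simps\<close>)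
      then have "inv\<^bsub>add_monoid ?K\<^esub> x = - x" by (simp only: a_inv_def)
      moreover have "- x \<in> I'" using x by (simp add: I'_iff I_uminus part_avoiding_uminus)
      ultimately show "inv\<^bsub>add_monoid ?K\<^esub> x \<in> I'" by (simp only:)
    qed
    fix a x assume a: "a \<in> I'" and x: "x \<in> carrier ?K"
    then have "Poly_Mapping.keys x \<subseteq> paths Q" "part_avoiding A x = x"
      by (simp_all add: path_algebra_simps keys_Q')
    then show "x \<otimes>\<^bsub>?K\<^esub> a \<in> I'" "a \<otimes>\<^bsub>?K\<^esub> x \<in> I'"
      using a by (simp_all add: path_algebra_simps I'_iff I_mult part_avoiding_path_mult)
  qed
  moreover have "\<forall>z\<in>I'. \<forall>p\<in>Poly_Mapping.keys z. 2 \<le> path_length p"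
    using admissible by (auto simp: admissible_ideal_def I'_iff)
  moreover have "\<exists>N>1. \<forall>p\<in>paths Q'. path_length p = N \<longrightarrow> Poly_Mapping.single p 1 \<in> I'"
    using admissible by (auto simp: admissible_ideal_def I'_iff paths_quiver_minus)
  ultimately show ?thesis using fin by (simp add: bound_quiver_def admissible_ideal_def)
qed

sublocale G: bound_quiver_presentation Q' I'
  by unfold_locales (rule bound')

abbreviation "\<Gamma> \<equiv> bound_quiver_algebra Q' I'"

text \<open>The map from z + I' to z + I, written as a union over the coset so that no
  representative is chosen.\<close>

definition incl :: "(('v, 'a) qpath \<Rightarrow>\<^sub>0 'k) set \<Rightarrow> (('v, 'a) qpath \<Rightarrow>\<^sub>0 'k) set" where
  "incl X = (\<Union>z\<in>X. coset I z)"

lemma incl_coset: "incl (coset I' z) = coset I z"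
proof -
  have "coset I (x + z) = coset I z" if "x \<in> I'" for x
    using that by (simp add: coset_eq_iff I'_iff)
  moreover have "I' \<noteq> {}" using G.I_zero by auto
  ultimately show ?thesis by (auto simp: incl_def coset_def[of I'])
qed

text \<open>Here pre-removability enters: the avoiding parts of elements of \<open>I\<close> stay in
  \<open>I\<close>, hence form exactly I'.\<close>

lemma restr_coset: "part_avoiding A ` coset I z = coset I' (part_avoiding A z)"
proof -
  have "part_avoiding A ` I = I'"
  proof
    show "part_avoiding A ` I \<subseteq> I'" using part_closed(2) by (auto simp: I'_iff part_avoiding_idem)
    show "I' \<subseteq> part_avoiding A ` I" by (auto simp: I'_iff intro: rev_image_eqI)
  qed
  then show ?thesis by (simp add: coset_def image_image \<open>part_avoiding A ` I = I'\<close>[symmetric])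
qed

lemma scalar': "G.scalar = scalar"
  by (intro ext) (simp only: G.scalar_def scalar_def verts_quiver_minus)

lemma keys_Q'D:
  fixes z :: "('v, 'a) qpath \<Rightarrow>\<^sub>0 'k"
  shows "Poly_Mapping.keys z \<subseteq> paths Q' \<Longrightarrow> Poly_Mapping.keys z \<subseteq> paths Q"
  by (simp add: keys_Q')

lemma part_avoiding_closed: "Poly_Mapping.keys z \<subseteq> paths Q \<Longrightarrow> Poly_Mapping.keys (part_avoiding A z) \<subseteq> paths Q'"
  by (auto simp: keys_part_avoiding paths_quiver_minus)

lemma incl_hom: "incl \<in> ring_hom \<Gamma> \<Lambda>"
proof (rule ring_hom_memI)
  fix X assume X: "X \<in> carrier \<Gamma>"
  then obtain x where x: "Poly_Mapping.keys x \<subseteq> paths Q'" "X = coset I' x" by (rule G.\<Lambda>_cases)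
  show "incl X \<in> carrier \<Lambda>" by (simp add: x(2) incl_coset coset_closed keys_Q'D[OF x(1)])
  fix Y assume "Y \<in> carrier \<Gamma>"
  then obtain y where y: "Poly_Mapping.keys y \<subseteq> paths Q'" "Y = coset I' y" by (rule G.\<Lambda>_cases)
  show "incl (X \<otimes>\<^bsub>\<Gamma>\<^esub> Y) = incl X \<otimes>\<^bsub>\<Lambda>\<^esub> incl Y"
    by (simp add: x(2) y(2) incl_coset G.coset_mult[OF x(1) y(1)] coset_mult[OF keys_Q'D[OF x(1)] keys_Q'D[OF y(1)]])
  show "incl (X \<oplus>\<^bsub>\<Gamma>\<^esub> Y) = incl X \<oplus>\<^bsub>\<Lambda>\<^esub> incl Y"
    by (simp add: x(2) y(2) incl_coset G.coset_add[OF x(1) y(1)] coset_add[OF keys_Q'D[OF x(1)] keys_Q'D[OF y(1)]])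
qed (simp add: \<Lambda>_one G.\<Lambda>_one incl_coset scalar')

lemma part_avoiding_scalar: "part_avoiding A (scalar c) = scalar c"
  using G.scalar_carrier[of c] by (simp add: scalar' keys_Q')

lemma restr_hom: "image (part_avoiding A) \<in> ring_hom \<Lambda> \<Gamma>"
proof (rule ring_hom_memI)
  fix X assume X: "X \<in> carrier \<Lambda>"
  then obtain x where x: "Poly_Mapping.keys x \<subseteq> paths Q" "X = coset I x" by (rule \<Lambda>_cases)
  note x' = part_avoiding_closed[OF x(1)]
  show "part_avoiding A ` X \<in> carrier \<Gamma>" by (simp add: x(2) restr_coset G.coset_closed x')
  fix Y assume "Y \<in> carrier \<Lambda>"
  then obtain y where y: "Poly_Mapping.keys y \<subseteq> paths Q" "Y = coset I y" by (rule \<Lambda>_cases)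
  note y' = part_avoiding_closed[OF y(1)]
  show "part_avoiding A ` (X \<otimes>\<^bsub>\<Lambda>\<^esub> Y) = part_avoiding A ` X \<otimes>\<^bsub>\<Gamma>\<^esub> part_avoiding A ` Y"
    by (simp add: x(2) y(2) restr_coset G.coset_mult[OF x' y'] coset_mult[OF x(1) y(1)] part_avoiding_path_mult)
  show "part_avoiding A ` (X \<oplus>\<^bsub>\<Lambda>\<^esub> Y) = part_avoiding A ` X \<oplus>\<^bsub>\<Gamma>\<^esub> part_avoiding A ` Y"
    by (simp add: x(2) y(2) restr_coset G.coset_add[OF x' y'] coset_add[OF x(1) y(1)])
qed (simp add: \<Lambda>_one G.\<Lambda>_one restr_coset scalar' part_avoiding_scalar)

lemma kernel_representative:
  assumes X: "X \<in> carrier \<Lambda>" "part_avoiding A ` X = \<zero>\<^bsub>\<Gamma>\<^esub>"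
  obtains z where "Poly_Mapping.keys z \<subseteq> paths Q" "X = coset I z"
    "\<And>p. p \<in> Poly_Mapping.keys z \<Longrightarrow> path_arrows p \<inter> A \<noteq> {}"
proof -
  obtain x where x: "Poly_Mapping.keys x \<subseteq> paths Q" "X = coset I x" by (rule \<Lambda>_cases[OF X(1)])
  have "part_avoiding A x \<in> I" using X(2) by (simp add: x(2) restr_coset G.\<Lambda>_zero G.coset_eq_iff I'_iff)
  moreover have "x - part_through A x = part_avoiding A x"
    using part_through_add_avoiding[of A x] by (simp add: algebra_simps)
  ultimately have "X = coset I (part_through A x)" by (simp add: x(2) coset_eq_iff)
  then show ?thesis using x(1) by (intro that[of "part_through A x"]) (auto simp: keys_part_through)
qed

lemma keys_path_mult_length:
  fixes x y :: "('v, 'a) qpath \<Rightarrow>\<^sub>0 'k"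
  assumes "\<And>p. p \<in> Poly_Mapping.keys x \<Longrightarrow> m \<le> path_length p"
    "\<And>p. p \<in> Poly_Mapping.keys y \<Longrightarrow> n \<le> path_length p" "p \<in> Poly_Mapping.keys (path_mult x y)"
  shows "m + n \<le> path_length p"
proof -
  have "p \<in> (\<Union>q\<in>Poly_Mapping.keys x. Poly_Mapping.keys (\<Sum>r\<in>Poly_Mapping.keys y.
      basis_mult q r (Poly_Mapping.lookup x q * Poly_Mapping.lookup y r)))"
    using assms(3) unfolding path_mult_def by (rule subsetD[OF Poly_Mapping.keys_sum])
  then obtain q where q: "q \<in> Poly_Mapping.keys x" "p \<in> Poly_Mapping.keys (\<Sum>r\<in>Poly_Mapping.keys y.
      basis_mult q r (Poly_Mapping.lookup x q * Poly_Mapping.lookup y r))" by blast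
  have "p \<in> (\<Union>r\<in>Poly_Mapping.keys y.
      Poly_Mapping.keys (basis_mult q r (Poly_Mapping.lookup x q * Poly_Mapping.lookup y r)))"
    using q(2) by (rule subsetD[OF Poly_Mapping.keys_sum])
  then obtain r where "r \<in> Poly_Mapping.keys y"
    "p \<in> Poly_Mapping.keys (basis_mult q r (Poly_Mapping.lookup x q * Poly_Mapping.lookup y r))"
    by blast
  then show ?thesis
    using assms(1)[OF q(1)] assms(2)[of r] by (auto simp: basis_mult_def path_length_def split: if_splits)
qed

lemma ideal_kernel: "ideal {X \<in> carrier \<Lambda>. part_avoiding A ` X = \<zero>\<^bsub>\<Gamma>\<^esub>} \<Lambda>"
proof -
  interpret ring_hom_ring \<Lambda> \<Gamma> "image (part_avoiding A)"
    by (rule ring_hom_ringI2[OF ring_\<Lambda> G.ring_\<Lambda> restr_hom])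
  show ?thesis using kernel_is_ideal unfolding a_kernel_def' .
qed

text \<open>A path through an arrow of \<open>A\<close> factors with that arrow as middle factor, so
  combinations of such paths lie in the ideal generated by \<open>A\<close>. By
  \<open>kernel_representative\<close> these combinations represent the whole kernel.\<close>

lemma arrow_ideal_eq: "arrow_ideal Q I A = {X \<in> carrier \<Lambda>. part_avoiding A ` X = \<zero>\<^bsub>\<Gamma>\<^esub>}"
proof
  interpret R: ring \<Lambda> by (rule ring_\<Lambda>)
  let ?a = "\<lambda>a. Poly_Mapping.single (arrow_path Q a) (1 :: 'k)"
  let ?G = "(\<lambda>a. coset I (?a a)) ` A"
  have arrow: "arrow_path Q a \<in> paths Q" if "a \<in> A" for a
    using that A_arcs by (auto simp: arrow_path_def paths_def awalk_def cas.simps)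
  have eq: "arrow_ideal Q I A = Idl\<^bsub>\<Lambda>\<^esub> ?G" by (simp add: arrow_ideal_def a_r_coset_path_algebra)
  have Gc: "?G \<subseteq> carrier \<Lambda>" using arrow by (auto intro!: coset_closed)
  show "arrow_ideal Q I A \<subseteq> {X \<in> carrier \<Lambda>. part_avoiding A ` X = \<zero>\<^bsub>\<Gamma>\<^esub>}"
    unfolding eq
  proof (rule R.genideal_minimal[OF ideal_kernel])
    show "?G \<subseteq> {X \<in> carrier \<Lambda>. part_avoiding A ` X = \<zero>\<^bsub>\<Gamma>\<^esub>}"
    proof
      fix X assume X: "X \<in> ?G"
      then obtain a where "a \<in> A" "X = coset I (?a a)" by blast
      then have "part_avoiding A ` X = \<zero>\<^bsub>\<Gamma>\<^esub>"
        by (simp add: restr_coset G.\<Lambda>_zero path_arrows_def arrow_path_def)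
      then show "X \<in> {X \<in> carrier \<Lambda>. part_avoiding A ` X = \<zero>\<^bsub>\<Gamma>\<^esub>}" using X Gc by blast
    qed
  qed
  interpret J: ideal "Idl\<^bsub>\<Lambda>\<^esub> ?G" \<Lambda> by (rule R.genideal_ideal[OF Gc])
  have single: "coset I (Poly_Mapping.single p c) \<in> Idl\<^bsub>\<Lambda>\<^esub> ?G" if p: "p \<in> paths Q" "path_arrows p \<inter> A \<noteq> {}" for p c
  proof -
    obtain u ps v where uv: "p = (u, ps, v)" by (cases p)
    obtain a where a: "a \<in> A" "a \<in> set ps" using p(2) by (auto simp: uv path_arrows_def)
    then obtain xs ys where ps: "ps = xs @ [a] @ ys" by (auto simp: in_set_conv_decomp)
    obtain w where w: "(u, xs, w) \<in> paths Q" "(w, [a] @ ys, v) \<in> paths Q"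
      using p(1) unfolding uv ps by (rule paths_split[OF _ fin_digraph]) (rule that)
    obtain w' where w': "(w, [a], w') \<in> paths Q" "(w', ys, v) \<in> paths Q"
      using w(2) by (rule paths_split[OF _ fin_digraph]) (rule that)
    have aw: "arrow_path Q a = (w, [a], w')"
      using w'(1) by (auto simp: arrow_path_def paths_def awalk_def cas.simps)
    have *: "Poly_Mapping.single p c =
        path_mult (path_mult (Poly_Mapping.single (u, xs, w) c) (?a a)) (Poly_Mapping.single (w', ys, v) 1)"
      by (simp add: path_mult_single basis_mult_def aw uv ps)
    have k: "Poly_Mapping.keys (Poly_Mapping.single (u, xs, w) c) \<subseteq> paths Q"
      "Poly_Mapping.keys (?a a) \<subseteq> paths Q" "Poly_Mapping.keys (Poly_Mapping.single (w', ys, v) (1::'k)) \<subseteq> paths Q"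
      using w(1) w'(2) arrow[OF a(1)] by simp_all
    have "coset I (Poly_Mapping.single p c) =
        coset I (Poly_Mapping.single (u, xs, w) c) \<otimes>\<^bsub>\<Lambda>\<^esub> coset I (?a a) \<otimes>\<^bsub>\<Lambda>\<^esub> coset I (Poly_Mapping.single (w', ys, v) 1)"
      unfolding * coset_mult[OF k(1,2)] by (rule coset_mult[OF keys_path_mult[OF k(1,2)] k(3), symmetric])
    also have "\<dots> \<in> Idl\<^bsub>\<Lambda>\<^esub> ?G"
      by (intro J.I_r_closed J.I_l_closed coset_closed k subsetD[OF R.genideal_self[OF Gc]] imageI a(1))
    finally show ?thesis .
  qed
  have "coset I z \<in> Idl\<^bsub>\<Lambda>\<^esub> ?G" if z: "Poly_Mapping.keys z \<subseteq> paths Q"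
    "\<And>p. p \<in> Poly_Mapping.keys z \<Longrightarrow> path_arrows p \<inter> A \<noteq> {}" for z
  proof -
    have "Poly_Mapping.keys z \<subseteq> paths Q \<and> coset I z \<in> Idl\<^bsub>\<Lambda>\<^esub> ?G"
    proof (rule path_single_induct[of "\<lambda>z. Poly_Mapping.keys z \<subseteq> paths Q \<and> coset I z \<in> Idl\<^bsub>\<Lambda>\<^esub> ?G" z])
      show "Poly_Mapping.keys (0 :: ('v, 'a) qpath \<Rightarrow>\<^sub>0 'k) \<subseteq> paths Q \<and> coset I 0 \<in> Idl\<^bsub>\<Lambda>\<^esub> ?G"
        using J.zero_closed by (simp add: \<Lambda>_zero)
      show "Poly_Mapping.keys (x + y) \<subseteq> paths Q \<and> coset I (x + y) \<in> Idl\<^bsub>\<Lambda>\<^esub> ?G"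
        if "Poly_Mapping.keys x \<subseteq> paths Q \<and> coset I x \<in> Idl\<^bsub>\<Lambda>\<^esub> ?G"
          "Poly_Mapping.keys y \<subseteq> paths Q \<and> coset I y \<in> Idl\<^bsub>\<Lambda>\<^esub> ?G" for x y
        using that J.a_closed[of "coset I x" "coset I y"] by (simp add: coset_add keys_add_paths)
      show "Poly_Mapping.keys (Poly_Mapping.single p c) \<subseteq> paths Q \<and>
          coset I (Poly_Mapping.single p c) \<in> Idl\<^bsub>\<Lambda>\<^esub> ?G" if p: "p \<in> Poly_Mapping.keys z" for p c
      proof
        have pp: "p \<in> paths Q" using p z(1) by blast
        then show "Poly_Mapping.keys (Poly_Mapping.single p c) \<subseteq> paths Q" by simp
        show "coset I (Poly_Mapping.single p c) \<in> Idl\<^bsub>\<Lambda>\<^esub> ?G" by (rule single[OF pp z(2)[OF p]])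
      qed
    qed
    then show ?thesis ..
  qed
  note combination = this
  show "{X \<in> carrier \<Lambda>. part_avoiding A ` X = \<zero>\<^bsub>\<Gamma>\<^esub>} \<subseteq> arrow_ideal Q I A"
  proof
    fix X assume "X \<in> {X \<in> carrier \<Lambda>. part_avoiding A ` X = \<zero>\<^bsub>\<Gamma>\<^esub>}"
    then obtain z where z: "Poly_Mapping.keys z \<subseteq> paths Q" "X = coset I z"
      "\<And>p. p \<in> Poly_Mapping.keys z \<Longrightarrow> path_arrows p \<inter> A \<noteq> {}"
      by (elim CollectE conjE) (rule kernel_representative, assumption, assumption, rule that)
    then show "X \<in> arrow_ideal Q I A" unfolding eq z(2) by (intro combination)
  qed
qed

text \<open>For nilpotency: elements of the arrow ideal are represented by combinations of paths of
  length at least 1, so a product of N of them is represented by paths of length at least N, and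
  such combinations lie in \<open>I\<close>.\<close>

sublocale cleft_extension \<Gamma> \<Lambda> incl "image (part_avoiding A)" "\<lambda>c. coset I (scalar c)"
  "\<lambda>c. coset I' (G.scalar c)" "arrow_ideal Q I A"
proof (intro cleft_extension.intro ring_retraction.intro cleft_extension_axioms.intro)
  show "finite_dimensional_algebra \<Lambda> (\<lambda>c. coset I (scalar c))" by (rule finite_dimensional_algebra_axioms)
  show "finite_dimensional_algebra \<Gamma> (\<lambda>c. coset I' (G.scalar c))" by (rule G.finite_dimensional_algebra_axioms)
  show "ring \<Gamma>" by (rule G.ring_\<Lambda>)
  show "ring \<Lambda>" by (rule ring_\<Lambda>)
  show "incl \<in> ring_hom \<Gamma> \<Lambda>" by (rule incl_hom)
  show "image (part_avoiding A) \<in> ring_hom \<Lambda> \<Gamma>" by (rule restr_hom)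
  show "part_avoiding A ` incl X = X" if X: "X \<in> carrier \<Gamma>" for X
  proof -
    obtain x where x: "Poly_Mapping.keys x \<subseteq> paths Q'" "X = coset I' x" by (rule G.\<Lambda>_cases[OF X])
    then show ?thesis by (simp add: incl_coset restr_coset keys_Q')
  qed
  show "arrow_ideal Q I A = {X \<in> carrier \<Lambda>. part_avoiding A ` X = \<zero>\<^bsub>\<Gamma>\<^esub>}" by (rule arrow_ideal_eq)
  obtain N where N:
    "\<And>z. Poly_Mapping.keys z \<subseteq> paths Q \<Longrightarrow> \<forall>p\<in>Poly_Mapping.keys z. N \<le> path_length p \<Longrightarrow> z \<in> I"
    by (rule long_in_I) (rule that)
  have prod: "\<exists>z. Poly_Mapping.keys z \<subseteq> paths Q \<and> (\<forall>p\<in>Poly_Mapping.keys z. length Xs \<le> path_length p) \<and>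
      foldr (\<otimes>\<^bsub>\<Lambda>\<^esub>) Xs \<one>\<^bsub>\<Lambda>\<^esub> = coset I z" if "set Xs \<subseteq> arrow_ideal Q I A" for Xs
    using that
  proof (induction Xs)
    case Nil
    show ?case using scalar_carrier[of 1] \<Lambda>_one by (intro exI[of _ "scalar 1"]) simp
  next
    case (Cons X Xs)
    then obtain z where z: "Poly_Mapping.keys z \<subseteq> paths Q" "\<forall>p\<in>Poly_Mapping.keys z. length Xs \<le> path_length p"
      "foldr (\<otimes>\<^bsub>\<Lambda>\<^esub>) Xs \<one>\<^bsub>\<Lambda>\<^esub> = coset I z" by auto
    obtain x where x: "Poly_Mapping.keys x \<subseteq> paths Q" "X = coset I x"
      "\<And>p. p \<in> Poly_Mapping.keys x \<Longrightarrow> path_arrows p \<inter> A \<noteq> {}"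
      by (rule kernel_representative[of X]) (use Cons.prems in \<open>auto simp: arrow_ideal_eq\<close>)
    have "1 \<le> path_length p" if "p \<in> Poly_Mapping.keys x" for p
      using x(3)[OF that] by (cases "fst (snd p)") (auto simp: path_arrows_def path_length_def)
    then have "\<forall>p\<in>Poly_Mapping.keys (path_mult x z). length (X # Xs) \<le> path_length p"
      using keys_path_mult_length[of x 1 z "length Xs"] z(2) by auto
    then show ?case
      using keys_path_mult[OF x(1) z(1)] coset_mult[OF x(1) z(1)] x(2) z(3)
      by (intro exI[of _ "path_mult x z"]) simp
  qed
  show "\<exists>N. \<forall>Xs. set Xs \<subseteq> arrow_ideal Q I A \<longrightarrow> length Xs = N \<longrightarrow> foldr (\<otimes>\<^bsub>\<Lambda>\<^esub>) Xs \<one>\<^bsub>\<Lambda>\<^esub> = \<zero>\<^bsub>\<Lambda>\<^esub>"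
  proof (intro exI allI impI)
    fix Xs assume Xs: "set Xs \<subseteq> arrow_ideal Q I A" "length Xs = N"
    obtain z where z: "Poly_Mapping.keys z \<subseteq> paths Q" "\<forall>p\<in>Poly_Mapping.keys z. N \<le> path_length p"
      "foldr (\<otimes>\<^bsub>\<Lambda>\<^esub>) Xs \<one>\<^bsub>\<Lambda>\<^esub> = coset I z" using prod[OF Xs(1)] Xs(2) by auto
    have "z \<in> I" by (rule N[OF z(1,2)])
    then show "foldr (\<otimes>\<^bsub>\<Lambda>\<^esub>) Xs \<one>\<^bsub>\<Lambda>\<^esub> = \<zero>\<^bsub>\<Lambda>\<^esub>" by (simp add: z(3) \<Lambda>_zero coset_eq_iff)
  qed
qed

end

section \<open>Removal of one set of arrows and its iteration\<close>

lemma square_zero: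
  assumes "ideal_prod R J J = {\<zero>\<^bsub>R\<^esub>}" "a \<in> J" "b \<in> J"
  shows "a \<otimes>\<^bsub>R\<^esub> b = \<zero>\<^bsub>R\<^esub>"
  using ideal_prod.prod[OF assms(2,3), of R] assms(1) by simp

text \<open>The dimensions of the arrow ideal are computed on the element type of the ring itself,
  and matrix presentations use sequences in that type. Both types contain the field, and both are
  infinite because there are arrow lists of every length.\<close>

lemma large_coset_type:
  fixes Q :: "('v, 'a) pre_digraph" and I :: "(('v, 'a) qpath \<Rightarrow>\<^sub>0 'k::field) set"
  assumes "bound_quiver Q I"
  shows "large (carrier (bound_quiver_algebra Q I)) TYPE((('v, 'a) qpath \<Rightarrow>\<^sub>0 'k) set)"
    and "large (carrier (bound_quiver_algebra Q I)) TYPE(nat \<Rightarrow> (('v, 'a) qpath \<Rightarrow>\<^sub>0 'k) set)"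
proof -
  interpret bound_quiver_presentation Q I by unfold_locales (rule assms)
  let ?s = "\<lambda>p (c :: 'k). {Poly_Mapping.single (p :: ('v, 'a) qpath) c}"
  have "inj (\<lambda>xs :: 'a list. ?s (undefined, xs, undefined) 1)"
  proof (rule injI)
    fix xs ys :: "'a list"
    assume "?s (undefined, xs, undefined) 1 = ?s (undefined, ys, undefined) 1"
    then have "Poly_Mapping.keys (Poly_Mapping.single (undefined :: 'v, xs, undefined :: 'v) (1 :: 'k)) =
      Poly_Mapping.keys (Poly_Mapping.single (undefined :: 'v, ys, undefined :: 'v) (1 :: 'k))" by simp
    then show "xs = ys" by simp
  qed
  then have inf: "infinite (UNIV :: (('v, 'a) qpath \<Rightarrow>\<^sub>0 'k) set set)"
    using infinite_UNIV_listI finite_imageD finite_subset[OF subset_UNIV] by metis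
  have inj: "inj (?s undefined)"
  proof (rule injI)
    fix c d assume "?s undefined c = ?s undefined d"
    then have "Poly_Mapping.lookup (Poly_Mapping.single (undefined :: ('v, 'a) qpath) c) undefined =
      Poly_Mapping.lookup (Poly_Mapping.single (undefined :: ('v, 'a) qpath) d) undefined" by simp
    then show "c = d" by simp
  qed
  show "large (carrier \<Lambda>) TYPE((('v, 'a) qpath \<Rightarrow>\<^sub>0 'k) set)" by (rule large_carrier[OF inf inj])
  have inj_const: "inj (\<lambda>(x :: (('v, 'a) qpath \<Rightarrow>\<^sub>0 'k) set) (_ :: nat). x)" by (simp add: inj_def fun_eq_iff)
  then have "infinite (UNIV :: (nat \<Rightarrow> (('v, 'a) qpath \<Rightarrow>\<^sub>0 'k) set) set)"
    using inf finite_imageD finite_subset[OF subset_UNIV] by metis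
  then show "large (carrier \<Lambda>) TYPE(nat \<Rightarrow> (('v, 'a) qpath \<Rightarrow>\<^sub>0 'k) set)"
    by (rule large_carrier) (use inj_compose[OF inj_const inj] in \<open>simp add: comp_def\<close>)
qed

lemma (in pre_removable_arrows) left_module_arrow_ideal:
  "left_module \<Lambda> (ideal_module \<Lambda> (arrow_ideal Q I A))"
  "left_module (op_ring \<Lambda>) (ideal_module (op_ring \<Lambda>) (arrow_ideal Q I A))"
proof -
  interpret J: ideal "arrow_ideal Q I A" \<Lambda> unfolding arrow_ideal_eq by (rule ideal_kernel)
  interpret A: left_module \<Lambda> "regular_module \<Lambda>" by (rule left_module_regular[OF ring_\<Lambda>])
  interpret B: left_module "op_ring \<Lambda>" "regular_module (op_ring \<Lambda>)"
    by (rule left_module_regular[OF ring_op_ring[OF ring_\<Lambda>]])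
  have "submodule (arrow_ideal Q I A) \<Lambda> (regular_module \<Lambda>)"
    by (rule A.submoduleI') (use J.Icarr J.zero_closed J.a_closed J.I_l_closed in auto)
  then have "left_module \<Lambda> ((regular_module \<Lambda>)\<lparr>carrier := arrow_ideal Q I A\<rparr>)"
    by (rule A.left_module_submodule)
  then show "left_module \<Lambda> (ideal_module \<Lambda> (arrow_ideal Q I A))"
    by (simp add: regular_module_def ideal_module_def)
  have "submodule (arrow_ideal Q I A) (op_ring \<Lambda>) (regular_module (op_ring \<Lambda>))"
    by (rule B.submoduleI') (use J.Icarr J.zero_closed J.a_closed J.I_r_closed in auto)
  then have "left_module (op_ring \<Lambda>) ((regular_module (op_ring \<Lambda>))\<lparr>carrier := arrow_ideal Q I A\<rparr>)"
    by (rule B.left_module_submodule)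
  then show "left_module (op_ring \<Lambda>) (ideal_module (op_ring \<Lambda>) (arrow_ideal Q I A))"
    by (simp add: regular_module_def ideal_module_def)
qed

text \<open>Both kinds of removability bound the right dimension of the arrow ideal, which carries
  finiteness from \<Gamma> to \<Lambda>. They differ in the way back: inflation in the two-sided
  case, extension of scalars when the ideal squares to zero.\<close>

lemma removable_step:
  fixes Q :: "('v, 'a) pre_digraph" and I :: "(('v, 'a) qpath \<Rightarrow>\<^sub>0 'k::field) set" and \<iota> :: "'k \<Rightarrow> 'm"
  assumes bound: "bound_quiver Q I" and rem: "removable Q I A"
    and m: "infinite (UNIV :: 'm set)" "inj \<iota>"
  defines "L \<equiv> bound_quiver_algebra Q I"
    and "G \<equiv> bound_quiver_algebra (quiver_minus Q A) (ideal_avoiding I A)"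
  shows "bound_quiver (quiver_minus Q A) (ideal_avoiding I A)"
    and "fin_dim TYPE('m) L < \<infinity> \<longleftrightarrow> fin_dim TYPE('m) G < \<infinity>"
    and "Fin_dim TYPE('m) L < \<infinity> \<longleftrightarrow> Fin_dim TYPE('m) G < \<infinity>"
    and "gl_dim TYPE('m) L < \<infinity> \<longleftrightarrow> gl_dim TYPE('m) G < \<infinity>"
proof -
  let ?J = "arrow_ideal Q I A"
  have pre: "pre_removable Q I A" and right: "right_projdim_ideal L ?J < \<infinity>"
    and left: "left_projdim_ideal L ?J < \<infinity> \<or> ideal_prod L ?J ?J = {\<zero>\<^bsub>L\<^esub>}"
    using rem by (auto simp: removable_def two_sided_removable_def only_left_removable_def L_def)
  interpret pre_removable_arrows Q I A by unfold_locales (rule bound, rule pre)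
  show B': "bound_quiver (quiver_minus Q A) (ideal_avoiding I A)" by (rule bound')
  have L: "L = \<Lambda>" and G: "G = \<Gamma>" by (simp_all add: L_def G_def)
  note large = large_carrier[OF m] G.large_carrier[OF m]
  note r = large_coset_type[OF bound] and r' = large_coset_type[OF B']
  have "large (carrier (op_ring \<Lambda>)) TYPE((('v, 'a) qpath \<Rightarrow>\<^sub>0 'k) set)" using r(1) by simp
  then obtain d where d: "pdle d (op_ring \<Lambda>) (ideal_module (op_ring \<Lambda>) ?J)"
    using right projdim_finite_iff[OF _ left_module_arrow_ideal(2)] by (auto simp: right_projdim_ideal_def L)
  note up = dimension_transfer_up[OF large r(2) d]
  show "gl_dim TYPE('m) L < \<infinity> \<longleftrightarrow> gl_dim TYPE('m) G < \<infinity>"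
    unfolding L G using up(3) gl_dim_transfer_down[OF large] by (rule iffI[rotated])
  from left have "(fin_dim TYPE('m) \<Lambda> < \<infinity> \<longrightarrow> fin_dim TYPE('m) \<Gamma> < \<infinity>) \<and>
      (Fin_dim TYPE('m) \<Lambda> < \<infinity> \<longrightarrow> Fin_dim TYPE('m) \<Gamma> < \<infinity>)"
  proof
    assume "left_projdim_ideal L ?J < \<infinity>"
    then obtain e where "pdle e \<Lambda> (ideal_module \<Lambda> ?J)"
      using projdim_finite_iff[OF r(1) left_module_arrow_ideal(1)] by (auto simp: left_projdim_ideal_def L)
    note down = dimension_transfer_down_two_sided[OF large this]
    show ?thesis by (intro conjI impI down)
  next
    assume sq: "ideal_prod L ?J ?J = {\<zero>\<^bsub>L\<^esub>}"
    show ?thesis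
      by (intro conjI impI; rule dimension_transfer_down_square_zero[OF large r' _ d])
        (rule square_zero[OF sq[unfolded L]], assumption+)+
  qed
  then show "fin_dim TYPE('m) L < \<infinity> \<longleftrightarrow> fin_dim TYPE('m) G < \<infinity>"
    and "Fin_dim TYPE('m) L < \<infinity> \<longleftrightarrow> Fin_dim TYPE('m) G < \<infinity>"
    unfolding L G using up(1,2) by (elim conjE, intro iffI, simp_all)+
qed

theorem theorem4p9:
  fixes Q Q' :: "('v, 'a) pre_digraph"
    and I I' :: "(('v, 'a) qpath \<Rightarrow>\<^sub>0 'k::field) set"
  assumes "bound_quiver Q I"
    and "arrow_reduced_version Q I Q' I'"
    and "infinite (UNIV :: 'm set)"
    and "\<exists>\<iota> :: 'k \<Rightarrow> 'm. inj \<iota>"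
  shows "(fin_dim TYPE('m) (bound_quiver_algebra Q I) < \<infinity> \<longleftrightarrow>
            fin_dim TYPE('m) (bound_quiver_algebra Q' I') < \<infinity>) \<and>
         (Fin_dim TYPE('m) (bound_quiver_algebra Q I) < \<infinity> \<longleftrightarrow>
            Fin_dim TYPE('m) (bound_quiver_algebra Q' I') < \<infinity>) \<and>
         (gl_dim TYPE('m) (bound_quiver_algebra Q I) < \<infinity> \<longleftrightarrow>
            gl_dim TYPE('m) (bound_quiver_algebra Q' I') < \<infinity>)"
proof -
  obtain A where A: "eventually_removable Q I A" and Q': "Q' = quiver_minus Q A" "I' = ideal_avoiding I A"
    using assms(2) unfolding arrow_reduced_version_def maximal_eventually_removable_def by blast
  obtain As where As: "\<Union>(set As) = A"
    and rem: "\<And>l. l < length As \<Longrightarrow>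
      removable (quiver_minus Q (\<Union>(set (take l As)))) (ideal_avoiding I (\<Union>(set (take l As)))) (As ! l)"
    using A unfolding eventually_removable_def Let_def by (metis partition_onD1)
  obtain \<iota> :: "'k \<Rightarrow> 'm" where \<iota>: "inj \<iota>" using assms(4) ..
  let ?L = "bound_quiver_algebra Q I"
  \<comment> \<open>Induction on the number l of removed blocks. Removing one more block from the
    canonical representation for U amounts to removing the larger union from \<open>Q\<close> and
    \<open>I\<close>, so the equivalences of \<open>removable_step\<close> compose.\<close>
  have "bound_quiver (quiver_minus Q U) (ideal_avoiding I U) \<and>
      (fin_dim TYPE('m) ?L < \<infinity> \<longleftrightarrow> fin_dim TYPE('m) (bound_quiver_algebra (quiver_minus Q U) (ideal_avoiding I U)) < \<infinity>) \<and>
      (Fin_dim TYPE('m) ?L < \<infinity> \<longleftrightarrow> Fin_dim TYPE('m) (bound_quiver_algebra (quiver_minus Q U) (ideal_avoiding I U)) < \<infinity>) \<and>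
      (gl_dim TYPE('m) ?L < \<infinity> \<longleftrightarrow> gl_dim TYPE('m) (bound_quiver_algebra (quiver_minus Q U) (ideal_avoiding I U)) < \<infinity>)"
    if "l \<le> length As" "U = \<Union>(set (take l As))" for l U
    using that
  proof (induction l arbitrary: U)
    case 0
    then show ?case using assms(1) by (simp add: quiver_minus_empty ideal_avoiding_empty)
  next
    case (Suc l)
    let ?V = "\<Union>(set (take l As))"
    have U: "U = ?V \<union> As ! l" using Suc.prems by (auto simp: take_Suc_conv_app_nth)
    have l: "l < length As" "l \<le> length As" using Suc.prems(1) by simp_all
    note IH = Suc.IH[OF l(2) refl]
    note step = removable_step[OF conjunct1[OF IH] rem[OF l(1)] assms(3) \<iota>,
      unfolded quiver_minus_quiver_minus ideal_avoiding_ideal_avoiding]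
    show ?case unfolding U using IH step by (elim conjE) (simp only: simp_thms)
  qed
  from this[of "length As" A] show ?thesis by (simp add: As Q')
qed

end
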